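(* Let $\Phi$ be any reduced irreducible crystallographic root system, $\mathbb{F}$ a field, $\Delta=\Delta_\Phi(\mathbb{F})$, $\alpha\in\Phi$ a long root and $a\in\mathbb{F}^\times$. Then $\theta=x_\alpha(a)$ is a type preserving automorphism of $\Delta$ with $\mathrm{Type}(\theta)=\wp$, and $$\{\delta(c,\theta(c)) : c \text{ a chamber of }\Delta\}=\{1\}\cup\{s_\beta:\beta\in W\varphi\},$$ where $s_\beta\in W$ is the reflection in $\beta$.
   Context: Let $\Phi$ be a reduced irreducible crystallographic root system with simple roots $\alpha_1,\dots,\alpha_n$ in Bourbaki labelling, Weyl group $W$ generated by $S=\{s_1,\dots,s_n\}$, longest element $w_0$, highest root $\varphi$. $G=G_\Phi(\mathbb{F})$ is the adjoint Chevalley group extended by diagonal automorphisms, generated by root elements $x_\alpha(a)$ and the torus $H$; $B=HU^+$ with $U^+=\langle x_\alpha(a):\alpha>0\rangle$. The split building $\Delta_\Phi(\mathbb{F})$ has chamber set $G/B$ with Weyl distance $\delta(gB,hB)=w$ iff $g^{-1}h\in BwB$; simplices of type $J$ are cosets of standard parabolic subgroups $P_{S\setminus J}$; simplices are opposite iff they have opposite types and lie in chambers at Weyl distance $w_0$. For an automorphism $\theta$, $\mathrm{Type}(\theta)$ is the union of the types of simplices mapped to opposite simplices. The polar type is $\wp=\{i:\langle\alpha_i,\varphi\rangle\neq0\}$ (e.g. $\{1,n\}$ for $\mathsf{A}_n$, $\{2\}$ for $\mathsf{B}_n$, $\{1\}$ for $\mathsf{C}_n$, $\{2\}$ for $\mathsf{D}_n$).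 In simply laced types all roots count as long. *)

theory Defs
  imports "HOL-Analysis.Analysis"
begin

definition root_refl :: "'a::real_inner \<Rightarrow> 'a \<Rightarrow> 'a" where
  "root_refl v x = x - (2 * (x \<bullet> v) / (v \<bullet> v)) *\<^sub>R v"

definition root_system :: "'a::euclidean_space set \<Rightarrow> bool" where
  "root_system \<Phi> \<longleftrightarrow> finite \<Phi> \<and> 0 \<notin> \<Phi> \<and> span \<Phi> = UNIV \<and>
     (\<forall>\<alpha>\<in>\<Phi>. root_refl \<alpha> ` \<Phi> = \<Phi>) \<and>
     (\<forall>\<alpha>\<in>\<Phi>. \<forall>\<beta>\<in>\<Phi>. 2 * (\<beta> \<bullet> \<alpha>) / (\<alpha> \<bullet> \<alpha>) \<in> \<int>)"

definition rs_reduced :: "'a::euclidean_space set \<Rightarrow> bool" where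
  "rs_reduced \<Phi> \<longleftrightarrow> (\<forall>\<alpha>\<in>\<Phi>. \<forall>c::real. c *\<^sub>R \<alpha> \<in> \<Phi> \<longrightarrow> c = 1 \<or> c = -1)"

definition rs_irreducible :: "'a::euclidean_space set \<Rightarrow> bool" where
  "rs_irreducible \<Phi> \<longleftrightarrow> \<not> (\<exists>A B. A \<noteq> {} \<and> B \<noteq> {} \<and> A \<union> B = \<Phi> \<and> A \<inter> B = {} \<and>
      (\<forall>\<alpha>\<in>A. \<forall>\<beta>\<in>B. \<alpha> \<bullet> \<beta> = 0))"

definition is_base :: "'a::euclidean_space set \<Rightarrow> 'a set \<Rightarrow> bool" where
  "is_base \<Phi> Bas \<longleftrightarrow> Bas \<subseteq> \<Phi> \<and> independent Bas \<and>
     (\<forall>\<beta>\<in>\<Phi>. \<exists>c::'a \<Rightarrow> int. \<beta> = (\<Sum>\<gamma>\<in>Bas. of_int (c \<gamma>) *\<^sub>R \<gamma>) \<and>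
        ((\<forall>\<gamma>\<in>Bas. c \<gamma> \<ge> 0) \<or> (\<forall>\<gamma>\<in>Bas. c \<gamma> \<le> 0)))"

definition coords :: "'a::real_vector set \<Rightarrow> 'a \<Rightarrow> 'a \<Rightarrow> int" where
  "coords X v = (THE c. (\<forall>\<gamma>. \<gamma> \<notin> X \<longrightarrow> c \<gamma> = 0) \<and> v = (\<Sum>\<gamma>\<in>X. of_int (c \<gamma>) *\<^sub>R \<gamma>))"

definition nonneg_comb :: "'a::real_vector set \<Rightarrow> 'a \<Rightarrow> bool" where
  "nonneg_comb Bas v \<longleftrightarrow> (\<exists>c::'a \<Rightarrow> nat. v = (\<Sum>\<gamma>\<in>Bas. of_nat (c \<gamma>) *\<^sub>R \<gamma>))"

definition pos_roots :: "'a::euclidean_space set \<Rightarrow> 'a set \<Rightarrow> 'a set" where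
  "pos_roots \<Phi> Bas = {\<beta>\<in>\<Phi>. nonneg_comb Bas \<beta>}"

definition highest_root :: "'a::euclidean_space set \<Rightarrow> 'a set \<Rightarrow> 'a" where
  "highest_root \<Phi> Bas = (THE \<phi>. \<phi> \<in> \<Phi> \<and> (\<forall>\<beta>\<in>\<Phi>. nonneg_comb Bas (\<phi> - \<beta>)))"

definition long_root :: "'a::euclidean_space set \<Rightarrow> 'a \<Rightarrow> bool" where
  "long_root \<Phi> \<alpha> \<longleftrightarrow> \<alpha> \<in> \<Phi> \<and> (\<forall>\<beta>\<in>\<Phi>. \<beta> \<bullet> \<beta> \<le> \<alpha> \<bullet> \<alpha>)"

definition polar_type :: "'a::euclidean_space set \<Rightarrow> 'a set \<Rightarrow> 'a set" where
  "polar_type \<Phi> Bas = {\<gamma>\<in>Bas. \<gamma> \<bullet> highest_root \<Phi> Bas \<noteq> 0}"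

inductive_set weyl_gen :: "'a::real_inner set \<Rightarrow> ('a \<Rightarrow> 'a) set" for R where
  weyl_id: "id \<in> weyl_gen R"
| weyl_step: "\<alpha> \<in> R \<Longrightarrow> w \<in> weyl_gen R \<Longrightarrow> root_refl \<alpha> \<circ> w \<in> weyl_gen R"

definition wword :: "'a::real_inner list \<Rightarrow> 'a \<Rightarrow> 'a" where
  "wword \<alpha>s = foldr (\<lambda>\<alpha> f. root_refl \<alpha> \<circ> f) \<alpha>s id"

definition word_length :: "'a::real_inner set \<Rightarrow> ('a \<Rightarrow> 'a) \<Rightarrow> nat" where
  "word_length Bas w = (LEAST k. \<exists>\<alpha>s. length \<alpha>s = k \<and> set \<alpha>s \<subseteq> Bas \<and> wword \<alpha>s = w)"

definition longest_elt :: "'a::real_inner set \<Rightarrow> 'a \<Rightarrow> 'a" where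
  "longest_elt Bas = (THE w. w \<in> weyl_gen Bas \<and> (\<forall>v\<in>weyl_gen Bas. word_length Bas v \<le> word_length Bas w))"

text \<open>Opposite type J' = w0 J w0 (types are sets of simple roots).\<close>
definition opp_type :: "'a::real_inner set \<Rightarrow> 'a set \<Rightarrow> 'a set" where
  "opp_type Bas J = {\<gamma>\<in>Bas. \<exists>\<delta>\<in>J. root_refl \<gamma> = longest_elt Bas \<circ> root_refl \<delta> \<circ> longest_elt Bas}"

text \<open>Basis indices: Inl \<beta> is e_\<beta> (\<beta> a root), Inr \<gamma> is h_\<gamma> (\<gamma> a simple root).\<close>
type_synonym 'a idx = "'a + 'a"

definition idxset :: "'a set \<Rightarrow> 'a set \<Rightarrow> 'a idx set" where
  "idxset \<Phi> Bas = Inl ` \<Phi> \<union> Inr ` Bas"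

definition cartan :: "'a::real_inner \<Rightarrow> 'a \<Rightarrow> int" where
  "cartan \<beta> \<gamma> = \<lfloor>2 * (\<beta> \<bullet> \<gamma>) / (\<gamma> \<bullet> \<gamma>)\<rfloor>"

definition coroot :: "'a::real_inner \<Rightarrow> 'a" where
  "coroot v = (2 / (v \<bullet> v)) *\<^sub>R v"

text \<open>h_\<beta> = sum of hcoef \<beta> \<gamma> h_\<gamma>, the coordinates of the coroot of \<beta> in the simple coroots.\<close>
definition hcoef :: "'a::real_inner set \<Rightarrow> 'a \<Rightarrow> 'a \<Rightarrow> int" where
  "hcoef Bas \<beta> \<gamma> = coords (coroot ` Bas) (coroot \<beta>) (coroot \<gamma>)"

definition string_p :: "'a::real_vector set \<Rightarrow> 'a \<Rightarrow> 'a \<Rightarrow> nat" where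
  "string_p \<Phi> \<alpha> \<beta> = (GREATEST p::nat. \<beta> - of_nat p *\<^sub>R \<alpha> \<in> \<Phi>)"

text \<open>Lie bracket of two basis elements, as integer coefficient vector.\<close>
definition brk :: "'a::real_inner set \<Rightarrow> 'a set \<Rightarrow> ('a \<Rightarrow> 'a \<Rightarrow> int) \<Rightarrow> 'a idx \<Rightarrow> 'a idx \<Rightarrow> 'a idx \<Rightarrow> int" where
  "brk \<Phi> Bas N x y = (case (x, y) of
      (Inr \<gamma>, Inr \<delta>) \<Rightarrow> (\<lambda>k. 0)
    | (Inr \<gamma>, Inl \<beta>) \<Rightarrow> (\<lambda>k. if k = Inl \<beta> then cartan \<beta> \<gamma> else 0)
    | (Inl \<beta>, Inr \<gamma>) \<Rightarrow> (\<lambda>k. if k = Inl \<beta> then - cartan \<beta> \<gamma> else 0)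
    | (Inl \<beta>, Inl \<delta>) \<Rightarrow>
        (if \<delta> = - \<beta> then (\<lambda>k. case k of Inr \<gamma> \<Rightarrow> hcoef Bas \<beta> \<gamma> | Inl _ \<Rightarrow> 0)
         else if \<beta> + \<delta> \<in> \<Phi> then (\<lambda>k. if k = Inl (\<beta> + \<delta>) then N \<beta> \<delta> else 0)
         else (\<lambda>k. 0)))"

definition chevalley_basis :: "'a::real_inner set \<Rightarrow> 'a set \<Rightarrow> ('a \<Rightarrow> 'a \<Rightarrow> int) \<Rightarrow> bool" where
  "chevalley_basis \<Phi> Bas N \<longleftrightarrow>
     (\<forall>\<alpha>\<in>\<Phi>. \<forall>\<beta>\<in>\<Phi>. \<alpha> + \<beta> \<in> \<Phi> \<longrightarrow>
        N \<alpha> \<beta> = int (string_p \<Phi> \<alpha> \<beta>) + 1 \<or> N \<alpha> \<beta> = - (int (string_p \<Phi> \<alpha> \<beta>) + 1)) \<and>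
     (\<forall>x\<in>idxset \<Phi> Bas. \<forall>y\<in>idxset \<Phi> Bas. \<forall>k. brk \<Phi> Bas N x y k = - brk \<Phi> Bas N y x k) \<and>
     (\<forall>x\<in>idxset \<Phi> Bas. \<forall>y\<in>idxset \<Phi> Bas. \<forall>z\<in>idxset \<Phi> Bas. \<forall>t.
        (\<Sum>m\<in>idxset \<Phi> Bas. brk \<Phi> Bas N y z m * brk \<Phi> Bas N x m t
                          + brk \<Phi> Bas N z x m * brk \<Phi> Bas N y m t
                          + brk \<Phi> Bas N x y m * brk \<Phi> Bas N z m t) = 0)"

text \<open>Matrices indexed by a finite index set I (entry (i,j) = coefficient of basis i in image of basis j).\<close>
definition mmul :: "'i set \<Rightarrow> ('i \<Rightarrow> 'i \<Rightarrow> 'r::comm_semiring_0) \<Rightarrow> ('i \<Rightarrow> 'i \<Rightarrow> 'r) \<Rightarrow> 'i \<Rightarrow> 'i \<Rightarrow> 'r" where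
  "mmul I A B = (\<lambda>i j. \<Sum>k\<in>I. A i k * B k j)"

definition idm :: "'i set \<Rightarrow> 'i \<Rightarrow> 'i \<Rightarrow> 'r::{zero,one}" where
  "idm I = (\<lambda>i j. if i = j \<and> i \<in> I then 1 else 0)"

definition mpow :: "'i set \<Rightarrow> ('i \<Rightarrow> 'i \<Rightarrow> 'r::comm_semiring_1) \<Rightarrow> nat \<Rightarrow> 'i \<Rightarrow> 'i \<Rightarrow> 'r" where
  "mpow I A k = (mmul I A ^^ k) (idm I)"

definition adm :: "'a::real_inner set \<Rightarrow> 'a set \<Rightarrow> ('a \<Rightarrow> 'a \<Rightarrow> int) \<Rightarrow> 'a \<Rightarrow> 'a idx \<Rightarrow> 'a idx \<Rightarrow> int" where
  "adm \<Phi> Bas N \<alpha> = (\<lambda>i j. if i \<in> idxset \<Phi> Bas \<and> j \<in> idxset \<Phi> Bas then brk \<Phi> Bas N (Inl \<alpha>) j i else 0)"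

text \<open>Root element x_\<alpha>(a) = exp(a ad e_\<alpha>) = sum a^k (ad e_\<alpha>)^k/k!, the divided powers being
  computed over the integers (Chevalley's Z-form) and then mapped into the field.\<close>
definition xr :: "'a::real_inner set \<Rightarrow> 'a set \<Rightarrow> ('a \<Rightarrow> 'a \<Rightarrow> int) \<Rightarrow> 'a \<Rightarrow> 'f::field \<Rightarrow> 'a idx \<Rightarrow> 'a idx \<Rightarrow> 'f" where
  "xr \<Phi> Bas N \<alpha> a = (\<lambda>i j. \<Sum>k\<le>card (idxset \<Phi> Bas).
       of_int (mpow (idxset \<Phi> Bas) (adm \<Phi> Bas N \<alpha>) k i j div fact k) * a ^ k)"

text \<open>Diagonal automorphism with character determined by t on the simple roots.\<close>
definition tor :: "'a::real_inner set \<Rightarrow> 'a set \<Rightarrow> ('a \<Rightarrow> 'f::field) \<Rightarrow> 'a idx \<Rightarrow> 'a idx \<Rightarrow> 'f" where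
  "tor \<Phi> Bas t = (\<lambda>i j. if i = j \<and> i \<in> idxset \<Phi> Bas then
       (case i of Inl \<beta> \<Rightarrow> (\<Prod>\<gamma>\<in>Bas. t \<gamma> powi coords Bas \<beta> \<gamma>) | Inr _ \<Rightarrow> 1) else 0)"

definition torus :: "'a::real_inner set \<Rightarrow> 'a set \<Rightarrow> ('a idx \<Rightarrow> 'a idx \<Rightarrow> 'f::field) set" where
  "torus \<Phi> Bas = {tor \<Phi> Bas t | t. \<forall>\<gamma>\<in>Bas. t \<gamma> \<noteq> 0}"

text \<open>G = <x_\<alpha>(a), H> (a group since the generators are closed under inverses).\<close>
inductive_set chev_group :: "'a::real_inner set \<Rightarrow> 'a set \<Rightarrow> ('a \<Rightarrow> 'a \<Rightarrow> int) \<Rightarrow> ('a idx \<Rightarrow> 'a idx \<Rightarrow> 'f::field) set"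
  for \<Phi> Bas N where
  cg_id: "idm (idxset \<Phi> Bas) \<in> chev_group \<Phi> Bas N"
| cg_root: "\<alpha> \<in> \<Phi> \<Longrightarrow> g \<in> chev_group \<Phi> Bas N \<Longrightarrow> mmul (idxset \<Phi> Bas) (xr \<Phi> Bas N \<alpha> a) g \<in> chev_group \<Phi> Bas N"
| cg_tor: "h \<in> torus \<Phi> Bas \<Longrightarrow> g \<in> chev_group \<Phi> Bas N \<Longrightarrow> mmul (idxset \<Phi> Bas) h g \<in> chev_group \<Phi> Bas N"

inductive_set uplus :: "'a::euclidean_space set \<Rightarrow> 'a set \<Rightarrow> ('a \<Rightarrow> 'a \<Rightarrow> int) \<Rightarrow> ('a idx \<Rightarrow> 'a idx \<Rightarrow> 'f::field) set"
  for \<Phi> Bas N where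
  up_id: "idm (idxset \<Phi> Bas) \<in> uplus \<Phi> Bas N"
| up_root: "\<alpha> \<in> pos_roots \<Phi> Bas \<Longrightarrow> u \<in> uplus \<Phi> Bas N \<Longrightarrow> mmul (idxset \<Phi> Bas) (xr \<Phi> Bas N \<alpha> a) u \<in> uplus \<Phi> Bas N"

definition borel :: "'a::euclidean_space set \<Rightarrow> 'a set \<Rightarrow> ('a \<Rightarrow> 'a \<Rightarrow> int) \<Rightarrow> ('a idx \<Rightarrow> 'a idx \<Rightarrow> 'f::field) set" where
  "borel \<Phi> Bas N = {mmul (idxset \<Phi> Bas) h u | h u. h \<in> torus \<Phi> Bas \<and> u \<in> uplus \<Phi> Bas N}"

definition nr :: "'a::real_inner set \<Rightarrow> 'a set \<Rightarrow> ('a \<Rightarrow> 'a \<Rightarrow> int) \<Rightarrow> 'a \<Rightarrow> 'a idx \<Rightarrow> 'a idx \<Rightarrow> 'f::field" where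
  "nr \<Phi> Bas N \<alpha> = mmul (idxset \<Phi> Bas) (xr \<Phi> Bas N \<alpha> 1)
      (mmul (idxset \<Phi> Bas) (xr \<Phi> Bas N (- \<alpha>) (- 1)) (xr \<Phi> Bas N \<alpha> 1))"

definition nword :: "'a::real_inner set \<Rightarrow> 'a set \<Rightarrow> ('a \<Rightarrow> 'a \<Rightarrow> int) \<Rightarrow> 'a list \<Rightarrow> 'a idx \<Rightarrow> 'a idx \<Rightarrow> 'f::field" where
  "nword \<Phi> Bas N \<alpha>s = foldr (\<lambda>\<alpha> M. mmul (idxset \<Phi> Bas) (nr \<Phi> Bas N \<alpha>) M) \<alpha>s (idm (idxset \<Phi> Bas))"

definition wreps :: "'a::real_inner set \<Rightarrow> 'a set \<Rightarrow> ('a \<Rightarrow> 'a \<Rightarrow> int) \<Rightarrow> ('a \<Rightarrow> 'a) \<Rightarrow> ('a idx \<Rightarrow> 'a idx \<Rightarrow> 'f::field) set" where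
  "wreps \<Phi> Bas N w = {nword \<Phi> Bas N \<alpha>s | \<alpha>s. set \<alpha>s \<subseteq> Bas \<and> wword \<alpha>s = w}"

definition coset :: "'i set \<Rightarrow> ('i \<Rightarrow> 'i \<Rightarrow> 'r::comm_semiring_0) \<Rightarrow> ('i \<Rightarrow> 'i \<Rightarrow> 'r) set \<Rightarrow> ('i \<Rightarrow> 'i \<Rightarrow> 'r) set" where
  "coset I g X = mmul I g ` X"

definition bruhat :: "'a::euclidean_space set \<Rightarrow> 'a set \<Rightarrow> ('a \<Rightarrow> 'a \<Rightarrow> int) \<Rightarrow> ('a \<Rightarrow> 'a) \<Rightarrow> ('a idx \<Rightarrow> 'a idx \<Rightarrow> 'f::field) set" where
  "bruhat \<Phi> Bas N w = {mmul (idxset \<Phi> Bas) b1 (mmul (idxset \<Phi> Bas) n b2) | b1 n b2.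
      b1 \<in> borel \<Phi> Bas N \<and> n \<in> wreps \<Phi> Bas N w \<and> b2 \<in> borel \<Phi> Bas N}"

definition parabolic :: "'a::euclidean_space set \<Rightarrow> 'a set \<Rightarrow> ('a \<Rightarrow> 'a \<Rightarrow> int) \<Rightarrow> 'a set \<Rightarrow> ('a idx \<Rightarrow> 'a idx \<Rightarrow> 'f::field) set" where
  "parabolic \<Phi> Bas N K = (\<Union>w\<in>weyl_gen K. bruhat \<Phi> Bas N w)"

definition chambers :: "'a::euclidean_space set \<Rightarrow> 'a set \<Rightarrow> ('a \<Rightarrow> 'a \<Rightarrow> int) \<Rightarrow> ('a idx \<Rightarrow> 'a idx \<Rightarrow> 'f::field) set set" where
  "chambers \<Phi> Bas N = {coset (idxset \<Phi> Bas) g (borel \<Phi> Bas N) | g. g \<in> chev_group \<Phi> Bas N}"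

definition wdist :: "'a::euclidean_space set \<Rightarrow> 'a set \<Rightarrow> ('a \<Rightarrow> 'a \<Rightarrow> int) \<Rightarrow>
    ('a idx \<Rightarrow> 'a idx \<Rightarrow> 'f::field) set \<Rightarrow> ('a idx \<Rightarrow> 'a idx \<Rightarrow> 'f) set \<Rightarrow> ('a \<Rightarrow> 'a) \<Rightarrow> bool" where
  "wdist \<Phi> Bas N C D w \<longleftrightarrow> w \<in> weyl_gen Bas \<and>
     (\<exists>g h. g \<in> chev_group \<Phi> Bas N \<and> h \<in> chev_group \<Phi> Bas N \<and>
        C = coset (idxset \<Phi> Bas) g (borel \<Phi> Bas N) \<and> D = coset (idxset \<Phi> Bas) h (borel \<Phi> Bas N) \<and>
        h \<in> coset (idxset \<Phi> Bas) g (bruhat \<Phi> Bas N w))"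

text \<open>Simplices of type J are cosets gP_{S\J}; a chamber C contains the simplex \<sigma> iff C \<subseteq> \<sigma>.
  Simplices of types J, J' are opposite iff J' is the opposite type of J and they lie in
  chambers at Weyl distance w0.\<close>
definition opposite_simplices :: "'a::euclidean_space set \<Rightarrow> 'a set \<Rightarrow> ('a \<Rightarrow> 'a \<Rightarrow> int) \<Rightarrow>
    'a set \<Rightarrow> ('a idx \<Rightarrow> 'a idx \<Rightarrow> 'f::field) set \<Rightarrow> 'a set \<Rightarrow> ('a idx \<Rightarrow> 'a idx \<Rightarrow> 'f) set \<Rightarrow> bool" where
  "opposite_simplices \<Phi> Bas N J \<sigma> J' \<tau> \<longleftrightarrow> J' = opp_type Bas J \<and>
     (\<exists>C D. C \<in> chambers \<Phi> Bas N \<and> D \<in> chambers \<Phi> Bas N \<and> C \<subseteq> \<sigma> \<and> D \<subseteq> \<tau> \<and>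
        wdist \<Phi> Bas N C D (longest_elt Bas))"

definition type_pres_aut :: "'a::euclidean_space set \<Rightarrow> 'a set \<Rightarrow> ('a \<Rightarrow> 'a \<Rightarrow> int) \<Rightarrow>
    ('a idx \<Rightarrow> 'a idx \<Rightarrow> 'f::field) \<Rightarrow> bool" where
  "type_pres_aut \<Phi> Bas N \<theta> \<longleftrightarrow>
     bij_betw (coset (idxset \<Phi> Bas) \<theta>) (chambers \<Phi> Bas N) (chambers \<Phi> Bas N) \<and>
     (\<forall>C\<in>chambers \<Phi> Bas N. \<forall>D\<in>chambers \<Phi> Bas N. \<forall>w.
        wdist \<Phi> Bas N C D w \<longleftrightarrow> wdist \<Phi> Bas N (coset (idxset \<Phi> Bas) \<theta> C) (coset (idxset \<Phi> Bas) \<theta> D) w)"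

definition opp_type_of :: "'a::euclidean_space set \<Rightarrow> 'a set \<Rightarrow> ('a \<Rightarrow> 'a \<Rightarrow> int) \<Rightarrow>
    ('a idx \<Rightarrow> 'a idx \<Rightarrow> 'f::field) \<Rightarrow> 'a set" where
  "opp_type_of \<Phi> Bas N \<theta> = \<Union>{J. J \<subseteq> Bas \<and> (\<exists>g\<in>chev_group \<Phi> Bas N.
       opposite_simplices \<Phi> Bas N J (coset (idxset \<Phi> Bas) g (parabolic \<Phi> Bas N (Bas - J)))
         J (coset (idxset \<Phi> Bas) (mmul (idxset \<Phi> Bas) \<theta> g) (parabolic \<Phi> Bas N (Bas - J))))}"

definition disp :: "'a::euclidean_space set \<Rightarrow> 'a set \<Rightarrow> ('a \<Rightarrow> 'a \<Rightarrow> int) \<Rightarrow>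
    ('a idx \<Rightarrow> 'a idx \<Rightarrow> 'f::field) \<Rightarrow> ('a \<Rightarrow> 'a) set" where
  "disp \<Phi> Bas N \<theta> = {w. \<exists>C\<in>chambers \<Phi> Bas N. wdist \<Phi> Bas N C (coset (idxset \<Phi> Bas) \<theta> C) w}"

end

theory Submission
  imports Defs
begin

text \<open>
  Every long root is a Weyl conjugate of the highest root \<open>\<phi>\<close>, and \<open>x\<^sub>\<phi>(a)\<close> commutes with \<open>U\<^sup>+\<close>.
  By the Bruhat decomposition each conjugate of \<open>\<theta> = x\<^sub>\<alpha>(a)\<close> therefore has the form \<open>b x\<^sub>\<beta>(c) b\<^sup>-\<^sup>1\<close> with
  \<open>b \<in> B\<close> and \<open>\<beta> \<in> W\<phi>\<close>; it lies in \<open>B\<close> if \<open>\<beta>\<close> is positive and in \<open>B s\<^sub>\<beta> B\<close> otherwise, which gives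
  the displacements. If a simplex of type \<open>J\<close> is mapped to an opposite one, then \<open>w\<^sub>0 = s\<^sub>\<beta> k\<close> with \<open>k\<close> in the parabolic
  subgroup of \<open>S - J\<close>; applied to the fundamental weight \<open>\<omega>\<^sub>j\<close> this makes \<open>\<omega>\<^sub>j - w\<^sub>0 \<omega>\<^sub>j\<close> a multiple of
  \<open>\<beta>\<close> that is dominant, so \<open>\<beta> = \<plusminus>\<phi>\<close> and \<open>\<langle>\<alpha>\<^sub>j, \<phi>\<rangle> > 0\<close>. Conversely \<open>s\<^sub>\<phi> w\<^sub>0\<close> fixes the dominant
  vector \<open>\<phi>\<close>, hence lies in the parabolic subgroup of \<open>S - \<wp>\<close>.

  Disjointness of the Bruhat cells is read off from the matrices: elements of \<open>B\<close> are triangular for the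
  dominance order on weights, so \<open>n\<^sub>v b = b' n\<^sub>w\<close> forces \<open>v\<beta> \<ge> w\<beta>\<close> for every root \<open>\<beta>\<close>, and by symmetry \<open>v = w\<close>.

  Chevalley's commutator formula is replaced by the following argument. Over the integers, let \<open>M\<close> be an
  automorphism of the Lie ring whose nonzero entries shift weights by \<open>p\<alpha> + q\<beta>\<close> with \<open>q \<ge> 1\<close>, up to the identity.
  The component of lowest shift \<open>\<gamma>\<close> in \<open>M - 1\<close> is a derivation, hence an integer multiple of \<open>ad e\<^sub>\<gamma>\<close>
  (integer because the coroot of \<open>\<gamma>\<close> is primitive), and is removed by multiplying with some \<open>x\<^sub>\<gamma>(c)\<close>. Thus \<open>M\<close> is a
  product of such factors. The entry of \<open>x\<^sub>\<alpha>(t) x\<^sub>\<beta>(s) x\<^sub>\<alpha>(-t)\<close> with shift \<open>p\<alpha> + q\<beta>\<close> is the corresponding integer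
  entry for \<open>s = t = 1\<close> times \<open>t\<^sup>p s\<^sup>q\<close>, which transfers the factorization to every field.
\<close>

section \<open>Matrices indexed by a finite set\<close>

text \<open>The field may have any characteristic, so structure constants can vanish in it and
  factorials need not be invertible. Structural facts about root elements are therefore proved for
  integral matrices, where factorials, signs and coefficients of coroots can be cancelled, and only
  then mapped to the field. The torus contains all characters of the root lattice; this puts the
  sign matrices met on the way, and the scaling of a single simple root by any nonzero factor,
  inside \<open>B\<close>. The set \<open>wreps\<close> uses all words for a Weyl element, reduced
  or not, so words for the same element must first be shown to differ by a torus element. A product
  of two cells is located only up to some word in the letters of the second one. This suffices for
  opposition: if a chamber \<open>c\<close> lies in the simplex and \<open>d\<close> in its image,
  then \<open>c\<^sup>-\<^sup>1 d = (c\<^sup>-\<^sup>1 \<theta> c) p\<^sup>-\<^sup>1 q\<close> with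
  \<open>p\<close>, \<open>q\<close> in the parabolic subgroup of \<open>Bas - J\<close>. The
  bracket lies in the cell of 1 or of a long root reflection \<open>s\<close>, and all further
  letters lie in \<open>Bas - J\<close>; comparison with the cell of \<open>w0\<close> gives
  \<open>w0 = s k\<close>.\<close>

lemma mmul_assoc: "mmul I (mmul I A B) C = mmul I A (mmul I B C)"
proof -
  have "(\<Sum>k\<in>I. (\<Sum>l\<in>I. A i l * B l k) * C k j) = (\<Sum>l\<in>I. A i l * (\<Sum>k\<in>I. B l k * C k j))" for i j
    by (simp add: sum_distrib_left sum_distrib_right mult.assoc) (rule sum.swap)
  then show ?thesis by (simp add: mmul_def)
qed

text \<open>Matrices are total functions on the index type. As \<open>idm I\<close> vanishes off
  \<open>I\<close>, it is a two-sided unit only for matrices that vanish there too.\<close>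

definition msupp :: "'i set \<Rightarrow> ('i \<Rightarrow> 'i \<Rightarrow> 'r::zero) \<Rightarrow> bool" where
  "msupp I A \<longleftrightarrow> (\<forall>i j. A i j \<noteq> 0 \<longrightarrow> i \<in> I \<and> j \<in> I)"

lemma msupp_mmul: "msupp I A \<Longrightarrow> msupp I B \<Longrightarrow> msupp I (mmul I A B)"
  unfolding msupp_def mmul_def
  by (metis (no_types, lifting) mult_zero_left mult_zero_right sum.neutral)

lemma msupp_idm: "msupp I (idm I)"
  by (auto simp: msupp_def idm_def)

lemma mmul_idm_left: "finite I \<Longrightarrow> msupp I A \<Longrightarrow> mmul I (idm I) A = (A :: 'i \<Rightarrow> 'i \<Rightarrow> 'r::comm_semiring_1)"
proof (intro ext)
  fix i j assume "finite I" "msupp I A"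
  have "(\<Sum>k\<in>I. idm I i k * A k j) = (\<Sum>k\<in>I. if k = i then A i j else 0)"
    by (intro sum.cong) (auto simp: idm_def)
  also have "\<dots> = A i j" using \<open>finite I\<close> \<open>msupp I A\<close> by (auto simp: msupp_def)
  finally show "mmul I (idm I) A i j = A i j" by (simp add: mmul_def)
qed

lemma mmul_idm_right: "finite I \<Longrightarrow> msupp I A \<Longrightarrow> mmul I A (idm I) = (A :: 'i \<Rightarrow> 'i \<Rightarrow> 'r::comm_semiring_1)"
proof (intro ext)
  fix i j assume "finite I" "msupp I A"
  have "(\<Sum>k\<in>I. A i k * idm I k j) = (\<Sum>k\<in>I. if k = j then A i j else 0)"
    by (intro sum.cong) (auto simp: idm_def)
  also have "\<dots> = A i j" using \<open>finite I\<close> \<open>msupp I A\<close> by (auto simp: msupp_def)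
  finally show "mmul I A (idm I) i j = A i j" by (simp add: mmul_def)
qed

lemma mmul_nonzeroE:
  assumes "mmul I A B i j \<noteq> 0"
  obtains k where "k \<in> I" "A i k \<noteq> 0" "B k j \<noteq> 0"
  using assms unfolding mmul_def
  by (metis (no_types, lifting) mult_zero_left mult_zero_right sum.neutral)

lemma mpow_0: "mpow I A 0 = idm I"
  by (simp add: mpow_def)

lemma mpow_Suc: "mpow I A (Suc k) = mmul I A (mpow I A k)"
  by (simp add: mpow_def)

lemma msupp_mpow: "msupp I A \<Longrightarrow> msupp I (mpow I A k)"
  by (induction k) (simp_all add: mpow_0 mpow_Suc msupp_idm msupp_mmul)

lemma mpow_commute:
  assumes "finite I" "msupp I A" "msupp I B" "mmul I A B = mmul I B A"
  shows "mmul I (mpow I A k) B = mmul I B (mpow I A k)"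
proof (induction k)
  case 0
  show ?case using assms by (simp add: mpow_0 mmul_idm_left mmul_idm_right)
next
  case (Suc k)
  then show ?case using assms(4) by (metis mmul_assoc mpow_Suc)
qed

lemma mpow_Suc2:
  assumes "finite I" "msupp I A"
  shows "mpow I A (Suc k) = mmul I (mpow I A k) A"
  using mpow_commute[OF assms assms(2) refl, of k] by (simp add: mpow_Suc)

definition zmat :: "('i \<Rightarrow> 'i \<Rightarrow> int) \<Rightarrow> 'i \<Rightarrow> 'i \<Rightarrow> 'r::ring_1" where
  "zmat M = (\<lambda>i j. of_int (M i j))"

lemma zmat_mmul: "zmat (mmul I A B) = (mmul I (zmat A) (zmat B) :: 'i \<Rightarrow> 'i \<Rightarrow> 'r::comm_ring_1)"
  by (simp add: zmat_def mmul_def)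

lemma zmat_idm: "zmat (idm I) = (idm I :: 'i \<Rightarrow> 'i \<Rightarrow> 'r::comm_ring_1)"
  by (auto simp: zmat_def idm_def fun_eq_iff)

lemma msupp_zmat: "msupp I A \<Longrightarrow> msupp I (zmat A)"
  unfolding msupp_def zmat_def by (metis of_int_0)

text \<open>The recursion has the shape of \<open>chev_group\<close> and \<open>uplus\<close>, so
  closure under products and inverses is proved once for all generated groups, including the
  unipotent radicals \<open>Urad\<close>.\<close>

inductive_set mgen :: "'i set \<Rightarrow> ('i \<Rightarrow> 'i \<Rightarrow> 'r::comm_semiring_1) set \<Rightarrow> ('i \<Rightarrow> 'i \<Rightarrow> 'r) set"
  for I X where
  mgen_id: "idm I \<in> mgen I X"
| mgen_step: "x \<in> X \<Longrightarrow> g \<in> mgen I X \<Longrightarrow> mmul I x g \<in> mgen I X"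

lemma mgen_msupp: "(\<And>x. x \<in> X \<Longrightarrow> msupp I x) \<Longrightarrow> g \<in> mgen I X \<Longrightarrow> msupp I g"
  by (rotate_tac 1, induction rule: mgen.induct) (auto simp: msupp_idm msupp_mmul)

lemma mgen_mmul:
  assumes "finite I" "\<And>x. x \<in> X \<Longrightarrow> msupp I x" "g \<in> mgen I X" "h \<in> mgen I X"
  shows "mmul I g h \<in> mgen I X"
  using assms(3)
proof induction
  case mgen_id
  show ?case using assms(4) mgen_msupp[OF assms(2) assms(4)] by (simp add: mmul_idm_left assms(1))
next
  case (mgen_step x g)
  then show ?case by (simp add: mmul_assoc mgen.mgen_step)
qed

lemma mgen_gen:
  assumes "finite I" "\<And>x. x \<in> X \<Longrightarrow> msupp I x" "x \<in> X"
  shows "x \<in> mgen I X"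
  using mgen_step[OF assms(3) mgen_id, of I] mmul_idm_right[OF assms(1) assms(2)[OF assms(3)]] by simp

lemma mgen_mono: "X \<subseteq> Y \<Longrightarrow> g \<in> mgen I X \<Longrightarrow> g \<in> mgen I Y"
  by (rotate_tac 1, induction rule: mgen.induct) (auto intro: mgen.intros)

lemma mgen_inverse:
  assumes "finite I" "\<And>x. x \<in> X \<Longrightarrow> msupp I x"
    and inv: "\<And>x. x \<in> X \<Longrightarrow> \<exists>y\<in>X. mmul I x y = idm I \<and> mmul I y x = idm I"
    and "g \<in> mgen I X"
  shows "\<exists>h\<in>mgen I X. mmul I g h = idm I \<and> mmul I h g = idm I"
  using assms(4)
proof induction
  case mgen_id
  show ?case using mmul_idm_left[OF assms(1) msupp_idm] mgen.mgen_id by blast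
next
  case (mgen_step x g)
  then obtain h where h: "h \<in> mgen I X" "mmul I g h = idm I" "mmul I h g = idm I" by blast
  obtain y where y: "y \<in> X" "mmul I x y = idm I" "mmul I y x = idm I" using inv mgen_step by blast
  have sg: "msupp I g" "msupp I y" "msupp I x" "msupp I h"
    using mgen_msupp assms(2) mgen_step h(1) y by blast+
  have 1: "mmul I (mmul I x g) (mmul I h y) = idm I"
    using h y sg by (metis mmul_assoc mmul_idm_left assms(1))
  have 2: "mmul I (mmul I h y) (mmul I x g) = idm I"
    using h y sg by (metis mmul_assoc mmul_idm_left assms(1))
  have 3: "mmul I h y \<in> mgen I X"
    using mgen_mmul[OF assms(1,2) h(1) mgen_gen[OF assms(1,2) y(1)]] by blast
  show ?case using 1 2 3 by blast
qed

section \<open>Root systems and the Weyl group\<close>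

lemma root_refl_linear: "linear (root_refl v)"
  by (rule linearI) (simp_all add: root_refl_def inner_add_left add_divide_distrib algebra_simps)

lemma root_refl_inner: "root_refl v x \<bullet> root_refl v y = x \<bullet> y"
  by (cases "v = 0") (simp_all add: root_refl_def inner_diff_left inner_diff_right inner_commute field_simps)

lemma root_refl_self: "root_refl v v = - v"
  by (cases "v = 0") (simp_all add: root_refl_def algebra_simps scaleR_2)

lemma root_refl_invol: "root_refl v (root_refl v x) = x"
proof -
  have "root_refl v (root_refl v x) = root_refl v x - (2 * (root_refl v x \<bullet> v) / (v \<bullet> v)) *\<^sub>R v"
    by (simp add: root_refl_def)
  also have "root_refl v x \<bullet> v = - (x \<bullet> v)"
    using root_refl_inner[of v x v] by (metis inner_minus_right minus_minus neg_equal_iff_equal root_refl_inner root_refl_self inner_commute)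
  finally show ?thesis by (simp add: root_refl_def)
qed

lemma root_refl_minus: "root_refl (- v) = root_refl v"
  by (rule ext) (simp add: root_refl_def)

lemma root_refl_minus_arg: "root_refl v (- x) = - root_refl v x"
  by (rule linear_neg[OF root_refl_linear])

lemma wword_Nil: "wword [] = id" by (simp add: wword_def)
lemma wword_Cons: "wword (\<alpha> # ws) = root_refl \<alpha> \<circ> wword ws" by (simp add: wword_def)

lemma wword_append: "wword (us @ vs) = wword us \<circ> wword vs"
  by (induction us) (simp_all add: wword_Nil wword_Cons o_assoc)

lemma wword_linear: "linear (wword ws)"
proof (induction ws)
  case Nil show ?case by (simp add: wword_Nil id_def linear_ident)
next
  case (Cons a ws) then show ?case unfolding wword_Cons by (rule linear_compose[OF _ root_refl_linear])
qed

lemma wword_inner: "wword ws x \<bullet> wword ws y = x \<bullet> y"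
  by (induction ws) (simp_all add: wword_Nil wword_Cons root_refl_inner)

lemma wword_rev: "wword (rev ws) (wword ws x) = x"
  by (induction ws arbitrary: x) (simp_all add: wword_Nil wword_Cons wword_append root_refl_invol)

lemma wword_rev2: "wword ws (wword (rev ws) x) = x"
  using wword_rev[of "rev ws"] by simp

lemma wword_minus: "wword ws (- x) = - wword ws x"
  by (rule linear_neg[OF wword_linear])

lemma weyl_gen_wword: "w \<in> weyl_gen R \<longleftrightarrow> (\<exists>ws. set ws \<subseteq> R \<and> w = wword ws)"
proof
  assume "w \<in> weyl_gen R" then show "\<exists>ws. set ws \<subseteq> R \<and> w = wword ws"
  proof induction
    case weyl_id then show ?case by (intro exI[of _ "[]"]) (simp add: wword_Nil)
  next
    case (weyl_step \<alpha> w)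
    then obtain ws where "set ws \<subseteq> R" "w = wword ws" by blast
    then show ?case using weyl_step by (intro exI[of _ "\<alpha> # ws"]) (simp add: wword_Cons)
  qed
next
  have "set ws \<subseteq> R \<Longrightarrow> wword ws \<in> weyl_gen R" for ws
    by (induction ws) (auto simp: wword_Nil wword_Cons intro: weyl_gen.intros)
  then show "\<exists>ws. set ws \<subseteq> R \<and> w = wword ws \<Longrightarrow> w \<in> weyl_gen R" by blast
qed

lemma wword_in: "set ws \<subseteq> R \<Longrightarrow> wword ws \<in> weyl_gen R"
  by (auto simp: weyl_gen_wword)

lemma weyl_gen_comp: "v \<in> weyl_gen R \<Longrightarrow> w \<in> weyl_gen R \<Longrightarrow> v \<circ> w \<in> weyl_gen R"
  unfolding weyl_gen_wword by (metis wword_append set_append Un_least)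

lemma weyl_gen_linear: "w \<in> weyl_gen R \<Longrightarrow> linear w"
  by (auto simp: weyl_gen_wword wword_linear)

lemma weyl_gen_inner: "w \<in> weyl_gen R \<Longrightarrow> w x \<bullet> w y = x \<bullet> y"
  by (auto simp: weyl_gen_wword wword_inner)

lemma weyl_gen_refl: "\<alpha> \<in> R \<Longrightarrow> root_refl \<alpha> \<in> weyl_gen R"
  using weyl_step[OF _ weyl_id, of \<alpha> R] by simp

lemma weyl_gen_inverse: "w \<in> weyl_gen R \<Longrightarrow> \<exists>v\<in>weyl_gen R. v \<circ> w = id \<and> w \<circ> v = id"
proof -
  assume "w \<in> weyl_gen R"
  then obtain ws where ws: "set ws \<subseteq> R" "w = wword ws" by (auto simp: weyl_gen_wword)
  then show ?thesis
    by (intro bexI[of _ "wword (rev ws)"]) (auto simp: wword_rev wword_rev2 intro!: wword_in)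
qed

lemma root_refl_conj: "root_refl (wword ws v) = wword ws \<circ> root_refl v \<circ> wword (rev ws)"
proof
  fix x
  have "x \<bullet> wword ws v = wword (rev ws) x \<bullet> v"
    by (metis wword_inner wword_rev2)
  then have "wword ws (root_refl v (wword (rev ws) x)) = root_refl (wword ws v) x"
    by (simp add: root_refl_def linear_diff[OF wword_linear] linear_cmul[OF wword_linear] wword_rev2 wword_inner)
  then show "root_refl (wword ws v) x = (wword ws \<circ> root_refl v \<circ> wword (rev ws)) x" by simp
qed

text \<open>Riesz representation of a linear extension of the coordinate functional. It supplies
  coordinates for simple roots, for simple coroots and for a pair of independent roots.\<close>

lemma ex_dual_vector:
  fixes X :: "'a::euclidean_space set"
  assumes "independent X"
  shows "\<exists>x. \<forall>\<delta>\<in>X. x \<bullet> \<delta> = (if \<delta> = \<gamma> then 1 else 0)"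
proof -
  obtain g :: "'a \<Rightarrow> real" where g: "linear g" "\<forall>\<delta>\<in>X. g \<delta> = (if \<delta> = \<gamma> then 1 else 0)"
    using linear_independent_extend[OF assms, of "\<lambda>\<delta>. if \<delta> = \<gamma> then 1 else 0"] by blast
  have "(\<Sum>b\<in>Basis. g b *\<^sub>R b) \<bullet> v = g v" for v
  proof -
    have "g v = g (\<Sum>b\<in>Basis. (v \<bullet> b) *\<^sub>R b)" by (simp add: euclidean_representation)
    also have "\<dots> = (\<Sum>b\<in>Basis. (v \<bullet> b) * g b)" by (simp add: linear_sum[OF g(1)] linear_cmul[OF g(1)])
    finally show ?thesis by (simp add: inner_sum_right inner_commute[of _ v] mult.commute)
  qed
  then show ?thesis using g(2) by metis
qed

lemma coords_unique:
  fixes X :: "'a::euclidean_space set"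
  assumes "independent X" "\<And>\<gamma>. \<gamma> \<notin> X \<Longrightarrow> c \<gamma> = 0" "v = (\<Sum>\<gamma>\<in>X. of_int (c \<gamma>) *\<^sub>R \<gamma>)"
  shows "coords X v = c"
  unfolding coords_def
proof (rule the_equality)
  show "(\<forall>\<gamma>. \<gamma> \<notin> X \<longrightarrow> c \<gamma> = 0) \<and> v = (\<Sum>\<gamma>\<in>X. of_int (c \<gamma>) *\<^sub>R \<gamma>)" using assms by blast
next
  fix d :: "'a \<Rightarrow> int" assume d: "(\<forall>\<gamma>. \<gamma> \<notin> X \<longrightarrow> d \<gamma> = 0) \<and> v = (\<Sum>\<gamma>\<in>X. of_int (d \<gamma>) *\<^sub>R \<gamma>)"
  have fin: "finite X" using assms(1) by (rule independent_imp_finite)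
  have "d \<gamma> = c \<gamma>" if "\<gamma> \<in> X" for \<gamma>
  proof -
    obtain x where x: "\<forall>\<delta>\<in>X. x \<bullet> \<delta> = (if \<delta> = \<gamma> then 1 else 0)" using ex_dual_vector[OF assms(1)] by blast
    have "x \<bullet> (\<Sum>\<gamma>\<in>X. of_int (e \<gamma>) *\<^sub>R \<gamma>) = of_int (e \<gamma>)" for e :: "'a \<Rightarrow> int"
    proof -
      have "x \<bullet> (\<Sum>\<gamma>\<in>X. of_int (e \<gamma>) *\<^sub>R \<gamma>) = (\<Sum>\<delta>\<in>X. of_int (e \<delta>) * (if \<delta> = \<gamma> then 1 else 0))"
        unfolding inner_sum_right inner_scaleR_right using x by (intro sum.cong) auto
      then show ?thesis using fin that by (simp add: if_distrib cong: if_cong)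
    qed
    then have "real_of_int (c \<gamma>) = of_int (d \<gamma>)" using d assms(3) by metis
    then show ?thesis by simp
  qed
  then show "d = c" using d assms(2) by (metis ext)
qed

locale root_base =
  fixes \<Phi> Bas :: "'a::euclidean_space set"
  assumes RS: "root_system \<Phi>" and red: "rs_reduced \<Phi>" and base: "is_base \<Phi> Bas"
begin

lemma finite_roots: "finite \<Phi>" and zero_not_root: "0 \<notin> \<Phi>" and span_roots: "span \<Phi> = UNIV"
  using RS by (auto simp: root_system_def)

lemma root_refl_root: "\<alpha> \<in> \<Phi> \<Longrightarrow> \<beta> \<in> \<Phi> \<Longrightarrow> root_refl \<alpha> \<beta> \<in> \<Phi>"
  using RS by (auto simp: root_system_def)

lemma cartan_int: "\<alpha> \<in> \<Phi> \<Longrightarrow> \<beta> \<in> \<Phi> \<Longrightarrow> 2 * (\<beta> \<bullet> \<alpha>) / (\<alpha> \<bullet> \<alpha>) \<in> \<int>"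
  using RS by (auto simp: root_system_def)

lemma of_int_cartan: "\<alpha> \<in> \<Phi> \<Longrightarrow> \<beta> \<in> \<Phi> \<Longrightarrow> real_of_int (cartan \<beta> \<alpha>) = 2 * (\<beta> \<bullet> \<alpha>) / (\<alpha> \<bullet> \<alpha>)"
  using cartan_int[of \<alpha> \<beta>] by (simp add: cartan_def)

lemma root_minus: "\<beta> \<in> \<Phi> \<Longrightarrow> - \<beta> \<in> \<Phi>"
  using root_refl_root[of \<beta> \<beta>] by (simp add: root_refl_self)

lemma reduced: "\<alpha> \<in> \<Phi> \<Longrightarrow> c *\<^sub>R \<alpha> \<in> \<Phi> \<Longrightarrow> c = 1 \<or> c = -1"
  using red by (auto simp: rs_reduced_def)

lemma base_roots: "\<gamma> \<in> Bas \<Longrightarrow> \<gamma> \<in> \<Phi>" and base_indep: "independent Bas"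
  using base by (auto simp: is_base_def)

lemma finite_base: "finite Bas"
  using base_indep by (rule independent_imp_finite)

lemma root_inner_pos: "\<beta> \<in> \<Phi> \<Longrightarrow> \<beta> \<bullet> \<beta> > 0"
  using zero_not_root by (metis inner_gt_zero_iff)

text \<open>The basis dual to the simple roots. Up to a positive factor \<open>fw \<gamma>\<close>
  is a fundamental weight, so the same vectors read off coefficients of roots and serve in the
  opposition argument.\<close>

definition fw :: "'a \<Rightarrow> 'a" where
  "fw \<gamma> = (SOME x. \<forall>\<delta>\<in>Bas. x \<bullet> \<delta> = (if \<delta> = \<gamma> then 1 else 0))"

lemma fw_base: "\<delta> \<in> Bas \<Longrightarrow> fw \<gamma> \<bullet> \<delta> = (if \<delta> = \<gamma> then 1 else 0)"
  using someI_ex[OF ex_dual_vector[OF base_indep, of \<gamma>]] by (auto simp: fw_def)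

lemma fw_sum: "\<gamma> \<in> Bas \<Longrightarrow> fw \<gamma> \<bullet> (\<Sum>\<delta>\<in>Bas. c \<delta> *\<^sub>R \<delta>) = c \<gamma>"
  using finite_base by (simp add: inner_sum_right fw_base if_distrib sum.delta cong: if_cong)

lemma root_expand: "\<beta> \<in> \<Phi> \<Longrightarrow> \<exists>c. \<beta> = (\<Sum>\<gamma>\<in>Bas. of_int (c \<gamma>) *\<^sub>R \<gamma>) \<and>
        ((\<forall>\<gamma>\<in>Bas. c \<gamma> \<ge> 0) \<or> (\<forall>\<gamma>\<in>Bas. c \<gamma> \<le> 0))" for \<beta>
  using base by (auto simp: is_base_def)

lemma span_Bas: "span Bas = UNIV"
proof -
  have "\<Phi> \<subseteq> span Bas"
  proof
    fix \<beta> assume "\<beta> \<in> \<Phi>"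
    then obtain c where "\<beta> = (\<Sum>\<gamma>\<in>Bas. of_int (c \<gamma>) *\<^sub>R \<gamma>)" using root_expand by blast
    then show "\<beta> \<in> span Bas" by (auto intro: span_sum span_scale span_base)
  qed
  then show ?thesis using span_roots span_minimal[OF _ subspace_span] by blast
qed

lemma expand: "v = (\<Sum>\<gamma>\<in>Bas. (fw \<gamma> \<bullet> v) *\<^sub>R \<gamma>)"
proof -
  have "v \<in> span Bas" using span_Bas by simp
  then obtain c where c: "v = (\<Sum>\<gamma>\<in>Bas. c \<gamma> *\<^sub>R \<gamma>)" using span_finite[OF finite_base] by auto
  then have "\<gamma> \<in> Bas \<Longrightarrow> fw \<gamma> \<bullet> v = c \<gamma>" for \<gamma> using fw_sum by simp
  then show ?thesis using c by simp
qed

lemma eq_by_base: "(\<And>\<gamma>. \<gamma> \<in> Bas \<Longrightarrow> v \<bullet> \<gamma> = w \<bullet> \<gamma>) \<Longrightarrow> v = w"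
proof -
  assume a: "\<And>\<gamma>. \<gamma> \<in> Bas \<Longrightarrow> v \<bullet> \<gamma> = w \<bullet> \<gamma>"
  have "(v - w) \<bullet> x = 0" for x
    by (subst expand[of x]) (simp add: inner_sum_right a inner_diff_left)
  then have "(v - w) \<bullet> (v - w) = 0" by blast
  then show "v = w" by simp
qed

lemma linear_eq_roots:
  assumes "linear f" "linear g" "\<And>\<beta>. \<beta> \<in> \<Phi> \<Longrightarrow> f \<beta> = g \<beta>"
  shows "f = g"
  using linear_eq_on_span[OF assms(1,2), of \<Phi>] assms(3) span_roots by auto

lemma fw_root_int: "\<beta> \<in> \<Phi> \<Longrightarrow> \<gamma> \<in> Bas \<Longrightarrow> fw \<gamma> \<bullet> \<beta> \<in> \<int>"
  using root_expand[of \<beta>] fw_sum by auto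

lemma nonneg_comb_iff: "nonneg_comb Bas v \<longleftrightarrow> (\<forall>\<gamma>\<in>Bas. fw \<gamma> \<bullet> v \<in> \<int> \<and> fw \<gamma> \<bullet> v \<ge> 0)"
proof
  assume "nonneg_comb Bas v" then show "\<forall>\<gamma>\<in>Bas. fw \<gamma> \<bullet> v \<in> \<int> \<and> fw \<gamma> \<bullet> v \<ge> 0"
    by (auto simp: nonneg_comb_def fw_sum)
next
  assume a: "\<forall>\<gamma>\<in>Bas. fw \<gamma> \<bullet> v \<in> \<int> \<and> fw \<gamma> \<bullet> v \<ge> 0"
  then have "\<gamma> \<in> Bas \<Longrightarrow> real (nat \<lfloor>fw \<gamma> \<bullet> v\<rfloor>) = fw \<gamma> \<bullet> v" for \<gamma>
    by (auto elim!: Ints_cases)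
  then have "v = (\<Sum>\<gamma>\<in>Bas. real (nat \<lfloor>fw \<gamma> \<bullet> v\<rfloor>) *\<^sub>R \<gamma>)"
    by (subst expand[of v]) (intro sum.cong, auto)
  then show "nonneg_comb Bas v" unfolding nonneg_comb_def
    by (rule exI[of _ "\<lambda>\<gamma>. nat \<lfloor>fw \<gamma> \<bullet> v\<rfloor>"])
qed

abbreviation P where "P \<equiv> pos_roots \<Phi> Bas"

lemma pos_iff: "\<beta> \<in> P \<longleftrightarrow> \<beta> \<in> \<Phi> \<and> (\<forall>\<gamma>\<in>Bas. fw \<gamma> \<bullet> \<beta> \<ge> 0)"
  by (auto simp: pos_roots_def nonneg_comb_iff fw_root_int)

lemma pos_or_neg: "\<beta> \<in> \<Phi> \<Longrightarrow> \<beta> \<in> P \<or> - \<beta> \<in> P"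
proof -
  assume b: "\<beta> \<in> \<Phi>"
  obtain c where c: "\<beta> = (\<Sum>\<gamma>\<in>Bas. of_int (c \<gamma>) *\<^sub>R \<gamma>)" "(\<forall>\<gamma>\<in>Bas. c \<gamma> \<ge> 0) \<or> (\<forall>\<gamma>\<in>Bas. c \<gamma> \<le> 0)"
    using root_expand[OF b] by blast
  have "\<gamma> \<in> Bas \<Longrightarrow> fw \<gamma> \<bullet> \<beta> = of_int (c \<gamma>)" for \<gamma> using c(1) fw_sum by simp
  then show ?thesis using c(2) b root_minus by (auto simp: pos_iff)
qed

lemma not_pos_and_neg: "\<beta> \<in> P \<Longrightarrow> - \<beta> \<notin> P"
proof
  assume "\<beta> \<in> P" "- \<beta> \<in> P"
  then have "\<gamma> \<in> Bas \<Longrightarrow> fw \<gamma> \<bullet> \<beta> = 0" for \<gamma> by (force simp: pos_iff)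
  then have "\<beta> = 0" by (subst expand) simp
  then show False using \<open>\<beta> \<in> P\<close> zero_not_root by (simp add: pos_iff)
qed

lemma pos_root: "\<beta> \<in> P \<Longrightarrow> \<beta> \<in> \<Phi>" by (simp add: pos_iff)

lemma base_pos: "\<gamma> \<in> Bas \<Longrightarrow> \<gamma> \<in> P"
  by (simp add: pos_iff base_roots fw_base)

lemma finite_P: "finite P"
  using finite_roots by (simp add: pos_roots_def)

text \<open>Otherwise reflecting \<open>\<gamma>\<close> in \<open>\<delta>\<close> would give a
  root with coefficient 1 at \<open>\<gamma>\<close> and a negative coefficient at
  \<open>\<delta>\<close>.\<close>

lemma base_obtuse: "\<gamma> \<in> Bas \<Longrightarrow> \<delta> \<in> Bas \<Longrightarrow> \<gamma> \<noteq> \<delta> \<Longrightarrow> \<gamma> \<bullet> \<delta> \<le> 0"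
proof (rule ccontr)
  assume a: "\<gamma> \<in> Bas" "\<delta> \<in> Bas" "\<gamma> \<noteq> \<delta>" and "\<not> \<gamma> \<bullet> \<delta> \<le> 0"
  let ?r = "root_refl \<delta> \<gamma>"
  have r: "?r \<in> \<Phi>" using a root_refl_root base_roots by blast
  have "fw \<gamma> \<bullet> ?r = 1" using a by (simp add: root_refl_def inner_diff_right fw_base)
  moreover have "fw \<delta> \<bullet> ?r < 0"
    using a \<open>\<not> \<gamma> \<bullet> \<delta> \<le> 0\<close> root_inner_pos[OF base_roots[OF a(2)]]
    by (simp add: root_refl_def inner_diff_right fw_base)
  ultimately show False using pos_or_neg[OF r] a unfolding pos_iff
    by (metis inner_minus_right linorder_not_le neg_0_le_iff_le not_one_le_zero)
qed

text \<open>A positive root supported on \<open>\<gamma>\<close> alone is a multiple of it, hence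
  equal to it by reducedness. The second positive coefficient is what keeps a root positive under
  changes along \<open>\<gamma>\<close>.\<close>

lemma pos_other_coord: "\<beta> \<in> P \<Longrightarrow> \<gamma> \<in> Bas \<Longrightarrow> \<beta> \<noteq> \<gamma> \<Longrightarrow> \<exists>\<delta>\<in>Bas. \<delta> \<noteq> \<gamma> \<and> fw \<delta> \<bullet> \<beta> > 0"
proof (rule ccontr)
  assume a: "\<beta> \<in> P" "\<gamma> \<in> Bas" "\<beta> \<noteq> \<gamma>" and n: "\<not> (\<exists>\<delta>\<in>Bas. \<delta> \<noteq> \<gamma> \<and> fw \<delta> \<bullet> \<beta> > 0)"
  have z: "\<delta> \<in> Bas \<Longrightarrow> \<delta> \<noteq> \<gamma> \<Longrightarrow> fw \<delta> \<bullet> \<beta> = 0" for \<delta> using a n by (force simp: pos_iff)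
  have "\<beta> = (\<Sum>\<delta>\<in>Bas. (fw \<delta> \<bullet> \<beta>) *\<^sub>R \<delta>)" by (rule expand)
  also have "\<dots> = (fw \<gamma> \<bullet> \<beta>) *\<^sub>R \<gamma>"
    using a finite_base z by (subst sum.remove[of _ \<gamma>]) auto
  finally have e: "\<beta> = (fw \<gamma> \<bullet> \<beta>) *\<^sub>R \<gamma>" .
  then have "(fw \<gamma> \<bullet> \<beta>) = 1 \<or> (fw \<gamma> \<bullet> \<beta>) = -1" using reduced[OF base_roots[OF a(2)], of "fw \<gamma> \<bullet> \<beta>"] a by (simp add: pos_iff)
  then have "(fw \<gamma> \<bullet> \<beta>) = 1" using a by (fastforce simp: pos_iff)
  then show False using e a by simp
qed

lemma pos_if_coord: "\<beta> \<in> \<Phi> \<Longrightarrow> \<gamma> \<in> Bas \<Longrightarrow> fw \<gamma> \<bullet> \<beta> > 0 \<Longrightarrow> \<beta> \<in> P"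
  using pos_or_neg[of \<beta>] by (force simp: pos_iff[of "- \<beta>"])

text \<open>The reflection alters only the coefficient of \<open>\<gamma>\<close>, and one other
  positive coefficient already decides the sign of a root.\<close>

lemma refl_permutes_pos: "\<beta> \<in> P \<Longrightarrow> \<gamma> \<in> Bas \<Longrightarrow> \<beta> \<noteq> \<gamma> \<Longrightarrow> root_refl \<gamma> \<beta> \<in> P \<and> root_refl \<gamma> \<beta> \<noteq> \<gamma>"
proof -
  assume a: "\<beta> \<in> P" "\<gamma> \<in> Bas" "\<beta> \<noteq> \<gamma>"
  obtain \<delta> where d: "\<delta> \<in> Bas" "\<delta> \<noteq> \<gamma>" "fw \<delta> \<bullet> \<beta> > 0" using pos_other_coord[OF a] by blast
  have "fw \<delta> \<bullet> root_refl \<gamma> \<beta> = fw \<delta> \<bullet> \<beta>"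
    using a d by (simp add: root_refl_def inner_diff_right fw_base)
  then have "root_refl \<gamma> \<beta> \<in> P"
    using pos_if_coord[of "root_refl \<gamma> \<beta>" \<delta>] d a root_refl_root pos_root base_roots by simp
  moreover have "root_refl \<gamma> \<beta> \<noteq> \<gamma>"
    using \<open>fw \<delta> \<bullet> root_refl \<gamma> \<beta> = fw \<delta> \<bullet> \<beta>\<close> d a by (auto simp: fw_base)
  ultimately show ?thesis by blast
qed

abbreviation W where "W \<equiv> weyl_gen Bas"

lemma wword_root: "set ws \<subseteq> \<Phi> \<Longrightarrow> \<beta> \<in> \<Phi> \<Longrightarrow> wword ws \<beta> \<in> \<Phi>"
  by (induction ws) (auto simp: wword_Nil wword_Cons root_refl_root)

lemma weyl_root: "w \<in> W \<Longrightarrow> \<beta> \<in> \<Phi> \<Longrightarrow> w \<beta> \<in> \<Phi>"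
  using wword_root base_roots by (force simp: weyl_gen_wword)

lemma weyl_minus: "w \<in> W \<Longrightarrow> w (- x) = - w x"
  by (rule linear_neg[OF weyl_gen_linear])

definition ht :: "'a \<Rightarrow> real" where "ht v = (\<Sum>\<gamma>\<in>Bas. fw \<gamma> \<bullet> v)"

lemma ht_root_int: "\<beta> \<in> \<Phi> \<Longrightarrow> ht \<beta> \<in> \<int>"
  by (auto simp: ht_def intro: fw_root_int)

lemma ht_pos: "\<beta> \<in> P \<Longrightarrow> ht \<beta> \<ge> 1"
proof -
  assume b: "\<beta> \<in> P"
  have "\<exists>\<gamma>\<in>Bas. fw \<gamma> \<bullet> \<beta> \<noteq> 0"
  proof (rule ccontr)
    assume "\<not> ?thesis" then have "\<beta> = 0" by (subst expand) simp
    then show False using b zero_not_root by (simp add: pos_iff)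
  qed
  then have "ht \<beta> > 0" unfolding ht_def using b finite_base
    by (metis (no_types, lifting) pos_iff sum_nonneg sum_nonneg_eq_0_iff order_less_le)
  moreover obtain n where "ht \<beta> = of_int n" using ht_root_int[OF pos_root[OF b]] by (auto elim: Ints_cases)
  ultimately show ?thesis by simp
qed

lemma ht_base: "\<gamma> \<in> Bas \<Longrightarrow> ht \<gamma> = 1"
  using finite_base by (simp add: ht_def fw_base)

lemma ht_linear: "linear ht"
  by (rule linearI) (simp_all add: ht_def inner_add_right sum.distrib sum_distrib_left)

text \<open>Induction on the height. Since \<open>\<beta> \<bullet> \<beta> > 0\<close>, some simple
  root has positive product with \<open>\<beta>\<close>. Reflecting in it lowers the height and
  keeps the root positive unless \<open>\<beta>\<close> is that simple root.\<close>

lemma pos_root_conj_base: "\<beta> \<in> P \<Longrightarrow> \<exists>ws. set ws \<subseteq> Bas \<and> (\<exists>\<gamma>\<in>Bas. \<beta> = wword ws \<gamma>)"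
proof (induction "nat \<lfloor>ht \<beta>\<rfloor>" arbitrary: \<beta> rule: less_induct)
  case less
  have "\<exists>\<gamma>\<in>Bas. \<beta> \<bullet> \<gamma> > 0"
  proof (rule ccontr)
    assume "\<not> ?thesis"
    then have n: "\<gamma> \<in> Bas \<Longrightarrow> \<beta> \<bullet> \<gamma> \<le> 0" for \<gamma> by force
    have "\<beta> \<bullet> \<beta> = (\<Sum>\<gamma>\<in>Bas. (fw \<gamma> \<bullet> \<beta>) * (\<beta> \<bullet> \<gamma>))"
      by (subst (2) expand[of \<beta>]) (simp add: inner_sum_right)
    also have "\<dots> \<le> 0" using n less.prems by (intro sum_nonpos mult_nonneg_nonpos) (auto simp: pos_iff)
    finally show False using root_inner_pos[OF pos_root[OF less.prems]] by linarith
  qed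
  then obtain \<gamma> where g: "\<gamma> \<in> Bas" "\<beta> \<bullet> \<gamma> > 0" by blast
  show ?case
  proof (cases "\<beta> = \<gamma>")
    case True then show ?thesis using g by (intro exI[of _ "[]"]) (auto simp: wword_Nil)
  next
    case False
    let ?b = "root_refl \<gamma> \<beta>"
    have p: "?b \<in> P" using refl_permutes_pos less.prems g False by blast
    have "ht ?b < ht \<beta>" using g root_inner_pos[OF base_roots[OF g(1)]]
      by (simp add: root_refl_def linear_diff[OF ht_linear] linear_cmul[OF ht_linear] ht_base)
    then have "nat \<lfloor>ht ?b\<rfloor> < nat \<lfloor>ht \<beta>\<rfloor>"
      using ht_root_int[OF pos_root[OF p]] ht_root_int[OF pos_root[OF less.prems]] ht_pos[OF p]
      by (auto elim!: Ints_cases)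
    from less.hyps[OF this p] obtain ws \<delta> where ws: "set ws \<subseteq> Bas" "\<delta> \<in> Bas" "?b = wword ws \<delta>" by blast
    then have "\<beta> = wword (\<gamma> # ws) \<delta>" by (metis comp_apply root_refl_invol wword_Cons)
    then show ?thesis using ws g by (intro exI[of _ "\<gamma> # ws"]) auto
  qed
qed

lemma root_conj_base: "\<beta> \<in> \<Phi> \<Longrightarrow> \<exists>ws. set ws \<subseteq> Bas \<and> (\<exists>\<gamma>\<in>Bas. \<beta> = wword ws \<gamma>)"
proof -
  assume "\<beta> \<in> \<Phi>"
  then consider "\<beta> \<in> P" | "- \<beta> \<in> P" using pos_or_neg by blast
  then show ?thesis
  proof cases
    case 1 then show ?thesis by (rule pos_root_conj_base)
  next
    case 2
    then obtain ws \<gamma> where ws: "set ws \<subseteq> Bas" "\<gamma> \<in> Bas" "- \<beta> = wword ws \<gamma>" using pos_root_conj_base by blast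
    then have "\<beta> = wword (ws @ [\<gamma>]) \<gamma>"
      by (simp add: wword_append wword_Cons wword_Nil root_refl_self wword_minus) (metis minus_minus)
    then show ?thesis using ws by (intro exI[of _ "ws @ [\<gamma>]"]) auto
  qed
qed

lemma root_refl_in_weyl: "\<beta> \<in> \<Phi> \<Longrightarrow> root_refl \<beta> \<in> W"
proof -
  assume "\<beta> \<in> \<Phi>"
  then obtain ws \<gamma> where ws: "set ws \<subseteq> Bas" "\<gamma> \<in> Bas" "\<beta> = wword ws \<gamma>" using root_conj_base by blast
  then have "root_refl \<beta> = wword (ws @ [\<gamma>] @ rev ws)" by (simp add: root_refl_conj wword_append wword_Cons wword_Nil o_assoc)
  then show ?thesis using ws by (auto intro!: wword_in)
qed

section \<open>Inversion sets, the exchange property and the longest element\<close>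

definition inversions :: "('a \<Rightarrow> 'a) \<Rightarrow> 'a set" where
  "inversions w = {\<beta>\<in>P. - w \<beta> \<in> P}"

lemma finite_inversions: "finite (inversions w)"
  using finite_P by (simp add: inversions_def)

text \<open>The reflection permutes the positive roots other than \<open>\<gamma>\<close>, so it
  carries the old inversions to new ones, and \<open>\<gamma>\<close> itself is the one extra
  inversion.\<close>

lemma inversions_step:
  assumes "w \<in> W" "\<gamma> \<in> Bas" "w \<gamma> \<in> P"
  shows "card (inversions (w \<circ> root_refl \<gamma>)) = Suc (card (inversions w))"
proof -
  have "inversions (w \<circ> root_refl \<gamma>) = insert \<gamma> (root_refl \<gamma> ` inversions w)"
  proof (intro set_eqI iffI)
    fix \<beta> assume b: "\<beta> \<in> inversions (w \<circ> root_refl \<gamma>)"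
    show "\<beta> \<in> insert \<gamma> (root_refl \<gamma> ` inversions w)"
    proof (cases "\<beta> = \<gamma>")
      case False
      then have "root_refl \<gamma> \<beta> \<in> inversions w" using b assms refl_permutes_pos by (auto simp: inversions_def)
      then show ?thesis by (metis image_eqI insertCI root_refl_invol)
    qed simp
  next
    fix \<beta> assume b: "\<beta> \<in> insert \<gamma> (root_refl \<gamma> ` inversions w)"
    show "\<beta> \<in> inversions (w \<circ> root_refl \<gamma>)"
    proof (cases "\<beta> = \<gamma>")
      case True
      then show ?thesis using assms by (simp add: inversions_def base_pos root_refl_self weyl_minus)
    next
      case False
      then obtain \<delta> where d: "\<delta> \<in> inversions w" "\<beta> = root_refl \<gamma> \<delta>" using b by blast
      have "\<delta> \<noteq> \<gamma>" using d assms(3) not_pos_and_neg by (auto simp: inversions_def)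
      then show ?thesis using d refl_permutes_pos assms by (auto simp: inversions_def root_refl_invol)
    qed
  qed
  moreover have "\<gamma> \<notin> root_refl \<gamma> ` inversions w"
  proof
    assume "\<gamma> \<in> root_refl \<gamma> ` inversions w"
    then obtain \<delta> where d: "\<delta> \<in> inversions w" "\<gamma> = root_refl \<gamma> \<delta>" by blast
    then have "\<delta> = - \<gamma>" by (metis root_refl_invol root_refl_self)
    then show False using d(1) base_pos[OF assms(2)] not_pos_and_neg by (auto simp: inversions_def)
  qed
  moreover have "card (root_refl \<gamma> ` inversions w) = card (inversions w)"
    by (intro card_image inj_onI) (metis root_refl_invol)
  ultimately show ?thesis using finite_inversions by (simp add: card_insert_disjoint)
qed

lemma inversions_step_neg:
  assumes "w \<in> W" "\<gamma> \<in> Bas" "- w \<gamma> \<in> P"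
  shows "card (inversions w) = Suc (card (inversions (w \<circ> root_refl \<gamma>)))"
proof -
  have "w \<circ> root_refl \<gamma> \<circ> root_refl \<gamma> = w" by (simp add: fun_eq_iff root_refl_invol)
  moreover have "(w \<circ> root_refl \<gamma>) \<gamma> \<in> P" using assms by (simp add: root_refl_self weyl_minus)
  ultimately show ?thesis
    using inversions_step[of "w \<circ> root_refl \<gamma>" \<gamma>] assms weyl_gen_comp[OF assms(1) weyl_gen_refl[OF assms(2)]] by simp
qed

lemma inversions_le_length: "set ws \<subseteq> Bas \<Longrightarrow> card (inversions (wword ws)) \<le> length ws"
proof (induction ws rule: rev_induct)
  case Nil
  have "inversions (wword []) = {}" using not_pos_and_neg by (auto simp: inversions_def wword_Nil)
  then show ?case by simp
next
  case (snoc \<gamma> ws)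
  then have w: "wword ws \<in> W" "\<gamma> \<in> Bas" by (auto intro: wword_in)
  have e: "wword (ws @ [\<gamma>]) = wword ws \<circ> root_refl \<gamma>" by (simp add: wword_append wword_Cons wword_Nil)
  consider "wword ws \<gamma> \<in> P" | "- wword ws \<gamma> \<in> P" using pos_or_neg weyl_root w base_roots by blast
  then show ?case
  proof cases
    case 1 then show ?thesis using inversions_step[OF w, folded e] snoc by simp
  next
    case 2 then show ?thesis using inversions_step_neg[OF w, folded e] snoc by simp
  qed
qed

text \<open>When the letters are applied from the right, some letter \<open>a\<close> first turns
  the image of \<open>\<gamma>\<close> negative. A simple reflection does this only to its own root,
  so that image is \<open>a\<close>. The reflection in \<open>a\<close> is then conjugate to the one
  in \<open>\<gamma>\<close>, and the letter can be deleted.\<close>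

lemma exchange:
  "set us \<subseteq> Bas \<Longrightarrow> \<gamma> \<in> Bas \<Longrightarrow> - wword us \<gamma> \<in> P \<Longrightarrow>
    \<exists>vs. set vs \<subseteq> Bas \<and> length vs < length us \<and> wword us \<circ> root_refl \<gamma> = wword vs"
proof (induction us)
  case Nil then show ?case using base_pos not_pos_and_neg by (auto simp: wword_Nil)
next
  case (Cons a us)
  show ?case
  proof (cases "- wword us \<gamma> \<in> P")
    case True
    then obtain vs where vs: "set vs \<subseteq> Bas" "length vs < length us" "wword us \<circ> root_refl \<gamma> = wword vs"
      using Cons.IH Cons.prems by (meson list.set_intros(2) subset_code(1))
    then show ?thesis using Cons.prems by (intro exI[of _ "a # vs"]) (auto simp: wword_Cons fun_eq_iff)
  next
    case False
    then have p: "wword us \<gamma> \<in> P" using pos_or_neg weyl_root wword_in base_roots Cons.prems by (metis list.set_intros(2) subset_code(1))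
    have a: "a \<in> Bas" using Cons.prems by simp
    have "wword us \<gamma> = a"
    proof (rule ccontr)
      assume "wword us \<gamma> \<noteq> a"
      then have "root_refl a (wword us \<gamma>) \<in> P" using refl_permutes_pos p a by blast
      then show False using Cons.prems not_pos_and_neg by (simp add: wword_Cons)
    qed
    then have "root_refl a = wword us \<circ> root_refl \<gamma> \<circ> wword (rev us)" using root_refl_conj by metis
    then have "wword (a # us) \<circ> root_refl \<gamma> = wword us"
      by (auto simp: wword_Cons fun_eq_iff wword_rev root_refl_invol)
    then show ?thesis using Cons.prems by (intro exI[of _ us]) auto
  qed
qed

text \<open>In a shortest word the last letter stays positive under \<open>w\<close>, so the rest of
  the word makes it negative; the exchange property would then shorten the word.\<close>

lemma inversions_empty_id: 
  assumes "w \<in> W" "inversions w = {}" shows "w = id"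
proof -
  obtain ws0 where "set ws0 \<subseteq> Bas \<and> wword ws0 = w" using assms(1) by (auto simp: weyl_gen_wword)
  from ex_has_least_nat[of "\<lambda>ws. set ws \<subseteq> Bas \<and> wword ws = w", OF this, of length]
  obtain ws where ws: "set ws \<subseteq> Bas" "wword ws = w"
    and min: "\<And>vs. set vs \<subseteq> Bas \<Longrightarrow> wword vs = w \<Longrightarrow> length ws \<le> length vs"
    by blast
  show ?thesis
  proof (cases ws rule: rev_cases)
    case Nil then show ?thesis using ws by (simp add: wword_Nil)
  next
    case (snoc us \<gamma>)
    have g: "\<gamma> \<in> Bas" "set us \<subseteq> Bas" using ws snoc by auto
    have e: "w = wword us \<circ> root_refl \<gamma>" using ws snoc by (simp add: wword_append wword_Cons wword_Nil)
    have "w \<gamma> \<in> P"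
      using assms(2) base_pos[OF g(1)] pos_or_neg[OF weyl_root[OF assms(1) base_roots[OF g(1)]]]
      by (auto simp: inversions_def)
    then have "- wword us \<gamma> \<in> P" using e by (simp add: root_refl_self wword_minus)
    then obtain vs where "set vs \<subseteq> Bas" "length vs < length us" "w = wword vs"
      using exchange[OF g(2,1)] e by metis
    then show ?thesis using min[of vs] snoc by simp
  qed
qed

lemma exists_descent:
  assumes "w \<in> W" "inversions w \<noteq> {}" shows "\<exists>\<gamma>\<in>Bas. - w \<gamma> \<in> P"
proof (rule ccontr)
  assume n: "\<not> ?thesis"
  have p: "\<gamma> \<in> Bas \<Longrightarrow> w \<gamma> \<in> P" for \<gamma>
    using n pos_or_neg weyl_root[OF assms(1)] base_roots by blast
  obtain \<beta> where b: "\<beta> \<in> P" "- w \<beta> \<in> P" using assms(2) by (auto simp: inversions_def)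
  have "w \<beta> = (\<Sum>\<delta>\<in>Bas. (fw \<delta> \<bullet> \<beta>) *\<^sub>R w \<delta>)"
    by (subst expand[of \<beta>]) (simp add: linear_sum[OF weyl_gen_linear[OF assms(1)]] linear_cmul[OF weyl_gen_linear[OF assms(1)]])
  then have "fw \<gamma> \<bullet> w \<beta> \<ge> 0" if "\<gamma> \<in> Bas" for \<gamma>
    using that b(1) p by (simp add: inner_sum_right) (intro sum_nonneg mult_nonneg_nonneg, auto simp: pos_iff)
  then have "w \<beta> \<in> P" using b pos_iff weyl_root[OF assms(1) pos_root] by blast
  then show False using not_pos_and_neg b(2) by blast
qed

lemma word_of_inversions: "w \<in> W \<Longrightarrow> \<exists>ws. set ws \<subseteq> Bas \<and> wword ws = w \<and> length ws = card (inversions w)"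
proof (induction "card (inversions w)" arbitrary: w)
  case 0
  then have "w = id" using inversions_empty_id finite_inversions by (metis card_0_eq)
  then show ?case using 0 by (intro exI[of _ "[]"]) (simp add: wword_Nil)
next
  case (Suc n)
  then have "inversions w \<noteq> {}" by auto
  then obtain \<gamma> where g: "\<gamma> \<in> Bas" "- w \<gamma> \<in> P" using exists_descent Suc by blast
  let ?v = "w \<circ> root_refl \<gamma>"
  have v: "?v \<in> W" using Suc.prems g weyl_gen_comp weyl_gen_refl by blast
  have "card (inversions ?v) = n" using inversions_step_neg[OF Suc.prems g] Suc by simp
  then obtain ws where "set ws \<subseteq> Bas" "wword ws = ?v" "length ws = n" using Suc.hyps(1)[OF _ v] by metis
  then show ?case using g Suc(2) 
    by (intro exI[of _ "ws @ [\<gamma>]"]) (auto simp: wword_append wword_Cons wword_Nil fun_eq_iff root_refl_invol)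
qed

lemma word_length_eq: "w \<in> W \<Longrightarrow> word_length Bas w = card (inversions w)"
  unfolding word_length_def
  by (rule Least_equality) (use word_of_inversions inversions_le_length in blast)+

lemma weyl_maps_pos_unique:
  assumes "v \<in> W" "w \<in> W" "\<And>\<beta>. \<beta> \<in> P \<Longrightarrow> - v \<beta> \<in> P" "\<And>\<beta>. \<beta> \<in> P \<Longrightarrow> - w \<beta> \<in> P"
  shows "v = w"
proof -
  obtain u where u: "u \<in> W" "u \<circ> w = id" "w \<circ> u = id" using weyl_gen_inverse[OF assms(2)] by blast
  \<comment> \<open>An injective self-map of the finite set \<open>P\<close> is onto. So every
    \<open>- v \<beta>\<close> has the form \<open>- w \<delta>\<close>, and the inverse of
    \<open>w\<close> followed after \<open>v\<close> preserves \<open>P\<close>.\<close>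
  have img: "(\<lambda>\<beta>. - w \<beta>) ` P = P"
  proof (rule endo_inj_surj[OF finite_P])
    show "(\<lambda>\<beta>. - w \<beta>) ` P \<subseteq> P" using assms(4) by blast
    show "inj_on (\<lambda>\<beta>. - w \<beta>) P" using u(2) by (intro inj_onI) (metis comp_apply id_apply minus_minus)
  qed
  have "inversions (u \<circ> v) = {}"
  proof -
    have "(u \<circ> v) \<beta> \<in> P" if "\<beta> \<in> P" for \<beta>
    proof -
      have "- v \<beta> \<in> (\<lambda>\<beta>. - w \<beta>) ` P" unfolding img by (rule assms(3)[OF that])
      then obtain \<delta> where "\<delta> \<in> P" "- v \<beta> = - w \<delta>" by blast
      then have "(u \<circ> v) \<beta> = (u \<circ> w) \<delta>" by (simp del: o_apply add: comp_apply)
      then show ?thesis using u(2) \<open>\<delta> \<in> P\<close> by simp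
    qed
    then show ?thesis using not_pos_and_neg by (auto simp: inversions_def)
  qed
  then have "u \<circ> v = id" using inversions_empty_id u assms weyl_gen_comp by blast
  then have "w \<circ> (u \<circ> v) = w" by simp
  then show ?thesis using u(3) by (metis o_assoc id_o)
qed

text \<open>An element with the most inversions sends no simple root to a positive one, because
  \<open>inversions_step\<close> would yield a further inversion; by linearity it then inverts all
  of \<open>P\<close>.\<close>

lemma exists_longest: "\<exists>w\<in>W. \<forall>\<beta>\<in>P. - w \<beta> \<in> P"
proof -
  have "\<And>w. w \<in> W \<Longrightarrow> card (inversions w) < Suc (card P)"
    using card_mono[OF finite_P] by (simp add: inversions_def less_Suc_eq_le)
  then obtain w where w: "w \<in> W" "\<And>v. v \<in> W \<Longrightarrow> card (inversions v) \<le> card (inversions w)"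
    using ex_has_greatest_nat[of "\<lambda>w. w \<in> W" id "\<lambda>w. card (inversions w)" "Suc (card P)"] weyl_id by (metis less_imp_le_nat)
  have n: "- w \<gamma> \<in> P" if "\<gamma> \<in> Bas" for \<gamma>
  proof (rule ccontr)
    assume "- w \<gamma> \<notin> P"
    then have "w \<gamma> \<in> P" using pos_or_neg weyl_root w(1) base_roots that by blast
    then show False using inversions_step[OF w(1) that] w(2)[OF weyl_gen_comp[OF w(1) weyl_gen_refl[OF that]]] by simp
  qed
  have "- w \<beta> \<in> P" if b: "\<beta> \<in> P" for \<beta>
  proof -
    have "- w \<beta> = (\<Sum>\<delta>\<in>Bas. (fw \<delta> \<bullet> \<beta>) *\<^sub>R (- w \<delta>))"
      by (subst expand[of \<beta>]) (simp add: linear_sum[OF weyl_gen_linear[OF w(1)]] linear_cmul[OF weyl_gen_linear[OF w(1)]] sum_negf)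
    then have "fw \<gamma> \<bullet> (- w \<beta>) = (\<Sum>\<delta>\<in>Bas. (fw \<delta> \<bullet> \<beta>) * (fw \<gamma> \<bullet> (- w \<delta>)))" for \<gamma>
      by (metis (no_types, lifting) inner_scaleR_right inner_sum_right sum.cong)
    moreover have "(\<Sum>\<delta>\<in>Bas. (fw \<delta> \<bullet> \<beta>) * (fw \<gamma> \<bullet> (- w \<delta>))) \<ge> 0" if "\<gamma> \<in> Bas" for \<gamma>
      using n b that by (intro sum_nonneg mult_nonneg_nonneg) (auto simp only: pos_iff)
    ultimately show ?thesis using pos_iff root_minus weyl_root[OF w(1) pos_root[OF b]] by metis
  qed
  then show ?thesis using w by blast
qed

abbreviation w0 where "w0 \<equiv> longest_elt Bas"

text \<open>\<open>longest_elt\<close> is a definite description in terms of word length. Length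
  counts inversions, so the longest elements are those inverting all of \<open>P\<close>, and there
  is only one. Its square has no inversions and is the identity.\<close>

lemma longest: "w0 \<in> W" "\<beta> \<in> P \<Longrightarrow> - w0 \<beta> \<in> P" "w0 (w0 x) = x"
proof -
  obtain w where w: "w \<in> W" "\<forall>\<beta>\<in>P. - w \<beta> \<in> P" using exists_longest by blast
  have cw: "card (inversions w) = card P" using w(2) by (auto simp: inversions_def intro: arg_cong[of _ _ card])
  have le: "card (inversions v) \<le> card P" for v
    using card_mono[OF finite_P] by (simp add: inversions_def)
  have "w0 = w" unfolding longest_elt_def
  proof (rule the_equality)
    show "w \<in> W \<and> (\<forall>v\<in>W. word_length Bas v \<le> word_length Bas w)"
      using w(1) le cw by (simp add: word_length_eq)
  next
    fix v assume v: "v \<in> W \<and> (\<forall>u\<in>W. word_length Bas u \<le> word_length Bas v)"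
    then have "card P \<le> card (inversions v)" using w(1) cw by (metis word_length_eq)
    then have "inversions v = P" by (intro card_seteq[OF finite_P]) (auto simp: inversions_def)
    then have "\<beta> \<in> P \<Longrightarrow> - v \<beta> \<in> P" for \<beta> by (auto simp: inversions_def)
    then show "v = w" using weyl_maps_pos_unique[of v w] v w by blast
  qed
  then show "w0 \<in> W" and n: "\<beta> \<in> P \<Longrightarrow> - w0 \<beta> \<in> P" for \<beta> using w by auto
  have "inversions (w0 \<circ> w0) = {}"
  proof -
    have "w0 (w0 \<beta>) \<in> P" if "\<beta> \<in> P" for \<beta>
      using n[OF n[OF that]] weyl_minus[OF \<open>w0 \<in> W\<close>] by simp
    then show ?thesis using not_pos_and_neg by (auto simp: inversions_def)
  qed
  then have "w0 \<circ> w0 = id" using inversions_empty_id \<open>w0 \<in> W\<close> weyl_gen_comp by blast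
  then show "w0 (w0 x) = x" by (metis comp_apply id_apply)
qed

text \<open>If \<open>w\<close> inverts the simple root \<open>\<gamma>\<close>, then
  \<open>x \<bullet> \<gamma> = x \<bullet> w \<gamma>\<close> is both nonnegative and nonpositive.
  So \<open>\<gamma>\<close> is orthogonal to \<open>x\<close>, its reflection fixes
  \<open>x\<close>, and it can be split off from \<open>w\<close>.\<close>

lemma stabilizer_dominant:
  assumes "w \<in> W" "\<And>\<gamma>. \<gamma> \<in> Bas \<Longrightarrow> x \<bullet> \<gamma> \<ge> 0" "w x = x"
  shows "w \<in> weyl_gen {\<gamma>\<in>Bas. x \<bullet> \<gamma> = 0}"
  using assms
proof (induction "card (inversions w)" arbitrary: w)
  case 0
  then have "w = id" using inversions_empty_id finite_inversions by (metis card_0_eq)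
  then show ?case by (simp only: weyl_id)
next
  case (Suc n)
  then have "inversions w \<noteq> {}" by auto
  then obtain \<gamma> where g: "\<gamma> \<in> Bas" "- w \<gamma> \<in> P" using exists_descent Suc by blast
  have "x \<bullet> \<gamma> = x \<bullet> w \<gamma>" using weyl_gen_inner[OF Suc.prems(1), of x \<gamma>] Suc.prems(3) by simp
  moreover have "x \<bullet> (- w \<gamma>) \<ge> 0"
  proof -
    have "x \<bullet> (- w \<gamma>) = (\<Sum>\<delta>\<in>Bas. (fw \<delta> \<bullet> (- w \<gamma>)) * (x \<bullet> \<delta>))"
      by (subst expand[of "- w \<gamma>"]) (simp add: inner_sum_right)
    also have "\<dots> \<ge> 0" using g Suc.prems(2) by (intro sum_nonneg mult_nonneg_nonneg) (auto simp only: pos_iff)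
    finally show ?thesis .
  qed
  ultimately have z: "x \<bullet> \<gamma> = 0" using Suc.prems(2)[OF g(1)] by simp
  then have fx: "root_refl \<gamma> x = x" by (simp add: root_refl_def)
  let ?v = "w \<circ> root_refl \<gamma>"
  have v: "?v \<in> W" using Suc.prems g weyl_gen_comp weyl_gen_refl by blast
  have "card (inversions ?v) = n" using inversions_step_neg[OF Suc.prems(1) g] Suc by simp
  then have "?v \<in> weyl_gen {\<gamma>\<in>Bas. x \<bullet> \<gamma> = 0}"
    using Suc.hyps(1)[of ?v] v Suc.prems fx by simp
  then have "?v \<circ> root_refl \<gamma> \<in> weyl_gen {\<gamma>\<in>Bas. x \<bullet> \<gamma> = 0}"
    using weyl_gen_comp weyl_gen_refl[of \<gamma> "{\<gamma>\<in>Bas. x \<bullet> \<gamma> = 0}"] g z by blast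
  moreover have "?v \<circ> root_refl \<gamma> = w" by (simp add: fun_eq_iff root_refl_invol)
  ultimately show ?case by simp
qed

text \<open>The two Cartan integers are negative with product below 4, so one of them is
  \<open>-1\<close>, and the corresponding reflection produces the sum.\<close>

lemma root_add:
  assumes "\<beta> \<in> \<Phi>" "\<gamma> \<in> \<Phi>" "\<beta> \<bullet> \<gamma> < 0" "\<beta> \<noteq> - \<gamma>"
  shows "\<beta> + \<gamma> \<in> \<Phi>"
proof -
  obtain m where m: "2 * (\<beta> \<bullet> \<gamma>) / (\<gamma> \<bullet> \<gamma>) = of_int m" using cartan_int[of \<gamma> \<beta>] assms by (auto elim: Ints_cases)
  obtain n where n: "2 * (\<gamma> \<bullet> \<beta>) / (\<beta> \<bullet> \<beta>) = of_int n" using cartan_int[of \<beta> \<gamma>] assms by (auto elim: Ints_cases)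
  have pos: "\<beta> \<bullet> \<beta> > 0" "\<gamma> \<bullet> \<gamma> > 0" using assms root_inner_pos by auto
  have "real_of_int m < 0" "real_of_int n < 0" using m n pos assms(3)
    by (metis divide_less_0_iff inner_commute mult_less_0_iff zero_less_numeral not_less_iff_gr_or_eq)+
  then have mn: "m < 0" "n < 0" by simp_all
  \<comment> \<open>Equality in the Cauchy-Schwarz inequality would make the roots proportional; by
    reducedness they would be equal or opposite, which the assumptions exclude.\<close>
  have ne: "\<bar>\<beta> \<bullet> \<gamma>\<bar> \<noteq> norm \<beta> * norm \<gamma>"
  proof
    assume "\<bar>\<beta> \<bullet> \<gamma>\<bar> = norm \<beta> * norm \<gamma>"
    then have "norm \<beta> *\<^sub>R \<gamma> = norm \<gamma> *\<^sub>R \<beta> \<or> norm \<beta> *\<^sub>R \<gamma> = - norm \<gamma> *\<^sub>R \<beta>"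
      by (simp add: norm_cauchy_schwarz_abs_eq)
    moreover have nz: "norm \<gamma> \<noteq> 0" using pos by auto
    ultimately have "(1 / norm \<gamma>) *\<^sub>R (norm \<gamma> *\<^sub>R \<beta>) = (norm \<beta> / norm \<gamma>) *\<^sub>R \<gamma> \<or>
        (1 / norm \<gamma>) *\<^sub>R (norm \<gamma> *\<^sub>R \<beta>) = (- norm \<beta> / norm \<gamma>) *\<^sub>R \<gamma>"
      by (elim disjE) (metis divide_inverse inverse_eq_divide mult.commute scaleR_scaleR, 
        metis (no_types, opaque_lifting) divide_inverse inverse_eq_divide mult.commute scaleR_scaleR scaleR_minus_left minus_minus mult_minus_left)
    then have "\<beta> = (norm \<beta> / norm \<gamma>) *\<^sub>R \<gamma> \<or> \<beta> = (- norm \<beta> / norm \<gamma>) *\<^sub>R \<gamma>" using nz by simp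
    then have "\<exists>c. \<beta> = c *\<^sub>R \<gamma>" by blast
    then obtain c where c: "\<beta> = c *\<^sub>R \<gamma>" by blast
    then have "c = 1 \<or> c = -1" using reduced assms by blast
    then show False using c assms pos by auto
  qed
  then have "\<bar>\<beta> \<bullet> \<gamma>\<bar> < norm \<beta> * norm \<gamma>" using Cauchy_Schwarz_ineq2[of \<beta> \<gamma>] by linarith
  then have "(\<beta> \<bullet> \<gamma>)\<^sup>2 < (norm \<beta> * norm \<gamma>)\<^sup>2" by (metis abs_ge_zero abs_norm_cancel abs_mult abs_power2 power2_abs power2_less_imp_less power_strict_mono zero_less_numeral)
  then have lt: "(\<beta> \<bullet> \<gamma>)\<^sup>2 < (\<beta> \<bullet> \<beta>) * (\<gamma> \<bullet> \<gamma>)" by (simp add: power_mult_distrib power2_norm_eq_inner)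
  have "real_of_int (m * n) = 4 * (\<beta> \<bullet> \<gamma>)\<^sup>2 / ((\<beta> \<bullet> \<beta>) * (\<gamma> \<bullet> \<gamma>))"
    unfolding of_int_mult m[symmetric] n[symmetric] by (simp add: power2_eq_square inner_commute)
  also have "\<dots> < 4" using lt pos by (simp add: divide_less_eq)
  finally have "m * n < 4" by linarith
  have "m = -1 \<or> n = -1"
  proof (rule ccontr)
    assume "\<not> ?thesis"
    then have "m \<le> -2" "n \<le> -2" using mn by auto
    then have "(-m) * (-n) \<ge> 2 * 2" by (intro mult_mono) auto
    then show False using \<open>m * n < 4\<close> by simp
  qed
  then show ?thesis
  proof
    assume "m = -1" then have "root_refl \<gamma> \<beta> = \<beta> + \<gamma>" using m by (simp add: root_refl_def)
    then show ?thesis using root_refl_root assms by metis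
  next
    assume "n = -1" then have "root_refl \<beta> \<gamma> = \<beta> + \<gamma>" using n by (simp add: root_refl_def add.commute)
    then show ?thesis using root_refl_root assms by metis
  qed
qed

end

section \<open>The highest root\<close>

context root_base
begin

text \<open>An orbit element of maximal height is dominant: reflecting in a simple root with
  negative product would raise the height.\<close>

lemma exists_dominant_conj: "\<beta> \<in> \<Phi> \<Longrightarrow> \<exists>w\<in>W. \<forall>\<gamma>\<in>Bas. w \<beta> \<bullet> \<gamma> \<ge> 0"
proof -
  assume b: "\<beta> \<in> \<Phi>"
  let ?S = "{w \<beta> | w. w \<in> W}"
  have "?S \<subseteq> \<Phi>" using weyl_root b by blast
  then have fin: "finite ?S" using finite_roots finite_subset by blast
  have ne: "?S \<noteq> {}" using weyl_id by blast
  obtain w where w: "w \<in> W" "\<And>v. v \<in> W \<Longrightarrow> ht (v \<beta>) \<le> ht (w \<beta>)"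
  proof -
    have "Max (ht ` ?S) \<in> ht ` ?S" using fin ne by (intro Max_in) auto
    then obtain w where "w \<in> W" "ht (w \<beta>) = Max (ht ` ?S)" by auto
    moreover have "v \<in> W \<Longrightarrow> ht (v \<beta>) \<le> Max (ht ` ?S)" for v using fin by (intro Max_ge) auto
    ultimately show ?thesis using that by metis
  qed
  have "w \<beta> \<bullet> \<gamma> \<ge> 0" if g: "\<gamma> \<in> Bas" for \<gamma>
  proof (rule ccontr)
    assume n: "\<not> ?thesis"
    have "ht (root_refl \<gamma> (w \<beta>)) > ht (w \<beta>)" using n g root_inner_pos[OF base_roots[OF g]]
      by (simp add: root_refl_def linear_diff[OF ht_linear] linear_cmul[OF ht_linear] ht_base divide_neg_pos)
    then show False using w(2)[OF weyl_gen_comp[OF weyl_gen_refl[OF g] w(1)]] by simp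
  qed
  then show ?thesis using w(1) by blast
qed

lemma dominant_inner_nonneg:
  assumes "\<And>\<gamma>. \<gamma> \<in> Bas \<Longrightarrow> x \<bullet> \<gamma> \<ge> 0" "\<And>\<gamma>. \<gamma> \<in> Bas \<Longrightarrow> fw \<gamma> \<bullet> v \<ge> 0"
  shows "x \<bullet> v \<ge> 0"
proof -
  have "x \<bullet> v = (\<Sum>\<delta>\<in>Bas. (fw \<delta> \<bullet> v) * (x \<bullet> \<delta>))"
    by (subst expand[of v]) (simp add: inner_sum_right)
  also have "\<dots> \<ge> 0" using assms by (intro sum_nonneg mult_nonneg_nonneg) auto
  finally show ?thesis .
qed

lemma weyl_sub_span:
  assumes "set ws \<subseteq> X \<union> Y" "\<And>x y. x \<in> X \<Longrightarrow> y \<in> Y \<Longrightarrow> x \<bullet> y = 0" "v \<in> span X"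
  shows "wword ws v \<in> span X"
  using assms(1)
proof (induction ws)
  case Nil then show ?case using assms(3) by (simp add: wword_Nil)
next
  case (Cons a ws)
  let ?v = "wword ws v"
  have v: "?v \<in> span X" using Cons by simp
  show ?case
  proof (cases "a \<in> X")
    case True
    then show ?thesis using v by (simp add: wword_Cons root_refl_def span_diff span_scale span_base)
  next
    case False
    then have "a \<in> Y" using Cons.prems by simp
    have "orthogonal a ?v" 
      by (rule orthogonal_to_span[OF v]) (use assms(2) \<open>a \<in> Y\<close> in \<open>simp add: orthogonal_def inner_commute\<close>)
    then have "?v \<bullet> a = 0" by (simp add: orthogonal_def inner_commute)
    then show ?thesis using v by (simp add: wword_Cons root_refl_def)
  qed
qed

end

section \<open>Irreducible systems: the highest root and its relation to the longest element\<close>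

locale irred_root_base = root_base +
  assumes irred: "rs_irreducible \<Phi>"
begin

text \<open>Reflections in \<open>X\<close> preserve \<open>span X\<close> and those in
  \<open>Y\<close> fix it pointwise, and likewise with the roles exchanged. Every root is conjugate
  to a simple root, so two orthogonal parts of the base would split \<open>\<Phi>\<close>
  itself.\<close>

lemma base_connected:
  assumes "X \<union> Y = Bas" "X \<inter> Y = {}" "\<And>x y. x \<in> X \<Longrightarrow> y \<in> Y \<Longrightarrow> x \<bullet> y = 0" "X \<noteq> {}"
  shows "Y = {}"
proof (rule ccontr)
  assume "Y \<noteq> {}"
  let ?A = "\<Phi> \<inter> span X" and ?B = "\<Phi> \<inter> span Y"
  have orth: "a \<bullet> b = 0" if "a \<in> span X" "b \<in> span Y" for a b
  proof -
    have "orthogonal y a" if "y \<in> Y" for y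
      by (rule orthogonal_to_span[OF \<open>a \<in> span X\<close>]) (use assms(3) that in \<open>simp add: orthogonal_def inner_commute\<close>)
    then have "orthogonal a b"
      by (intro orthogonal_to_span[OF \<open>b \<in> span Y\<close>]) (simp add: orthogonal_def inner_commute)
    then show ?thesis by (simp add: orthogonal_def)
  qed
  have "\<Phi> \<subseteq> ?A \<union> ?B"
  proof
    fix \<beta> assume b: "\<beta> \<in> \<Phi>"
    then obtain ws \<gamma> where ws: "set ws \<subseteq> Bas" "\<gamma> \<in> Bas" "\<beta> = wword ws \<gamma>" using root_conj_base by blast
    have "\<gamma> \<in> X \<Longrightarrow> \<beta> \<in> span X" using ws weyl_sub_span[of ws X Y \<gamma>] assms by (auto simp: span_base)
    moreover have "\<gamma> \<in> Y \<Longrightarrow> \<beta> \<in> span Y" using ws weyl_sub_span[of ws Y X \<gamma>] assms(1)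
      by (metis assms(3) inner_commute span_base sup_commute)
    ultimately show "\<beta> \<in> ?A \<union> ?B" using ws assms(1) b by blast
  qed
  moreover have "?A \<inter> ?B = {}"
  proof -
    have "a \<bullet> a = 0" if "a \<in> ?A" "a \<in> ?B" for a using orth[of a a] that by simp
    then show ?thesis using root_inner_pos by fastforce
  qed
  moreover have "?A \<noteq> {}" "?B \<noteq> {}" using assms(1,4) \<open>Y \<noteq> {}\<close> base_roots by (auto intro: span_base)
  moreover have "\<forall>a\<in>?A. \<forall>b\<in>?B. a \<bullet> b = 0" using orth by simp
  ultimately have "?A \<noteq> {} \<and> ?B \<noteq> {} \<and> ?A \<union> ?B = \<Phi> \<and> ?A \<inter> ?B = {} \<and> (\<forall>a\<in>?A. \<forall>b\<in>?B. a \<bullet> b = 0)"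
    by (simp add: subset_antisym)
  then have "\<exists>A B. A \<noteq> {} \<and> B \<noteq> {} \<and> A \<union> B = \<Phi> \<and> A \<inter> B = {} \<and> (\<forall>a\<in>A. \<forall>b\<in>B. a \<bullet> b = 0)"
    by (intro exI[of _ ?A] exI[of _ ?B])
  then show False by (rule notE[OF irred[unfolded rs_irreducible_def]])
qed

lemma base_nonempty: "Bas \<noteq> {}"
proof
  assume "Bas = {}"
  then have "span Bas = {0}" by simp
  then have "(UNIV :: 'a set) = {0}" using span_Bas by simp
  then show False using nonempty_Basis nonzero_Basis by blast
qed

text \<open>Maximality in the dominance order, whereas \<open>highest_root\<close> describes a
  greatest root. Maximal roots exist by finiteness; their uniqueness turns maximal into
  greatest.\<close>

definition maximal :: "'a \<Rightarrow> bool" where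
  "maximal \<phi> \<longleftrightarrow> \<phi> \<in> \<Phi> \<and> (\<forall>\<beta>\<in>\<Phi>. nonneg_comb Bas (\<beta> - \<phi>) \<longrightarrow> \<beta> = \<phi>)"

lemma nonneg_comb_trans: "nonneg_comb Bas (a - b) \<Longrightarrow> nonneg_comb Bas (b - c) \<Longrightarrow> nonneg_comb Bas (a - c)"
proof -
  assume a: "nonneg_comb Bas (a - b)" "nonneg_comb Bas (b - c)"
  show ?thesis unfolding nonneg_comb_iff
  proof
    fix \<gamma> assume "\<gamma> \<in> Bas"
    moreover have "fw \<gamma> \<bullet> (a - c) = fw \<gamma> \<bullet> (a - b) + fw \<gamma> \<bullet> (b - c)" by (simp add: inner_diff_right)
    ultimately show "fw \<gamma> \<bullet> (a - c) \<in> \<int> \<and> 0 \<le> fw \<gamma> \<bullet> (a - c)"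
      using a unfolding nonneg_comb_iff by simp
  qed
qed

lemma nonneg_comb_antisym: "nonneg_comb Bas (a - b) \<Longrightarrow> nonneg_comb Bas (b - a) \<Longrightarrow> a = b"
proof -
  assume a: "nonneg_comb Bas (a - b)" "nonneg_comb Bas (b - a)"
  have "fw \<gamma> \<bullet> (a - b) = 0" if "\<gamma> \<in> Bas" for \<gamma>
    using a that unfolding nonneg_comb_iff by (simp add: inner_diff_right) (metis antisym diff_ge_0_iff_ge)
  then have "a - b = 0" by (subst expand) simp
  then show "a = b" by simp
qed

lemma nonneg_comb_ht: "nonneg_comb Bas v \<Longrightarrow> ht v \<ge> 0"
  by (auto simp: nonneg_comb_iff ht_def intro: sum_nonneg)

lemma exists_maximal: "\<beta> \<in> \<Phi> \<Longrightarrow> \<exists>\<phi>. maximal \<phi> \<and> nonneg_comb Bas (\<phi> - \<beta>)"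
proof -
  assume b: "\<beta> \<in> \<Phi>"
  let ?S = "{\<phi>\<in>\<Phi>. nonneg_comb Bas (\<phi> - \<beta>)}"
  have z: "nonneg_comb Bas 0" by (simp add: nonneg_comb_iff)
  have fin: "finite ?S" using finite_roots by simp
  have ne: "?S \<noteq> {}" using b z by auto
  have "Max (ht ` ?S) \<in> ht ` ?S" using fin ne by (intro Max_in) auto
  then obtain \<phi> where p: "\<phi> \<in> ?S" "ht \<phi> = Max (ht ` ?S)" by auto
  have mx: "\<psi> \<in> ?S \<Longrightarrow> ht \<psi> \<le> ht \<phi>" for \<psi> unfolding p(2) using fin by (intro Max_ge) auto
  have "maximal \<phi>" unfolding maximal_def
  proof (intro conjI ballI impI)
    show "\<phi> \<in> \<Phi>" using p by simp
    fix \<psi> assume q: "\<psi> \<in> \<Phi>" "nonneg_comb Bas (\<psi> - \<phi>)"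
    then have "\<psi> \<in> ?S" using p nonneg_comb_trans by blast
    then have "ht (\<psi> - \<phi>) = 0" using mx[of \<psi>] nonneg_comb_ht[OF q(2)] by (simp add: linear_diff[OF ht_linear])
    then have "\<forall>\<gamma>\<in>Bas. fw \<gamma> \<bullet> (\<psi> - \<phi>) = 0" using q(2) finite_base unfolding ht_def nonneg_comb_iff
      by (subst (asm) sum_nonneg_eq_0_iff) auto
    then have "\<psi> - \<phi> = 0" by (subst expand) simp
    then show "\<psi> = \<phi>" by simp
  qed
  then show ?thesis using p by blast
qed

lemma nonneg_comb_base: "\<gamma> \<in> Bas \<Longrightarrow> nonneg_comb Bas \<gamma>"
  by (simp add: nonneg_comb_iff fw_base)

lemma maximal_dominant: "maximal \<phi> \<Longrightarrow> \<gamma> \<in> Bas \<Longrightarrow> \<phi> \<bullet> \<gamma> \<ge> 0"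
proof (rule ccontr)
  assume a: "maximal \<phi>" "\<gamma> \<in> Bas" "\<not> \<phi> \<bullet> \<gamma> \<ge> 0"
  have ne: "\<phi> \<noteq> - \<gamma>"
  proof
    assume "\<phi> = - \<gamma>"
    then have "nonneg_comb Bas (\<gamma> - \<phi>)" using a(2) by (simp add: nonneg_comb_iff fw_base inner_add_right)
    then have "\<gamma> = \<phi>" using a base_roots by (auto simp: maximal_def)
    then show False using \<open>\<phi> = - \<gamma>\<close> a base_pos not_pos_and_neg by metis
  qed
  have "\<phi> + \<gamma> \<in> \<Phi>" using root_add[of \<phi> \<gamma>] a ne base_roots by (auto simp: maximal_def)
  moreover have "nonneg_comb Bas (\<phi> + \<gamma> - \<phi>)" using a nonneg_comb_base[of \<gamma>] by simp
  ultimately have "\<phi> + \<gamma> = \<phi>" using a(1) unfolding maximal_def by blast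
  then show False using base_roots[OF a(2)] zero_not_root by simp
qed

lemma dominant_root_pos:
  assumes "\<phi> \<in> \<Phi>" "\<And>\<gamma>. \<gamma> \<in> Bas \<Longrightarrow> \<phi> \<bullet> \<gamma> \<ge> 0" shows "\<phi> \<in> P"
proof (rule ccontr)
  assume "\<phi> \<notin> P"
  then have "- \<phi> \<in> P" using pos_or_neg assms by blast
  then have "\<phi> \<bullet> (- \<phi>) \<ge> 0" using assms(2) unfolding pos_iff by (blast intro: dominant_inner_nonneg)
  then show False using root_inner_pos[OF assms(1)] by simp
qed

text \<open>For a simple root \<open>y\<close> outside the support,
  \<open>\<phi> \<bullet> y\<close> is nonnegative by dominance but also a sum of nonpositive terms.
  Hence \<open>y\<close> is orthogonal to the whole support, and connectedness of the base leaves no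
  such \<open>y\<close>.\<close>

lemma dominant_full_support:
  assumes "\<phi> \<in> \<Phi>" "\<And>\<gamma>. \<gamma> \<in> Bas \<Longrightarrow> \<phi> \<bullet> \<gamma> \<ge> 0" "\<gamma> \<in> Bas" shows "fw \<gamma> \<bullet> \<phi> > 0"
proof -
  have pos: "\<phi> \<in> P" using dominant_root_pos assms by blast
  let ?X = "{\<gamma>\<in>Bas. fw \<gamma> \<bullet> \<phi> > 0}" and ?Y = "{\<gamma>\<in>Bas. fw \<gamma> \<bullet> \<phi> = 0}"
  have "?Y = {}"
  proof (rule base_connected[of ?X])
    show "?X \<union> ?Y = Bas" using pos by (force simp: pos_iff)
    show "?X \<inter> ?Y = {}" by auto
    show "?X \<noteq> {}"
    proof
      assume "?X = {}"
      then have "\<And>\<gamma>. \<gamma> \<in> Bas \<Longrightarrow> fw \<gamma> \<bullet> \<phi> = 0" using pos by (force simp: pos_iff)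
      then have "\<phi> = 0" by (subst expand) simp
      then show False using assms zero_not_root by simp
    qed
    fix x y assume x: "x \<in> ?X" and y: "y \<in> ?Y"
    have t: "(fw \<delta> \<bullet> \<phi>) * (\<delta> \<bullet> y) \<le> 0" if "\<delta> \<in> Bas" for \<delta>
    proof (cases "\<delta> = y")
      case True then show ?thesis using y by simp
    next
      case False then show ?thesis using that y base_obtuse pos by (intro mult_nonneg_nonpos) (auto simp: pos_iff)
    qed
    have "\<phi> \<bullet> y = (\<Sum>\<delta>\<in>Bas. (fw \<delta> \<bullet> \<phi>) * (\<delta> \<bullet> y))"
      by (subst expand[of \<phi>]) (simp add: inner_sum_left)
    moreover have "\<phi> \<bullet> y \<ge> 0" using assms y by simp
    moreover have "(\<Sum>\<delta>\<in>Bas. (fw \<delta> \<bullet> \<phi>) * (\<delta> \<bullet> y)) \<le> 0" using t by (rule sum_nonpos)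
    ultimately have "(\<Sum>\<delta>\<in>Bas. - ((fw \<delta> \<bullet> \<phi>) * (\<delta> \<bullet> y))) = 0" by (simp add: sum_negf)
    then have "\<forall>\<delta>\<in>Bas. - ((fw \<delta> \<bullet> \<phi>) * (\<delta> \<bullet> y)) = 0"
      using t finite_base by (subst (asm) sum_nonneg_eq_0_iff) auto
    then show "x \<bullet> y = 0" using x by auto
  qed
  then show ?thesis using assms(3) pos by (force simp: pos_iff)
qed

text \<open>Full support of one root and dominance of the other give a positive inner product. The
  difference of two distinct maximal roots would then be a root, and its sign would make them
  comparable.\<close>

lemma maximal_unique: assumes "maximal \<phi>" "maximal \<psi>" shows "\<phi> = \<psi>"
proof (rule ccontr)
  assume ne: "\<phi> \<noteq> \<psi>"
  have r: "\<phi> \<in> \<Phi>" "\<psi> \<in> \<Phi>" using assms by (auto simp: maximal_def)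
  have d: "\<gamma> \<in> Bas \<Longrightarrow> \<phi> \<bullet> \<gamma> \<ge> 0" "\<gamma> \<in> Bas \<Longrightarrow> \<psi> \<bullet> \<gamma> \<ge> 0" for \<gamma> using maximal_dominant assms by auto
  have e: "\<phi> \<bullet> \<psi> = (\<Sum>\<delta>\<in>Bas. (fw \<delta> \<bullet> \<phi>) * (\<delta> \<bullet> \<psi>))"
    by (subst expand[of \<phi>]) (simp add: inner_sum_left)
  have t: "(fw \<delta> \<bullet> \<phi>) * (\<delta> \<bullet> \<psi>) \<ge> 0" if "\<delta> \<in> Bas" for \<delta>
    using dominant_full_support[OF r(1) d(1) that] d(2)[OF that] by (simp add: inner_commute less_imp_le)
  have "\<phi> \<bullet> \<psi> > 0"
  proof (rule ccontr)
    assume "\<not> \<phi> \<bullet> \<psi> > 0"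
    then have "(\<Sum>\<delta>\<in>Bas. (fw \<delta> \<bullet> \<phi>) * (\<delta> \<bullet> \<psi>)) = 0" using e sum_nonneg[of Bas "\<lambda>\<delta>. (fw \<delta> \<bullet> \<phi>) * (\<delta> \<bullet> \<psi>)", OF t] by linarith
    then have "\<forall>\<delta>\<in>Bas. (fw \<delta> \<bullet> \<phi>) * (\<delta> \<bullet> \<psi>) = 0" using t finite_base by (subst (asm) sum_nonneg_eq_0_iff) auto
    then have "\<forall>\<delta>\<in>Bas. \<psi> \<bullet> \<delta> = 0 \<bullet> \<delta>" using dominant_full_support[OF r(1) d(1)] by (force simp: inner_commute)
    then have "\<psi> = 0" using eq_by_base by blast
    then show False using r zero_not_root by simp
  qed
  then have "\<phi> + (- \<psi>) \<in> \<Phi>" using root_add[OF r(1) root_minus[OF r(2)]] ne by simp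
  then have "\<phi> - \<psi> \<in> P \<or> \<psi> - \<phi> \<in> P" using pos_or_neg by fastforce
  then have "nonneg_comb Bas (\<phi> - \<psi>) \<or> nonneg_comb Bas (\<psi> - \<phi>)" by (auto simp: pos_roots_def)
  then show False using assms ne by (auto simp: maximal_def)
qed

abbreviation hr where "hr \<equiv> highest_root \<Phi> Bas"

lemma highest_root: "hr \<in> \<Phi>" "\<beta> \<in> \<Phi> \<Longrightarrow> nonneg_comb Bas (hr - \<beta>)"
  and hr_dominant: "\<gamma> \<in> Bas \<Longrightarrow> hr \<bullet> \<gamma> \<ge> 0"
proof -
  obtain \<gamma>0 where "\<gamma>0 \<in> Bas" using base_nonempty by blast
  then obtain \<phi> where p: "maximal \<phi>" using exists_maximal base_roots by blast
  have top: "\<phi> \<in> \<Phi> \<and> (\<forall>\<beta>\<in>\<Phi>. nonneg_comb Bas (\<phi> - \<beta>))"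
    using p exists_maximal maximal_unique by (metis maximal_def)
  have "hr = \<phi>" unfolding highest_root_def
  proof (rule the_equality, rule top)
    fix \<psi> assume "\<psi> \<in> \<Phi> \<and> (\<forall>\<beta>\<in>\<Phi>. nonneg_comb Bas (\<psi> - \<beta>))"
    then show "\<psi> = \<phi>" using top nonneg_comb_antisym by blast
  qed
  then show "hr \<in> \<Phi>" "\<beta> \<in> \<Phi> \<Longrightarrow> nonneg_comb Bas (hr - \<beta>)" "\<gamma> \<in> Bas \<Longrightarrow> hr \<bullet> \<gamma> \<ge> 0"
    using top p maximal_dominant by auto
qed

lemma hr_pos: "hr \<in> P" using dominant_root_pos highest_root(1) hr_dominant by blast

text \<open>The difference \<open>hr - \<beta>\<close> has nonnegative coefficients, so pairing it
  with the dominant roots \<open>\<beta>\<close> and \<open>hr\<close> gives \<open>\<beta>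
  \<bullet> \<beta> \<le> hr \<bullet> \<beta> \<le> hr \<bullet> hr\<close>. Uniqueness of
  \<open>hr\<close> among dominant roots of its length later identifies conjugates of long roots,
  \<open>- w0 hr\<close>, and the root that arises from opposition.\<close>

lemma dominant_root_le:
  assumes "\<beta> \<in> \<Phi>" "\<And>\<gamma>. \<gamma> \<in> Bas \<Longrightarrow> \<beta> \<bullet> \<gamma> \<ge> 0"
  shows "\<beta> \<bullet> \<beta> \<le> hr \<bullet> hr" "\<beta> \<bullet> \<beta> = hr \<bullet> hr \<Longrightarrow> \<beta> = hr"
proof -
  have c: "\<And>\<gamma>. \<gamma> \<in> Bas \<Longrightarrow> fw \<gamma> \<bullet> (hr - \<beta>) \<ge> 0" using highest_root(2)[OF assms(1)] by (simp add: nonneg_comb_iff)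
  have "\<beta> \<bullet> (hr - \<beta>) \<ge> 0" "hr \<bullet> (hr - \<beta>) \<ge> 0"
    using dominant_inner_nonneg[of \<beta>, OF assms(2) c] dominant_inner_nonneg[of hr, OF hr_dominant c] by auto
  then have i: "\<beta> \<bullet> \<beta> \<le> hr \<bullet> \<beta>" "hr \<bullet> \<beta> \<le> hr \<bullet> hr" by (simp_all add: inner_diff_right inner_commute)
  then show "\<beta> \<bullet> \<beta> \<le> hr \<bullet> hr" by simp
  assume "\<beta> \<bullet> \<beta> = hr \<bullet> hr"
  then have "(hr - \<beta>) \<bullet> (hr - \<beta>) = 0" using i by (simp add: inner_diff_left inner_diff_right inner_commute)
  then show "\<beta> = hr" by simp
qed

lemma root_norm_le_hr: "\<beta> \<in> \<Phi> \<Longrightarrow> \<beta> \<bullet> \<beta> \<le> hr \<bullet> hr"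
  using exists_dominant_conj[of \<beta>] dominant_root_le(1) weyl_gen_inner weyl_root by metis

lemma long_root_conj: assumes "long_root \<Phi> \<alpha>" shows "\<exists>w\<in>W. \<alpha> = w hr"
proof -
  have a: "\<alpha> \<in> \<Phi>" "\<alpha> \<bullet> \<alpha> = hr \<bullet> hr"
    using assms root_norm_le_hr highest_root(1) by (auto simp: long_root_def intro: antisym)
  obtain w where w: "w \<in> W" "\<forall>\<gamma>\<in>Bas. w \<alpha> \<bullet> \<gamma> \<ge> 0" using exists_dominant_conj[OF a(1)] by blast
  have "w \<alpha> = hr" using dominant_root_le(2)[of "w \<alpha>"] w a weyl_root weyl_gen_inner by metis
  moreover obtain v where "v \<in> W" "v \<circ> w = id" using weyl_gen_inverse[OF w(1)] by blast
  ultimately show ?thesis by (metis comp_apply id_apply)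
qed

lemma w0_hr: "w0 hr = - hr"
proof -
  have m: "- w0 hr \<in> \<Phi>" using weyl_root[OF longest(1) highest_root(1)] root_minus by blast
  have "- w0 hr \<bullet> \<gamma> \<ge> 0" if "\<gamma> \<in> Bas" for \<gamma>
  proof -
    have "w0 hr \<bullet> \<gamma> = hr \<bullet> w0 \<gamma>" using weyl_gen_inner[OF longest(1), of "hr" "w0 \<gamma>"] longest(3) by simp
    moreover have "hr \<bullet> (- w0 \<gamma>) \<ge> 0"
      using longest(2)[OF base_pos[OF that]] unfolding pos_iff by (blast intro: dominant_inner_nonneg[OF hr_dominant])
    ultimately show ?thesis by simp
  qed
  then have "- w0 hr = hr" using dominant_root_le(2)[OF m] weyl_gen_inner[OF longest(1)] by simp
  then show ?thesis by (metis minus_minus)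
qed

lemma w0_factor: "\<exists>k\<in>weyl_gen (Bas - polar_type \<Phi> Bas). root_refl hr \<circ> k = w0"
proof -
  let ?k = "root_refl hr \<circ> w0"
  have k: "?k \<in> W" using root_refl_in_weyl highest_root(1) longest(1) weyl_gen_comp by blast
  have "?k hr = hr" by (simp add: w0_hr root_refl_minus_arg root_refl_self)
  then have "?k \<in> weyl_gen {\<gamma>\<in>Bas. hr \<bullet> \<gamma> = 0}" using stabilizer_dominant[OF k hr_dominant] by blast
  moreover have "{\<gamma>\<in>Bas. hr \<bullet> \<gamma> = 0} = Bas - polar_type \<Phi> Bas" by (auto simp: polar_type_def inner_commute)
  moreover have "root_refl hr \<circ> ?k = w0" by (simp add: fun_eq_iff root_refl_invol)
  ultimately show ?thesis by metis
qed

text \<open>A height count. Applying \<open>- w0\<close> to the expansion of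
  \<open>- w0 \<gamma>\<close> returns \<open>\<gamma>\<close>, of height 1, while every
  \<open>- w0 \<delta>\<close> has height at least 1. So the coefficients of
  \<open>- w0 \<gamma>\<close> sum to at most 1, which leaves room for a single simple root.\<close>

lemma w0_base: "\<gamma> \<in> Bas \<Longrightarrow> - w0 \<gamma> \<in> Bas"
proof -
  assume g: "\<gamma> \<in> Bas"
  let ?b = "- w0 \<gamma>"
  have p: "?b \<in> P" using longest(2)[OF base_pos[OF g]] .
  note lin = weyl_gen_linear[OF longest(1)]
  have "\<gamma> = - w0 ?b" by (simp add: weyl_minus[OF longest(1)] longest(3))
  also have "\<dots> = (\<Sum>\<delta>\<in>Bas. (fw \<delta> \<bullet> ?b) *\<^sub>R (- w0 \<delta>))"
    by (subst expand[of ?b]) (simp add: linear_sum[OF lin] linear_cmul[OF lin] sum_negf linear_neg[OF lin])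
  finally have "ht \<gamma> = ht (\<Sum>\<delta>\<in>Bas. (fw \<delta> \<bullet> ?b) *\<^sub>R (- w0 \<delta>))" by (rule arg_cong)
  then have h: "1 = (\<Sum>\<delta>\<in>Bas. (fw \<delta> \<bullet> ?b) * ht (- w0 \<delta>))"
    by (simp only: linear_sum[OF ht_linear] linear_cmul[OF ht_linear] real_scaleR_def ht_base[OF g])
  have nn: "\<delta> \<in> Bas \<Longrightarrow> fw \<delta> \<bullet> ?b \<ge> 0" for \<delta> using p by (simp only: pos_iff)
  have "(\<Sum>\<delta>\<in>Bas. (fw \<delta> \<bullet> ?b) * 1) \<le> (\<Sum>\<delta>\<in>Bas. (fw \<delta> \<bullet> ?b) * ht (- w0 \<delta>))"
    using nn ht_pos[OF longest(2)[OF base_pos]] by (intro sum_mono mult_left_mono) auto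
  then have le: "ht ?b \<le> 1" using h by (simp only: ht_def mult_1_right)
  show "?b \<in> Bas"
  proof (rule ccontr)
    assume n: "?b \<notin> Bas"
    obtain \<delta>0 where d0: "\<delta>0 \<in> Bas" using g by blast
    obtain \<delta> where d: "\<delta> \<in> Bas" "fw \<delta> \<bullet> ?b > 0" using pos_other_coord[OF p d0] n d0 by blast
    obtain \<epsilon> where e: "\<epsilon> \<in> Bas" "\<epsilon> \<noteq> \<delta>" "fw \<epsilon> \<bullet> ?b > 0" using pos_other_coord[OF p d(1)] n d by blast
    have ge1: "fw \<eta> \<bullet> ?b \<ge> 1" if "\<eta> \<in> Bas" "fw \<eta> \<bullet> ?b > 0" for \<eta>
    proof -
      have "fw \<eta> \<bullet> ?b \<in> \<int>" using fw_root_int[OF pos_root[OF p] that(1)] .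
      then show ?thesis using that(2) by (auto elim!: Ints_cases simp del: inner_minus_right)
    qed
    have "ht ?b \<ge> (\<Sum>\<eta>\<in>{\<delta>,\<epsilon>}. fw \<eta> \<bullet> ?b)" unfolding ht_def
      using finite_base d e nn by (intro sum_mono2) auto
    then have "ht ?b \<ge> 2" using e d ge1[of \<delta>] ge1[of \<epsilon>] by simp
    then show False using le by simp
  qed
qed

text \<open>The map \<open>- w0\<close> permutes the simple roots and fixes \<open>hr\<close>.
  Opposite simplices must have opposite types, so a simplex of polar type can only be mapped to an
  opposite one because of this.\<close>

lemma opp_type_polar: "opp_type Bas (polar_type \<Phi> Bas) = polar_type \<Phi> Bas"
proof (intro set_eqI iffI)
  note lin = weyl_gen_linear[OF longest(1)]
  have conj: "root_refl (- w0 \<delta>) = w0 \<circ> root_refl \<delta> \<circ> w0" for \<delta>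
  proof
    fix x
    have "x \<bullet> w0 \<delta> = w0 x \<bullet> \<delta>" using weyl_gen_inner[OF longest(1), of "x" "w0 \<delta>"] longest(3) by simp
    then show "root_refl (- w0 \<delta>) x = (w0 \<circ> root_refl \<delta> \<circ> w0) x"
      using weyl_gen_inner[OF longest(1), of \<delta> \<delta>]
      by (simp add: root_refl_minus root_refl_def linear_diff[OF lin] linear_cmul[OF lin] longest(3))
  qed
  have hrw: "(- w0 \<delta>) \<bullet> hr = \<delta> \<bullet> hr" for \<delta>
    using weyl_gen_inner[OF longest(1), of \<delta> hr] by (simp add: w0_hr)
  fix \<gamma>
  {
    assume "\<gamma> \<in> polar_type \<Phi> Bas"
    then have "\<gamma> \<in> Bas" "\<gamma> \<bullet> hr \<noteq> 0" by (auto simp: polar_type_def)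
    moreover have "- w0 \<gamma> \<in> polar_type \<Phi> Bas" using calculation w0_base hrw by (simp add: polar_type_def)
    moreover have "root_refl \<gamma> = w0 \<circ> root_refl (- w0 \<gamma>) \<circ> w0"
      unfolding conj by (simp add: fun_eq_iff longest(3))
    ultimately show "\<gamma> \<in> opp_type Bas (polar_type \<Phi> Bas)" by (auto simp: opp_type_def)
  next
    assume "\<gamma> \<in> opp_type Bas (polar_type \<Phi> Bas)"
    then obtain \<delta> where d: "\<gamma> \<in> Bas" "\<delta> \<in> Bas" "\<delta> \<bullet> hr \<noteq> 0" "root_refl \<gamma> = w0 \<circ> root_refl \<delta> \<circ> w0"
      by (auto simp: opp_type_def polar_type_def)
    let ?d = "- w0 \<delta>"
    \<comment> \<open>Equal reflections determine the root only up to a factor. Proportionality of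
      \<open>?d\<close> and \<open>\<gamma>\<close> suffices to transfer a nonzero product with
      \<open>hr\<close>.\<close>
    have "root_refl \<gamma> ?d = - ?d" using d(4) conj[of \<delta>] root_refl_self[of ?d] by simp
    then have "2 *\<^sub>R ?d = (2 * (?d \<bullet> \<gamma>) / (\<gamma> \<bullet> \<gamma>)) *\<^sub>R \<gamma>"
      unfolding root_refl_def scaleR_2 by (metis add.inverse_inverse diff_add_cancel diff_minus_eq_add minus_diff_eq)
    then have "2 * (?d \<bullet> hr) = (2 * (?d \<bullet> \<gamma>) / (\<gamma> \<bullet> \<gamma>)) * (\<gamma> \<bullet> hr)"
      by (metis inner_scaleR_left)
    then have "\<gamma> \<bullet> hr \<noteq> 0" using hrw[of \<delta>] d(3) by auto
    then show "\<gamma> \<in> polar_type \<Phi> Bas" using d(1) by (simp add: polar_type_def)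
  }
qed

lemma weyl_fixes_fw:
  assumes "k \<in> weyl_gen (Bas - J)" "\<gamma> \<in> J" shows "k (fw \<gamma>) = fw \<gamma>"
  using assms(1)
proof induction
  case (weyl_step \<alpha> w)
  then have "fw \<gamma> \<bullet> \<alpha> = 0" using fw_base[of \<alpha> \<gamma>] assms(2) by auto
  then show ?case using weyl_step by (simp add: root_refl_def)
qed simp

lemma type_subset_polar:
  assumes "k \<in> weyl_gen (Bas - J)" "J \<subseteq> Bas" "\<gamma> \<in> J" "w0 = s \<circ> k"
    and "s = id \<or> (\<exists>w\<in>W. s = root_refl (w hr))"
  shows "\<gamma> \<in> polar_type \<Phi> Bas"
proof -
  let ?f = "fw \<gamma>" 
  have g: "\<gamma> \<in> Bas" using assms by blast
  have e: "w0 ?f = s ?f" using weyl_fixes_fw[OF assms(1,3)] assms(4) by simp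
  let ?d = "?f - w0 ?f"
  have di: "?d \<bullet> \<delta> = ?f \<bullet> \<delta> + ?f \<bullet> (- w0 \<delta>)" for \<delta>
    using weyl_gen_inner[OF longest(1), of "?f" "w0 \<delta>"] longest(3) by (simp add: inner_diff_left)
  have nn: "?f \<bullet> (- w0 \<delta>) \<ge> 0" if "\<delta> \<in> Bas" for \<delta> using longest(2)[OF base_pos[OF that]] g unfolding pos_iff by blast
  have dd: "?d \<bullet> \<delta> \<ge> 0" if "\<delta> \<in> Bas" for \<delta> unfolding di using nn[OF that] fw_base[OF that, of \<gamma>] by (simp split: if_splits)
  have dg: "?d \<bullet> \<gamma> > 0" unfolding di using nn[OF g] g by (simp add: fw_base)
  show ?thesis using assms(5)
  proof
    assume "s = id" then show ?thesis using e dg by simp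
  next
    assume "\<exists>w\<in>W. s = root_refl (w hr)"
    then obtain w where w: "w \<in> W" "s = root_refl (w hr)" by blast
    let ?b = "w hr"
    have b: "?b \<in> \<Phi>" "?b \<bullet> ?b = hr \<bullet> hr" using weyl_root w highest_root(1) weyl_gen_inner by auto
    define c where "c = 2 * (?f \<bullet> ?b) / (?b \<bullet> ?b)"
    have dc: "?d = c *\<^sub>R ?b" using e w by (simp add: root_refl_def c_def)
    have c0: "c \<noteq> 0" using dc dg by auto
    \<comment> \<open>The sign is chosen so that \<open>?d\<close> is a positive multiple of
      \<open>b'\<close>; this makes \<open>b'\<close> a dominant root of the length of
      \<open>hr\<close>.\<close>
    define b' where "b' = (if c > 0 then ?b else - ?b)"
    have db: "?d = \<bar>c\<bar> *\<^sub>R b'" using dc c0 by (auto simp: b'_def abs_if)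
    have "b' \<bullet> \<delta> \<ge> 0" if "\<delta> \<in> Bas" for \<delta>
      using dd[OF that] c0 unfolding db by (simp add: zero_le_mult_iff)
    moreover have "b' \<in> \<Phi>" "b' \<bullet> b' = hr \<bullet> hr" using b root_minus by (auto simp: b'_def)
    ultimately have "b' = hr" using dominant_root_le(2) by blast
    then have "hr \<bullet> \<gamma> \<noteq> 0" using dg unfolding db by auto
    then show ?thesis using g by (simp add: polar_type_def inner_commute)
  qed
qed

end

section \<open>Coroots and divided powers\<close>

lemma coroot_coroot: "coroot (coroot v) = v"
  by (cases "v = 0") (simp_all add: coroot_def)

lemma inj_coroot: "inj coroot"
  by (metis coroot_coroot injI)

lemma coroot_wword: "coroot (wword ws v) = wword ws (coroot v)"
  by (simp add: coroot_def wword_inner linear_cmul[OF wword_linear])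

lemma coroot_minus: "coroot (- v) = - coroot v"
  by (simp add: coroot_def)

text \<open>Exponentials are truncated at \<open>K\<close>. All terms beyond \<open>K\<close>
  vanish, so the square of index pairs can be completed to the triangle of total degree at most
  \<open>2 * K\<close>, in which a product is grouped by degree.\<close>

lemma trunc_cauchy:
  fixes f :: "nat \<Rightarrow> nat \<Rightarrow> 'r::comm_monoid_add"
  assumes "\<And>k l. k > K \<or> l > K \<Longrightarrow> f k l = 0"
  shows "(\<Sum>k\<le>K. \<Sum>l\<le>K. f k l) = (\<Sum>n\<le>2*K. \<Sum>k\<le>n. f k (n - k))"
proof -
  have "(\<Sum>k\<le>K. \<Sum>l\<le>K. f k l) = sum (\<lambda>(k, l). f k l) ({..K} \<times> {..K})"
    by (simp add: sum.cartesian_product)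
  also have "\<dots> = sum (\<lambda>(k, l). f k l) {(k, l). k + l \<le> 2 * K}"
  proof (rule sum.mono_neutral_left)
    have "{(k, l). k + l \<le> 2 * K} \<subseteq> {..2*K} \<times> {..2*K}" by auto
    then show "finite {(k, l). k + l \<le> 2 * K}" using finite_subset by blast
    show "\<forall>i\<in>{(k, l). k + l \<le> 2 * K} - {..K} \<times> {..K}. (case i of (k, l) \<Rightarrow> f k l) = 0"
    proof
      fix x assume "x \<in> {(k, l). k + l \<le> 2 * K} - {..K} \<times> {..K}"
      then have "fst x > K \<or> snd x > K" by (cases x) auto
      then show "(case x of (k, l) \<Rightarrow> f k l) = 0" using assms[of "fst x" "snd x"] by (simp add: case_prod_beta)
    qed
  qed auto
  also have "\<dots> = (\<Sum>n\<le>2*K. \<Sum>k\<le>n. f k (n - k))" by (rule sum.triangle_reindex_eq)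
  finally show ?thesis .
qed

context root_base
begin

lemma of_int_cartan_coroot: "\<alpha> \<in> \<Phi> \<Longrightarrow> \<beta> \<in> \<Phi> \<Longrightarrow> real_of_int (cartan \<beta> \<alpha>) = \<beta> \<bullet> coroot \<alpha>"
  by (simp add: of_int_cartan coroot_def)

lemma independent_coroots: "independent (coroot ` Bas)"
proof (rule independent_if_scalars_zero)
  show "finite (coroot ` Bas)" using finite_base by simp
  fix f x assume s: "(\<Sum>x\<in>coroot ` Bas. f x *\<^sub>R x) = 0" and x: "x \<in> coroot ` Bas"
  then obtain \<gamma> where g: "\<gamma> \<in> Bas" "x = coroot \<gamma>" by blast
  have "(\<Sum>\<delta>\<in>Bas. (f (coroot \<delta>) * (2 / (\<delta> \<bullet> \<delta>))) *\<^sub>R \<delta>) = 0"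
    using s by (subst (asm) sum.reindex[OF inj_on_subset[OF inj_coroot subset_UNIV]]) (simp add: coroot_def)
  then have "f (coroot \<gamma>) * (2 / (\<gamma> \<bullet> \<gamma>)) = 0"
    using fw_sum[OF g(1), of "\<lambda>\<delta>. f (coroot \<delta>) * (2 / (\<delta> \<bullet> \<delta>))"] by simp
  then show "f x = 0" using root_inner_pos[OF base_roots[OF g(1)]] g by auto
qed

text \<open>\<open>hcoef\<close> rests on a description that is meaningful only for integral
  combinations, so integrality of coroots over the simple coroots has to come first.\<close>

definition in_coroot_lattice :: "'a \<Rightarrow> bool" where
  "in_coroot_lattice v \<longleftrightarrow> (\<exists>c::'a \<Rightarrow> int. v = (\<Sum>\<gamma>\<in>Bas. of_int (c \<gamma>) *\<^sub>R coroot \<gamma>))"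

lemma refl_coroot_lattice:
  assumes "\<delta> \<in> Bas" "in_coroot_lattice v" shows "in_coroot_lattice (root_refl \<delta> v)"
proof -
  obtain c where c: "v = (\<Sum>\<gamma>\<in>Bas. of_int (c \<gamma>) *\<^sub>R coroot \<gamma>)" using assms(2) by (auto simp: in_coroot_lattice_def)
  define m where "m = (\<Sum>\<gamma>\<in>Bas. c \<gamma> * cartan \<delta> \<gamma>)"
  have "real_of_int m = v \<bullet> \<delta>"
    unfolding inner_commute[of v] by (simp add: m_def c inner_sum_right of_int_cartan_coroot assms(1) base_roots)
  then have "root_refl \<delta> v = v - of_int m *\<^sub>R coroot \<delta>"
    by (simp add: root_refl_def coroot_def mult.commute)
  also have "\<dots> = (\<Sum>\<gamma>\<in>Bas. of_int (c \<gamma> - (if \<gamma> = \<delta> then m else 0)) *\<^sub>R coroot \<gamma>)"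
    using assms(1) finite_base
    by (simp add: c scaleR_left_diff_distrib sum_subtractf if_distrib[of real_of_int] if_distrib[of "\<lambda>x. x *\<^sub>R _"] cong: if_cong)
  finally show ?thesis
    unfolding in_coroot_lattice_def by (rule exI[of _ "\<lambda>\<gamma>. c \<gamma> - (if \<gamma> = \<delta> then m else 0)"])
qed

lemma coroot_in_lattice: "\<beta> \<in> \<Phi> \<Longrightarrow> in_coroot_lattice (coroot \<beta>)"
proof -
  assume "\<beta> \<in> \<Phi>"
  then obtain ws \<gamma> where ws: "set ws \<subseteq> Bas" "\<gamma> \<in> Bas" "\<beta> = wword ws \<gamma>" using root_conj_base by blast
  have "coroot \<gamma> = (\<Sum>\<delta>\<in>Bas. of_int (if \<delta> = \<gamma> then 1 else 0) *\<^sub>R coroot \<delta>)"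
    using ws(2) finite_base by (simp add: if_distrib[of real_of_int] if_distrib[of "\<lambda>x. x *\<^sub>R _"] cong: if_cong)
  then have "in_coroot_lattice (coroot \<gamma>)"
    unfolding in_coroot_lattice_def by (rule exI[of _ "\<lambda>\<delta>. if \<delta> = \<gamma> then 1 else 0"])
  then have "set ws \<subseteq> Bas \<Longrightarrow> in_coroot_lattice (wword ws (coroot \<gamma>))"
    by (induction ws) (auto simp: wword_Nil wword_Cons refl_coroot_lattice)
  then show ?thesis using ws by (simp add: coroot_wword)
qed

text \<open>\<open>coords\<close> is indexed by coroots and \<open>hcoef\<close> by roots; since
  \<open>coroot\<close> is an involution, it translates between the two.\<close>

lemma hcoef_unique:
  assumes "coroot \<beta> = (\<Sum>\<gamma>\<in>Bas. of_int (c \<gamma>) *\<^sub>R coroot \<gamma>)" "\<And>\<gamma>. \<gamma> \<notin> Bas \<Longrightarrow> c \<gamma> = 0"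
  shows "hcoef Bas \<beta> = c"
proof -
  let ?d = "\<lambda>v. c (coroot v)"
  have "coords (coroot ` Bas) (coroot \<beta>) = ?d"
  proof (rule coords_unique[OF independent_coroots])
    show "\<gamma> \<notin> coroot ` Bas \<Longrightarrow> c (coroot \<gamma>) = 0" for \<gamma>
      using assms(2) by (metis coroot_coroot image_eqI)
    show "coroot \<beta> = (\<Sum>\<gamma>\<in>coroot ` Bas. of_int (c (coroot \<gamma>)) *\<^sub>R \<gamma>)"
      by (subst sum.reindex[OF inj_on_subset[OF inj_coroot subset_UNIV]]) (simp add: coroot_coroot assms(1))
  qed
  then show ?thesis by (simp add: hcoef_def fun_eq_iff coroot_coroot)
qed

lemma hcoef_sum: "\<beta> \<in> \<Phi> \<Longrightarrow> coroot \<beta> = (\<Sum>\<gamma>\<in>Bas. of_int (hcoef Bas \<beta> \<gamma>) *\<^sub>R coroot \<gamma>)"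
  and hcoef_outside: "\<beta> \<in> \<Phi> \<Longrightarrow> \<gamma> \<notin> Bas \<Longrightarrow> hcoef Bas \<beta> \<gamma> = 0"
proof -
  assume "\<beta> \<in> \<Phi>"
  then obtain c :: "'a \<Rightarrow> int" where c: "coroot \<beta> = (\<Sum>\<gamma>\<in>Bas. of_int (c \<gamma>) *\<^sub>R coroot \<gamma>)"
    using coroot_in_lattice by (auto simp: in_coroot_lattice_def)
  define d where "d \<gamma> = (if \<gamma> \<in> Bas then c \<gamma> else 0)" for \<gamma>
  have "coroot \<beta> = (\<Sum>\<gamma>\<in>Bas. of_int (d \<gamma>) *\<^sub>R coroot \<gamma>)" by (simp add: c d_def)
  moreover from this have "hcoef Bas \<beta> = d" by (rule hcoef_unique) (simp add: d_def)
  ultimately show "coroot \<beta> = (\<Sum>\<gamma>\<in>Bas. of_int (hcoef Bas \<beta> \<gamma>) *\<^sub>R coroot \<gamma>)"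
    and "\<gamma> \<notin> Bas \<Longrightarrow> hcoef Bas \<beta> \<gamma> = 0" by (auto simp: d_def)
qed

lemma hcoef_base: "\<alpha> \<in> Bas \<Longrightarrow> hcoef Bas \<alpha> = (\<lambda>\<gamma>. if \<gamma> = \<alpha> then 1 else 0)"
  using finite_base
  by (intro hcoef_unique) (auto simp add: if_distrib[of real_of_int] if_distrib[of "\<lambda>x. x *\<^sub>R _"] cong: if_cong)

lemma hcoef_minus: "\<beta> \<in> \<Phi> \<Longrightarrow> hcoef Bas (- \<beta>) = (\<lambda>\<gamma>. - hcoef Bas \<beta> \<gamma>)"
  using hcoef_sum[of \<beta>] hcoef_outside[of \<beta>]
  by (intro hcoef_unique) (auto simp: coroot_minus sum_negf)

lemma sum_hcoef_cartan: "\<alpha> \<in> \<Phi> \<Longrightarrow> \<beta> \<in> \<Phi> \<Longrightarrow> (\<Sum>\<gamma>\<in>Bas. hcoef Bas \<beta> \<gamma> * cartan \<alpha> \<gamma>) = cartan \<alpha> \<beta>"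
proof -
  assume a: "\<alpha> \<in> \<Phi>" "\<beta> \<in> \<Phi>"
  have "real_of_int (\<Sum>\<gamma>\<in>Bas. hcoef Bas \<beta> \<gamma> * cartan \<alpha> \<gamma>) = \<alpha> \<bullet> coroot \<beta>"
    by (subst hcoef_sum[OF a(2)]) (simp add: inner_sum_right of_int_cartan_coroot a base_roots)
  also have "\<dots> = real_of_int (cartan \<alpha> \<beta>)" by (simp add: of_int_cartan_coroot a)
  finally show ?thesis by linarith
qed

text \<open>The coroot of \<open>\<beta>\<close> is a Weyl image of a simple coroot, and the Weyl
  group preserves the coroot lattice. Transporting the dual vector of that simple coroot gives an
  integral functional with value 1. It later divides out an integer factor.\<close>

lemma hcoef_primitive: "\<beta> \<in> \<Phi> \<Longrightarrow> \<exists>z::'a \<Rightarrow> int. (\<Sum>\<gamma>\<in>Bas. hcoef Bas \<beta> \<gamma> * z \<gamma>) = 1"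
proof -
  assume b: "\<beta> \<in> \<Phi>"
  then obtain ws \<delta> where ws: "set ws \<subseteq> Bas" "\<delta> \<in> Bas" "\<beta> = wword ws \<delta>" using root_conj_base by blast
  obtain e where e: "\<forall>x\<in>coroot ` Bas. e \<bullet> x = (if x = coroot \<delta> then 1 else 0)"
    using ex_dual_vector[OF independent_coroots] by blast
  have int: "e \<bullet> coroot \<eta> \<in> \<int>" if "\<eta> \<in> \<Phi>" for \<eta>
    by (subst hcoef_sum[OF that]) (use e in \<open>auto simp: inner_sum_right\<close>)
  define z where "z \<gamma> = \<lfloor>e \<bullet> coroot (wword (rev ws) \<gamma>)\<rfloor>" for \<gamma>
  have z: "real_of_int (z \<gamma>) = e \<bullet> coroot (wword (rev ws) \<gamma>)" if "\<gamma> \<in> Bas" for \<gamma>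
    using int[OF wword_root[of "rev ws" \<gamma>]] ws(1) that base_roots by (simp add: z_def subset_iff)
  have "coroot \<delta> = wword (rev ws) (coroot \<beta>)" using ws by (simp add: coroot_wword wword_rev)
  also have "\<dots> = (\<Sum>\<gamma>\<in>Bas. of_int (hcoef Bas \<beta> \<gamma>) *\<^sub>R coroot (wword (rev ws) \<gamma>))"
    by (subst hcoef_sum[OF b]) (simp add: linear_sum[OF wword_linear] linear_cmul[OF wword_linear] coroot_wword)
  finally have "e \<bullet> coroot \<delta> = (\<Sum>\<gamma>\<in>Bas. of_int (hcoef Bas \<beta> \<gamma>) * (e \<bullet> coroot (wword (rev ws) \<gamma>)))"
    by (simp add: inner_sum_right)
  moreover have "e \<bullet> coroot \<delta> = 1" using e ws by auto
  ultimately have "real_of_int (\<Sum>\<gamma>\<in>Bas. hcoef Bas \<beta> \<gamma> * z \<gamma>) = 1" by (simp add: z)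
  then show ?thesis by (metis of_int_eq_1_iff)
qed

text \<open>The numbers \<open>cartan v \<delta>\<close> are the eigenvalues of the elements
  \<open>h_\<delta>\<close>; weights are identified below by comparing them.\<close>

lemma cartan_separates:
  assumes "v \<in> insert 0 \<Phi>" "w \<in> insert 0 \<Phi>" "\<And>\<delta>. \<delta> \<in> Bas \<Longrightarrow> cartan v \<delta> = cartan w \<delta>"
  shows "v = w"
proof (rule eq_by_base)
  fix \<delta> assume d: "\<delta> \<in> Bas"
  have e: "u \<in> insert 0 \<Phi> \<Longrightarrow> real_of_int (cartan u \<delta>) = 2 * (u \<bullet> \<delta>) / (\<delta> \<bullet> \<delta>)" for u
    using of_int_cartan[OF base_roots[OF d]] by (auto simp: cartan_def)
  have "2 * (v \<bullet> \<delta>) / (\<delta> \<bullet> \<delta>) = 2 * (w \<bullet> \<delta>) / (\<delta> \<bullet> \<delta>)"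
    using e[OF assms(1)] e[OF assms(2)] assms(3)[OF d] by metis
  then show "v \<bullet> \<delta> = w \<bullet> \<delta>" using root_inner_pos[OF base_roots[OF d]] by simp
qed

section \<open>Basis indices and their weights\<close>

abbreviation I where "I \<equiv> idxset \<Phi> Bas"

lemma finite_I: "finite I"
  using finite_roots finite_base by (simp add: idxset_def)

lemma Inl_I: "Inl \<beta> \<in> I \<longleftrightarrow> \<beta> \<in> \<Phi>" and Inr_I: "Inr \<gamma> \<in> I \<longleftrightarrow> \<gamma> \<in> Bas"
  by (auto simp: idxset_def)

definition wt :: "'a idx \<Rightarrow> 'a" where
  "wt i = (case i of Inl \<beta> \<Rightarrow> \<beta> | Inr _ \<Rightarrow> 0)"

lemma wt_simps [simp]: "wt (Inl \<beta>) = \<beta>" "wt (Inr \<gamma>) = 0"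
  by (simp_all add: wt_def)

lemma wt_I: "i \<in> I \<Longrightarrow> wt i \<in> insert 0 \<Phi>"
  by (auto simp: idxset_def)

lemma wt_eq_root: "i \<in> I \<Longrightarrow> wt i = \<beta> \<Longrightarrow> \<beta> \<in> \<Phi> \<Longrightarrow> i = Inl \<beta>"
  using zero_not_root by (cases i) (auto simp: idxset_def)

lemma sum_I: "(\<Sum>i\<in>I. f i) = (\<Sum>\<beta>\<in>\<Phi>. f (Inl \<beta>)) + (\<Sum>\<gamma>\<in>Bas. f (Inr \<gamma>))"
proof -
  have "(\<Sum>i\<in>I. f i) = sum f (Inl ` \<Phi>) + sum f (Inr ` Bas)"
    unfolding idxset_def using finite_roots finite_base by (intro sum.union_disjoint) auto
  then show ?thesis by (simp add: sum.reindex)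
qed

end

locale chevalley = root_base +
  fixes N :: "'a::euclidean_space \<Rightarrow> 'a \<Rightarrow> int"
  assumes CB: "chevalley_basis \<Phi> Bas N"
begin

abbreviation mm (infixl "\<otimes>" 70) where "A \<otimes> B \<equiv> mmul I A B"
abbreviation br where "br \<equiv> brk \<Phi> Bas N"
abbreviation ad where "ad \<equiv> adm \<Phi> Bas N"

lemma N_cases: "\<alpha> \<in> \<Phi> \<Longrightarrow> \<beta> \<in> \<Phi> \<Longrightarrow> \<alpha> + \<beta> \<in> \<Phi> \<Longrightarrow>
    N \<alpha> \<beta> = int (string_p \<Phi> \<alpha> \<beta>) + 1 \<or> N \<alpha> \<beta> = - (int (string_p \<Phi> \<alpha> \<beta>) + 1)"
  using CB unfolding chevalley_basis_def by blast

lemma br_anti: "i \<in> I \<Longrightarrow> j \<in> I \<Longrightarrow> br i j k = - br j i k"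
  using CB unfolding chevalley_basis_def by blast

lemma br_jacobi: "x \<in> I \<Longrightarrow> y \<in> I \<Longrightarrow> z \<in> I \<Longrightarrow>
    (\<Sum>m\<in>I. br y z m * br x m t + br z x m * br y m t + br x y m * br z m t) = 0"
  using CB unfolding chevalley_basis_def by blast

lemma br_Inr: "br (Inr \<delta>) q t = (if t = q then cartan (wt q) \<delta> else 0)"
  by (cases q) (simp_all add: brk_def cartan_def)

lemma br_Inr_right: "br q (Inr \<delta>) t = (if t = q then - cartan (wt q) \<delta> else 0)"
  by (cases q) (simp_all add: brk_def cartan_def)

lemma br_supp: "i \<in> I \<Longrightarrow> j \<in> I \<Longrightarrow> br i j t \<noteq> 0 \<Longrightarrow> t \<in> I \<and> wt t = wt i + wt j"
proof -
  assume a: "i \<in> I" "j \<in> I" "br i j t \<noteq> 0"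
  consider \<delta> where "i = Inr \<delta>" | \<delta> where "j = Inr \<delta>" | \<beta> \<delta> where "i = Inl \<beta>" "j = Inl \<delta>" by (cases i; cases j) auto
  then show ?thesis
  proof cases
    case 1 then show ?thesis using a by (auto simp: br_Inr split: if_splits)
  next
    case 2 then show ?thesis using a by (auto simp: br_Inr_right split: if_splits)
  next
    case 3
    then have r: "\<beta> \<in> \<Phi>" "\<delta> \<in> \<Phi>" using a by (auto simp: Inl_I)
    show ?thesis
    proof (cases "\<delta> = - \<beta>")
      case True
      then show ?thesis using a 3 hcoef_outside[OF r(1)] by (cases t) (auto simp: brk_def Inr_I)
    next
      case False
      then show ?thesis using a 3 by (auto simp: brk_def Inl_I split: if_splits)
    qed
  qed
qed

lemma ad_eq: "i \<in> I \<Longrightarrow> j \<in> I \<Longrightarrow> ad \<alpha> i j = br (Inl \<alpha>) j i"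
  by (simp add: adm_def)

lemma msupp_ad: "msupp I (ad \<alpha>)"
  by (auto simp: msupp_def adm_def)

lemma ad_supp: "\<alpha> \<in> \<Phi> \<Longrightarrow> ad \<alpha> i j \<noteq> 0 \<Longrightarrow> i \<in> I \<and> j \<in> I \<and> wt i = wt j + \<alpha>"
  using br_supp[of "Inl \<alpha>" j i] by (auto simp: adm_def Inl_I split: if_splits)

lemma ad_Inr: "\<alpha> \<in> \<Phi> \<Longrightarrow> \<delta> \<in> Bas \<Longrightarrow> ad \<alpha> t (Inr \<delta>) = (if t = Inl \<alpha> then - cartan \<alpha> \<delta> else 0)"
  by (auto simp: adm_def br_Inr_right Inr_I Inl_I)

lemma ad_neg: "\<alpha> \<in> \<Phi> \<Longrightarrow> ad \<alpha> t (Inl (- \<alpha>)) = (case t of Inr \<gamma> \<Rightarrow> hcoef Bas \<alpha> \<gamma> | Inl _ \<Rightarrow> 0)"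
  using hcoef_outside by (auto simp: adm_def brk_def Inr_I Inl_I root_minus split: sum.splits)

lemma ad_root: "\<alpha> \<in> \<Phi> \<Longrightarrow> \<beta> \<in> \<Phi> \<Longrightarrow> \<beta> \<noteq> - \<alpha> \<Longrightarrow>
   ad \<alpha> t (Inl \<beta>) = (if \<alpha> + \<beta> \<in> \<Phi> \<and> t = Inl (\<alpha> + \<beta>) then N \<alpha> \<beta> else 0)"
  by (auto simp: adm_def brk_def Inr_I Inl_I)

lemma double_not_root: "\<alpha> \<in> \<Phi> \<Longrightarrow> \<alpha> + \<alpha> \<notin> \<Phi>"
  using reduced[of \<alpha> 2] by (auto simp: scaleR_2)

lemma neg_ne_self: "\<alpha> \<in> \<Phi> \<Longrightarrow> \<alpha> \<noteq> - \<alpha>"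
proof
  assume a: "\<alpha> \<in> \<Phi>" "\<alpha> = - \<alpha>"
  then have "2 *\<^sub>R \<alpha> = 0" by (metis add.right_inverse scaleR_2)
  then show False using a zero_not_root by auto
qed

lemma ad_self: "\<alpha> \<in> \<Phi> \<Longrightarrow> ad \<alpha> t (Inl \<alpha>) = 0"
  using ad_root[of \<alpha> \<alpha>] double_not_root neg_ne_self by auto

section \<open>Powers of \<open>ad e_\<alpha>\<close> and their divisibility by factorials\<close>

lemma mpow_ad_supp: "\<alpha> \<in> \<Phi> \<Longrightarrow> mpow I (ad \<alpha>) k i j \<noteq> 0 \<Longrightarrow>
   i \<in> I \<and> j \<in> I \<and> wt i = wt j + of_nat k *\<^sub>R \<alpha> \<and> (\<forall>l\<le>k. wt j + of_nat l *\<^sub>R \<alpha> \<in> insert 0 \<Phi>)"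
proof (induction k arbitrary: i)
  case 0
  then show ?case using wt_I[of j] by (auto simp: mpow_0 idm_def split: if_splits)
next
  case (Suc k)
  then obtain m where m: "ad \<alpha> i m \<noteq> 0" "mpow I (ad \<alpha>) k m j \<noteq> 0" by (auto simp: mpow_Suc elim: mmul_nonzeroE)
  note a = ad_supp[OF Suc.prems(1) m(1)] and b = Suc.IH[OF Suc.prems(1) m(2)]
  have e: "wt i = wt j + of_nat (Suc k) *\<^sub>R \<alpha>" using a b by (simp add: algebra_simps)
  moreover have "wt j + of_nat l *\<^sub>R \<alpha> \<in> insert 0 \<Phi>" if "l \<le> Suc k" for l
  proof (cases "l = Suc k")
    case True then show ?thesis using a wt_I[of i] e by metis
  next
    case False then show ?thesis using b that by (metis le_SucE)
  qed
  ultimately show ?case using a b by blast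
qed

text \<open>The weights are the roots and 0, so there are \<open>card \<Phi> + 1\<close> of them.
  The bound places the truncation index \<open>card I\<close> of \<open>xr\<close> beyond the length
  of every root string.\<close>

lemma card_I: "\<alpha> \<in> \<Phi> \<Longrightarrow> card I \<ge> Suc (card \<Phi>)"
proof -
  assume "\<alpha> \<in> \<Phi>"
  then have "Bas \<noteq> {}" using root_conj_base by blast
  then have "card Bas \<ge> 1" using finite_base by (simp add: Suc_leI card_gt_0_iff)
  moreover have "card I = card \<Phi> + card Bas" unfolding idxset_def using finite_roots finite_base
    by (subst card_Un_disjoint) (auto simp: card_image)
  ultimately show ?thesis by simp
qed

text \<open>A nonzero entry of the \<open>k\<close>-th power passes through \<open>k + 1\<close>
  distinct weights; for this reason \<open>mpow_ad_supp\<close> records the intermediate weights as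
  well.\<close>

lemma mpow_ad_zero: "\<alpha> \<in> \<Phi> \<Longrightarrow> k > card I \<Longrightarrow> mpow I (ad \<alpha>) k i j = 0"
proof (rule ccontr)
  assume a: "\<alpha> \<in> \<Phi>" "k > card I" "mpow I (ad \<alpha>) k i j \<noteq> 0"
  let ?f = "\<lambda>l. wt j + of_nat l *\<^sub>R \<alpha>"
  have "\<alpha> \<noteq> 0" using a zero_not_root by auto
  then have "inj_on ?f {..k}" by (auto intro!: inj_onI)
  then have "card (?f ` {..k}) = Suc k" by (simp add: card_image)
  moreover have "?f ` {..k} \<subseteq> insert 0 \<Phi>" using mpow_ad_supp[OF a(1,3)] by auto
  moreover have "card (insert 0 \<Phi>) = Suc (card \<Phi>)" using finite_roots zero_not_root by simp
  ultimately have "Suc k \<le> Suc (card \<Phi>)" using finite_roots card_mono[of "insert 0 \<Phi>"] by (metis finite_insert)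
  then show False using card_I[OF a(1)] a(2) by simp
qed

text \<open>Moving up by \<open>k\<close> steps leaves the lower end of the string in place.
  Finiteness of \<open>\<Phi>\<close> bounds the candidates, without which \<open>GREATEST\<close>
  says nothing.\<close>

lemma string_p_shift:
  assumes "\<alpha> \<in> \<Phi>" "\<beta> \<in> \<Phi>"
  shows "string_p \<Phi> \<alpha> (\<beta> + of_nat k *\<^sub>R \<alpha>) = string_p \<Phi> \<alpha> \<beta> + k"
proof -
  let ?S = "{p::nat. \<beta> - of_nat p *\<^sub>R \<alpha> \<in> \<Phi>}"
  have a0: "\<alpha> \<noteq> 0" using assms zero_not_root by auto
  have "inj (\<lambda>p::nat. \<beta> - of_nat p *\<^sub>R \<alpha>)" using a0 by (auto intro!: injI)
  then have "finite ?S" using finite_roots finite_vimageI[of \<Phi> "\<lambda>p::nat. \<beta> - of_nat p *\<^sub>R \<alpha>"] by (simp add: vimage_def)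
  then obtain b where b: "\<And>p. \<beta> - of_nat p *\<^sub>R \<alpha> \<in> \<Phi> \<Longrightarrow> p \<le> b" using finite_nat_set_iff_bounded_le[of ?S] by auto
  define p0 where "p0 = string_p \<Phi> \<alpha> \<beta>"
  have p0: "\<beta> - of_nat p0 *\<^sub>R \<alpha> \<in> \<Phi>" unfolding p0_def string_p_def
    by (rule GreatestI_nat[of "\<lambda>p. \<beta> - of_nat p *\<^sub>R \<alpha> \<in> \<Phi>" 0 b]) (use assms b in auto)
  have mx: "p \<le> p0" if "\<beta> - of_nat p *\<^sub>R \<alpha> \<in> \<Phi>" for p unfolding p0_def string_p_def
    by (rule Greatest_le_nat[of "\<lambda>p. \<beta> - of_nat p *\<^sub>R \<alpha> \<in> \<Phi>" p b]) (use that b in auto)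
  have "(GREATEST p::nat. \<beta> + of_nat k *\<^sub>R \<alpha> - of_nat p *\<^sub>R \<alpha> \<in> \<Phi>) = p0 + k"
  proof (rule Greatest_equality)
    show "\<beta> + of_nat k *\<^sub>R \<alpha> - of_nat (p0 + k) *\<^sub>R \<alpha> \<in> \<Phi>" using p0 by (simp add: algebra_simps)
    fix y assume y: "\<beta> + of_nat k *\<^sub>R \<alpha> - of_nat y *\<^sub>R \<alpha> \<in> \<Phi>"
    show "y \<le> p0 + k"
    proof (cases "y \<ge> k")
      case True
      then have "\<beta> - of_nat (y - k) *\<^sub>R \<alpha> \<in> \<Phi>" using y by (simp add: of_nat_diff algebra_simps)
      then show ?thesis using mx[of "y - k"] by simp
    qed simp
  qed
  then show ?thesis by (simp add: string_p_def p0_def)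
qed

text \<open>With \<open>p = string_p \<Phi> \<alpha> \<beta>\<close>, the structure constants along
  the string are \<open>p + 1, ..., p + k\<close> up to sign, and their product is
  \<open>fact k\<close> times a binomial coefficient. The factor \<open>\<epsilon>\<close> collects
  the signs and becomes 0 once the string leaves \<open>\<Phi>\<close>.\<close>

lemma mpow_ad_root_column:
  assumes "\<alpha> \<in> \<Phi>" "\<beta> \<in> \<Phi>" "\<beta> \<noteq> - \<alpha>"
  shows "\<exists>\<epsilon>::int. (\<epsilon> \<noteq> 0 \<longrightarrow> \<beta> + of_nat k *\<^sub>R \<alpha> \<in> \<Phi>) \<and> (\<forall>t. mpow I (ad \<alpha>) k t (Inl \<beta>) =
     (if t = Inl (\<beta> + of_nat k *\<^sub>R \<alpha>) then \<epsilon> * (fact k * int ((string_p \<Phi> \<alpha> \<beta> + k) choose k)) else 0))"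
proof (induction k)
  case 0
  then show ?case using assms by (intro exI[of _ 1]) (auto simp: mpow_0 idm_def Inl_I)
next
  case (Suc k)
  let ?p = "string_p \<Phi> \<alpha> \<beta>" and ?b = "\<beta> + of_nat k *\<^sub>R \<alpha>"
  from Suc obtain \<epsilon> :: int where e: "\<epsilon> \<noteq> 0 \<longrightarrow> ?b \<in> \<Phi>"
    "\<And>t. mpow I (ad \<alpha>) k t (Inl \<beta>) = (if t = Inl ?b then \<epsilon> * (fact k * int ((?p + k) choose k)) else 0)" by blast
  have col: "mpow I (ad \<alpha>) (Suc k) t (Inl \<beta>) = ad \<alpha> t (Inl ?b) * (\<epsilon> * (fact k * int ((?p + k) choose k)))" for t
    using finite_I msupp_ad[of \<alpha>] unfolding mpow_Suc mmul_def e(2)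
    by (auto simp: if_distrib msupp_def cong: if_cong)
  have sm: "?b + \<alpha> = \<beta> + of_nat (Suc k) *\<^sub>R \<alpha>" by (simp add: algebra_simps)
  show ?case
  proof (cases "\<epsilon> \<noteq> 0 \<and> \<alpha> + ?b \<in> \<Phi>")
    case False
    then have "mpow I (ad \<alpha>) (Suc k) t (Inl \<beta>) = 0" for t
    proof (cases "\<epsilon> = 0")
      case False
      then have b: "?b \<in> \<Phi>" using e by blast
      have "?b \<noteq> - \<alpha>"
      proof
        assume "?b = - \<alpha>"
        then have bb: "\<beta> = (- of_nat (Suc k)) *\<^sub>R \<alpha>" by (simp add: algebra_simps eq_neg_iff_add_eq_0)
        then have "(- real (Suc k)) *\<^sub>R \<alpha> \<in> \<Phi>" using assms by metis
        then have "- real (Suc k) = 1 \<or> - real (Suc k) = -1" by (rule reduced[OF assms(1)])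
        then have "- real (Suc k) = -1" by linarith
        then show False using bb assms by simp
      qed
      then show ?thesis using col ad_root[OF assms(1) b] False \<open>\<not> (\<epsilon> \<noteq> 0 \<and> \<alpha> + ?b \<in> \<Phi>)\<close> by simp
    qed (simp add: col)
    then show ?thesis by (intro exI[of _ 0]) simp
  next
    case True
    then have b: "?b \<in> \<Phi>" "\<alpha> + ?b \<in> \<Phi>" using e by auto
    have "?b \<noteq> - \<alpha>" using b zero_not_root by auto
    then have a: "ad \<alpha> t (Inl ?b) = (if t = Inl (\<beta> + of_nat (Suc k) *\<^sub>R \<alpha>) then N \<alpha> ?b else 0)" for t
      using ad_root[OF assms(1) b(1)] b sm by (simp add: add.commute)
    obtain s :: int where s: "N \<alpha> ?b = s * (int (?p + k) + 1)"
      using N_cases[OF assms(1) b] string_p_shift[OF assms(1,2), of k] by (metis mult_1 mult_minus1)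
    \<comment> \<open>The absorption identity for binomial coefficients trades the new factor
      \<open>p + k + 1\<close> for \<open>k + 1\<close>, which completes the factorial.\<close>
    have "int (Suc (?p + k)) * int ((?p + k) choose k) = int (Suc k) * int (Suc (?p + k) choose Suc k)"
      unfolding of_nat_mult[symmetric] Suc_times_binomial ..
    then have "(int (?p + k) + 1) * int ((?p + k) choose k) = (int k + 1) * int ((?p + Suc k) choose Suc k)"
      by (simp only: of_nat_Suc add_Suc_right add_Suc add.commute)
    then have "s * \<epsilon> * fact k * ((int (?p + k) + 1) * int ((?p + k) choose k)) = s * \<epsilon> * fact k * ((int k + 1) * int ((?p + Suc k) choose Suc k))"
      by (rule arg_cong)
    then have "N \<alpha> ?b * (\<epsilon> * (fact k * int ((?p + k) choose k))) = (s * \<epsilon>) * (fact (Suc k) * int ((?p + Suc k) choose Suc k))"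
      unfolding s fact_Suc by (simp only: of_nat_Suc of_int_of_nat_eq of_nat_add of_nat_1 mult.assoc mult.left_commute add.commute)
    then have "mpow I (ad \<alpha>) (Suc k) t (Inl \<beta>) = (if t = Inl (\<beta> + of_nat (Suc k) *\<^sub>R \<alpha>)
        then (s * \<epsilon>) * (fact (Suc k) * int ((?p + Suc k) choose Suc k)) else 0)" for t
      unfolding col a by (simp only: if_distrib[of "\<lambda>x. x * _"] mult_zero_left)
    moreover have "\<beta> + of_nat (Suc k) *\<^sub>R \<alpha> \<in> \<Phi>" using b(2) sm by (metis add.commute)
    ultimately show ?thesis by blast
  qed
qed

text \<open>The one string through weight 0: \<open>e_{-\<alpha>}\<close> goes to
  \<open>h_\<alpha>\<close>, then to \<open>-2 e_\<alpha>\<close>, then to 0.\<close>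

lemma mpow_ad_neg_column:
  assumes "\<alpha> \<in> \<Phi>"
  shows "mpow I (ad \<alpha>) 1 t (Inl (- \<alpha>)) = (case t of Inr \<gamma> \<Rightarrow> hcoef Bas \<alpha> \<gamma> | Inl _ \<Rightarrow> 0)"
    and "mpow I (ad \<alpha>) 2 t (Inl (- \<alpha>)) = (if t = Inl \<alpha> then -2 else 0)"
    and "k \<ge> 3 \<Longrightarrow> mpow I (ad \<alpha>) k t (Inl (- \<alpha>)) = 0"
proof -
  have 1: "mpow I (ad \<alpha>) 1 t (Inl (- \<alpha>)) = (case t of Inr \<gamma> \<Rightarrow> hcoef Bas \<alpha> \<gamma> | Inl _ \<Rightarrow> 0)" for t
    unfolding One_nat_def mpow_Suc mpow_0 mmul_idm_right[OF finite_I msupp_ad] by (rule ad_neg[OF assms])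
  then show "mpow I (ad \<alpha>) 1 t (Inl (- \<alpha>)) = (case t of Inr \<gamma> \<Rightarrow> hcoef Bas \<alpha> \<gamma> | Inl _ \<Rightarrow> 0)" .
  have c: "cartan \<alpha> \<alpha> = 2" using root_inner_pos[OF assms] by (simp add: cartan_def)
  have 2: "mpow I (ad \<alpha>) 2 t (Inl (- \<alpha>)) = (if t = Inl \<alpha> then -2 else 0)" for t
  proof -
    have "mpow I (ad \<alpha>) 2 t (Inl (- \<alpha>)) = (\<Sum>m\<in>I. ad \<alpha> t m * mpow I (ad \<alpha>) 1 m (Inl (- \<alpha>)))"
      by (simp add: numeral_2_eq_2 mpow_Suc mmul_def)
    also have "\<dots> = (\<Sum>\<gamma>\<in>Bas. ad \<alpha> t (Inr \<gamma>) * hcoef Bas \<alpha> \<gamma>)" unfolding 1 sum_I by simp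
    also have "\<dots> = (if t = Inl \<alpha> then - (\<Sum>\<gamma>\<in>Bas. hcoef Bas \<alpha> \<gamma> * cartan \<alpha> \<gamma>) else 0)"
      by (simp add: ad_Inr assms sum_negf mult.commute)
    also have "\<dots> = (if t = Inl \<alpha> then -2 else 0)" by (simp add: sum_hcoef_cartan assms c)
    finally show ?thesis .
  qed
  then show "mpow I (ad \<alpha>) 2 t (Inl (- \<alpha>)) = (if t = Inl \<alpha> then -2 else 0)" .
  have 3: "mpow I (ad \<alpha>) (3 + l) t (Inl (- \<alpha>)) = 0" for l t
  proof (induction l arbitrary: t)
    case 0
    have "mpow I (ad \<alpha>) 3 t (Inl (- \<alpha>)) = (\<Sum>m\<in>I. ad \<alpha> t m * mpow I (ad \<alpha>) 2 m (Inl (- \<alpha>)))"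
      by (simp add: numeral_3_eq_3 numeral_2_eq_2 mpow_Suc mmul_def)
    also have "\<dots> = 0" unfolding 2 by (intro sum.neutral) (auto simp: ad_self[OF assms])
    finally show ?case by simp
  next
    case (Suc l) then show ?case unfolding add_Suc_right mpow_Suc mmul_def by simp
  qed
  assume "k \<ge> 3" then show "mpow I (ad \<alpha>) k t (Inl (- \<alpha>)) = 0" using 3[of "k - 3" t] by simp
qed

lemma mpow_ad_Inr_column:
  assumes "\<alpha> \<in> \<Phi>" "\<delta> \<in> Bas"
  shows "mpow I (ad \<alpha>) 1 t (Inr \<delta>) = (if t = Inl \<alpha> then - cartan \<alpha> \<delta> else 0)"
    and "k \<ge> 2 \<Longrightarrow> mpow I (ad \<alpha>) k t (Inr \<delta>) = 0"
proof -
  have 1: "mpow I (ad \<alpha>) 1 t (Inr \<delta>) = (if t = Inl \<alpha> then - cartan \<alpha> \<delta> else 0)" for t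
    unfolding One_nat_def mpow_Suc mpow_0 mmul_idm_right[OF finite_I msupp_ad] by (rule ad_Inr[OF assms])
  then show "mpow I (ad \<alpha>) 1 t (Inr \<delta>) = (if t = Inl \<alpha> then - cartan \<alpha> \<delta> else 0)" .
  have 2: "mpow I (ad \<alpha>) (2 + l) t (Inr \<delta>) = 0" for l t
  proof (induction l arbitrary: t)
    case 0
    have "mpow I (ad \<alpha>) 2 t (Inr \<delta>) = (\<Sum>m\<in>I. ad \<alpha> t m * mpow I (ad \<alpha>) 1 m (Inr \<delta>))"
      by (simp add: numeral_2_eq_2 mpow_Suc mmul_def)
    also have "\<dots> = 0" unfolding 1 by (intro sum.neutral) (auto simp: ad_self[OF assms(1)])
    finally show ?case by simp
  next
    case (Suc l) then show ?case unfolding add_Suc_right mpow_Suc mmul_def by simp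
  qed
  assume "k \<ge> 2" then show "mpow I (ad \<alpha>) k t (Inr \<delta>) = 0" using 2[of "k - 2" t] by (metis le_add_diff_inverse)
qed

text \<open>In \<open>xr\<close> the powers are divided with \<open>div\<close> on integers;
  exactness of this division makes \<open>xr\<close> a true exponential. Columns of the elements
  \<open>h_\<delta>\<close> vanish from the second power on, the string through
  \<open>- \<alpha>\<close> ends with the factor \<open>-2\<close>, and all other columns carry the
  factorial explicitly.\<close>

lemma fact_dvd_mpow_ad:
  assumes "\<alpha> \<in> \<Phi>" shows "fact k dvd mpow I (ad \<alpha>) k i j"
proof (cases "k \<le> 1 \<or> j \<notin> I")
  case True
  then show ?thesis using msupp_mpow[OF msupp_ad, of \<alpha> k] by (metis dvd_0_right fact_0 fact_1 le_SucE le_zero_eq msupp_def one_dvd One_nat_def)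
next
  case False
  show ?thesis
  proof (cases j)
    case (Inr \<delta>)
    then show ?thesis using False mpow_ad_Inr_column(2)[OF assms] by (simp add: Inr_I)
  next
    case (Inl \<beta>)
    then have b: "\<beta> \<in> \<Phi>" using False by (simp add: Inl_I)
    show ?thesis
    proof (cases "\<beta> = - \<alpha>")
      case True
      then show ?thesis using mpow_ad_neg_column(2,3)[OF assms] Inl False
        by (cases "k = 2") (auto simp: numeral_2_eq_2 fact_2)
    next
      case F: False
      then obtain \<epsilon> where "mpow I (ad \<alpha>) k i j = (if i = Inl (\<beta> + of_nat k *\<^sub>R \<alpha>) then \<epsilon> * (fact k * int ((string_p \<Phi> \<alpha> \<beta> + k) choose k)) else 0)"
        using mpow_ad_root_column[OF assms b F, of k] Inl by blast
      then show ?thesis by auto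
    qed
  qed
qed

definition dp :: "nat \<Rightarrow> 'a \<Rightarrow> 'a idx \<Rightarrow> 'a idx \<Rightarrow> int" where
  "dp k \<alpha> = (\<lambda>i j. mpow I (ad \<alpha>) k i j div fact k)"

lemma fact_dp: "\<alpha> \<in> \<Phi> \<Longrightarrow> fact k * dp k \<alpha> i j = mpow I (ad \<alpha>) k i j"
  using fact_dvd_mpow_ad[of \<alpha> k i j] by (simp add: dp_def)

lemma dp_supp: "\<alpha> \<in> \<Phi> \<Longrightarrow> dp k \<alpha> i j \<noteq> 0 \<Longrightarrow> i \<in> I \<and> j \<in> I \<and> wt i = wt j + of_nat k *\<^sub>R \<alpha>"
  using mpow_ad_supp[of \<alpha> k i j] fact_dp[of \<alpha> k i j] by (metis mult_zero_right mult_eq_0_iff fact_nonzero)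

lemma dp_zero: "\<alpha> \<in> \<Phi> \<Longrightarrow> k > card I \<Longrightarrow> dp k \<alpha> i j = 0"
  by (simp add: dp_def mpow_ad_zero)

lemma dp_0: "dp 0 \<alpha> = idm I"
  by (simp add: dp_def mpow_0)

lemma dp_1: "dp 1 \<alpha> = ad \<alpha>"
  by (simp add: dp_def mpow_Suc mpow_0 mmul_idm_right[OF finite_I msupp_ad])

lemma mpow_ad_add: "mpow I (ad \<alpha>) (k + l) = mpow I (ad \<alpha>) k \<otimes> mpow I (ad \<alpha>) l"
  by (induction k) (simp_all add: mpow_0 mpow_Suc mmul_idm_left[OF finite_I msupp_mpow[OF msupp_ad]] mmul_assoc)

lemma mmul_scale: "mmul J (\<lambda>i j. c * A i j) (\<lambda>i j. d * B i j) i j = (c * d) * mmul J A B i (j::'i)" for c d :: int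
  by (simp add: mmul_def sum_distrib_left algebra_simps)

lemma dp_mult: 
  assumes "\<alpha> \<in> \<Phi>" shows "(dp k \<alpha> \<otimes> dp l \<alpha>) i j = int ((k + l) choose k) * dp (k + l) \<alpha> i j"
proof -
  have "(fact k * fact l) * (dp k \<alpha> \<otimes> dp l \<alpha>) i j = mpow I (ad \<alpha>) (k + l) i j"
    unfolding mpow_ad_add mmul_scale[symmetric] fact_dp[OF assms] ..
  also have "\<dots> = fact (k + l) * dp (k + l) \<alpha> i j" using fact_dp[OF assms] by simp
  also have "(fact (k + l) :: int) = (fact k * fact l) * int ((k + l) choose k)"
    using binomial_fact_lemma[of k "k + l"] by (metis add_diff_cancel_left' le_add1 of_nat_fact of_nat_mult)
  finally show ?thesis by simp
qed

end

section \<open>Exponentials as automorphisms\<close>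

context chevalley
begin

text \<open>The Jacobi identity with two brackets turned around by antisymmetry:
  \<open>ad e_\<alpha>\<close> is a derivation.\<close>

lemma ad_der:
  assumes "\<alpha> \<in> \<Phi>" "x \<in> I" "y \<in> I" "t \<in> I"
  shows "(\<Sum>m\<in>I. ad \<alpha> t m * br x y m) = (\<Sum>p\<in>I. ad \<alpha> p x * br p y t) + (\<Sum>q\<in>I. ad \<alpha> q y * br x q t)"
proof -
  have a: "Inl \<alpha> \<in> I" using assms by (simp add: Inl_I)
  have "0 = (\<Sum>m\<in>I. br x y m * br (Inl \<alpha>) m t + br y (Inl \<alpha>) m * br x m t + br (Inl \<alpha>) x m * br y m t)"
    using br_jacobi[OF a assms(2,3), of t] by simp
  also have "\<dots> = (\<Sum>m\<in>I. ad \<alpha> t m * br x y m - ad \<alpha> m y * br x m t - ad \<alpha> m x * br m y t)"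
  proof (rule sum.cong[OF refl])
    fix m assume m: "m \<in> I"
    show "br x y m * br (Inl \<alpha>) m t + br y (Inl \<alpha>) m * br x m t + br (Inl \<alpha>) x m * br y m t =
       ad \<alpha> t m * br x y m - ad \<alpha> m y * br x m t - ad \<alpha> m x * br m y t"
      using br_anti[OF assms(3) a, of m] br_anti[OF assms(3) m, of t] by (simp add: ad_eq m assms)
  qed
  also have "\<dots> = (\<Sum>m\<in>I. ad \<alpha> t m * br x y m) - (\<Sum>m\<in>I. ad \<alpha> m y * br x m t) - (\<Sum>m\<in>I. ad \<alpha> m x * br m y t)"
    by (simp add: sum_subtractf)
  finally show ?thesis by simp
qed

lemma ad_commute:
  assumes "\<alpha> \<in> \<Phi>" "\<beta> \<in> \<Phi>" "\<alpha> + \<beta> \<notin> \<Phi>" "\<beta> \<noteq> - \<alpha>"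
  shows "ad \<alpha> \<otimes> ad \<beta> = ad \<beta> \<otimes> ad \<alpha>"
proof (intro ext)
  fix t y
  show "(ad \<alpha> \<otimes> ad \<beta>) t y = (ad \<beta> \<otimes> ad \<alpha>) t y"
  proof (cases "t \<in> I \<and> y \<in> I")
    case True
    have b: "Inl \<beta> \<in> I" using assms by (simp add: Inl_I)
    have "(ad \<alpha> \<otimes> ad \<beta>) t y = (\<Sum>m\<in>I. ad \<alpha> t m * br (Inl \<beta>) y m)"
      unfolding mmul_def using True by (intro sum.cong) (simp_all add: ad_eq)
    also have "\<dots> = (\<Sum>q\<in>I. ad \<alpha> q y * br (Inl \<beta>) q t)"
      using ad_der[OF assms(1) b, of y t] True ad_root[OF assms(1,2,4)] assms(3) by simp
    also have "\<dots> = (ad \<beta> \<otimes> ad \<alpha>) t y"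
      unfolding mmul_def using True by (intro sum.cong) (simp_all add: ad_eq)
    finally show ?thesis .
  next
    case False
    then show ?thesis using msupp_mmul[OF msupp_ad msupp_ad] unfolding msupp_def by metis
  qed
qed

text \<open>The coefficient at \<open>t\<close> of the bracket of \<open>A x\<close> with
  \<open>B y\<close>. Precomposition in either argument becomes matrix multiplication, by
  \<open>bb_left\<close> and \<open>bb_right\<close>.\<close>

definition bb :: "('a idx \<Rightarrow> 'a idx \<Rightarrow> int) \<Rightarrow> ('a idx \<Rightarrow> 'a idx \<Rightarrow> int) \<Rightarrow> 'a idx \<Rightarrow> 'a idx \<Rightarrow> 'a idx \<Rightarrow> int" where
  "bb A B x y t = (\<Sum>p\<in>I. \<Sum>q\<in>I. A p x * B q y * br p q t)"

lemma bb_left: "(\<Sum>p\<in>I. C p x * bb A B p y t) = bb (A \<otimes> C) B x y t"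
proof -
  have "(\<Sum>p\<in>I. C p x * bb A B p y t) = (\<Sum>p\<in>I. \<Sum>p'\<in>I. \<Sum>q\<in>I. C p x * (A p' p * B q y * br p' q t))"
    by (simp add: bb_def sum_distrib_left)
  also have "\<dots> = (\<Sum>p'\<in>I. \<Sum>p\<in>I. \<Sum>q\<in>I. C p x * (A p' p * B q y * br p' q t))" by (rule sum.swap)
  also have "\<dots> = (\<Sum>p'\<in>I. \<Sum>q\<in>I. \<Sum>p\<in>I. C p x * (A p' p * B q y * br p' q t))"
    by (intro sum.cong refl sum.swap)
  also have "\<dots> = bb (A \<otimes> C) B x y t"
    by (simp add: bb_def mmul_def sum_distrib_right sum_distrib_left algebra_simps)
  finally show ?thesis .
qed

lemma bb_right: "(\<Sum>p\<in>I. C p y * bb A B x p t) = bb A (B \<otimes> C) x y t"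
proof -
  have "(\<Sum>p\<in>I. C p y * bb A B x p t) = (\<Sum>p\<in>I. \<Sum>p'\<in>I. \<Sum>q\<in>I. C p y * (A p' x * B q p * br p' q t))"
    by (simp add: bb_def sum_distrib_left)
  also have "\<dots> = (\<Sum>p'\<in>I. \<Sum>p\<in>I. \<Sum>q\<in>I. C p y * (A p' x * B q p * br p' q t))" by (rule sum.swap)
  also have "\<dots> = (\<Sum>p'\<in>I. \<Sum>q\<in>I. \<Sum>p\<in>I. C p y * (A p' x * B q p * br p' q t))"
    by (intro sum.cong refl sum.swap)
  also have "\<dots> = bb A (B \<otimes> C) x y t"
    by (simp add: bb_def mmul_def sum_distrib_right sum_distrib_left algebra_simps)
  finally show ?thesis .
qed

lemma bb_idm_left: "x \<in> I \<Longrightarrow> bb (idm I) B x y t = (\<Sum>q\<in>I. B q y * br x q t)"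
proof -
  assume "x \<in> I"
  have "bb (idm I) B x y t = (\<Sum>p\<in>I. if p = x then (\<Sum>q\<in>I. B q y * br p q t) else 0)"
    unfolding bb_def by (intro sum.cong) (auto simp: idm_def)
  then show ?thesis using \<open>x \<in> I\<close> finite_I by simp
qed

lemma bb_idm_right: "y \<in> I \<Longrightarrow> bb A (idm I) x y t = (\<Sum>p\<in>I. A p x * br p y t)"
proof -
  assume "y \<in> I"
  have "bb A (idm I) x y t = (\<Sum>p\<in>I. \<Sum>q\<in>I. if q = y then A p x * br p q t else 0)"
    unfolding bb_def by (intro sum.cong) (auto simp: idm_def)
  then show ?thesis using \<open>y \<in> I\<close> finite_I by simp
qed

lemma bb_idm: "x \<in> I \<Longrightarrow> y \<in> I \<Longrightarrow> bb (idm I) (idm I) x y t = br x y t"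
proof -
  assume a: "x \<in> I" "y \<in> I"
  have "(\<Sum>q\<in>I. idm I q y * br x q t) = (\<Sum>q\<in>I. if q = y then br x q t else 0)"
    by (intro sum.cong) (auto simp: idm_def)
  then show ?thesis using a finite_I by (simp add: bb_idm_left)
qed

lemma bb_scale: "bb (\<lambda>i j. c * A i j) (\<lambda>i j. d * B i j) x y t = c * d * bb A B x y t"
  by (simp add: bb_def sum_distrib_left algebra_simps)

lemma dp_Suc_right: "\<alpha> \<in> \<Phi> \<Longrightarrow> dp k \<alpha> \<otimes> ad \<alpha> = (\<lambda>i j. int (Suc k) * dp (Suc k) \<alpha> i j)"
  using dp_mult[of \<alpha> k 1] by (intro ext) (simp only: dp_1 Suc_eq_plus1[symmetric] binomial_Suc_n)

text \<open>Division is avoided by multiplying the claim for \<open>Suc k\<close> by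
  \<open>Suc k\<close>: then \<open>dp (Suc k) \<alpha>\<close> may be replaced by
  \<open>dp k \<alpha> \<otimes> ad \<alpha>\<close>, the derivation rule handles the right factor
  and the induction hypothesis the left one.\<close>

lemma leibniz:
  assumes "\<alpha> \<in> \<Phi>" "x \<in> I" "y \<in> I" "t \<in> I"
  shows "(\<Sum>m\<in>I. dp k \<alpha> t m * br x y m) = (\<Sum>l\<le>k. bb (dp l \<alpha>) (dp (k - l) \<alpha>) x y t)"
  using assms(2,3)
proof (induction k arbitrary: x y)
  case 0
  have "(\<Sum>m\<in>I. idm I t m * br x y m) = (\<Sum>m\<in>I. if m = t then br x y m else 0)"
    by (intro sum.cong) (auto simp: idm_def)
  then show ?case using 0 assms(4) finite_I by (simp add: dp_0 bb_idm)
next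
  case (Suc k)
  let ?T = "\<lambda>l r. bb (dp l \<alpha>) (dp r \<alpha>) x y t"
  have bl: "(\<Sum>p\<in>I. ad \<alpha> p x * bb (dp l \<alpha>) (dp r \<alpha>) p y t) = int (Suc l) * ?T (Suc l) r" for l r
    unfolding bb_left dp_Suc_right[OF assms(1)] using bb_scale[of "int (Suc l)" _ 1] by simp
  have brr: "(\<Sum>p\<in>I. ad \<alpha> p y * bb (dp l \<alpha>) (dp r \<alpha>) x p t) = int (Suc r) * ?T l (Suc r)" for l r
    unfolding bb_right dp_Suc_right[OF assms(1)] using bb_scale[of 1 _ "int (Suc r)"] by simp
  have "int (Suc k) * (\<Sum>m\<in>I. dp (Suc k) \<alpha> t m * br x y m) = (\<Sum>m\<in>I. (dp k \<alpha> \<otimes> ad \<alpha>) t m * br x y m)"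
    by (simp add: dp_Suc_right[OF assms(1)] sum_distrib_left mult.assoc)
  also have "\<dots> = (\<Sum>m\<in>I. \<Sum>n\<in>I. dp k \<alpha> t n * (ad \<alpha> n m * br x y m))"
    by (simp add: mmul_def sum_distrib_right mult.assoc)
  also have "\<dots> = (\<Sum>n\<in>I. dp k \<alpha> t n * (\<Sum>m\<in>I. ad \<alpha> n m * br x y m))"
    by (subst sum.swap) (simp add: sum_distrib_left)
  also have "\<dots> = (\<Sum>n\<in>I. dp k \<alpha> t n * ((\<Sum>p\<in>I. ad \<alpha> p x * br p y n) + (\<Sum>q\<in>I. ad \<alpha> q y * br x q n)))"
    using ad_der[OF assms(1) Suc.prems] by (intro sum.cong) auto
  also have "\<dots> = (\<Sum>n\<in>I. \<Sum>p\<in>I. dp k \<alpha> t n * (ad \<alpha> p x * br p y n)) + (\<Sum>n\<in>I. \<Sum>q\<in>I. dp k \<alpha> t n * (ad \<alpha> q y * br x q n))"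
    by (simp add: distrib_left sum.distrib sum_distrib_left)
  also have "(\<Sum>n\<in>I. \<Sum>p\<in>I. dp k \<alpha> t n * (ad \<alpha> p x * br p y n)) = (\<Sum>p\<in>I. ad \<alpha> p x * (\<Sum>n\<in>I. dp k \<alpha> t n * br p y n))"
    by (subst sum.swap) (simp add: sum_distrib_left algebra_simps)
  also have "\<dots> = (\<Sum>p\<in>I. ad \<alpha> p x * (\<Sum>l\<le>k. bb (dp l \<alpha>) (dp (k - l) \<alpha>) p y t))"
    using Suc by (intro sum.cong) auto
  also have "\<dots> = (\<Sum>l\<le>k. \<Sum>p\<in>I. ad \<alpha> p x * bb (dp l \<alpha>) (dp (k - l) \<alpha>) p y t)"
    by (subst sum.swap) (simp add: sum_distrib_left)
  also have "\<dots> = (\<Sum>l\<le>k. int (Suc l) * ?T (Suc l) (k - l))" unfolding bl ..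
  also have "(\<Sum>n\<in>I. \<Sum>q\<in>I. dp k \<alpha> t n * (ad \<alpha> q y * br x q n)) = (\<Sum>p\<in>I. ad \<alpha> p y * (\<Sum>n\<in>I. dp k \<alpha> t n * br x p n))"
    by (subst sum.swap) (simp add: sum_distrib_left algebra_simps)
  also have "\<dots> = (\<Sum>p\<in>I. ad \<alpha> p y * (\<Sum>l\<le>k. bb (dp l \<alpha>) (dp (k - l) \<alpha>) x p t))"
    using Suc by (intro sum.cong) auto
  also have "\<dots> = (\<Sum>l\<le>k. \<Sum>p\<in>I. ad \<alpha> p y * bb (dp l \<alpha>) (dp (k - l) \<alpha>) x p t)"
    by (subst sum.swap) (simp add: sum_distrib_left)
  also have "\<dots> = (\<Sum>l\<le>k. int (Suc (k - l)) * ?T l (Suc (k - l)))" unfolding brr ..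
  also have "(\<Sum>l\<le>k. int (Suc l) * ?T (Suc l) (k - l)) = (\<Sum>j\<le>Suc k. int j * ?T j (Suc k - j))"
    by (subst sum.atMost_Suc_shift) simp
  also have "(\<Sum>l\<le>k. int (Suc (k - l)) * ?T l (Suc (k - l))) = (\<Sum>j\<le>Suc k. int (Suc k - j) * ?T j (Suc k - j))"
    by (simp add: Suc_diff_le of_nat_diff algebra_simps)
  \<comment> \<open>Raising the first or the second divided power contributes \<open>j\<close> and
    \<open>Suc k - j\<close>, together the factor \<open>Suc k\<close> that is cancelled at the
    end.\<close>
  also have "(\<Sum>j\<le>Suc k. int j * ?T j (Suc k - j)) + (\<Sum>j\<le>Suc k. int (Suc k - j) * ?T j (Suc k - j))
      = (\<Sum>j\<le>Suc k. int (Suc k) * ?T j (Suc k - j))"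
    unfolding sum.distrib[symmetric] by (intro sum.cong refl) (simp add: distrib_right[symmetric] of_nat_diff)
  also have "\<dots> = int (Suc k) * (\<Sum>j\<le>Suc k. ?T j (Suc k - j))" by (simp only: sum_distrib_left)
  finally show ?case by simp
qed

text \<open>\<open>xr\<close> over an arbitrary commutative ring. The instance over
  \<open>int\<close> carries the structural arguments, and \<open>zmat\<close> maps it to the
  field.\<close>

definition xz :: "'a \<Rightarrow> 'r::comm_ring_1 \<Rightarrow> 'a idx \<Rightarrow> 'a idx \<Rightarrow> 'r" where
  "xz \<alpha> a = (\<lambda>i j. \<Sum>k\<le>card I. of_int (dp k \<alpha> i j) * a ^ k)"

lemma xr_eq_xz: "xr \<Phi> Bas N \<alpha> a = xz \<alpha> a"
  by (simp add: xr_def xz_def dp_def)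

lemma xz_extend: "\<alpha> \<in> \<Phi> \<Longrightarrow> n \<ge> card I \<Longrightarrow> xz \<alpha> a i j = (\<Sum>k\<le>n. of_int (dp k \<alpha> i j) * a ^ k)"
  unfolding xz_def by (intro sum.mono_neutral_left) (auto simp: dp_zero)

lemma xz_supp: "\<alpha> \<in> \<Phi> \<Longrightarrow> xz \<alpha> a i j \<noteq> 0 \<Longrightarrow> i \<in> I \<and> j \<in> I \<and> (\<exists>k::nat. wt i = wt j + of_nat k *\<^sub>R \<alpha>)"
proof -
  assume a: "\<alpha> \<in> \<Phi>" "xz \<alpha> a i j \<noteq> 0"
  then obtain k where "of_int (dp k \<alpha> i j) * a ^ k \<noteq> 0" unfolding xz_def by (metis (no_types, lifting) sum.neutral)
  then have "dp k \<alpha> i j \<noteq> 0" by auto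
  then show ?thesis using dp_supp[OF a(1)] by blast
qed

lemma msupp_xz: "\<alpha> \<in> \<Phi> \<Longrightarrow> msupp I (xz \<alpha> a)"
  using xz_supp by (fastforce simp: msupp_def)

text \<open>As \<open>\<alpha> \<noteq> 0\<close>, the weight shift determines the exponent, so each
  entry is a monomial in the parameter. Conjugation by the torus and the rescaling of integral
  identities rest on this homogeneity.\<close>

lemma xz_entry: "\<alpha> \<in> \<Phi> \<Longrightarrow> wt i = wt j + of_nat k *\<^sub>R \<alpha> \<Longrightarrow> xz \<alpha> a i j = of_int (dp k \<alpha> i j) * a ^ k"
proof -
  assume a: "\<alpha> \<in> \<Phi>" "wt i = wt j + of_nat k *\<^sub>R \<alpha>"
  then have a0: "\<alpha> \<noteq> 0" using zero_not_root by auto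
  have z: "dp l \<alpha> i j = 0" if "l \<noteq> k" for l
    using dp_supp[OF a(1), of l i j] a(2) a0 that by auto
  have "xz \<alpha> a i j = (\<Sum>l\<le>card I + k. of_int (dp l \<alpha> i j) * a ^ l)" by (rule xz_extend[OF a(1)]) simp
  also have "\<dots> = (\<Sum>l\<le>card I + k. if l = k then of_int (dp k \<alpha> i j) * a ^ k else 0)"
    by (intro sum.cong) (auto simp: z)
  finally show ?thesis by simp
qed

lemma xz_diag: "\<alpha> \<in> \<Phi> \<Longrightarrow> wt i = wt j \<Longrightarrow> xz \<alpha> a i j = idm I i j"
  using xz_entry[of \<alpha> i j 0 a] by (auto simp: dp_0 idm_def)

lemma xz_0: "\<alpha> \<in> \<Phi> \<Longrightarrow> xz \<alpha> (0::'r::comm_ring_1) = idm I"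
proof (intro ext)
  fix i j assume "\<alpha> \<in> \<Phi>"
  have "xz \<alpha> (0::'r) i j = (\<Sum>k\<le>card I. if k = 0 then of_int (dp 0 \<alpha> i j) else 0)"
    unfolding xz_def by (intro sum.cong) (auto simp: power_0_left)
  then show "xz \<alpha> (0::'r) i j = idm I i j" by (auto simp: dp_0 idm_def)
qed

text \<open>The binomial coefficients from multiplying divided powers are those of the binomial
  theorem, so the law holds over every commutative ring.\<close>

lemma xz_add: assumes "\<alpha> \<in> \<Phi>" shows "xz \<alpha> a \<otimes> xz \<alpha> b = xz \<alpha> (a + b)"
proof (intro ext)
  fix i j
  let ?K = "card I"
  let ?f = "\<lambda>k l. of_int (int ((k + l) choose k) * dp (k + l) \<alpha> i j) * (a ^ k * b ^ l)"
  have "(xz \<alpha> a \<otimes> xz \<alpha> b) i j = (\<Sum>m\<in>I. \<Sum>k\<le>?K. \<Sum>l\<le>?K. of_int (dp k \<alpha> i m * dp l \<alpha> m j) * (a ^ k * b ^ l))"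
    by (simp add: mmul_def xz_def sum_product algebra_simps)
  also have "\<dots> = (\<Sum>k\<le>?K. \<Sum>l\<le>?K. \<Sum>m\<in>I. of_int (dp k \<alpha> i m * dp l \<alpha> m j) * (a ^ k * b ^ l))"
    by (subst sum.swap) (intro sum.cong refl sum.swap)
  also have "\<dots> = (\<Sum>k\<le>?K. \<Sum>l\<le>?K. ?f k l)"
    unfolding dp_mult[OF assms, symmetric] mmul_def of_int_sum sum_distrib_right ..
  also have "\<dots> = (\<Sum>n\<le>2*?K. \<Sum>k\<le>n. ?f k (n - k))"
    by (rule trunc_cauchy) (use dp_zero[OF assms] in \<open>auto simp: trans_less_add1 trans_less_add2\<close>)
  also have "\<dots> = (\<Sum>n\<le>2*?K. of_int (dp n \<alpha> i j) * (a + b) ^ n)"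
    by (intro sum.cong refl) (simp add: binomial_ring sum_distrib_left algebra_simps)
  also have "\<dots> = xz \<alpha> (a + b) i j" by (rule xz_extend[OF assms, symmetric]) simp
  finally show "(xz \<alpha> a \<otimes> xz \<alpha> b) i j = xz \<alpha> (a + b) i j" .
qed

lemma xz_inverse: "\<alpha> \<in> \<Phi> \<Longrightarrow> xz \<alpha> a \<otimes> xz \<alpha> (- a) = idm I" "\<alpha> \<in> \<Phi> \<Longrightarrow> xz \<alpha> (- a) \<otimes> xz \<alpha> a = idm I"
  by (simp_all add: xz_add xz_0)

lemma zmat_xz: "zmat (xz \<alpha> c) = xz \<alpha> (of_int c)"
  by (simp add: zmat_def xz_def)

section \<open>Automorphisms of the Lie ring and conjugation of root elements\<close>

definition aut :: "('a idx \<Rightarrow> 'a idx \<Rightarrow> int) \<Rightarrow> bool" where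
  "aut M \<longleftrightarrow> (\<forall>x\<in>I. \<forall>y\<in>I. \<forall>t\<in>I. (\<Sum>m\<in>I. M t m * br x y m) = bb M M x y t)"

lemma aut_mmul: assumes "aut A" "aut B" shows "aut (A \<otimes> B)"
  unfolding aut_def
proof (intro ballI)
  fix x y t assume i: "x \<in> I" "y \<in> I" "t \<in> I"
  have "(\<Sum>m\<in>I. (A \<otimes> B) t m * br x y m) = (\<Sum>m\<in>I. \<Sum>n\<in>I. A t n * (B n m * br x y m))"
    by (simp add: mmul_def sum_distrib_right mult.assoc)
  also have "\<dots> = (\<Sum>n\<in>I. A t n * (\<Sum>m\<in>I. B n m * br x y m))"
    by (subst sum.swap) (simp add: sum_distrib_left)
  also have "\<dots> = (\<Sum>n\<in>I. A t n * bb B B x y n)"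
    using assms(2) i by (intro sum.cong) (auto simp: aut_def)
  also have "\<dots> = (\<Sum>n\<in>I. \<Sum>p\<in>I. \<Sum>q\<in>I. B p x * (B q y * (A t n * br p q n)))"
    by (simp add: bb_def sum_distrib_left algebra_simps)
  also have "\<dots> = (\<Sum>p\<in>I. \<Sum>n\<in>I. \<Sum>q\<in>I. B p x * (B q y * (A t n * br p q n)))" by (rule sum.swap)
  also have "\<dots> = (\<Sum>p\<in>I. \<Sum>q\<in>I. \<Sum>n\<in>I. B p x * (B q y * (A t n * br p q n)))"
    by (intro sum.cong refl sum.swap)
  also have "\<dots> = (\<Sum>p\<in>I. B p x * (\<Sum>q\<in>I. B q y * (\<Sum>n\<in>I. A t n * br p q n)))"
    by (simp add: sum_distrib_left)
  also have "\<dots> = (\<Sum>p\<in>I. B p x * (\<Sum>q\<in>I. B q y * bb A A p q t))"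
    using assms(1) i by (intro sum.cong) (auto simp: aut_def)
  also have "\<dots> = bb (A \<otimes> B) (A \<otimes> B) x y t" by (simp add: bb_right bb_left)
  finally show "(\<Sum>m\<in>I. (A \<otimes> B) t m * br x y m) = bb (A \<otimes> B) (A \<otimes> B) x y t" .
qed

text \<open>The Leibniz rule for divided powers, summed over all degrees;
  \<open>trunc_cauchy\<close> turns the sum by total degree into a product of two truncated
  exponentials.\<close>

lemma aut_xz: assumes "\<alpha> \<in> \<Phi>" shows "aut (xz \<alpha> c)"
  unfolding aut_def
proof (intro ballI)
  fix x y t assume i: "x \<in> I" "y \<in> I" "t \<in> I"
  let ?K = "card I"
  let ?f = "\<lambda>k l. c ^ (k + l) * bb (dp k \<alpha>) (dp l \<alpha>) x y t"
  have "(\<Sum>m\<in>I. xz \<alpha> c t m * br x y m) = (\<Sum>m\<in>I. (\<Sum>n\<le>2*?K. dp n \<alpha> t m * c ^ n) * br x y m)"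
    using xz_extend[OF assms, of "2*?K" c] by simp
  also have "\<dots> = (\<Sum>n\<le>2*?K. c ^ n * (\<Sum>m\<in>I. dp n \<alpha> t m * br x y m))"
    unfolding sum_distrib_left sum_distrib_right by (subst sum.swap) (simp add: algebra_simps)
  also have "\<dots> = (\<Sum>n\<le>2*?K. \<Sum>k\<le>n. ?f k (n - k))"
    unfolding leibniz[OF assms i] sum_distrib_left by simp
  also have "\<dots> = (\<Sum>k\<le>?K. \<Sum>l\<le>?K. ?f k l)"
    by (rule trunc_cauchy[symmetric]) (auto simp: bb_def dp_zero[OF assms])
  also have "\<dots> = (\<Sum>k\<le>?K. \<Sum>l\<le>?K. \<Sum>p\<in>I. \<Sum>q\<in>I. (dp k \<alpha> p x * c ^ k) * (dp l \<alpha> q y * c ^ l) * br p q t)"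
    by (simp add: bb_def sum_distrib_left power_add algebra_simps)
  also have "\<dots> = (\<Sum>k\<le>?K. \<Sum>p\<in>I. \<Sum>l\<le>?K. \<Sum>q\<in>I. (dp k \<alpha> p x * c ^ k) * (dp l \<alpha> q y * c ^ l) * br p q t)"
    by (intro sum.cong refl sum.swap)
  also have "\<dots> = (\<Sum>p\<in>I. \<Sum>k\<le>?K. \<Sum>l\<le>?K. \<Sum>q\<in>I. (dp k \<alpha> p x * c ^ k) * (dp l \<alpha> q y * c ^ l) * br p q t)"
    by (rule sum.swap)
  also have "\<dots> = (\<Sum>p\<in>I. \<Sum>k\<le>?K. \<Sum>q\<in>I. \<Sum>l\<le>?K. (dp k \<alpha> p x * c ^ k) * (dp l \<alpha> q y * c ^ l) * br p q t)"
    by (intro sum.cong refl sum.swap)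
  also have "\<dots> = (\<Sum>p\<in>I. \<Sum>q\<in>I. \<Sum>k\<le>?K. \<Sum>l\<le>?K. (dp k \<alpha> p x * c ^ k) * (dp l \<alpha> q y * c ^ l) * br p q t)"
    by (intro sum.cong refl sum.swap)
  also have "\<dots> = bb (xz \<alpha> c) (xz \<alpha> c) x y t"
    unfolding bb_def xz_def
    by (simp add: sum_distrib_left sum_distrib_right mult.assoc) (rule sum.cong[OF refl], rule sum.cong[OF refl], rule sum.swap)
  finally show "(\<Sum>m\<in>I. xz \<alpha> c t m * br x y m) = bb (xz \<alpha> c) (xz \<alpha> c) x y t" .
qed

text \<open>An automorphism satisfies \<open>n [e_\<beta>, y] = [n e_\<beta>, n y]\<close>, and the
  assumption on the column says that \<open>n e_\<beta>\<close> is \<open>\<epsilon>\<close> times a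
  root vector.\<close>

lemma conj_ad:
  assumes "aut n" "msupp I n" "\<beta> \<in> \<Phi>" "\<beta>' \<in> \<Phi>"
    and col: "\<And>t. n t (Inl \<beta>) = (if t = Inl \<beta>' then \<epsilon> else 0)"
  shows "n \<otimes> ad \<beta> = (\<lambda>i j. \<epsilon> * (ad \<beta>' \<otimes> n) i j)"
proof (intro ext)
  fix t y
  show "(n \<otimes> ad \<beta>) t y = \<epsilon> * (ad \<beta>' \<otimes> n) t y"
  proof (cases "t \<in> I \<and> y \<in> I")
    case True
    have b: "Inl \<beta> \<in> I" "Inl \<beta>' \<in> I" using assms by (simp_all add: Inl_I)
    have "(n \<otimes> ad \<beta>) t y = (\<Sum>m\<in>I. n t m * br (Inl \<beta>) y m)"
      unfolding mmul_def using True by (intro sum.cong) (simp_all add: ad_eq)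
    also have "\<dots> = bb n n (Inl \<beta>) y t" using assms(1) b True unfolding aut_def by blast
    also have "\<dots> = (\<Sum>p\<in>I. if p = Inl \<beta>' then (\<Sum>q\<in>I. \<epsilon> * n q y * br p q t) else 0)"
      unfolding bb_def col by (intro sum.cong) auto
    also have "\<dots> = (\<Sum>q\<in>I. \<epsilon> * n q y * br (Inl \<beta>') q t)" using b finite_I by simp
    also have "\<dots> = \<epsilon> * (ad \<beta>' \<otimes> n) t y"
      unfolding mmul_def sum_distrib_left using True by (intro sum.cong) (simp_all add: ad_eq)
    finally show ?thesis .
  next
    case False
    then show ?thesis using msupp_mmul[OF assms(2) msupp_ad] msupp_mmul[OF msupp_ad assms(2)] unfolding msupp_def
      by (metis mult_zero_right)
  qed
qed

lemma conj_dp: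
  assumes "aut n" "msupp I n" "\<beta> \<in> \<Phi>" "\<beta>' \<in> \<Phi>"
    and col: "\<And>t. n t (Inl \<beta>) = (if t = Inl \<beta>' then \<epsilon> else 0)"
  shows "(n \<otimes> dp k \<beta>) i j = \<epsilon> ^ k * (dp k \<beta>' \<otimes> n) i j"
proof -
  have m: "n \<otimes> mpow I (ad \<beta>) k = (\<lambda>i j. \<epsilon> ^ k * (mpow I (ad \<beta>') k \<otimes> n) i j)"
  proof (induction k)
    case 0
    then show ?case by (simp add: mpow_0 mmul_idm_left[OF finite_I assms(2)] mmul_idm_right[OF finite_I assms(2)])
  next
    case (Suc k)
    have "n \<otimes> mpow I (ad \<beta>) (Suc k) = (n \<otimes> ad \<beta>) \<otimes> mpow I (ad \<beta>) k" by (simp add: mpow_Suc mmul_assoc)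
    also have "\<dots> = (\<lambda>i j. \<epsilon> * (ad \<beta>' \<otimes> (n \<otimes> mpow I (ad \<beta>) k)) i j)"
      unfolding conj_ad[OF assms] mmul_assoc[symmetric] by (simp add: mmul_def sum_distrib_left[symmetric] mult.assoc)
    also have "\<dots> = (\<lambda>i j. \<epsilon> * (\<epsilon> ^ k * (ad \<beta>' \<otimes> (mpow I (ad \<beta>') k \<otimes> n)) i j))"
      unfolding Suc.IH by (simp add: mmul_def sum_distrib_left algebra_simps)
    also have "\<dots> = (\<lambda>i j. \<epsilon> ^ Suc k * (mpow I (ad \<beta>') (Suc k) \<otimes> n) i j)"
      by (simp add: mpow_Suc mmul_assoc mult.assoc)
    finally show ?case .
  qed
  have "fact k * (n \<otimes> dp k \<beta>) i j = (n \<otimes> mpow I (ad \<beta>) k) i j"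
    unfolding mmul_def fact_dp[OF assms(3), symmetric] by (simp add: sum_distrib_left algebra_simps)
  also have "\<dots> = \<epsilon> ^ k * (mpow I (ad \<beta>') k \<otimes> n) i j" by (simp add: m)
  also have "\<dots> = fact k * (\<epsilon> ^ k * (dp k \<beta>' \<otimes> n) i j)"
    unfolding mmul_def fact_dp[OF assms(4), symmetric] by (simp add: sum_distrib_left algebra_simps)
  finally show ?thesis by simp
qed

text \<open>The relation for powers of \<open>ad\<close> holds over the integers, where
  \<open>fact k\<close> cancels; only then are the coefficients mapped to the ring. This settles
  conjugation by Weyl representatives over all fields at once.\<close>

lemma conj_xz:
  assumes "aut n" "msupp I n" "\<beta> \<in> \<Phi>" "\<beta>' \<in> \<Phi>"
    and col: "\<And>t. n t (Inl \<beta>) = (if t = Inl \<beta>' then \<epsilon> else 0)"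
  shows "zmat n \<otimes> xz \<beta> a = xz \<beta>' (of_int \<epsilon> * a) \<otimes> zmat n"
proof (intro ext)
  fix i j
  let ?K = "card I"
  have "(zmat n \<otimes> xz \<beta> a) i j = (\<Sum>m\<in>I. \<Sum>k\<le>?K. of_int (n i m * dp k \<beta> m j) * a ^ k)"
    by (simp add: mmul_def xz_def zmat_def sum_distrib_left algebra_simps)
  also have "\<dots> = (\<Sum>k\<le>?K. of_int ((n \<otimes> dp k \<beta>) i j) * a ^ k)"
    unfolding mmul_def of_int_sum sum_distrib_right by (rule sum.swap)
  also have "\<dots> = (\<Sum>k\<le>?K. \<Sum>m\<in>I. of_int (dp k \<beta>' i m * n m j) * (of_int \<epsilon> * a) ^ k)"
    unfolding conj_dp[OF assms] by (simp add: mmul_def sum_distrib_left sum_distrib_right power_mult_distrib algebra_simps)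
  also have "\<dots> = (xz \<beta>' (of_int \<epsilon> * a) \<otimes> zmat n) i j"
    by (subst sum.swap) (simp add: mmul_def xz_def zmat_def sum_distrib_right sum_distrib_left algebra_simps)
  finally show "(zmat n \<otimes> xz \<beta> a) i j = (xz \<beta>' (of_int \<epsilon> * a) \<otimes> zmat n) i j" .
qed

lemma xz_commute:
  assumes "\<alpha> \<in> \<Phi>" "\<beta> \<in> \<Phi>" "\<alpha> + \<beta> \<notin> \<Phi>" "\<beta> \<noteq> - \<alpha>"
  shows "xz \<alpha> a \<otimes> xz \<beta> b = xz \<beta> b \<otimes> xz \<alpha> a"
proof -
  have m: "mpow I (ad \<alpha>) k \<otimes> mpow I (ad \<beta>) l = mpow I (ad \<beta>) l \<otimes> mpow I (ad \<alpha>) k" for k l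
    using mpow_commute[OF finite_I msupp_ad msupp_mpow[OF msupp_ad] mpow_commute[OF finite_I msupp_ad msupp_ad ad_commute[OF assms, symmetric], symmetric]] .
  have d: "(dp k \<alpha> \<otimes> dp l \<beta>) i j = (dp l \<beta> \<otimes> dp k \<alpha>) i j" for k l i j
  proof -
    have "(fact k * fact l) * (dp k \<alpha> \<otimes> dp l \<beta>) i j = (mpow I (ad \<alpha>) k \<otimes> mpow I (ad \<beta>) l) i j"
      unfolding mmul_scale[symmetric] fact_dp[OF assms(1)] fact_dp[OF assms(2)] ..
    also have "\<dots> = (fact l * fact k) * (dp l \<beta> \<otimes> dp k \<alpha>) i j"
      unfolding m mmul_scale[symmetric] fact_dp[OF assms(1)] fact_dp[OF assms(2)] ..
    finally show ?thesis by simp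
  qed
  have e: "(xz \<gamma> u \<otimes> xz \<delta> v) i j = (\<Sum>k\<le>card I. \<Sum>l\<le>card I. of_int ((dp k \<gamma> \<otimes> dp l \<delta>) i j) * (u ^ k * v ^ l))"
    for \<gamma> \<delta> i j and u v :: 'b
  proof -
    have "(xz \<gamma> u \<otimes> xz \<delta> v) i j = (\<Sum>m\<in>I. \<Sum>k\<le>card I. \<Sum>l\<le>card I. of_int (dp k \<gamma> i m * dp l \<delta> m j) * (u ^ k * v ^ l))"
      by (simp add: mmul_def xz_def sum_product algebra_simps)
    also have "\<dots> = (\<Sum>k\<le>card I. \<Sum>l\<le>card I. \<Sum>m\<in>I. of_int (dp k \<gamma> i m * dp l \<delta> m j) * (u ^ k * v ^ l))"
      by (subst sum.swap) (intro sum.cong refl sum.swap)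
    finally show ?thesis unfolding mmul_def of_int_sum sum_distrib_right .
  qed
  show ?thesis
    by (intro ext, unfold e d, subst sum.swap) (simp add: mult.commute)
qed

end

section \<open>Representatives of reflections and inner derivations\<close>

context chevalley
begin

lemma cartan_self: "\<alpha> \<in> \<Phi> \<Longrightarrow> cartan \<alpha> \<alpha> = 2"
  using root_inner_pos[of \<alpha>] by (simp add: cartan_def)

lemma cartan_minus_left: "\<alpha> \<in> \<Phi> \<Longrightarrow> \<beta> \<in> \<Phi> \<Longrightarrow> cartan (- \<beta>) \<alpha> = - cartan \<beta> \<alpha>"
  using of_int_cartan[of \<alpha> \<beta>] of_int_cartan[of \<alpha> "- \<beta>"] root_minus[of \<beta>]
  by (metis inner_minus_left minus_divide_left mult_minus_right of_int_eq_iff of_int_minus)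

lemma card_I_ge: "\<alpha> \<in> \<Phi> \<Longrightarrow> card I \<ge> 2"
  using card_I[of \<alpha>] finite_roots by (metis One_nat_def Suc_1 Suc_le_mono card_gt_0_iff empty_iff less_eq_Suc_le order_trans)

lemma xz_three:
  assumes "\<alpha> \<in> \<Phi>" "\<And>k. k \<ge> 3 \<Longrightarrow> dp k \<alpha> i j = 0"
  shows "xz \<alpha> c i j = of_int (dp 0 \<alpha> i j) + of_int (dp 1 \<alpha> i j) * c + of_int (dp 2 \<alpha> i j) * c\<^sup>2"
proof -
  have "xz \<alpha> c i j = (\<Sum>k\<le>2. of_int (dp k \<alpha> i j) * c ^ k)"
    unfolding xz_def using card_I_ge[OF assms(1)] assms(2) by (intro sum.mono_neutral_right) auto
  then show ?thesis by (simp add: numeral_2_eq_2)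
qed

lemma xz_col_h:
  assumes "\<alpha> \<in> \<Phi>" "\<delta> \<in> Bas"
  shows "xz \<alpha> c t (Inr \<delta>) = (if t = Inr \<delta> then 1 else 0) - (if t = Inl \<alpha> then c * of_int (cartan \<alpha> \<delta>) else 0)"
proof -
  have "xz \<alpha> c t (Inr \<delta>) = of_int (dp 0 \<alpha> t (Inr \<delta>)) + of_int (dp 1 \<alpha> t (Inr \<delta>)) * c + of_int (dp 2 \<alpha> t (Inr \<delta>)) * c\<^sup>2"
    by (rule xz_three[OF assms(1)]) (simp add: dp_def mpow_ad_Inr_column(2)[OF assms])
  then show ?thesis using assms
    by (simp add: dp_def mpow_ad_Inr_column[OF assms] mpow_ad_Inr_column(1)[OF assms, unfolded One_nat_def] mpow_0 idm_def Inr_I)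
qed

lemma xz_col_self:
  assumes "\<alpha> \<in> \<Phi>"
  shows "xz \<alpha> c t (Inl \<alpha>) = (if t = Inl \<alpha> then 1 else 0)"
proof -
  have z: "dp k \<alpha> t (Inl \<alpha>) = 0" if "k \<ge> 1" for k
  proof -
    obtain l where l: "k = Suc l" using \<open>k \<ge> 1\<close> by (cases k) auto
    have "mpow I (ad \<alpha>) k t (Inl \<alpha>) = 0" unfolding l mpow_Suc2[OF finite_I msupp_ad] mmul_def
      by (simp add: ad_self[OF assms])
    then show ?thesis by (simp add: dp_def)
  qed
  have "xz \<alpha> c t (Inl \<alpha>) = of_int (dp 0 \<alpha> t (Inl \<alpha>)) + of_int (dp 1 \<alpha> t (Inl \<alpha>)) * c + of_int (dp 2 \<alpha> t (Inl \<alpha>)) * c\<^sup>2"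
    by (rule xz_three[OF assms(1)]) (simp add: z)
  then show ?thesis using assms by (simp add: z dp_0 idm_def Inl_I)
qed

lemma xz_col_neg:
  assumes "\<alpha> \<in> \<Phi>"
  shows "xz \<alpha> c t (Inl (- \<alpha>)) = (case t of Inl \<beta> \<Rightarrow> (if \<beta> = - \<alpha> then 1 else 0) - (if \<beta> = \<alpha> then c\<^sup>2 else 0)
     | Inr \<gamma> \<Rightarrow> c * of_int (hcoef Bas \<alpha> \<gamma>))"
proof -
  have "xz \<alpha> c t (Inl (- \<alpha>)) = of_int (dp 0 \<alpha> t (Inl (- \<alpha>))) + of_int (dp 1 \<alpha> t (Inl (- \<alpha>))) * c + of_int (dp 2 \<alpha> t (Inl (- \<alpha>))) * c\<^sup>2"
    by (rule xz_three[OF assms(1)]) (simp add: dp_def mpow_ad_neg_column(3)[OF assms])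
  then show ?thesis using assms
    by (simp add: dp_def mpow_ad_neg_column[OF assms] mpow_ad_neg_column(1)[OF assms, unfolded One_nat_def] mpow_0 idm_def Inl_I root_minus fact_2 split: sum.splits)
qed

text \<open>\<open>nr\<close> is the image of the case \<open>c = 1\<close>. The case
  \<open>c = -1\<close> gives the inverse matrix, again integral, which makes the relevant entries
  units of the integers.\<close>

definition zn :: "'a \<Rightarrow> int \<Rightarrow> 'a idx \<Rightarrow> 'a idx \<Rightarrow> int" where
  "zn \<alpha> c = xz \<alpha> c \<otimes> (xz (- \<alpha>) (- c) \<otimes> xz \<alpha> c)"

lemma msupp_zn: "\<alpha> \<in> \<Phi> \<Longrightarrow> msupp I (zn \<alpha> c)"
  unfolding zn_def using root_minus by (intro msupp_mmul msupp_xz)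

lemma aut_zn: "\<alpha> \<in> \<Phi> \<Longrightarrow> aut (zn \<alpha> c)"
  unfolding zn_def using root_minus by (intro aut_mmul aut_xz)

lemma zn_inverse: assumes "\<alpha> \<in> \<Phi>" shows "zn \<alpha> (- c) \<otimes> zn \<alpha> c = idm I"
proof -
  have m: "- \<alpha> \<in> \<Phi>" using assms root_minus by blast
  note s = msupp_xz[OF assms] msupp_xz[OF m]
  have "zn \<alpha> (- c) \<otimes> zn \<alpha> c = xz \<alpha> (- c) \<otimes> (xz (- \<alpha>) c \<otimes> ((xz \<alpha> (- c) \<otimes> xz \<alpha> c) \<otimes> (xz (- \<alpha>) (- c) \<otimes> xz \<alpha> c)))"
    by (simp add: zn_def mmul_assoc)
  also have "\<dots> = xz \<alpha> (- c) \<otimes> ((xz (- \<alpha>) c \<otimes> xz (- \<alpha>) (- c)) \<otimes> xz \<alpha> c)"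
    by (simp add: xz_inverse assms mmul_idm_left finite_I msupp_mmul s mmul_assoc)
  also have "\<dots> = idm I"
    by (simp add: xz_inverse assms m mmul_idm_left finite_I s)
  finally show ?thesis .
qed

text \<open>The one direct computation with the three factors: it exhibits the reflection on the
  span of the elements \<open>h_\<delta>\<close>. The action on root vectors is then deduced from
  the automorphism property.\<close>

lemma zn_col_h:
  assumes a: "\<alpha> \<in> \<Phi>" and d: "\<delta> \<in> Bas" and c2: "c\<^sup>2 = 1"
  shows "zn \<alpha> c t (Inr \<delta>) = (case t of Inl _ \<Rightarrow> 0 | Inr \<epsilon> \<Rightarrow> (if \<epsilon> = \<delta> then 1 else 0) - cartan \<alpha> \<delta> * hcoef Bas \<alpha> \<epsilon>)"
proof -
  have m: "- \<alpha> \<in> \<Phi>" using a root_minus by blast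
  let ?a = "cartan \<alpha> \<delta>"
  have ne: "\<alpha> \<noteq> - \<alpha>" "- \<alpha> \<noteq> \<alpha>" using neg_ne_self[OF a] by auto
  have ca: "cartan (- \<alpha>) \<delta> = - ?a" using cartan_minus_left[OF base_roots[OF d] a] .
  have s1: "(\<Sum>j\<in>I. f j * xz \<alpha> c j (Inr \<delta>)) = f (Inr \<delta>) - c * ?a * f (Inl \<alpha>)" for f :: "'a idx \<Rightarrow> int"
    using a d finite_roots finite_base
    by (simp add: sum_I xz_col_h[OF a d] if_distrib[of "\<lambda>x. _ * x"] sum_negf cong: if_cong)
  have y: "(xz (- \<alpha>) (- c) \<otimes> xz \<alpha> c) t (Inr \<delta>) =
     (if t = Inr \<delta> then 1 else 0) - (if t = Inl \<alpha> then c * ?a else 0) - (case t of Inl _ \<Rightarrow> 0 | Inr \<epsilon> \<Rightarrow> ?a * hcoef Bas \<alpha> \<epsilon>)" for t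
  proof -
    have "c * c = 1" using c2 by (simp add: power2_eq_square)
    then have cc: "c * (?a * (c * x)) = ?a * x" for x by (metis mult.assoc mult.commute mult_1)
    have cn: "xz (- \<alpha>) (- c) t (Inl \<alpha>) = (case t of Inl \<beta> \<Rightarrow> (if \<beta> = \<alpha> then 1 else 0) - (if \<beta> = - \<alpha> then 1 else 0)
        | Inr \<gamma> \<Rightarrow> c * hcoef Bas \<alpha> \<gamma>)" for t
      using xz_col_neg[OF m, of "- c" t] c2 by (simp add: hcoef_minus[OF a] split: sum.splits)
    have "(xz (- \<alpha>) (- c) \<otimes> xz \<alpha> c) t (Inr \<delta>) = xz (- \<alpha>) (- c) t (Inr \<delta>) - c * ?a * xz (- \<alpha>) (- c) t (Inl \<alpha>)"
      unfolding mmul_def by (rule s1)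
    also have "\<dots> = (if t = Inr \<delta> then 1 else 0) - (if t = Inl \<alpha> then c * ?a else 0) - (case t of Inl _ \<Rightarrow> 0 | Inr \<epsilon> \<Rightarrow> ?a * hcoef Bas \<alpha> \<epsilon>)"
      unfolding xz_col_h[OF m d] cn using ne by (cases t) (auto simp: ca cc mult.assoc)
    finally show ?thesis .
  qed
  have "zn \<alpha> c t (Inr \<delta>) = (\<Sum>j\<in>I. xz \<alpha> c t j * (xz (- \<alpha>) (- c) \<otimes> xz \<alpha> c) j (Inr \<delta>))"
    by (simp add: zn_def mmul_def)
  also have "\<dots> = xz \<alpha> c t (Inr \<delta>) - c * ?a * xz \<alpha> c t (Inl \<alpha>) - ?a * (\<Sum>\<epsilon>\<in>Bas. hcoef Bas \<alpha> \<epsilon> * xz \<alpha> c t (Inr \<epsilon>))"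
    unfolding y sum_I using a d finite_roots finite_base
    by (simp add: algebra_simps if_distrib[of "\<lambda>x. _ * x"] if_distrib[of "\<lambda>x. x * _"] sum_negf sum_subtractf sum_distrib_left cong: if_cong)
  also have "(\<Sum>\<epsilon>\<in>Bas. hcoef Bas \<alpha> \<epsilon> * xz \<alpha> c t (Inr \<epsilon>)) = (case t of Inl \<beta> \<Rightarrow> (if \<beta> = \<alpha> then - c * 2 else 0) | Inr \<epsilon> \<Rightarrow> hcoef Bas \<alpha> \<epsilon>)"
  proof (cases t)
    case (Inr \<epsilon>)
    have "(\<Sum>\<eta>\<in>Bas. hcoef Bas \<alpha> \<eta> * xz \<alpha> c t (Inr \<eta>)) = (\<Sum>\<eta>\<in>Bas. if \<eta> = \<epsilon> then hcoef Bas \<alpha> \<epsilon> else 0)"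
      using Inr by (intro sum.cong) (auto simp: xz_col_h[OF a])
    then show ?thesis using Inr finite_base hcoef_outside[OF a] by simp
  next
    case (Inl \<beta>)
    have "(\<Sum>\<eta>\<in>Bas. hcoef Bas \<alpha> \<eta> * xz \<alpha> c t (Inr \<eta>)) = (\<Sum>\<eta>\<in>Bas. if \<beta> = \<alpha> then - c * (hcoef Bas \<alpha> \<eta> * cartan \<alpha> \<eta>) else 0)"
      using Inl by (intro sum.cong) (auto simp: xz_col_h[OF a])
    also have "\<dots> = (if \<beta> = \<alpha> then - c * (\<Sum>\<eta>\<in>Bas. hcoef Bas \<alpha> \<eta> * cartan \<alpha> \<eta>) else 0)" by (simp add: sum_distrib_left)
    finally show ?thesis using Inl by (simp add: sum_hcoef_cartan[OF a a] cartan_self[OF a])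
  qed
  finally show ?thesis
    by (cases t) (auto simp: xz_col_h[OF a d] xz_col_self[OF a] algebra_simps split: if_splits)
qed

text \<open>Applying the automorphism to \<open>[h_\<delta>, e_j]\<close> and reading the
  coefficient at \<open>t\<close> compares two eigenvalues of the Cartan part. They agree for every
  simple \<open>\<delta>\<close>, so \<open>wt t\<close> is the reflected weight. This replaces a
  calculation in root strings.\<close>

lemma zn_supp:
  assumes a: "\<alpha> \<in> \<Phi>" and c2: "c\<^sup>2 = 1" and nz: "zn \<alpha> c t j \<noteq> 0"
  shows "wt t = root_refl \<alpha> (wt j)"
proof -
  have t: "t \<in> I" "j \<in> I" using nz msupp_zn[OF a, of c] unfolding msupp_def by blast+
  show ?thesis
  proof (cases j)
    case (Inr \<delta>)
    then have "\<delta> \<in> Bas" using t by (simp add: Inr_I)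
    then show ?thesis using nz Inr zn_col_h[OF a _ c2, of \<delta> t] by (cases t) (auto simp: root_refl_def)
  next
    case (Inl \<beta>)
    then have b: "\<beta> \<in> \<Phi>" using t by (simp add: Inl_I)
    have "cartan \<beta> \<delta> = cartan (root_refl \<alpha> (wt t)) \<delta>" if d: "\<delta> \<in> Bas" for \<delta>
    proof -
      have i: "Inr \<delta> \<in> I" using d by (simp add: Inr_I)
      have "cartan \<beta> \<delta> * zn \<alpha> c t j = (\<Sum>m\<in>I. zn \<alpha> c t m * br (Inr \<delta>) j m)"
        using t finite_I Inl by (simp add: br_Inr if_distrib cong: if_cong)
      also have "\<dots> = bb (zn \<alpha> c) (zn \<alpha> c) (Inr \<delta>) j t" using aut_zn[OF a] i t unfolding aut_def by blast
      also have "\<dots> = (\<Sum>p\<in>I. zn \<alpha> c p (Inr \<delta>) * (\<Sum>q\<in>I. zn \<alpha> c q j * br p q t))"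
        by (simp add: bb_def sum_distrib_left mult.assoc)
      also have "\<dots> = (\<Sum>\<epsilon>\<in>Bas. ((if \<epsilon> = \<delta> then 1 else 0) - cartan \<alpha> \<delta> * hcoef Bas \<alpha> \<epsilon>) * (\<Sum>q\<in>I. zn \<alpha> c q j * br (Inr \<epsilon>) q t))"
        unfolding zn_col_h[OF a d c2] by (subst sum_I) simp
      also have "\<dots> = (\<Sum>\<epsilon>\<in>Bas. ((if \<epsilon> = \<delta> then 1 else 0) - cartan \<alpha> \<delta> * hcoef Bas \<alpha> \<epsilon>) * (zn \<alpha> c t j * cartan (wt t) \<epsilon>))"
        using t finite_I by (simp add: br_Inr if_distrib cong: if_cong)
      also have "\<dots> = (\<Sum>\<epsilon>\<in>Bas. (if \<epsilon> = \<delta> then zn \<alpha> c t j * cartan (wt t) \<delta> else 0)) -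
          (\<Sum>\<epsilon>\<in>Bas. zn \<alpha> c t j * cartan \<alpha> \<delta> * (hcoef Bas \<alpha> \<epsilon> * cartan (wt t) \<epsilon>))"
        unfolding sum_subtractf[symmetric] by (intro sum.cong) (auto simp: algebra_simps)
      also have "\<dots> = zn \<alpha> c t j * (cartan (wt t) \<delta> - cartan \<alpha> \<delta> * (\<Sum>\<epsilon>\<in>Bas. hcoef Bas \<alpha> \<epsilon> * cartan (wt t) \<epsilon>))"
        using d finite_base by (simp add: sum_distrib_left algebra_simps)
      also have "(\<Sum>\<epsilon>\<in>Bas. hcoef Bas \<alpha> \<epsilon> * cartan (wt t) \<epsilon>) = cartan (wt t) \<alpha>"
        using wt_I[OF t(1)] sum_hcoef_cartan[OF _ a] by (auto simp: cartan_def)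
      finally have e: "cartan \<beta> \<delta> = cartan (wt t) \<delta> - cartan \<alpha> \<delta> * cartan (wt t) \<alpha>" using nz by simp
      have oi: "v \<in> insert 0 \<Phi> \<Longrightarrow> \<gamma> \<in> \<Phi> \<Longrightarrow> real_of_int (cartan v \<gamma>) = 2 * (v \<bullet> \<gamma>) / (\<gamma> \<bullet> \<gamma>)" for v \<gamma>
        using of_int_cartan[of \<gamma> v] by (auto simp: cartan_def)
      have r: "root_refl \<alpha> (wt t) \<in> insert 0 \<Phi>"
        using wt_I[OF t(1)] root_refl_root[OF a] by (auto simp: root_refl_def)
      have "real_of_int (cartan (root_refl \<alpha> (wt t)) \<delta>) = real_of_int (cartan \<beta> \<delta>)"
        unfolding e of_int_diff of_int_mult oi[OF r base_roots[OF d]] oi[OF wt_I[OF t(1)] base_roots[OF d]] oi[OF wt_I[OF t(1)] a]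
          of_int_cartan[OF base_roots[OF d] a]
        by (simp add: root_refl_def inner_diff_left diff_divide_distrib algebra_simps)
      then show ?thesis by linarith
    qed
    then have "\<beta> = root_refl \<alpha> (wt t)"
      using b wt_I[OF t(1)] root_refl_root[OF a] by (intro cartan_separates) (auto simp: root_refl_def)
    then show ?thesis using Inl by (simp add: root_refl_invol)
  qed
qed

text \<open>By \<open>zn_supp\<close> the column has at most one nonzero entry. The inverse matrix
  is integral and equally sparse, so this entry divides 1.\<close>

lemma zn_col_root:
  assumes a: "\<alpha> \<in> \<Phi>" and b: "\<beta> \<in> \<Phi>" and c2: "c\<^sup>2 = 1"
  shows "\<exists>\<epsilon>::int. (\<epsilon> = 1 \<or> \<epsilon> = -1) \<and> (\<forall>t. zn \<alpha> c t (Inl \<beta>) = (if t = Inl (root_refl \<alpha> \<beta>) then \<epsilon> else 0))"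
proof -
  let ?b = "root_refl \<alpha> \<beta>"
  have rb: "?b \<in> \<Phi>" using root_refl_root a b by blast
  have z: "zn \<alpha> d t (Inl \<beta>) = 0" if "t \<noteq> Inl ?b" "d\<^sup>2 = 1" for t d
    using zn_supp[OF a that(2), of t "Inl \<beta>"] wt_eq_root[OF _ _ rb] msupp_zn[OF a, of d] that(1) unfolding msupp_def by fastforce
  have "1 = (zn \<alpha> (- c) \<otimes> zn \<alpha> c) (Inl \<beta>) (Inl \<beta>)" using b by (simp add: zn_inverse[OF a] idm_def Inl_I)
  also have "\<dots> = (\<Sum>k\<in>I. if k = Inl ?b then zn \<alpha> (- c) (Inl \<beta>) (Inl ?b) * zn \<alpha> c (Inl ?b) (Inl \<beta>) else 0)"
    unfolding mmul_def by (intro sum.cong) (auto simp: z[OF _ c2])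
  also have "\<dots> = zn \<alpha> (- c) (Inl \<beta>) (Inl ?b) * zn \<alpha> c (Inl ?b) (Inl \<beta>)" using rb finite_I by (simp add: Inl_I)
  finally have "zn \<alpha> c (Inl ?b) (Inl \<beta>) = 1 \<or> zn \<alpha> c (Inl ?b) (Inl \<beta>) = -1" by (metis mult.commute zmult_eq_1_iff)
  then show ?thesis using z[OF _ c2] by (intro exI[of _ "zn \<alpha> c (Inl ?b) (Inl \<beta>)"]) auto
qed

section \<open>Derivations of the Lie ring that shift weights\<close>

definition derivation :: "('a idx \<Rightarrow> 'a idx \<Rightarrow> int) \<Rightarrow> bool" where
  "derivation M \<longleftrightarrow> (\<forall>x\<in>I. \<forall>y\<in>I. \<forall>t\<in>I. (\<Sum>m\<in>I. M t m * br x y m) = (\<Sum>p\<in>I. M p x * br p y t) + (\<Sum>q\<in>I. M q y * br x q t))"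

lemma derivation_ad: "\<gamma> \<in> \<Phi> \<Longrightarrow> derivation (ad \<gamma>)"
  unfolding derivation_def using ad_der by blast

lemma derivation_comb: "derivation A \<Longrightarrow> derivation B \<Longrightarrow> derivation (\<lambda>i j. c * A i j + d * B i j)"
  unfolding derivation_def
  by (simp add: distrib_right sum.distrib mult.assoc sum_distrib_left[symmetric] distrib_left algebra_simps)

text \<open>A derivation that kills every \<open>h_\<delta>\<close> commutes with their action and
  so preserves weights, whereas \<open>D\<close> shifts them by
  \<open>\<gamma> \<noteq> 0\<close>.\<close>

lemma derivation_zero:
  assumes "derivation D" "msupp I D" "\<gamma> \<noteq> 0" and sh: "\<And>i j. D i j \<noteq> 0 \<Longrightarrow> wt i = wt j + \<gamma>"
    and h: "\<And>t \<delta>. \<delta> \<in> Bas \<Longrightarrow> D t (Inr \<delta>) = 0"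
  shows "D t j = 0"
proof (rule ccontr)
  assume nz: "D t j \<noteq> 0"
  then have i: "t \<in> I" "j \<in> I" using assms(2) unfolding msupp_def by blast+
  then obtain \<beta> where b: "j = Inl \<beta>" "\<beta> \<in> \<Phi>" using h nz by (cases j) (auto simp: Inr_I Inl_I)
  have "cartan \<beta> \<delta> = cartan (wt t) \<delta>" if d: "\<delta> \<in> Bas" for \<delta>
  proof -
    have "Inr \<delta> \<in> I" using d by (simp add: Inr_I)
    then have "(\<Sum>m\<in>I. D t m * br (Inr \<delta>) j m) = (\<Sum>p\<in>I. D p (Inr \<delta>) * br p j t) + (\<Sum>q\<in>I. D q j * br (Inr \<delta>) q t)"
      using assms(1) i unfolding derivation_def by blast
    then have "D t j * cartan \<beta> \<delta> = D t j * cartan (wt t) \<delta>"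
      using i finite_I b by (simp add: h[OF d] br_Inr if_distrib cong: if_cong)
    then show ?thesis using nz by simp
  qed
  then have "\<beta> = wt t" using b wt_I[OF i(1)] by (intro cartan_separates) auto
  then show False using sh[OF nz] b assms(3) by simp
qed

text \<open>Combining \<open>D\<close> with \<open>ad e_\<gamma>\<close> so that every
  \<open>h_\<delta>\<close> is killed reduces the claim to \<open>derivation_zero\<close>. Over the
  integers this yields only a relation \<open>m D = - l ad e_\<gamma>\<close> with a Cartan integer
  \<open>m\<close>, which then has to be divided out.\<close>

lemma derivation_inner:
  assumes "derivation D" "msupp I D" "\<gamma> \<noteq> 0" and sh: "\<And>i j. D i j \<noteq> 0 \<Longrightarrow> wt i = wt j + \<gamma>"
    and nz: "D i0 j0 \<noteq> 0"
  shows "\<gamma> \<in> \<Phi> \<and> (\<exists>c. \<forall>i j. D i j = c * ad \<gamma> i j)"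
proof -
  have gr: "\<gamma> \<in> \<Phi>"
  proof (rule ccontr)
    assume n: "\<gamma> \<notin> \<Phi>"
    have "D t (Inr \<delta>) = 0" for t \<delta>
    proof (rule ccontr)
      assume "D t (Inr \<delta>) \<noteq> 0"
      then have "t \<in> I" "wt t = \<gamma>" using sh assms(2) unfolding msupp_def by force+
      then show False using n assms(3) wt_I by blast
    qed
    then show False using derivation_zero[OF assms(1-4)] nz by blast
  qed
  have "\<exists>\<delta>\<in>Bas. cartan \<gamma> \<delta> \<noteq> 0"
  proof (rule ccontr)
    assume "\<not> ?thesis"
    then have "\<And>\<delta>. \<delta> \<in> Bas \<Longrightarrow> cartan \<gamma> \<delta> = cartan 0 \<delta>" by (simp add: cartan_def)
    then have "\<gamma> = 0" using gr by (intro cartan_separates) auto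
    then show False using assms(3) by simp
  qed
  then obtain \<delta>0 where d0: "\<delta>0 \<in> Bas" "cartan \<gamma> \<delta>0 \<noteq> 0" by blast
  define l where "l \<delta> = D (Inl \<gamma>) (Inr \<delta>)" for \<delta>
  have col: "D t (Inr \<delta>) = (if t = Inl \<gamma> then l \<delta> else 0)" for t \<delta>
  proof (cases "D t (Inr \<delta>) = 0")
    case False
    then have "t \<in> I" "wt t = \<gamma>" using sh assms(2) unfolding msupp_def by force+
    then have "t = Inl \<gamma>" using wt_eq_root gr by blast
    then show ?thesis by (simp add: l_def)
  qed (auto simp: l_def)
  \<comment> \<open>Obtained from \<open>D\<close> applied to the vanishing bracket of
    \<open>h_\<delta>\<close> and \<open>h_\<delta>0\<close>. The values \<open>l \<delta>\<close>
    are thus proportional to the Cartan integers of \<open>\<gamma>\<close>, as for an inner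
    derivation.\<close>
  have ll: "l \<delta> * cartan \<gamma> \<delta>0 = l \<delta>0 * cartan \<gamma> \<delta>" if d: "\<delta> \<in> Bas" for \<delta>
  proof -
    have i: "Inr \<delta> \<in> I" "Inr \<delta>0 \<in> I" "Inl \<gamma> \<in> I" using d d0 gr by (simp_all add: Inr_I Inl_I)
    have "(\<Sum>m\<in>I. D (Inl \<gamma>) m * br (Inr \<delta>) (Inr \<delta>0) m) =
       (\<Sum>p\<in>I. D p (Inr \<delta>) * br p (Inr \<delta>0) (Inl \<gamma>)) + (\<Sum>q\<in>I. D q (Inr \<delta>0) * br (Inr \<delta>) q (Inl \<gamma>))"
      using assms(1) i unfolding derivation_def by blast
    moreover have "(\<Sum>m\<in>I. D (Inl \<gamma>) m * br (Inr \<delta>) (Inr \<delta>0) m) = 0" by (simp add: brk_def)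
    moreover have "(\<Sum>p\<in>I. D p (Inr \<delta>) * br p (Inr \<delta>0) (Inl \<gamma>)) = l \<delta> * br (Inl \<gamma>) (Inr \<delta>0) (Inl \<gamma>)"
      using i finite_I by (simp add: col if_distrib[of "\<lambda>x. x * _"] cong: if_cong)
    moreover have "(\<Sum>q\<in>I. D q (Inr \<delta>0) * br (Inr \<delta>) q (Inl \<gamma>)) = l \<delta>0 * br (Inr \<delta>) (Inl \<gamma>) (Inl \<gamma>)"
      using i finite_I by (simp add: col if_distrib[of "\<lambda>x. x * _"] cong: if_cong)
    ultimately show ?thesis by (simp add: br_Inr br_Inr_right)
  qed
  let ?m = "cartan \<gamma> \<delta>0"
  define E where "E = (\<lambda>i j. ?m * D i j + l \<delta>0 * ad \<gamma> i j)"
  have "E t j = 0" for t j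
  proof (rule derivation_zero[of E \<gamma>])
    show "derivation E" unfolding E_def by (rule derivation_comb[OF assms(1) derivation_ad[OF gr]])
    show "msupp I E" using assms(2) msupp_ad[of \<gamma>] unfolding msupp_def E_def by (metis add.right_neutral mult_zero_right)
    show "\<gamma> \<noteq> 0" by fact
    show "wt i = wt j + \<gamma>" if "E i j \<noteq> 0" for i j
      using that sh[of i j] ad_supp[OF gr, of i j] unfolding E_def by fastforce
    show "E t (Inr \<delta>) = 0" if "\<delta> \<in> Bas" for t \<delta>
      using ll[OF that] by (simp add: E_def col ad_Inr[OF gr that] mult.commute)
  qed
  then have mD: "?m * D i j = - l \<delta>0 * ad \<gamma> i j" for i j unfolding E_def by (simp add: add_eq_0_iff)
  \<comment> \<open>On \<open>e_{-\<gamma>}\<close> the matrix \<open>ad e_\<gamma>\<close> has the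
    coroot coefficients of \<open>\<gamma>\<close> as entries. A combination of them with value 1,
    applied to the entries of \<open>D\<close>, gives the integral multiplier
    \<open>c\<close>.\<close>
  obtain z :: "'a \<Rightarrow> int" where z: "(\<Sum>\<epsilon>\<in>Bas. hcoef Bas \<gamma> \<epsilon> * z \<epsilon>) = 1" using hcoef_primitive[OF gr] by blast
  define c where "c = (\<Sum>\<epsilon>\<in>Bas. D (Inr \<epsilon>) (Inl (- \<gamma>)) * z \<epsilon>)"
  have "?m * c = (\<Sum>\<epsilon>\<in>Bas. (?m * D (Inr \<epsilon>) (Inl (- \<gamma>))) * z \<epsilon>)" by (simp add: c_def sum_distrib_left mult.assoc)
  also have "\<dots> = (\<Sum>\<epsilon>\<in>Bas. - l \<delta>0 * (hcoef Bas \<gamma> \<epsilon> * z \<epsilon>))"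
    unfolding mD by (simp add: ad_neg[OF gr] mult.assoc)
  also have "\<dots> = - l \<delta>0" by (simp add: sum_distrib_left[symmetric] sum_negf z)
  finally have "?m * D i j = ?m * (c * ad \<gamma> i j)" for i j unfolding mD by (metis mult.assoc)
  then have "D i j = c * ad \<gamma> i j" for i j using d0 by simp
  then show ?thesis using gr by blast
qed

end

section \<open>Factorization of unipotent automorphisms\<close>

text \<open>The vectors \<open>x\<close> and \<open>y\<close> read the exponents \<open>p\<close>
  and \<open>q\<close> off a weight shift \<open>p \<alpha> + q \<beta>\<close>; they exist whenever
  the two roots are linearly independent.\<close>

locale root_pair = chevalley +
  fixes \<alpha> \<beta> x y :: "'a::euclidean_space"
  assumes pair_roots: "\<alpha> \<in> \<Phi>" "\<beta> \<in> \<Phi>"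
    and dual: "x \<bullet> \<alpha> = 1" "x \<bullet> \<beta> = 0" "y \<bullet> \<alpha> = 0" "y \<bullet> \<beta> = 1"
begin

definition pq :: "nat \<Rightarrow> nat \<Rightarrow> 'a" where "pq p q = of_nat p *\<^sub>R \<alpha> + of_nat q *\<^sub>R \<beta>"

lemma pq_add: "pq p q + pq p' q' = pq (p + p') (q + q')"
  by (simp add: pq_def algebra_simps)

lemma pq_scale: "of_nat k *\<^sub>R pq p q = pq (k * p) (k * q)"
  by (simp add: pq_def algebra_simps)

lemma x_pq: "x \<bullet> pq p q = of_nat p" and y_pq: "y \<bullet> pq p q = of_nat q"
  by (simp_all add: pq_def inner_add_right dual)

lemma pq_inj: "pq p q = pq p' q' \<longleftrightarrow> p = p' \<and> q = q'"
  by (metis x_pq y_pq of_nat_eq_iff)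

lemma pq_eq_0: "pq p q = 0 \<longleftrightarrow> p = 0 \<and> q = 0"
  using pq_inj[of p q 0 0] by (simp add: pq_def)

lemma shift_bound: "\<exists>b\<ge>1. \<forall>i\<in>I. \<forall>j\<in>I. \<forall>p q. wt i - wt j = pq p q \<longrightarrow> p < b \<and> q < b"
proof -
  let ?S = "(\<lambda>(i, j). nat \<lfloor>x \<bullet> (wt i - wt j)\<rfloor> + nat \<lfloor>y \<bullet> (wt i - wt j)\<rfloor>) ` (I \<times> I)"
  have "finite ?S" using finite_I by blast
  then obtain b where b: "\<forall>n\<in>?S. n < b" using finite_nat_set_iff_bounded by blast
  have "p < Suc b \<and> q < Suc b" if "i \<in> I" "j \<in> I" "wt i - wt j = pq p q" for i j p q
  proof -
    have "nat \<lfloor>x \<bullet> (wt i - wt j)\<rfloor> + nat \<lfloor>y \<bullet> (wt i - wt j)\<rfloor> < b" using b that(1,2) by fast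
    then show ?thesis by (simp add: that(3) x_pq y_pq)
  qed
  then show ?thesis by (intro exI[of _ "Suc b"]) auto
qed

text \<open>A filtration of unipotent matrices by the level \<open>p + b * q\<close>. The condition
  \<open>q \<ge> 1\<close> keeps root elements for \<open>\<alpha>\<close> itself out of the
  factorization.\<close>

definition upper :: "nat \<Rightarrow> nat \<Rightarrow> ('a idx \<Rightarrow> 'a idx \<Rightarrow> int) \<Rightarrow> bool" where
  "upper b n M \<longleftrightarrow> (\<forall>i\<in>I. \<forall>j\<in>I. M i j \<noteq> idm I i j \<longrightarrow>
     (\<exists>p q. q \<ge> 1 \<and> wt i - wt j = pq p q \<and> n \<le> p + b * q))"

definition cone_roots :: "('a idx \<Rightarrow> 'a idx \<Rightarrow> 'r::comm_ring_1) set" where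
  "cone_roots = {xz \<gamma> c | \<gamma> c. \<gamma> \<in> \<Phi> \<and> (\<exists>p q. q \<ge> 1 \<and> \<gamma> = pq p q)}"

text \<open>In the automorphism identity write \<open>M\<close> as the identity plus
  \<open>?E\<close>. Terms quadratic in \<open>?E\<close> have level at least \<open>2 * n\<close>,
  so in the chosen shift, of level \<open>n\<close>, only the linear terms survive, and these form
  the derivation rule.\<close>

lemma lowest_component_derivation:
  assumes M: "aut M" and U: "upper b n M" and n: "n \<ge> 1" and g: "n = p0 + b * q0" and q0: "q0 \<ge> 1"
  shows "derivation (\<lambda>i j. if wt i - wt j = pq p0 q0 then M i j else 0)"
  unfolding derivation_def
proof (intro ballI)
  let ?g = "pq p0 q0"
  let ?D = "\<lambda>i j. if wt i - wt j = ?g then M i j else 0"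
  let ?E = "\<lambda>i j. M i j - idm I i j"
  have g0: "?g \<noteq> 0" using q0 by (simp add: pq_eq_0)
  fix i j t assume i: "i \<in> I" "j \<in> I" "t \<in> I"
  show "(\<Sum>m\<in>I. ?D t m * br i j m) = (\<Sum>p\<in>I. ?D p i * br p j t) + (\<Sum>q\<in>I. ?D q j * br i q t)"
  proof (cases "wt t = wt i + wt j + ?g")
    case False
    have "?D t m * br i j m = 0" if "m \<in> I" for m using br_supp[OF i(1,2), of m] False
      by (cases "br i j m = 0") (auto simp: algebra_simps)
    moreover have "?D m i * br m j t = 0" if "m \<in> I" for m using br_supp[OF that i(2), of t] False
      by (cases "br m j t = 0") (auto simp: algebra_simps)
    moreover have "?D m j * br i m t = 0" if "m \<in> I" for m using br_supp[OF i(1) that, of t] False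
      by (cases "br i m t = 0") (auto simp: algebra_simps)
    ultimately show ?thesis by (simp only: sum.neutral_const cong: sum.cong)
  next
    case True
    have DE: "?D m k = ?E m k" if "wt m - wt k = ?g" for m k using that g0 by (auto simp: idm_def)
    have "(\<Sum>m\<in>I. ?D t m * br i j m) = (\<Sum>m\<in>I. M t m * br i j m)"
    proof (rule sum.cong[OF refl])
      fix m show "?D t m * br i j m = M t m * br i j m"
        using br_supp[OF i(1,2), of m] True by (cases "br i j m = 0") auto
    qed
    also have "\<dots> = bb M M i j t" using M i unfolding aut_def by blast
    also have "\<dots> = (\<Sum>p\<in>I. \<Sum>q\<in>I. (idm I p i + ?E p i) * (idm I q j + ?E q j) * br p q t)"
      by (simp add: bb_def)
    also have "\<dots> = bb (idm I) (idm I) i j t + bb ?E (idm I) i j t + bb (idm I) ?E i j t + bb ?E ?E i j t"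
      unfolding bb_def sum.distrib[symmetric] by (simp add: algebra_simps)
    also have "bb (idm I) (idm I) i j t = 0"
      using br_supp[OF i(1,2), of t] True g0 i by (auto simp: bb_idm)
    also have "bb ?E ?E i j t = 0"
      unfolding bb_def
    proof (intro sum.neutral ballI)
      fix p q assume pq: "p \<in> I" "q \<in> I"
      show "?E p i * ?E q j * br p q t = 0"
      proof (rule ccontr)
        assume "?E p i * ?E q j * br p q t \<noteq> 0"
        then have nz: "M p i \<noteq> idm I p i" "M q j \<noteq> idm I q j" "br p q t \<noteq> 0" by auto
        obtain p1 q1 where 1: "wt p - wt i = pq p1 q1" "n \<le> p1 + b * q1" using U nz(1) pq i unfolding upper_def by blast
        obtain p2 q2 where 2: "wt q - wt j = pq p2 q2" "n \<le> p2 + b * q2" using U nz(2) pq i unfolding upper_def by blast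
        have "wt t = wt p + wt q" using br_supp[OF pq nz(3)] by blast
        then have "?g = (wt p - wt i) + (wt q - wt j)" using True by (simp add: algebra_simps)
        then have "p0 = p1 + p2 \<and> q0 = q1 + q2" using 1 2 by (simp add: pq_add pq_inj)
        then have "n = (p1 + b * q1) + (p2 + b * q2)" using g by (simp add: algebra_simps)
        then show False using 1 2 n by simp
      qed
    qed
    also have "bb ?E (idm I) i j t = (\<Sum>p\<in>I. ?D p i * br p j t)"
      unfolding bb_idm_right[OF i(2)]
    proof (rule sum.cong[OF refl])
      fix p assume "p \<in> I"
      then have "br p j t \<noteq> 0 \<Longrightarrow> wt p - wt i = ?g" using br_supp[OF _ i(2), of p t] True by (auto simp: algebra_simps)
      then show "?E p i * br p j t = ?D p i * br p j t" using DE by (cases "br p j t = 0") auto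
    qed
    also have "bb (idm I) ?E i j t = (\<Sum>q\<in>I. ?D q j * br i q t)"
      unfolding bb_idm_left[OF i(1)]
    proof (rule sum.cong[OF refl])
      fix q assume "q \<in> I"
      then have "br i q t \<noteq> 0 \<Longrightarrow> wt q - wt j = ?g" using br_supp[OF i(1), of q t] True by (auto simp: algebra_simps)
      then show "?E q j * br i q t = ?D q j * br i q t" using DE by (cases "br i q t = 0") auto
    qed
    finally show ?thesis by simp
  qed
qed

text \<open>Shifts are removed in the order of their level \<open>p + b q\<close>; since \<open>p < b\<close> for every shift that occurs,
  the level determines the shift.\<close>

lemma unipotent_factor:
  assumes b: "b \<ge> 1" "\<forall>i\<in>I. \<forall>j\<in>I. \<forall>p q. wt i - wt j = pq p q \<longrightarrow> p < b \<and> q < b"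
  shows "msupp I M \<Longrightarrow> aut M \<Longrightarrow> n \<ge> 1 \<Longrightarrow> upper b n M \<Longrightarrow> M \<in> mgen I cone_roots"
\<comment> \<open>Every level that occurs lies below \<open>b + b * b\<close>, because
  \<open>p < b\<close> and \<open>q \<le> b\<close>; from there on \<open>M\<close> is the
  identity.\<close>
proof (induction "b + b * b - n" arbitrary: n M rule: less_induct)
  case less
  note S = less.prems(1) and A = less.prems(2) and n = less.prems(3) and U = less.prems(4)
  let ?E = "\<lambda>i j. M i j - idm I i j"
  show ?case
  proof (cases "upper b (Suc n) M")
    case True
    show ?thesis
    proof (cases "n < b + b * b")
      case lt: True
      show ?thesis by (rule less.hyps[OF _ S A _ True]) (use lt in auto)
    next
      case False
      have "M i j = idm I i j" for i j
      proof (rule ccontr)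
        assume nz: "M i j \<noteq> idm I i j"
        then have i: "i \<in> I" "j \<in> I" using S msupp_idm[of I] unfolding msupp_def by metis+
        obtain p q where "wt i - wt j = pq p q" "n \<le> p + b * q" using U nz i unfolding upper_def by blast
        moreover from this have "p < b" "q \<le> b" using b i by fastforce+
        ultimately have "n < b + b * b" using mult_le_mono2[of q b b] by linarith
        then show False using False by simp
      qed
      then have "M = idm I" by (intro ext)
      then show ?thesis using mgen_id by blast
    qed
  next
    case False
    then obtain i0 j0 where i0: "i0 \<in> I" "j0 \<in> I" "M i0 j0 \<noteq> idm I i0 j0"
      and no: "\<not> (\<exists>p q. q \<ge> 1 \<and> wt i0 - wt j0 = pq p q \<and> Suc n \<le> p + b * q)"
      unfolding upper_def by blast
    obtain p0 q0 where pq0: "q0 \<ge> 1" "wt i0 - wt j0 = pq p0 q0" "n \<le> p0 + b * q0"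
      using U i0 unfolding upper_def by blast
    then have lev: "n = p0 + b * q0" using no by (metis le_antisym not_less_eq_eq)
    define g where "g = pq p0 q0"
    define D where "D = (\<lambda>i j. if wt i - wt j = g then M i j else 0)"
    have g0: "g \<noteq> 0" using pq0(1) by (simp add: g_def pq_eq_0)
    have p0b: "p0 < b" using b i0 pq0 by blast
    have dD: "derivation D" unfolding D_def g_def
      by (rule lowest_component_derivation[OF A U n lev pq0(1)])
    have sD: "msupp I D" using S unfolding msupp_def D_def by auto
    have hD: "wt i = wt j + g" if "D i j \<noteq> 0" for i j using that by (auto simp: D_def algebra_simps split: if_splits)
    have "i0 \<noteq> j0" using pq0(2) g0 by (auto simp: g_def)
    then have "D i0 j0 \<noteq> 0" using i0 pq0(2) by (simp add: D_def g_def idm_def)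
    from derivation_inner[OF dD sD g0 hD this] obtain c where gr: "g \<in> \<Phi>" and c: "\<And>i j. D i j = c * ad g i j" by blast
    define M' where "M' = xz g (- c) \<otimes> M"
    have S': "msupp I M'" unfolding M'_def by (intro msupp_mmul msupp_xz gr S)
    have A': "aut M'" unfolding M'_def by (intro aut_mmul aut_xz gr A)
    let ?Y = "\<lambda>i j. xz g (- c) i j - idm I i j"
    have Y: "\<exists>k\<ge>1. wt i - wt j = of_nat k *\<^sub>R g" if nz: "?Y i j \<noteq> 0" for i j
    proof -
      have "\<exists>k. wt i = wt j + of_nat k *\<^sub>R g"
      proof (cases "xz g (- c) i j = 0")
        case True
        then have "i = j" using nz by (auto simp: idm_def split: if_splits)
        then show ?thesis by (intro exI[of _ 0]) simp
      next
        case False then show ?thesis using xz_supp[OF gr] by blast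
      qed
      then obtain k where k: "wt i = wt j + of_nat k *\<^sub>R g" by blast
      moreover have "k \<noteq> 0"
      proof
        assume "k = 0" then have "wt i = wt j" using k by simp
        then show False using nz xz_diag[OF gr, of i j "- c"] by simp
      qed
      ultimately show ?thesis by (intro exI[of _ k]) auto
    qed
    have E: "\<exists>p q. q \<ge> 1 \<and> wt i - wt j = pq p q \<and> n \<le> p + b * q" if "?E i j \<noteq> 0" for i j
    proof -
      have "M i j \<noteq> idm I i j" using that by simp
      moreover from this have "i \<in> I" "j \<in> I" using S msupp_idm[of I] unfolding msupp_def by metis+
      ultimately show ?thesis using U unfolding upper_def by blast
    qed
    have U': "upper b (Suc n) M'"
      unfolding upper_def
    proof (intro ballI impI)
      fix i j assume i: "i \<in> I" "j \<in> I" and nz: "M' i j \<noteq> idm I i j"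
      have "M' i j = (\<Sum>l\<in>I. (idm I i l + ?Y i l) * M l j)" by (simp add: M'_def mmul_def)
      also have "\<dots> = (\<Sum>l\<in>I. idm I i l * M l j) + (\<Sum>l\<in>I. ?Y i l * M l j)"
        by (simp only: distrib_right sum.distrib)
      also have "(\<Sum>l\<in>I. ?Y i l * M l j) = (\<Sum>l\<in>I. ?Y i l * (idm I l j + ?E l j))" by simp
      also have "(\<Sum>l\<in>I. idm I i l * M l j) = M i j"
        using fun_cong[OF fun_cong[OF mmul_idm_left[OF finite_I S], of i], of j] by (simp only: mmul_def)
      also have "(\<Sum>l\<in>I. ?Y i l * (idm I l j + ?E l j)) = (\<Sum>l\<in>I. ?Y i l * idm I l j) + (\<Sum>l\<in>I. ?Y i l * ?E l j)"
        by (simp only: distrib_left sum.distrib)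
      also have "(\<Sum>l\<in>I. ?Y i l * idm I l j) = (\<Sum>l\<in>I. if l = j then ?Y i l else 0)"
        by (intro sum.cong) (auto simp: idm_def)
      also have "\<dots> = ?Y i j" using i finite_I by simp
      \<comment> \<open>Terms of the product of \<open>?Y\<close> and \<open>?E\<close>, and shifts
        \<open>k g\<close> with \<open>k \<ge> 2\<close>, have level above \<open>n\<close>. Entries
        of \<open>?E\<close> at level \<open>n\<close> have shift \<open>g\<close>, where
        \<open>?E\<close> and \<open>?Y\<close> cancel by the choice of \<open>c\<close>.\<close>
      finally have eq: "M' i j - idm I i j = ?E i j + ?Y i j + (\<Sum>l\<in>I. ?Y i l * ?E l j)" by simp
      show "\<exists>p q. q \<ge> 1 \<and> wt i - wt j = pq p q \<and> Suc n \<le> p + b * q"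
      proof (cases "(\<Sum>l\<in>I. ?Y i l * ?E l j) = 0")
        case False
        then obtain l where l: "?Y i l \<noteq> 0" "?E l j \<noteq> 0" by (metis (no_types, lifting) mult_zero_left mult_zero_right sum.neutral)
        obtain k where k: "k \<ge> 1" "wt i - wt l = pq (k * p0) (k * q0)" using Y[OF l(1)] by (auto simp: g_def pq_scale)
        obtain p q where pq: "q \<ge> 1" "wt l - wt j = pq p q" "n \<le> p + b * q" using E[OF l(2)] by blast
        have "wt i - wt j = pq (k * p0 + p) (k * q0 + q)" unfolding pq_add[symmetric] using k pq by (metis diff_add_cancel add_diff_eq)
        moreover have "Suc n \<le> (k * p0 + p) + b * (k * q0 + q)"
        proof -
          have "k * n = k * p0 + b * (k * q0)" by (simp add: lev algebra_simps)
          moreover have "k * n \<ge> 1" using k n by simp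
          ultimately show ?thesis using pq(3) by (simp add: algebra_simps)
        qed
        ultimately show ?thesis using pq(1) by (intro exI[of _ "k * p0 + p"] exI[of _ "k * q0 + q"]) simp
      next
        case True
        then have nz2: "?E i j + ?Y i j \<noteq> 0" using eq nz by simp
        have ng: "wt i - wt j \<noteq> g"
        proof
          assume s: "wt i - wt j = g"
          then have "wt i \<noteq> wt j" using g0 by auto
          then have z: "idm I i j = (0::int)" by (auto simp: idm_def)
          have "wt i = wt j + of_nat 1 *\<^sub>R g" using s by (simp add: algebra_simps)
          then have "xz g (- c) i j = ad g i j * (- c)" using xz_entry[OF gr, of i j 1 "- c"] by (simp add: dp_1 del: One_nat_def)
          moreover have "M i j = c * ad g i j" using c[of i j] s by (simp add: D_def)
          ultimately show False using nz2 z by simp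
        qed
        show ?thesis
        proof (cases "?E i j = 0")
          case False
          obtain p q where pq: "q \<ge> 1" "wt i - wt j = pq p q" "n \<le> p + b * q" using E[OF False] by blast
          have "n \<noteq> p + b * q"
          proof
            assume "n = p + b * q"
            then have e: "p0 + b * q0 = p + b * q" using lev by simp
            have pb: "p < b" using b i pq by blast
            have "(p0 + b * q0) mod b = p0" "(p + b * q) mod b = p" using p0b pb by simp_all
            then have "p0 = p" using e by simp
            then have "q0 = q" using e b(1) by simp
            then show False using ng pq(2) \<open>p0 = p\<close> by (simp add: g_def)
          qed
          then show ?thesis using pq by (intro exI[of _ p] exI[of _ q]) simp
        next
          case True
          then have "?Y i j \<noteq> 0" using nz2 by simp
          then obtain k where k: "k \<ge> 1" "wt i - wt j = of_nat k *\<^sub>R g" using Y by blast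
          then have "k \<noteq> 1" using ng by auto
          then have k2: "k \<ge> 2" using k by simp
          have "k * n = k * p0 + b * (k * q0)" by (simp add: lev algebra_simps)
          moreover have "k * n \<ge> 2 * n" using k2 by simp
          ultimately have "Suc n \<le> k * p0 + b * (k * q0)" using n by linarith
          moreover have "k * q0 \<ge> 1" using k pq0(1) by simp
          ultimately show ?thesis using k(2) unfolding g_def pq_scale by blast
        qed
      qed
    qed
    have "n < b + b * b"
    proof -
      have "q0 \<le> b" using b(2) i0(1,2) pq0(2) by (meson less_imp_le)
      then show ?thesis using p0b lev mult_le_mono2[of q0 b b] by linarith
    qed
    then have M': "M' \<in> mgen I cone_roots" by (intro less.hyps[OF _ S' A' _ U']) auto
    have "xz g c \<otimes> M' = M" unfolding M'_def mmul_assoc[symmetric]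
      using xz_inverse(1)[OF gr, of c] by (simp add: mmul_idm_left finite_I S)
    moreover have "xz g c \<in> cone_roots" using gr pq0(1) unfolding cone_roots_def g_def by blast
    ultimately show ?thesis using mgen_step[OF _ M'] by metis
  qed
qed

text \<open>Subtracting the identity leaves a conjugate of \<open>xz \<beta> 1 - idm I\<close>, and
  every nonzero entry of that matrix has a shift involving \<open>\<beta>\<close> at least
  once.\<close>

lemma conj_upper: "b \<ge> 1 \<Longrightarrow> upper b 1 (xz \<alpha> 1 \<otimes> (xz \<beta> 1 \<otimes> xz \<alpha> (- 1)))"
  unfolding upper_def
proof (intro ballI impI)
  let ?X = "xz \<alpha> (1::int)" and ?X' = "xz \<alpha> (- 1::int)" and ?Y = "\<lambda>i j. xz \<beta> (1::int) i j - idm I i j"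
  fix i j assume b: "b \<ge> 1" and i: "i \<in> I" "j \<in> I" and nz: "(?X \<otimes> (xz \<beta> 1 \<otimes> ?X')) i j \<noteq> idm I i j"
  have "(xz \<beta> 1 \<otimes> ?X') k j = ?X' k j + (\<Sum>l\<in>I. ?Y k l * ?X' l j)" for k
  proof -
    have "(xz \<beta> 1 \<otimes> ?X') k j = (\<Sum>l\<in>I. (idm I k l + ?Y k l) * ?X' l j)" by (simp add: mmul_def)
    also have "\<dots> = (\<Sum>l\<in>I. idm I k l * ?X' l j) + (\<Sum>l\<in>I. ?Y k l * ?X' l j)" by (simp only: distrib_right sum.distrib)
    also have "(\<Sum>l\<in>I. idm I k l * ?X' l j) = ?X' k j"
      using fun_cong[OF fun_cong[OF mmul_idm_left[OF finite_I msupp_xz[OF pair_roots(1)], of "- 1::int"], of k], of j]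
      by (simp only: mmul_def)
    finally show ?thesis .
  qed
  then have "(?X \<otimes> (xz \<beta> 1 \<otimes> ?X')) i j = (?X \<otimes> ?X') i j + (\<Sum>k\<in>I. ?X i k * (\<Sum>l\<in>I. ?Y k l * ?X' l j))"
    by (simp add: mmul_def[of I ?X] distrib_left sum.distrib)
  then have "(\<Sum>k\<in>I. ?X i k * (\<Sum>l\<in>I. ?Y k l * ?X' l j)) \<noteq> 0"
    using nz xz_inverse(1)[OF pair_roots(1), of "1::int"] by simp
  then obtain k where "?X i k \<noteq> 0" "(\<Sum>l\<in>I. ?Y k l * ?X' l j) \<noteq> 0"
    by (metis (no_types, lifting) mult_zero_left mult_zero_right sum.neutral)
  moreover from this obtain l where "?Y k l \<noteq> 0" "?X' l j \<noteq> 0"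
    by (metis (no_types, lifting) mult_zero_left mult_zero_right sum.neutral)
  ultimately have nz3: "?X i k \<noteq> 0" "?Y k l \<noteq> 0" "?X' l j \<noteq> 0" by auto
  obtain p1 where p1: "wt i = wt k + of_nat p1 *\<^sub>R \<alpha>" using xz_supp[OF pair_roots(1) nz3(1)] by blast
  obtain p2 where p2: "wt l = wt j + of_nat p2 *\<^sub>R \<alpha>" using xz_supp[OF pair_roots(1) nz3(3)] by blast
  obtain q where q: "wt k = wt l + of_nat q *\<^sub>R \<beta>"
  proof (cases "xz \<beta> (1::int) k l = 0")
    case True then have "k = l" using nz3(2) by (auto simp: idm_def split: if_splits)
    then show ?thesis using that[of 0] by simp
  next
    case False then show ?thesis using xz_supp[OF pair_roots(2)] that by blast
  qed
  have "q \<noteq> 0"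
  proof
    assume "q = 0" then have "wt k = wt l" using q by simp
    then show False using nz3(2) xz_diag[OF pair_roots(2), of k l "1::int"] by simp
  qed
  moreover have "wt i - wt j = pq (p1 + p2) q" using p1 p2 q by (simp add: pq_def algebra_simps)
  moreover have "1 \<le> p1 + p2 + b * q" using b \<open>q \<noteq> 0\<close> by (metis One_nat_def Suc_leI add_gr_0 nat_0_less_mult_iff neq0_conv less_le_trans zero_less_one)
  ultimately show "\<exists>p q. q \<ge> 1 \<and> wt i - wt j = pq p q \<and> 1 \<le> p + b * q"
    by (intro exI[of _ "p1 + p2"] exI[of _ q]) auto
qed

section \<open>Rescaling integral factorizations to arbitrary parameters\<close>

definition csupp :: "('a idx \<Rightarrow> 'a idx \<Rightarrow> int) \<Rightarrow> bool" where
  "csupp M \<longleftrightarrow> (\<forall>i j. M i j \<noteq> 0 \<longrightarrow> (\<exists>p q. wt i - wt j = pq p q))"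

text \<open>Under \<open>csupp\<close> the shifts grade the multiplication, so inserting
  \<open>t ^ p * s ^ q\<close> in shift \<open>p \<alpha> + q \<beta>\<close> is compatible with
  products, also for parameters that are not invertible. The \<open>nat\<close> of a floor recovers
  the exponents \<open>p\<close> and \<open>q\<close>.\<close>

definition scal :: "'r::comm_ring_1 \<Rightarrow> 'r \<Rightarrow> ('a idx \<Rightarrow> 'a idx \<Rightarrow> int) \<Rightarrow> 'a idx \<Rightarrow> 'a idx \<Rightarrow> 'r" where
  "scal t s M = (\<lambda>i j. of_int (M i j) * (t ^ nat \<lfloor>x \<bullet> (wt i - wt j)\<rfloor> * s ^ nat \<lfloor>y \<bullet> (wt i - wt j)\<rfloor>))"

lemma scal_pq: "wt i - wt j = pq p q \<Longrightarrow> scal t s M i j = of_int (M i j) * (t ^ p * s ^ q)"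
  by (simp add: scal_def x_pq y_pq)

lemma csupp_mmul: "csupp A \<Longrightarrow> csupp B \<Longrightarrow> csupp (A \<otimes> B)"
  unfolding csupp_def
proof (intro allI impI)
  fix i j assume A: "\<forall>i j. A i j \<noteq> 0 \<longrightarrow> (\<exists>p q. wt i - wt j = pq p q)"
    and B: "\<forall>i j. B i j \<noteq> 0 \<longrightarrow> (\<exists>p q. wt i - wt j = pq p q)" and "(A \<otimes> B) i j \<noteq> 0"
  then obtain k where "A i k \<noteq> 0" "B k j \<noteq> 0" by (elim mmul_nonzeroE)
  then obtain p q p' q' where "wt i - wt k = pq p q" "wt k - wt j = pq p' q'" using A B by blast
  then have "wt i - wt j = pq (p + p') (q + q')" unfolding pq_add[symmetric] by (metis diff_add_cancel add_diff_eq)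
  then show "\<exists>p q. wt i - wt j = pq p q" by blast
qed

lemma scal_mmul:
  assumes "csupp A" "csupp B"
  shows "scal t s (A \<otimes> B) = scal t s A \<otimes> scal t s B"
proof (intro ext)
  fix i j
  have "scal t s (A \<otimes> B) i j = (\<Sum>k\<in>I. of_int (A i k * B k j) * (t ^ nat \<lfloor>x \<bullet> (wt i - wt j)\<rfloor> * s ^ nat \<lfloor>y \<bullet> (wt i - wt j)\<rfloor>))"
    by (simp add: scal_def mmul_def sum_distrib_right)
  also have "\<dots> = (\<Sum>k\<in>I. scal t s A i k * scal t s B k j)"
  proof (rule sum.cong[OF refl])
    fix k
    show "of_int (A i k * B k j) * (t ^ nat \<lfloor>x \<bullet> (wt i - wt j)\<rfloor> * s ^ nat \<lfloor>y \<bullet> (wt i - wt j)\<rfloor>) = scal t s A i k * scal t s B k j"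
    proof (cases "A i k = 0 \<or> B k j = 0")
      case True then show ?thesis by (auto simp: scal_def)
    next
      case False
      then obtain p q p' q' where s: "wt i - wt k = pq p q" "wt k - wt j = pq p' q'" using assms unfolding csupp_def by metis
      then have e: "wt i - wt j = pq (p + p') (q + q')" unfolding pq_add[symmetric] by (metis diff_add_cancel add_diff_eq)
      show ?thesis unfolding scal_pq[OF s(1)] scal_pq[OF s(2)] e x_pq y_pq
        by (simp add: power_add algebra_simps flip: of_nat_add)
    qed
  qed
  finally show "scal t s (A \<otimes> B) i j = (scal t s A \<otimes> scal t s B) i j" by (simp add: mmul_def)
qed

lemma csupp_idm: "csupp (idm I)"
  unfolding csupp_def
proof (intro allI impI)
  fix i j assume "idm I i j \<noteq> (0::int)"
  then have "wt i - wt j = pq 0 0" by (auto simp: idm_def pq_def split: if_splits)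
  then show "\<exists>p q. wt i - wt j = pq p q" by blast
qed

lemma scal_idm: "scal t s (idm I) = idm I"
  by (auto simp: scal_def idm_def fun_eq_iff)

lemma csupp_xz: "pq p q \<in> \<Phi> \<Longrightarrow> csupp (xz (pq p q) c)"
  unfolding csupp_def
proof (intro allI impI)
  fix i j assume g: "pq p q \<in> \<Phi>" "xz (pq p q) c i j \<noteq> 0"
  then obtain k where "wt i = wt j + of_nat k *\<^sub>R pq p q" using xz_supp by blast
  then have "wt i - wt j = pq (k * p) (k * q)" by (simp add: pq_scale)
  then show "\<exists>p q. wt i - wt j = pq p q" by blast
qed

lemma scal_xz:
  assumes g: "pq p q \<in> \<Phi>" shows "scal t s (xz (pq p q) c) = xz (pq p q) (of_int c * (t ^ p * s ^ q))"
proof (intro ext)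
  fix i j
  let ?g = "pq p q"
  show "scal t s (xz ?g c) i j = xz ?g (of_int c * (t ^ p * s ^ q)) i j"
  proof (cases "\<exists>k. wt i = wt j + of_nat k *\<^sub>R ?g")
    case True
    then obtain k where k: "wt i = wt j + of_nat k *\<^sub>R ?g" by blast
    then have "wt i - wt j = pq (k * p) (k * q)" by (simp add: pq_scale)
    then show ?thesis unfolding xz_entry[OF g k] by (simp add: scal_pq xz_entry[OF g k] power_mult_distrib power_mult[symmetric] mult.commute[of k] mult.assoc)
  next
    case False
    then have "xz ?g c i j = 0" "xz ?g (of_int c * (t ^ p * s ^ q)) i j = 0" using xz_supp[OF g] by blast+
    then show ?thesis by (simp add: scal_def)
  qed
qed

lemma conj_xz_cone:
  "xz \<alpha> t \<otimes> (xz \<beta> s \<otimes> xz \<alpha> (- t)) \<in> mgen I (cone_roots :: ('a idx \<Rightarrow> 'a idx \<Rightarrow> 'r::comm_ring_1) set)"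
proof -
  let ?M = "xz \<alpha> (1::int) \<otimes> (xz \<beta> 1 \<otimes> xz \<alpha> (- 1))"
  obtain b where b: "b \<ge> 1" "\<forall>i\<in>I. \<forall>j\<in>I. \<forall>p q. wt i - wt j = pq p q \<longrightarrow> p < b \<and> q < b"
    using shift_bound by blast
  have M: "?M \<in> mgen I cone_roots"
    by (rule unipotent_factor[OF b _ _ _ conj_upper[OF b(1)]])
      (auto intro!: msupp_mmul msupp_xz aut_mmul aut_xz pair_roots)
  have gen: "csupp G \<and> scal t s G \<in> mgen I (cone_roots :: ('a idx \<Rightarrow> 'a idx \<Rightarrow> 'r) set)" if "G \<in> mgen I cone_roots" for G
    using that
  proof induction
    case mgen_id then show ?case using csupp_idm scal_idm mgen.mgen_id by metis
  next
    case (mgen_step X G)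
    then obtain c p q where X: "X = xz (pq p q) c" "pq p q \<in> \<Phi>" "q \<ge> 1" unfolding cone_roots_def by blast
    have "scal t s X = xz (pq p q) (of_int c * (t ^ p * s ^ q))" using X scal_xz by simp
    then have "scal t s X \<in> cone_roots" using X unfolding cone_roots_def by blast
    then show ?case using mgen_step X csupp_xz csupp_mmul scal_mmul mgen.mgen_step by metis
  qed
  have a: "\<alpha> = pq 1 0" "\<beta> = pq 0 1" by (simp_all add: pq_def)
  have ca: "csupp (xz \<alpha> c)" "csupp (xz \<beta> c)" for c
    using csupp_xz[of 1 0] csupp_xz[of 0 1] pair_roots a by auto
  have sa: "scal t s (xz \<alpha> c) = xz \<alpha> (of_int c * t)" "scal t s (xz \<beta> c) = xz \<beta> (of_int c * s)" for c
    using scal_xz[of 1 0 t s c] scal_xz[of 0 1 t s c] pair_roots a by auto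
  have "scal t s ?M = xz \<alpha> t \<otimes> (xz \<beta> s \<otimes> xz \<alpha> (- t))"
    by (simp add: scal_mmul csupp_mmul ca sa)
  then show ?thesis using gen[OF M] by metis
qed

end

context chevalley
begin

text \<open>By reducedness, two roots that are neither equal nor opposite are linearly independent;
  this provides the vectors \<open>x\<close> and \<open>y\<close> of
  \<open>root_pair\<close>.\<close>

lemma conj_xz_gen:
  assumes "\<alpha> \<in> \<Phi>" "\<beta> \<in> \<Phi>" "\<beta> \<noteq> \<alpha>" "\<beta> \<noteq> - \<alpha>"
  shows "xz \<alpha> t \<otimes> (xz \<beta> s \<otimes> xz \<alpha> (- t)) \<in>
    mgen I {xz \<gamma> c | \<gamma> c. \<gamma> \<in> \<Phi> \<and> (\<exists>p q::nat. q \<ge> 1 \<and> \<gamma> = of_nat p *\<^sub>R \<alpha> + of_nat q *\<^sub>R \<beta>)}"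
proof -
  have a0: "\<alpha> \<noteq> 0" using assms zero_not_root by auto
  have "\<beta> \<notin> span {\<alpha>}"
  proof
    assume "\<beta> \<in> span {\<alpha>}"
    then obtain k where "\<beta> = k *\<^sub>R \<alpha>" by (auto simp: span_singleton)
    then show False using reduced[OF assms(1), of k] assms by auto
  qed
  then have ind: "independent {\<beta>, \<alpha>}" using a0 by (simp add: independent_insert)
  obtain x where x: "\<forall>\<delta>\<in>{\<beta>, \<alpha>}. x \<bullet> \<delta> = (if \<delta> = \<alpha> then 1 else 0)" using ex_dual_vector[OF ind] by blast
  obtain y where y: "\<forall>\<delta>\<in>{\<beta>, \<alpha>}. y \<bullet> \<delta> = (if \<delta> = \<beta> then 1 else 0)" using ex_dual_vector[OF ind] by blast
  interpret root_pair \<Phi> Bas N \<alpha> \<beta> x y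
    by unfold_locales (use assms x y in auto)
  show ?thesis using conj_xz_cone[of t s] unfolding cone_roots_def pq_def .
qed

end

section \<open>Torus, unipotent radical and Borel subgroup\<close>

context chevalley
begin

text \<open>The character of the root lattice with value \<open>t \<gamma>\<close> on each simple
  root. The floor is exact on lattice vectors and arbitrary elsewhere, so the multiplicative laws
  assume \<open>lattice_vec\<close>.\<close>

definition chi :: "('a \<Rightarrow> 'f::field) \<Rightarrow> 'a \<Rightarrow> 'f" where
  "chi t v = (\<Prod>\<gamma>\<in>Bas. t \<gamma> powi \<lfloor>fw \<gamma> \<bullet> v\<rfloor>)"

definition lattice_vec :: "'a \<Rightarrow> bool" where
  "lattice_vec v \<longleftrightarrow> (\<forall>\<gamma>\<in>Bas. fw \<gamma> \<bullet> v \<in> \<int>)"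

abbreviation nz :: "('a \<Rightarrow> 'f::field) \<Rightarrow> bool" where "nz t \<equiv> \<forall>\<gamma>\<in>Bas. t \<gamma> \<noteq> 0"

lemma lattice_root: "v \<in> insert 0 \<Phi> \<Longrightarrow> lattice_vec v"
  by (auto simp: lattice_vec_def fw_root_int)

lemma lattice_floor: "lattice_vec v \<Longrightarrow> \<gamma> \<in> Bas \<Longrightarrow> real_of_int \<lfloor>fw \<gamma> \<bullet> v\<rfloor> = fw \<gamma> \<bullet> v"
  by (auto simp: lattice_vec_def elim!: Ints_cases)

lemma lattice_add: "lattice_vec v \<Longrightarrow> lattice_vec w \<Longrightarrow> lattice_vec (v + w)"
  by (auto simp: lattice_vec_def inner_add_right)

lemma lattice_scale: "lattice_vec v \<Longrightarrow> lattice_vec (of_int c *\<^sub>R v)"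
  by (auto simp: lattice_vec_def)

lemma chi_0: "chi t 0 = 1"
  by (simp add: chi_def)

lemma chi_nonzero: "nz t \<Longrightarrow> chi t v \<noteq> 0"
  using finite_base by (simp add: chi_def)

lemma chi_add: "nz t \<Longrightarrow> lattice_vec v \<Longrightarrow> lattice_vec w \<Longrightarrow> chi t (v + w) = chi t v * chi t w"
proof -
  assume a: "nz t" "lattice_vec v" "lattice_vec w"
  have "\<lfloor>fw \<gamma> \<bullet> (v + w)\<rfloor> = \<lfloor>fw \<gamma> \<bullet> v\<rfloor> + \<lfloor>fw \<gamma> \<bullet> w\<rfloor>" if "\<gamma> \<in> Bas" for \<gamma>
    using a(2) that unfolding inner_add_right lattice_vec_def by (metis floor_add2)
  then show ?thesis using a(1) by (simp add: chi_def prod.distrib[symmetric] power_int_add)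
qed

lemma powi_prod: "finite S \<Longrightarrow> (\<Prod>x\<in>S. f x) powi c = (\<Prod>x\<in>S. (f x :: 'f::field) powi c)"
  by (induction S rule: finite_induct) (simp_all add: power_int_mult_distrib)

lemma chi_scale: "lattice_vec v \<Longrightarrow> chi t (of_int c *\<^sub>R v) = chi t v powi c"
proof -
  assume a: "lattice_vec v"
  have "\<lfloor>fw \<gamma> \<bullet> (of_int c *\<^sub>R v)\<rfloor> = \<lfloor>fw \<gamma> \<bullet> v\<rfloor> * c" if "\<gamma> \<in> Bas" for \<gamma>
  proof -
    have "fw \<gamma> \<bullet> (of_int c *\<^sub>R v) = of_int (\<lfloor>fw \<gamma> \<bullet> v\<rfloor> * c)"
      by (simp only: inner_scaleR_right of_int_mult lattice_floor[OF a that] mult.commute)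
    then show ?thesis by (metis floor_of_int)
  qed
  then show ?thesis by (simp add: chi_def powi_prod[OF finite_base] power_int_mult)
qed

lemma chi_sum:
  assumes "nz t" "finite S" "\<And>\<delta>. \<delta> \<in> S \<Longrightarrow> lattice_vec (f \<delta>)"
  shows "chi t (\<Sum>\<delta>\<in>S. of_int (c \<delta>) *\<^sub>R f \<delta>) = (\<Prod>\<delta>\<in>S. chi t (f \<delta>) powi c \<delta>)"
proof -
  have "lattice_vec (\<Sum>\<delta>\<in>S. of_int (c \<delta>) *\<^sub>R f \<delta>) \<and> chi t (\<Sum>\<delta>\<in>S. of_int (c \<delta>) *\<^sub>R f \<delta>) = (\<Prod>\<delta>\<in>S. chi t (f \<delta>) powi c \<delta>)"
    using assms(2,3)
  proof (induction S rule: finite_induct)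
    case empty then show ?case by (simp add: chi_0 lattice_vec_def)
  next
    case (insert a S)
    then show ?case by (simp add: chi_add[OF assms(1)] chi_scale lattice_scale lattice_add)
  qed
  then show ?thesis by blast
qed

lemma tor_eq: "tor \<Phi> Bas t = (\<lambda>i j. if i = j \<and> i \<in> I then chi t (wt i) else 0)"
proof (intro ext)
  fix i j
  have "coords Bas \<beta> \<gamma> = \<lfloor>fw \<gamma> \<bullet> \<beta>\<rfloor>" if b: "\<beta> \<in> \<Phi>" and g: "\<gamma> \<in> Bas" for \<beta> \<gamma>
  proof -
    have "coords Bas \<beta> = (\<lambda>\<gamma>. if \<gamma> \<in> Bas then \<lfloor>fw \<gamma> \<bullet> \<beta>\<rfloor> else 0)"
    proof (rule coords_unique[OF base_indep])
      show "\<beta> = (\<Sum>\<gamma>\<in>Bas. real_of_int (if \<gamma> \<in> Bas then \<lfloor>fw \<gamma> \<bullet> \<beta>\<rfloor> else 0) *\<^sub>R \<gamma>)"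
        by (subst expand[of \<beta>], rule sum.cong[OF refl]) (simp only: if_True lattice_floor[OF lattice_root[OF insertI2[OF b]]])
    qed simp
    then show ?thesis using g by simp
  qed
  then show "tor \<Phi> Bas t i j = (if i = j \<and> i \<in> I then chi t (wt i) else 0)"
    by (cases i) (auto simp: tor_def chi_def Inl_I)
qed

lemma msupp_tor: "msupp I (tor \<Phi> Bas t)"
  by (auto simp: tor_eq msupp_def)

lemma tor_left: "msupp I A \<Longrightarrow> (tor \<Phi> Bas t \<otimes> A) i j = chi t (wt i) * A i j"
proof -
  assume a: "msupp I A"
  have "(tor \<Phi> Bas t \<otimes> A) i j = (\<Sum>k\<in>I. if k = i then chi t (wt i) * A i j else 0)"
    unfolding mmul_def tor_eq by (intro sum.cong) auto
  moreover have "i \<notin> I \<Longrightarrow> A i j = 0" using a unfolding msupp_def by blast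
  ultimately show ?thesis using finite_I by (cases "i \<in> I") auto
qed

lemma tor_right: "msupp I A \<Longrightarrow> (A \<otimes> tor \<Phi> Bas t) i j = A i j * chi t (wt j)"
proof -
  assume a: "msupp I A"
  have "(A \<otimes> tor \<Phi> Bas t) i j = (\<Sum>k\<in>I. if k = j then A i j * chi t (wt j) else 0)"
    unfolding mmul_def tor_eq by (intro sum.cong) auto
  moreover have "j \<notin> I \<Longrightarrow> A i j = 0" using a unfolding msupp_def by blast
  ultimately show ?thesis using finite_I by (cases "j \<in> I") auto
qed

abbreviation T :: "('a idx \<Rightarrow> 'a idx \<Rightarrow> 'f::field) set" where "T \<equiv> torus \<Phi> Bas"

lemma torus_I: "nz t \<Longrightarrow> tor \<Phi> Bas t \<in> T"
  by (auto simp: torus_def)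

lemma torus_E: "h \<in> T \<Longrightarrow> (\<And>t. nz t \<Longrightarrow> h = tor \<Phi> Bas t \<Longrightarrow> thesis) \<Longrightarrow> thesis"
  by (auto simp: torus_def)

lemma torus_msupp: "h \<in> T \<Longrightarrow> msupp I h"
  by (auto elim: torus_E simp: msupp_tor)

lemma tor_mult: "tor \<Phi> Bas t \<otimes> tor \<Phi> Bas s = tor \<Phi> Bas (\<lambda>\<gamma>. t \<gamma> * s \<gamma>)"
  by (intro ext, subst tor_left[OF msupp_tor]) (auto simp: tor_eq chi_def power_int_mult_distrib prod.distrib)

lemma tor_one: "tor \<Phi> Bas (\<lambda>_. 1) = idm I"
  by (intro ext) (auto simp: tor_eq chi_def idm_def)

lemma torus_mult: "h \<in> T \<Longrightarrow> k \<in> T \<Longrightarrow> h \<otimes> k \<in> T"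
  by (elim torus_E) (simp add: tor_mult torus_I)

lemma torus_one: "idm I \<in> T"
  using torus_I[of "\<lambda>_. 1"] by (simp add: tor_one)

lemma torus_inv: "h \<in> T \<Longrightarrow> \<exists>k\<in>T. h \<otimes> k = idm I \<and> k \<otimes> h = idm I"
proof (elim torus_E)
  fix t assume t: "nz t" "h = tor \<Phi> Bas t"
  let ?s = "\<lambda>\<gamma>. if \<gamma> \<in> Bas then inverse (t \<gamma>) else 1"
  have "tor \<Phi> Bas (\<lambda>\<gamma>. t \<gamma> * ?s \<gamma>) = tor \<Phi> Bas (\<lambda>_. 1)" "tor \<Phi> Bas (\<lambda>\<gamma>. ?s \<gamma> * t \<gamma>) = tor \<Phi> Bas (\<lambda>_. 1)"
    using t(1) unfolding tor_eq chi_def by (auto intro!: ext)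
  moreover have "nz ?s" using t(1) by simp
  ultimately show ?thesis using t by (intro bexI[of _ "tor \<Phi> Bas ?s"]) (simp_all add: tor_mult tor_one torus_I)
qed

text \<open>An entry with shift \<open>k \<beta>\<close> has degree \<open>k\<close> in the
  parameter, and conjugation multiplies it by the \<open>k\<close>-th power of
  \<open>chi t \<beta>\<close>.\<close>

lemma tor_xz: assumes "nz t" "\<beta> \<in> \<Phi>" shows "tor \<Phi> Bas t \<otimes> xz \<beta> a = xz \<beta> (chi t \<beta> * a) \<otimes> tor \<Phi> Bas t"
proof (intro ext)
  fix i j
  have "chi t (wt i) * xz \<beta> a i j = xz \<beta> (chi t \<beta> * a) i j * chi t (wt j)"
  proof (cases "i \<in> I \<and> j \<in> I \<and> (\<exists>k::nat. wt i = wt j + of_nat k *\<^sub>R \<beta>)")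
    case True
    then obtain k :: nat where k: "wt i = wt j + of_nat k *\<^sub>R \<beta>" by blast
    have "chi t (wt i) = chi t (wt j) * chi t \<beta> ^ k"
      using chi_add[OF assms(1), of "wt j" "of_int (int k) *\<^sub>R \<beta>"] chi_scale[of \<beta> t "int k"] True k
        lattice_root[OF wt_I] lattice_root[of \<beta>] lattice_scale[of \<beta> "int k"] assms(2) by simp
    then show ?thesis by (simp add: xz_entry[OF assms(2) k] power_mult_distrib)
  next
    case False
    then have "xz \<beta> a i j = 0" "xz \<beta> (chi t \<beta> * a) i j = 0" using xz_supp[OF assms(2)] by blast+
    then show ?thesis by simp
  qed
  then show "(tor \<Phi> Bas t \<otimes> xz \<beta> a) i j = (xz \<beta> (chi t \<beta> * a) \<otimes> tor \<Phi> Bas t) i j"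
    by (simp add: tor_left[OF msupp_xz[OF assms(2)]] tor_right[OF msupp_xz[OF assms(2)]])
qed

lemma torus_xz: "h \<in> T \<Longrightarrow> \<beta> \<in> \<Phi> \<Longrightarrow> \<exists>c. c \<noteq> 0 \<and> (\<forall>a. h \<otimes> xz \<beta> a = xz \<beta> (c * a) \<otimes> h)"
  by (elim torus_E) (metis tor_xz chi_nonzero)

lemma xz_torus: "h \<in> T \<Longrightarrow> \<beta> \<in> \<Phi> \<Longrightarrow> \<exists>a'. xz \<beta> a \<otimes> h = h \<otimes> xz \<beta> a'"
proof -
  assume a: "h \<in> T" "\<beta> \<in> \<Phi>"
  obtain c where c: "c \<noteq> 0" "\<forall>a. h \<otimes> xz \<beta> a = xz \<beta> (c * a) \<otimes> h" using torus_xz[OF a] by blast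
  have "h \<otimes> xz \<beta> (a / c) = xz \<beta> a \<otimes> h" using c by simp
  then show ?thesis by metis
qed

abbreviation n :: "'a \<Rightarrow> 'a idx \<Rightarrow> 'a idx \<Rightarrow> 'f::field" where "n \<equiv> nr \<Phi> Bas N"

lemma nr_zmat: "n \<gamma> = zmat (zn \<gamma> 1)"
  by (simp add: nr_def zn_def zmat_mmul zmat_xz xr_eq_xz)

lemma nr_xz_eq: "n \<gamma> = xz \<gamma> 1 \<otimes> (xz (- \<gamma>) (- 1) \<otimes> xz \<gamma> 1)"
  by (simp add: nr_def xr_eq_xz)

lemma msupp_nr: "\<gamma> \<in> \<Phi> \<Longrightarrow> msupp I (n \<gamma>)"
  by (simp add: nr_zmat msupp_zmat msupp_zn)

lemma nr_supp: "\<gamma> \<in> \<Phi> \<Longrightarrow> n \<gamma> i j \<noteq> 0 \<Longrightarrow> wt i = root_refl \<gamma> (wt j)"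
  using zn_supp[of \<gamma> 1 i j] unfolding nr_zmat zmat_def by (metis of_int_0 power_one)

text \<open>The matrix \<open>n \<gamma>\<close> moves weights by the reflection, so passing through
  it replaces a character by its composite with the reflection. The reflection is an involution,
  hence one \<open>k\<close> serves both equations.\<close>

lemma nr_torus_commute:
  assumes g: "\<gamma> \<in> Bas" and h: "h \<in> T"
  shows "\<exists>k\<in>T. n \<gamma> \<otimes> h = k \<otimes> n \<gamma> \<and> h \<otimes> n \<gamma> = n \<gamma> \<otimes> k"
proof -
  obtain t where t: "nz t" "h = tor \<Phi> Bas t" using h by (rule torus_E)
  define s where "s \<delta> = chi t (root_refl \<gamma> \<delta>)" for \<delta>
  have s: "nz s" using chi_nonzero[OF t(1)] by (simp add: s_def)
  have chis: "chi s v = chi t (root_refl \<gamma> v)" if v: "lattice_vec v" for v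
  proof -
    have "root_refl \<gamma> v = (\<Sum>\<delta>\<in>Bas. (fw \<delta> \<bullet> v) *\<^sub>R root_refl \<gamma> \<delta>)"
      by (subst expand[of v]) (simp add: linear_sum[OF root_refl_linear] linear_cmul[OF root_refl_linear])
    also have "\<dots> = (\<Sum>\<delta>\<in>Bas. of_int \<lfloor>fw \<delta> \<bullet> v\<rfloor> *\<^sub>R root_refl \<gamma> \<delta>)"
      by (intro sum.cong) (simp_all add: lattice_floor[OF v])
    finally have "chi t (root_refl \<gamma> v) = (\<Prod>\<delta>\<in>Bas. chi t (root_refl \<gamma> \<delta>) powi \<lfloor>fw \<delta> \<bullet> v\<rfloor>)"
      using chi_sum[OF t(1) finite_base, of "root_refl \<gamma>"] lattice_root root_refl_root base_roots g by simp
    then show ?thesis by (simp add: chi_def[of s] s_def)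
  qed
  note sn = msupp_nr[OF base_roots[OF g]]
  have "n \<gamma> i j * chi t (wt j) = chi s (wt i) * n \<gamma> i j \<and> chi t (wt i) * n \<gamma> i j = n \<gamma> i j * chi s (wt j)" for i j
  proof (cases "n \<gamma> i j = (0::'b)")
    case False
    then have i: "i \<in> I" "j \<in> I" using sn unfolding msupp_def by blast+
    have "wt i = root_refl \<gamma> (wt j)" using nr_supp[OF base_roots[OF g] False] .
    then have "wt j = root_refl \<gamma> (wt i)" by (simp add: root_refl_invol)
    moreover have "chi s (wt i) = chi t (root_refl \<gamma> (wt i))" "chi s (wt j) = chi t (root_refl \<gamma> (wt j))"
      using chis lattice_root[OF wt_I] i by blast+
    ultimately show ?thesis by (simp add: root_refl_invol)
  qed simp
  then have "n \<gamma> \<otimes> h = tor \<Phi> Bas s \<otimes> n \<gamma> \<and> h \<otimes> n \<gamma> = n \<gamma> \<otimes> tor \<Phi> Bas s"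
    by (auto simp: t(2) tor_left[OF sn] tor_right[OF sn] intro!: ext)
  then show ?thesis using torus_I[OF s] by blast
qed

section \<open>The groups \<open>U\<close>, \<open>G\<close> and \<open>B\<close> as generated
  sets\<close>

definition xset :: "'a set \<Rightarrow> ('a idx \<Rightarrow> 'a idx \<Rightarrow> 'f::field) set" where
  "xset R = {xz \<beta> c | \<beta> c. \<beta> \<in> R}"

lemma xset_msupp: "R \<subseteq> \<Phi> \<Longrightarrow> u \<in> xset R \<Longrightarrow> msupp I u"
  by (auto simp: xset_def intro: msupp_xz)

lemma P_sub: "P \<subseteq> \<Phi>" using pos_root by blast

abbreviation U :: "('a idx \<Rightarrow> 'a idx \<Rightarrow> 'f::field) set" where "U \<equiv> uplus \<Phi> Bas N"

lemma uplus_mgen: "U = mgen I (xset P)"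
proof (intro set_eqI iffI)
  fix u :: "'a idx \<Rightarrow> 'a idx \<Rightarrow> 'b"
  show "u \<in> U \<Longrightarrow> u \<in> mgen I (xset P)"
  proof (induction rule: uplus.induct)
    case (up_root \<alpha> u a)
    then show ?case unfolding xr_eq_xz by (intro mgen_step) (auto simp: xset_def)
  qed (rule mgen_id)
  show "u \<in> mgen I (xset P) \<Longrightarrow> u \<in> U"
  proof (induction rule: mgen.induct)
    case (mgen_step x g)
    then obtain \<alpha> a where "\<alpha> \<in> P" "x = xr \<Phi> Bas N \<alpha> a" by (auto simp: xset_def xr_eq_xz)
    then show ?case using mgen_step uplus.up_root by blast
  qed (rule uplus.up_id)
qed

abbreviation G :: "('a idx \<Rightarrow> 'a idx \<Rightarrow> 'f::field) set" where "G \<equiv> chev_group \<Phi> Bas N"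

lemma chev_mgen: "G = mgen I (xset \<Phi> \<union> T)"
proof (intro set_eqI iffI)
  fix u :: "'a idx \<Rightarrow> 'a idx \<Rightarrow> 'b"
  show "u \<in> G \<Longrightarrow> u \<in> mgen I (xset \<Phi> \<union> T)"
  proof (induction rule: chev_group.induct)
    case (cg_root \<alpha> u a)
    then show ?case unfolding xr_eq_xz by (intro mgen_step) (auto simp: xset_def)
  next
    case (cg_tor h g)
    then show ?case by (intro mgen_step) auto
  qed (rule mgen_id)
  show "u \<in> mgen I (xset \<Phi> \<union> T) \<Longrightarrow> u \<in> G"
  proof (induction rule: mgen.induct)
    case (mgen_step x g)
    then consider "x \<in> T" | \<alpha> a where "\<alpha> \<in> \<Phi>" "x = xr \<Phi> Bas N \<alpha> a" by (auto simp: xset_def xr_eq_xz)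
    then show ?case using mgen_step chev_group.cg_root chev_group.cg_tor by cases blast+
  qed (rule chev_group.cg_id)
qed

lemma xset_inv: "R \<subseteq> \<Phi> \<Longrightarrow> u \<in> xset R \<Longrightarrow> \<exists>v\<in>xset R. u \<otimes> v = idm I \<and> v \<otimes> u = idm I"
  unfolding xset_def using xz_inverse by blast

lemma U_msupp: "u \<in> U \<Longrightarrow> msupp I u"
  unfolding uplus_mgen using mgen_msupp xset_msupp[OF P_sub] by blast

lemma U_mult: "u \<in> U \<Longrightarrow> v \<in> U \<Longrightarrow> u \<otimes> v \<in> U"
  unfolding uplus_mgen using mgen_mmul[OF finite_I xset_msupp[OF P_sub]] by blast

lemma U_inv: "u \<in> U \<Longrightarrow> \<exists>v\<in>U. u \<otimes> v = idm I \<and> v \<otimes> u = idm I"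
  unfolding uplus_mgen using mgen_inverse[OF finite_I xset_msupp[OF P_sub] xset_inv[OF P_sub]] by blast

lemma U_gen: "\<beta> \<in> P \<Longrightarrow> xz \<beta> a \<in> U"
  unfolding uplus_mgen by (rule mgen_gen[OF finite_I xset_msupp[OF P_sub]]) (auto simp: xset_def)

lemma gens_msupp: "x \<in> xset \<Phi> \<union> T \<Longrightarrow> msupp I x"
  using xset_msupp[OF subset_refl] torus_msupp by blast

lemma gens_inv: "x \<in> xset \<Phi> \<union> T \<Longrightarrow> \<exists>y\<in>xset \<Phi> \<union> T. x \<otimes> y = idm I \<and> y \<otimes> x = idm I"
  using xset_inv[OF subset_refl] torus_inv by blast

lemma G_msupp: "g \<in> G \<Longrightarrow> msupp I g"
  unfolding chev_mgen using mgen_msupp gens_msupp by blast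

lemma G_mult: "g \<in> G \<Longrightarrow> h \<in> G \<Longrightarrow> g \<otimes> h \<in> G"
  unfolding chev_mgen using mgen_mmul[OF finite_I gens_msupp] by blast

lemma G_inv: "g \<in> G \<Longrightarrow> \<exists>h\<in>G. g \<otimes> h = idm I \<and> h \<otimes> g = idm I"
  unfolding chev_mgen using mgen_inverse[OF finite_I gens_msupp gens_inv] by blast

lemma G_xz: "\<beta> \<in> \<Phi> \<Longrightarrow> xz \<beta> a \<in> G"
  unfolding chev_mgen by (rule mgen_gen[OF finite_I gens_msupp]) (auto simp: xset_def)

lemma G_torus: "h \<in> T \<Longrightarrow> h \<in> G"
  unfolding chev_mgen by (rule mgen_gen[OF finite_I gens_msupp]) auto

lemma G_one: "idm I \<in> G" by (rule chev_group.cg_id)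

lemma U_sub_G: "u \<in> U \<Longrightarrow> u \<in> G"
  by (induction rule: uplus.induct) (auto intro: G_one G_mult G_xz pos_root simp: xr_eq_xz)

text \<open>A torus element only rescales the parameters of the root elements that it passes, so any
  group generated by full root groups is normalized.\<close>

lemma torus_mgen:
  assumes "h \<in> T" "R \<subseteq> \<Phi>" "u \<in> mgen I (xset R)"
  shows "\<exists>v\<in>mgen I (xset R). h \<otimes> u = v \<otimes> h" "\<exists>v\<in>mgen I (xset R). u \<otimes> h = h \<otimes> v"
proof -
  note sh = torus_msupp[OF assms(1)]
  show "\<exists>v\<in>mgen I (xset R). h \<otimes> u = v \<otimes> h"
    using assms(3)
  proof induction
    case mgen_id
    then show ?case using mmul_idm_left[OF finite_I sh] mmul_idm_right[OF finite_I sh] mgen.mgen_id by metis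
  next
    case (mgen_step x g)
    then obtain \<beta> a where x: "x = xz \<beta> a" "\<beta> \<in> R" by (auto simp: xset_def)
    obtain c where c: "h \<otimes> xz \<beta> a = xz \<beta> (c * a) \<otimes> h" using torus_xz[OF assms(1)] x assms(2) by blast
    obtain v where v: "v \<in> mgen I (xset R)" "h \<otimes> g = v \<otimes> h" using mgen_step by blast
    have "h \<otimes> (x \<otimes> g) = (xz \<beta> (c * a) \<otimes> v) \<otimes> h" using c v x by (metis mmul_assoc)
    moreover have "xz \<beta> (c * a) \<otimes> v \<in> mgen I (xset R)" using v x by (intro mgen.mgen_step) (auto simp: xset_def)
    ultimately show ?case by blast
  qed
  show "\<exists>v\<in>mgen I (xset R). u \<otimes> h = h \<otimes> v"
    using assms(3)
  proof induction
    case mgen_id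
    then show ?case using mmul_idm_left[OF finite_I sh] mmul_idm_right[OF finite_I sh] mgen.mgen_id by metis
  next
    case (mgen_step x g)
    then obtain \<beta> a where x: "x = xz \<beta> a" "\<beta> \<in> R" by (auto simp: xset_def)
    obtain a' where c: "xz \<beta> a \<otimes> h = h \<otimes> xz \<beta> a'" using xz_torus[OF assms(1)] x assms(2) by blast
    obtain v where v: "v \<in> mgen I (xset R)" "g \<otimes> h = h \<otimes> v" using mgen_step by blast
    have "(x \<otimes> g) \<otimes> h = h \<otimes> (xz \<beta> a' \<otimes> v)" using c v x by (metis mmul_assoc)
    moreover have "xz \<beta> a' \<otimes> v \<in> mgen I (xset R)" using v x by (intro mgen.mgen_step) (auto simp: xset_def)
    ultimately show ?case by blast
  qed
qed

abbreviation B :: "('a idx \<Rightarrow> 'a idx \<Rightarrow> 'f::field) set" where "B \<equiv> borel \<Phi> Bas N"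

lemma B_I: "h \<in> T \<Longrightarrow> u \<in> U \<Longrightarrow> h \<otimes> u \<in> B"
  by (auto simp: borel_def)

lemma B_E: "b \<in> B \<Longrightarrow> (\<And>h u. h \<in> T \<Longrightarrow> u \<in> U \<Longrightarrow> b = h \<otimes> u \<Longrightarrow> thesis) \<Longrightarrow> thesis"
  by (auto simp: borel_def)

lemma B_U: "u \<in> U \<Longrightarrow> u \<in> B"
  using B_I[OF torus_one, of u] by (simp add: mmul_idm_left[OF finite_I U_msupp])

lemma B_T: "h \<in> T \<Longrightarrow> h \<in> B"
  using B_I[OF _ uplus.up_id] mmul_idm_right[OF finite_I torus_msupp] by metis

lemma B_xz: "\<beta> \<in> P \<Longrightarrow> xz \<beta> a \<in> B"
  by (intro B_U U_gen)

lemma B_one: "idm I \<in> B"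
  by (rule B_T[OF torus_one])

lemma B_sub_G: "b \<in> B \<Longrightarrow> b \<in> G"
  by (elim B_E) (simp add: G_mult G_torus U_sub_G)

lemma B_msupp: "b \<in> B \<Longrightarrow> msupp I b"
  using B_sub_G G_msupp by blast

lemma B_mult: "b \<in> B \<Longrightarrow> c \<in> B \<Longrightarrow> b \<otimes> c \<in> B"
proof (elim B_E)
  fix h u k v assume a: "h \<in> T" "u \<in> U" "k \<in> T" "v \<in> U" and e: "b = h \<otimes> u" "c = k \<otimes> v"
  obtain u' where u': "u' \<in> U" "u \<otimes> k = k \<otimes> u'" using torus_mgen(2)[OF a(3) P_sub] a(2) unfolding uplus_mgen by blast
  have "b \<otimes> c = (h \<otimes> k) \<otimes> (u' \<otimes> v)" unfolding e using u' by (metis mmul_assoc)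
  then show ?thesis using B_I[OF torus_mult[OF a(1,3)] U_mult[OF u'(1) a(4)]] by simp
qed

lemma inv_prod:
  fixes a a' b b' :: "'a idx \<Rightarrow> 'a idx \<Rightarrow> 'r::comm_semiring_1"
  assumes "msupp I a" "msupp I a'" "msupp I b" "msupp I b'" "a \<otimes> a' = idm I" "a' \<otimes> a = idm I" "b \<otimes> b' = idm I" "b' \<otimes> b = idm I"
  shows "(a \<otimes> b) \<otimes> (b' \<otimes> a') = idm I" "(b' \<otimes> a') \<otimes> (a \<otimes> b) = idm I"
  using assms by (metis mmul_assoc mmul_idm_left finite_I)+

lemma B_inv: "b \<in> B \<Longrightarrow> \<exists>c\<in>B. b \<otimes> c = idm I \<and> c \<otimes> b = idm I"
proof (elim B_E)
  fix h u assume a: "h \<in> T" "u \<in> U" and e: "b = h \<otimes> u"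
  obtain k where k: "k \<in> T" "h \<otimes> k = idm I" "k \<otimes> h = idm I" using torus_inv[OF a(1)] by blast
  obtain v where v: "v \<in> U" "u \<otimes> v = idm I" "v \<otimes> u = idm I" using U_inv[OF a(2)] by blast
  have "v \<otimes> k \<in> B" using B_mult[OF B_U[OF v(1)] B_T[OF k(1)]] .
  then show ?thesis unfolding e
    using inv_prod[OF torus_msupp[OF a(1)] torus_msupp[OF k(1)] U_msupp[OF a(2)] U_msupp[OF v(1)] k(2,3) v(2,3)] by blast
qed

section \<open>Unipotent radicals of minimal parabolic subgroups and rank one relations\<close>

definition Urad :: "'a \<Rightarrow> ('a idx \<Rightarrow> 'a idx \<Rightarrow> 'f::field) set" where
  "Urad \<gamma> = mgen I (xset (P - {\<gamma>}))"

lemma Urad_sub: "P - {\<gamma>} \<subseteq> \<Phi>" using P_sub by blast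

lemma Urad_U: "u \<in> Urad \<gamma> \<Longrightarrow> u \<in> U"
  unfolding Urad_def uplus_mgen by (rule mgen_mono) (auto simp: xset_def)

text \<open>The conjugate of a root element for \<open>\<beta>\<close> is a product of root elements
  for roots \<open>p \<eta> + q \<beta>\<close> with \<open>q \<ge> 1\<close>. Such a root keeps a
  positive coefficient at some simple root other than \<open>\<gamma>\<close>, so it is positive and
  different from \<open>\<gamma>\<close>.\<close>

lemma Urad_conj:
  assumes g: "\<gamma> \<in> Bas" and x: "\<eta> = \<gamma> \<or> \<eta> = - \<gamma>" and u: "u \<in> Urad \<gamma>"
  shows "\<exists>v\<in>Urad \<gamma>. xz \<eta> t \<otimes> u = v \<otimes> xz \<eta> t"
  using u unfolding Urad_def
proof induction
  have er: "\<eta> \<in> \<Phi>" using x base_roots[OF g] root_minus by blast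
  note s = msupp_xz[OF er, of t]
  {
    case mgen_id
    then show ?case using mmul_idm_left[OF finite_I s] mmul_idm_right[OF finite_I s] mgen.mgen_id by metis
  next
    case (mgen_step y g)
    then obtain \<beta> a where y: "y = xz \<beta> a" "\<beta> \<in> P" "\<beta> \<noteq> \<gamma>" by (auto simp: xset_def)
    obtain v where v: "v \<in> mgen I (xset (P - {\<gamma>}))" "xz \<eta> t \<otimes> g = v \<otimes> xz \<eta> t" using mgen_step by blast
    have "\<beta> \<noteq> - \<gamma>" using y(2) not_pos_and_neg[OF base_pos[OF assms(1)]] by auto
    then have ne: "\<beta> \<noteq> \<eta>" "\<beta> \<noteq> - \<eta>" using x y by auto
    obtain \<delta> where d: "\<delta> \<in> Bas" "\<delta> \<noteq> \<gamma>" "fw \<delta> \<bullet> \<beta> > 0" using pos_other_coord[OF y(2) assms(1) y(3)] by blast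
    let ?w = "xz \<eta> t \<otimes> (xz \<beta> a \<otimes> xz \<eta> (- t))"
    have "{xz \<zeta> c | \<zeta> c. \<zeta> \<in> \<Phi> \<and> (\<exists>p q::nat. q \<ge> 1 \<and> \<zeta> = of_nat p *\<^sub>R \<eta> + of_nat q *\<^sub>R \<beta>)} \<subseteq> xset (P - {\<gamma>})"
    proof -
      have "\<zeta> \<in> P - {\<gamma>}" if "\<zeta> \<in> \<Phi>" "q \<ge> 1" "\<zeta> = of_nat p *\<^sub>R \<eta> + of_nat q *\<^sub>R \<beta>" for \<zeta> and p q :: nat
      proof -
        have "fw \<delta> \<bullet> \<eta> = 0" using x d(1,2) assms(1) fw_base by auto
        then have "fw \<delta> \<bullet> \<zeta> > 0" using that(2,3) d(3) by (simp add: inner_add_right)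
        then show ?thesis using pos_if_coord[OF that(1) d(1)] fw_base[OF assms(1), of \<delta>] d(2) by auto
      qed
      then show ?thesis unfolding xset_def by blast
    qed
    then have w: "?w \<in> mgen I (xset (P - {\<gamma>}))"
      using conj_xz_gen[OF er pos_root[OF y(2)] ne, of t a] mgen_mono by blast
    have "?w \<otimes> xz \<eta> t = xz \<eta> t \<otimes> xz \<beta> a"
      by (simp add: mmul_assoc xz_inverse(2)[OF er] mmul_idm_right[OF finite_I msupp_xz[OF pos_root[OF y(2)]]])
    then have "xz \<eta> t \<otimes> (y \<otimes> g) = ?w \<otimes> (xz \<eta> t \<otimes> g)" unfolding y(1) mmul_assoc[symmetric] by simp
    then have "xz \<eta> t \<otimes> (y \<otimes> g) = (?w \<otimes> v) \<otimes> xz \<eta> t" unfolding v(2) by (simp only: mmul_assoc)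
    moreover have "?w \<otimes> v \<in> mgen I (xset (P - {\<gamma>}))"
      by (rule mgen_mmul[OF finite_I xset_msupp[OF Urad_sub] w v(1)])
    ultimately show ?case by blast
  }
qed

lemma Urad_nr:
  assumes g: "\<gamma> \<in> Bas" and u: "u \<in> Urad \<gamma>"
  shows "\<exists>v\<in>Urad \<gamma>. n \<gamma> \<otimes> u = v \<otimes> n \<gamma>"
proof -
  obtain v1 where v1: "v1 \<in> Urad \<gamma>" "xz \<gamma> 1 \<otimes> u = v1 \<otimes> xz \<gamma> 1" using Urad_conj[OF g _ u] by blast
  obtain v2 where v2: "v2 \<in> Urad \<gamma>" "xz (- \<gamma>) (- 1) \<otimes> v1 = v2 \<otimes> xz (- \<gamma>) (- 1)" using Urad_conj[OF g _ v1(1)] by blast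
  obtain v3 where v3: "v3 \<in> Urad \<gamma>" "xz \<gamma> 1 \<otimes> v2 = v3 \<otimes> xz \<gamma> 1" using Urad_conj[OF g _ v2(1)] by blast
  have "n \<gamma> \<otimes> u = xz \<gamma> 1 \<otimes> (xz (- \<gamma>) (- 1) \<otimes> (xz \<gamma> 1 \<otimes> u))" unfolding nr_xz_eq by (simp only: mmul_assoc)
  also have "\<dots> = xz \<gamma> 1 \<otimes> ((xz (- \<gamma>) (- 1) \<otimes> v1) \<otimes> xz \<gamma> 1)" unfolding v1(2) by (simp only: mmul_assoc)
  also have "\<dots> = (xz \<gamma> 1 \<otimes> v2) \<otimes> (xz (- \<gamma>) (- 1) \<otimes> xz \<gamma> 1)" unfolding v2(2) by (simp only: mmul_assoc)
  also have "\<dots> = v3 \<otimes> n \<gamma>" unfolding v3(2) nr_xz_eq by (simp only: mmul_assoc)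
  finally have "n \<gamma> \<otimes> u = v3 \<otimes> n \<gamma>" .
  then show ?thesis using v3(1) by blast
qed

lemma U_split:
  assumes g: "\<gamma> \<in> Bas" and u: "u \<in> U"
  shows "\<exists>v\<in>Urad \<gamma>. \<exists>a. u = v \<otimes> xz \<gamma> a"
  using u unfolding uplus_mgen
proof induction
  case mgen_id
  have "idm I = idm I \<otimes> xz \<gamma> 0" using mmul_idm_left[OF finite_I msupp_idm] xz_0[OF base_roots[OF g]] by metis
  then show ?case unfolding Urad_def using mgen.mgen_id by blast
next
  case (mgen_step x u)
  then obtain v a where v: "v \<in> Urad \<gamma>" "u = v \<otimes> xz \<gamma> a" by blast
  obtain \<beta> b where x: "x = xz \<beta> b" "\<beta> \<in> P" using mgen_step by (auto simp: xset_def)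
  show ?case
  proof (cases "\<beta> = \<gamma>")
    case True
    obtain v' where v': "v' \<in> Urad \<gamma>" "xz \<gamma> b \<otimes> v = v' \<otimes> xz \<gamma> b" using Urad_conj[OF g _ v(1)] by blast
    have "x \<otimes> u = v' \<otimes> xz \<gamma> (b + a)" unfolding v x True using v'(2) xz_add[OF base_roots[OF g], of b a] by (metis mmul_assoc)
    then show ?thesis using v' by blast
  next
    case False
    then have "x \<in> xset (P - {\<gamma>})" using x by (auto simp: xset_def)
    then have "x \<otimes> v \<in> Urad \<gamma>" using v(1) unfolding Urad_def by (rule mgen.mgen_step)
    moreover have "x \<otimes> u = (x \<otimes> v) \<otimes> xz \<gamma> a" using v by (simp add: mmul_assoc)
    ultimately show ?thesis by blast
  qed
qed

text \<open>\<open>B\<close> is the product of the torus, \<open>Urad \<gamma>\<close> and the root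
  group of \<open>\<gamma>\<close>. The first two are normalized by \<open>n \<gamma>\<close>, so a
  single root element remains on the right.\<close>

lemma nr_B:
  assumes g: "\<gamma> \<in> Bas" and b: "b \<in> B"
  shows "\<exists>c\<in>B. \<exists>a. n \<gamma> \<otimes> b = c \<otimes> (n \<gamma> \<otimes> xz \<gamma> a)"
proof -
  obtain h u where h: "h \<in> T" "u \<in> U" "b = h \<otimes> u" using b by (rule B_E)
  obtain v a where v: "v \<in> Urad \<gamma>" "u = v \<otimes> xz \<gamma> a" using U_split[OF g h(2)] by blast
  obtain k where k: "k \<in> T" "n \<gamma> \<otimes> h = k \<otimes> n \<gamma>" using nr_torus_commute[OF g h(1)] by blast
  obtain w where w: "w \<in> Urad \<gamma>" "n \<gamma> \<otimes> v = w \<otimes> n \<gamma>" using Urad_nr[OF g v(1)] by blast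
  have "n \<gamma> \<otimes> b = (n \<gamma> \<otimes> h) \<otimes> (v \<otimes> xz \<gamma> a)" unfolding h(3) v(2) by (simp only: mmul_assoc)
  also have "\<dots> = k \<otimes> ((n \<gamma> \<otimes> v) \<otimes> xz \<gamma> a)" unfolding k(2) by (simp only: mmul_assoc)
  also have "\<dots> = (k \<otimes> w) \<otimes> (n \<gamma> \<otimes> xz \<gamma> a)" unfolding w(2) by (simp only: mmul_assoc)
  finally have "n \<gamma> \<otimes> b = (k \<otimes> w) \<otimes> (n \<gamma> \<otimes> xz \<gamma> a)" .
  moreover have "k \<otimes> w \<in> B" by (rule B_I[OF k(1) Urad_U[OF w(1)]])
  ultimately show ?thesis
    by (metis (no_types, lifting))
qed

text \<open>Conjugating the representative of the reflection by the diagonal automorphism that scales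
  the root by \<open>-1/c\<close> turns it into \<open>x(-1/c) x'(c) x(-1/c)\<close>, so no computation in rank one is needed.\<close>

lemma xz_neg_decomp:
  assumes g: "\<gamma> \<in> Bas" and c: "c \<noteq> 0"
  shows "\<exists>h\<in>T. \<exists>k\<in>T. h \<otimes> k = idm I \<and> xz (- \<gamma>) c = xz \<gamma> (1 / c) \<otimes> (h \<otimes> (n \<gamma> \<otimes> (k \<otimes> xz \<gamma> (1 / c))))"
proof -
  have gr: "\<gamma> \<in> \<Phi>" "- \<gamma> \<in> \<Phi>" using base_roots[OF g] root_minus by blast+
  define t where "t = (\<lambda>\<delta>. if \<delta> = \<gamma> then - 1 / c else 1)"
  have t: "nz t" using c by (simp add: t_def)
  define h where "h = tor \<Phi> Bas t"
  have h: "h \<in> T" using torus_I[OF t] by (simp add: h_def)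
  obtain k where k: "k \<in> T" "h \<otimes> k = idm I" using torus_inv[OF h] by blast
  have "chi t \<gamma> = (\<Prod>\<delta>\<in>Bas. if \<delta> = \<gamma> then - 1 / c else 1)"
    unfolding chi_def by (intro prod.cong) (auto simp: t_def fw_base[OF g])
  then have ch: "chi t \<gamma> = - 1 / c" using g finite_base by simp
  have "chi t (\<gamma> + - \<gamma>) = chi t \<gamma> * chi t (- \<gamma>)"
    using chi_add[OF t] lattice_root gr by blast
  then have chm: "chi t (- \<gamma>) = - c" using c ch by (simp add: chi_0 field_simps)
  have 1: "h \<otimes> xz \<gamma> 1 = xz \<gamma> (- 1 / c) \<otimes> h" using tor_xz[OF t gr(1), of 1] ch by (simp add: h_def)
  have 2: "h \<otimes> xz (- \<gamma>) (- 1) = xz (- \<gamma>) c \<otimes> h" using tor_xz[OF t gr(2), of "- 1"] chm by (simp add: h_def)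
  have "h \<otimes> n \<gamma> = (h \<otimes> xz \<gamma> 1) \<otimes> (xz (- \<gamma>) (- 1) \<otimes> xz \<gamma> 1)" unfolding nr_xz_eq by (simp only: mmul_assoc)
  also have "\<dots> = xz \<gamma> (- 1 / c) \<otimes> ((h \<otimes> xz (- \<gamma>) (- 1)) \<otimes> xz \<gamma> 1)" unfolding 1 by (simp only: mmul_assoc)
  also have "\<dots> = xz \<gamma> (- 1 / c) \<otimes> (xz (- \<gamma>) c \<otimes> (h \<otimes> xz \<gamma> 1))" unfolding 2 by (simp only: mmul_assoc)
  finally have hn: "h \<otimes> n \<gamma> = xz \<gamma> (- 1 / c) \<otimes> (xz (- \<gamma>) c \<otimes> (xz \<gamma> (- 1 / c) \<otimes> h))" unfolding 1 .
  have "h \<otimes> (n \<gamma> \<otimes> (k \<otimes> xz \<gamma> (1 / c))) = (h \<otimes> n \<gamma>) \<otimes> (k \<otimes> xz \<gamma> (1 / c))" by (simp only: mmul_assoc)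
  also have "\<dots> = xz \<gamma> (- 1 / c) \<otimes> (xz (- \<gamma>) c \<otimes> (xz \<gamma> (- 1 / c) \<otimes> ((h \<otimes> k) \<otimes> xz \<gamma> (1 / c))))"
    unfolding hn by (simp only: mmul_assoc)
  also have "\<dots> = xz \<gamma> (- 1 / c) \<otimes> xz (- \<gamma>) c"
    by (simp add: k(2) mmul_idm_left[OF finite_I msupp_xz[OF gr(1)]] mmul_idm_right[OF finite_I msupp_xz[OF gr(2)]] xz_inverse(2)[OF gr(1)])
  finally have "xz \<gamma> (1 / c) \<otimes> (h \<otimes> (n \<gamma> \<otimes> (k \<otimes> xz \<gamma> (1 / c)))) = (xz \<gamma> (1 / c) \<otimes> xz \<gamma> (- (1 / c))) \<otimes> xz (- \<gamma>) c"
    by (simp add: mmul_assoc)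
  then have "xz \<gamma> (1 / c) \<otimes> (h \<otimes> (n \<gamma> \<otimes> (k \<otimes> xz \<gamma> (1 / c)))) = xz (- \<gamma>) c"
    by (simp add: xz_inverse(1)[OF gr(1)] mmul_idm_left[OF finite_I msupp_xz[OF gr(2)]])
  then show ?thesis using h k by metis
qed

lemma zmat_zn_minus: "zmat (zn \<gamma> (- 1)) = xz \<gamma> (- 1) \<otimes> (xz (- \<gamma>) 1 \<otimes> xz \<gamma> (- 1))"
  by (simp add: zn_def zmat_mmul zmat_xz)

text \<open>The inverse of \<open>n \<gamma>\<close> is the same product with opposite parameters.
  Decomposing its middle factor by \<open>xz_neg_decomp\<close> with parameter 1 cancels the outer
  factors and leaves \<open>n \<gamma>\<close> between two torus elements.\<close>

lemma nr_inv:
  assumes g: "\<gamma> \<in> Bas"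
  shows "\<exists>h\<in>(T :: ('a idx \<Rightarrow> 'a idx \<Rightarrow> 'f::field) set). n \<gamma> \<otimes> (h \<otimes> n \<gamma>) = idm I \<and> (h \<otimes> n \<gamma>) \<otimes> n \<gamma> = idm I"
proof -
  have gr: "\<gamma> \<in> \<Phi>" "- \<gamma> \<in> \<Phi>" using base_roots[OF g] root_minus by blast+
  let ?m = "xz \<gamma> (- 1::'f) \<otimes> (xz (- \<gamma>) 1 \<otimes> xz \<gamma> (- 1))"
  obtain h k :: "'a idx \<Rightarrow> 'a idx \<Rightarrow> 'f" where h: "h \<in> T" "k \<in> T" "xz (- \<gamma>) 1 = xz \<gamma> 1 \<otimes> (h \<otimes> (n \<gamma> \<otimes> (k \<otimes> xz \<gamma> 1)))"
    using xz_neg_decomp[OF g, of "1::'f"] by auto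
  have s: "msupp I (h \<otimes> (n \<gamma> \<otimes> k))" by (intro msupp_mmul torus_msupp msupp_nr h gr)
  have "?m = (xz \<gamma> (- 1) \<otimes> xz \<gamma> 1) \<otimes> ((h \<otimes> (n \<gamma> \<otimes> k)) \<otimes> (xz \<gamma> 1 \<otimes> xz \<gamma> (- 1)))"
    unfolding h(3) by (simp add: mmul_assoc)
  also have "\<dots> = h \<otimes> (n \<gamma> \<otimes> k)"
    by (simp add: xz_inverse[OF gr(1)] mmul_idm_left[OF finite_I s] mmul_idm_right[OF finite_I s])
  finally have m: "?m = h \<otimes> (n \<gamma> \<otimes> k)" .
  obtain k' where k': "k' \<in> T" "n \<gamma> \<otimes> k = k' \<otimes> n \<gamma>" using nr_torus_commute[OF g h(2)] by blast
  have m2: "?m = (h \<otimes> k') \<otimes> n \<gamma>" unfolding m k'(2) mmul_assoc ..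
  have "?m \<otimes> n \<gamma> = zmat (zn \<gamma> (- 1) \<otimes> zn \<gamma> 1)" by (simp add: zmat_mmul zmat_zn_minus nr_zmat)
  then have i1: "?m \<otimes> n \<gamma> = idm I" using zn_inverse[OF gr(1), of 1] by (simp add: zmat_idm)
  have "n \<gamma> \<otimes> ?m = zmat (zn \<gamma> 1 \<otimes> zn \<gamma> (- 1))" by (simp add: zmat_mmul zmat_zn_minus nr_zmat)
  then have i2: "n \<gamma> \<otimes> ?m = idm I" using zn_inverse[OF gr(1), of "- 1"] by (simp add: zmat_idm)
  show ?thesis
    by (rule bexI[OF _ torus_mult[OF h(1) k'(1)]]) (use i1 i2 in \<open>simp add: m2[symmetric]\<close>)
qed

lemma nr_sq:
  assumes g: "\<gamma> \<in> Bas" shows "n \<gamma> \<otimes> n \<gamma> \<in> (T :: ('a idx \<Rightarrow> 'a idx \<Rightarrow> 'f::field) set)"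
proof -
  obtain h :: "'a idx \<Rightarrow> 'a idx \<Rightarrow> 'f" where h: "h \<in> T" "(h \<otimes> n \<gamma>) \<otimes> n \<gamma> = idm I" using nr_inv[OF g] by blast
  obtain k where k: "k \<in> T" "k \<otimes> h = idm I" using torus_inv[OF h(1)] by blast
  have s: "msupp I (n \<gamma> \<otimes> n \<gamma> :: 'a idx \<Rightarrow> 'a idx \<Rightarrow> 'f)" by (intro msupp_mmul msupp_nr base_roots g)
  have "n \<gamma> \<otimes> n \<gamma> = (k \<otimes> h) \<otimes> (n \<gamma> \<otimes> n \<gamma>)" by (simp add: k(2) mmul_idm_left[OF finite_I s])
  also have "\<dots> = k \<otimes> ((h \<otimes> n \<gamma>) \<otimes> n \<gamma>)" by (simp add: mmul_assoc)
  also have "\<dots> = k" by (simp add: h(2) mmul_idm_right[OF finite_I torus_msupp[OF k(1)]])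
  finally show ?thesis using k(1) by simp
qed

end

section \<open>Bruhat cells\<close>

context chevalley
begin

abbreviation nw :: "'a list \<Rightarrow> 'a idx \<Rightarrow> 'a idx \<Rightarrow> 'f::field" where "nw \<equiv> nword \<Phi> Bas N"

lemma nw_Nil: "nw [] = idm I" by (simp add: nword_def)
lemma nw_Cons: "nw (a # ws) = n a \<otimes> nw ws" by (simp add: nword_def)

lemma msupp_nw: "set ws \<subseteq> Bas \<Longrightarrow> msupp I (nw ws)"
  by (induction ws) (auto simp: nw_Nil nw_Cons msupp_idm base_roots intro!: msupp_mmul msupp_nr)

lemma nw_append: "set us \<subseteq> Bas \<Longrightarrow> set vs \<subseteq> Bas \<Longrightarrow> nw (us @ vs) = nw us \<otimes> nw vs"
  by (induction us) (simp_all add: nw_Nil nw_Cons mmul_assoc mmul_idm_left[OF finite_I msupp_nw])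

lemma nw_single: "\<gamma> \<in> Bas \<Longrightarrow> nw [\<gamma>] = n \<gamma>"
  by (simp add: nw_Cons nw_Nil mmul_idm_right[OF finite_I msupp_nr] base_roots)

text \<open>The integral lift of \<open>nword\<close>; it keeps the automorphism property and the
  integrality of entries available for whole words.\<close>

definition zw :: "'a list \<Rightarrow> 'a idx \<Rightarrow> 'a idx \<Rightarrow> int" where
  "zw ws = foldr (\<lambda>a M. zn a 1 \<otimes> M) ws (idm I)"

lemma nw_zmat: "nw ws = zmat (zw ws)"
  by (induction ws) (simp_all add: nw_Nil nw_Cons zw_def zmat_idm zmat_mmul nr_zmat)

lemma aut_idm: "aut (idm I)"
  unfolding aut_def
proof (intro ballI)
  fix x y t assume i: "x \<in> I" "y \<in> I" "t \<in> I"
  have "(\<Sum>m\<in>I. idm I t m * br x y m) = (\<Sum>m\<in>I. if m = t then br x y m else 0)"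
    by (intro sum.cong) (auto simp: idm_def)
  then show "(\<Sum>m\<in>I. idm I t m * br x y m) = bb (idm I) (idm I) x y t" using i finite_I by (simp add: bb_idm)
qed

lemma zw_aut: "set ws \<subseteq> Bas \<Longrightarrow> aut (zw ws) \<and> msupp I (zw ws)"
  by (induction ws) (auto simp: zw_def aut_idm msupp_idm base_roots intro!: aut_mmul aut_zn msupp_mmul msupp_zn)

lemma zw_supp: "set ws \<subseteq> Bas \<Longrightarrow> zw ws i j \<noteq> 0 \<Longrightarrow> wt i = wword ws (wt j)"
proof (induction ws arbitrary: i)
  case Nil then show ?case by (auto simp: zw_def idm_def wword_Nil split: if_splits)
next
  case (Cons a ws)
  then have "(zn a 1 \<otimes> zw ws) i j \<noteq> 0" by (simp add: zw_def)
  then obtain k where "zn a 1 i k \<noteq> 0" "zw ws k j \<noteq> 0" by (rule mmul_nonzeroE)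
  then show ?case using Cons zn_supp[of a 1 i k] base_roots by (auto simp: wword_Cons)
qed

lemma zw_col: "set ws \<subseteq> Bas \<Longrightarrow> \<beta> \<in> \<Phi> \<Longrightarrow>
   \<exists>\<epsilon>::int. (\<epsilon> = 1 \<or> \<epsilon> = -1) \<and> (\<forall>t. zw ws t (Inl \<beta>) = (if t = Inl (wword ws \<beta>) then \<epsilon> else 0))"
proof (induction ws)
  case Nil then show ?case by (intro exI[of _ 1]) (auto simp: zw_def idm_def wword_Nil Inl_I)
next
  case (Cons a ws)
  let ?b = "wword ws \<beta>"
  have a: "a \<in> \<Phi>" "?b \<in> \<Phi>" using Cons.prems base_roots wword_root[of ws \<beta>] by auto
  obtain \<epsilon> :: int where e: "\<epsilon> = 1 \<or> \<epsilon> = -1" "\<And>t. zw ws t (Inl \<beta>) = (if t = Inl ?b then \<epsilon> else 0)" using Cons by auto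
  obtain \<delta> :: int where d: "\<delta> = 1 \<or> \<delta> = -1" "\<And>t. zn a 1 t (Inl ?b) = (if t = Inl (root_refl a ?b) then \<delta> else 0)"
    using zn_col_root[OF a, of 1] by auto
  have "zw (a # ws) t (Inl \<beta>) = (\<Sum>k\<in>I. zn a 1 t k * zw ws k (Inl \<beta>))" for t
    by (simp add: zw_def mmul_def)
  then have "zw (a # ws) t (Inl \<beta>) = zn a 1 t (Inl ?b) * \<epsilon>" for t
    using a finite_I by (simp add: e(2) if_distrib Inl_I cong: if_cong)
  then show ?case using e(1) d(1) by (intro exI[of _ "\<delta> * \<epsilon>"]) (auto simp: d(2) wword_Cons)
qed

lemma nw_supp: "set ws \<subseteq> Bas \<Longrightarrow> nw ws i j \<noteq> 0 \<Longrightarrow> wt i = wword ws (wt j)"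
  using zw_supp[of ws i j] unfolding nw_zmat zmat_def by (metis of_int_0)

lemma nw_root_entry: "set ws \<subseteq> Bas \<Longrightarrow> \<beta> \<in> \<Phi> \<Longrightarrow> (nw ws (Inl (wword ws \<beta>)) (Inl \<beta>) :: 'f::field) \<noteq> 0"
  using zw_col[of ws \<beta>] by (auto simp: nw_zmat zmat_def)

text \<open>The sign from \<open>zw_col\<close> is invertible in every field, so a nontrivial root
  element stays nontrivial. The displacement argument depends on this.\<close>

lemma nw_xz:
  assumes "set ws \<subseteq> Bas" "\<beta> \<in> \<Phi>"
  shows "\<exists>a'. (a' = 0 \<longleftrightarrow> a = 0) \<and> nw ws \<otimes> xz \<beta> a = xz (wword ws \<beta>) a' \<otimes> nw ws"
proof -
  obtain \<epsilon> :: int where e: "\<epsilon> = 1 \<or> \<epsilon> = -1" "\<And>t. zw ws t (Inl \<beta>) = (if t = Inl (wword ws \<beta>) then \<epsilon> else 0)"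
    using zw_col[OF assms] by blast
  have "wword ws \<beta> \<in> \<Phi>" using assms base_roots wword_root by blast
  then have "nw ws \<otimes> xz \<beta> a = xz (wword ws \<beta>) (of_int \<epsilon> * a) \<otimes> nw ws"
    unfolding nw_zmat using conj_xz[OF conjunct1[OF zw_aut] conjunct2[OF zw_aut] assms(2) _ e(2)] assms(1) by blast
  then show ?thesis using e(1) by (intro exI[of _ "of_int \<epsilon> * a"]) auto
qed

lemma xz_nw:
  assumes "set ws \<subseteq> Bas" "\<beta> \<in> \<Phi>"
  shows "\<exists>a'. (a' = 0 \<longleftrightarrow> a = 0) \<and> xz \<beta> a \<otimes> nw ws = nw ws \<otimes> xz (wword (rev ws) \<beta>) a'"
proof -
  let ?b = "wword (rev ws) \<beta>"
  have b: "?b \<in> \<Phi>" using assms base_roots wword_root[of "rev ws" \<beta>] by auto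
  obtain \<epsilon> :: int where e: "\<epsilon> = 1 \<or> \<epsilon> = -1" "\<And>t. zw ws t (Inl ?b) = (if t = Inl (wword ws ?b) then \<epsilon> else 0)"
    using zw_col[OF assms(1) b] by blast
  have "nw ws \<otimes> xz ?b (of_int \<epsilon> * a) = xz \<beta> (of_int \<epsilon> * (of_int \<epsilon> * a)) \<otimes> nw ws"
    unfolding nw_zmat using conj_xz[OF conjunct1[OF zw_aut] conjunct2[OF zw_aut] b assms(2), of ws] assms(1) e(2) wword_rev2[of ws \<beta>] by metis
  moreover have "of_int \<epsilon> * (of_int \<epsilon> * a) = a" using e(1) by auto
  ultimately show ?thesis using e(1) by (intro exI[of _ "of_int \<epsilon> * a"]) auto
qed

lemma nw_torus: "set ws \<subseteq> Bas \<Longrightarrow> h \<in> T \<Longrightarrow> \<exists>k\<in>T. nw ws \<otimes> h = k \<otimes> nw ws"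
proof (induction ws)
  case Nil then show ?case by (auto simp: nw_Nil mmul_idm_left[OF finite_I torus_msupp] mmul_idm_right[OF finite_I torus_msupp])
next
  case (Cons a ws)
  then obtain k where k: "k \<in> T" "nw ws \<otimes> h = k \<otimes> nw ws" by auto
  obtain l where l: "l \<in> T" "n a \<otimes> k = l \<otimes> n a" using nr_torus_commute[OF _ k(1), of a] Cons.prems by auto
  have "nw (a # ws) \<otimes> h = (n a \<otimes> k) \<otimes> nw ws" unfolding nw_Cons mmul_assoc k(2) ..
  then show ?case unfolding l(2) nw_Cons using l(1) mmul_assoc by metis
qed

lemma torus_nw: "set ws \<subseteq> Bas \<Longrightarrow> h \<in> T \<Longrightarrow> \<exists>k\<in>T. h \<otimes> nw ws = nw ws \<otimes> k"
proof (induction ws arbitrary: h)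
  case Nil then show ?case by (auto simp: nw_Nil mmul_idm_left[OF finite_I torus_msupp] mmul_idm_right[OF finite_I torus_msupp])
next
  case (Cons a ws)
  obtain l where l: "l \<in> T" "h \<otimes> n a = n a \<otimes> l" using nr_torus_commute[OF _ Cons.prems(2), of a] Cons.prems by auto
  obtain k where k: "k \<in> T" "l \<otimes> nw ws = nw ws \<otimes> k" using Cons l(1) by auto
  have "h \<otimes> nw (a # ws) = n a \<otimes> (l \<otimes> nw ws)" unfolding nw_Cons mmul_assoc[symmetric] l(2) ..
  then show ?case unfolding k(2) nw_Cons using k(1) mmul_assoc by metis
qed

text \<open>Each letter is its own inverse up to the torus, and the torus elements can be collected
  at the right end.\<close>

lemma nw_inv: "set ws \<subseteq> Bas \<Longrightarrow>
  \<exists>h\<in>(T :: ('a idx \<Rightarrow> 'a idx \<Rightarrow> 'f::field) set). nw ws \<otimes> (nw (rev ws) \<otimes> h) = idm I \<and> (nw (rev ws) \<otimes> h) \<otimes> nw ws = idm I"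
proof (induction ws)
  case Nil
  have "nw [] \<otimes> (nw (rev []) \<otimes> idm I) = (idm I :: 'a idx \<Rightarrow> 'a idx \<Rightarrow> 'f)"
    by (simp add: nw_Nil mmul_idm_left[OF finite_I msupp_idm])
  then show ?case by (intro bexI[OF _ torus_one]) (simp add: nw_Nil mmul_idm_left[OF finite_I msupp_idm])
next
  case (Cons a ws)
  have a: "a \<in> Bas" "set ws \<subseteq> Bas" using Cons.prems by auto
  obtain h :: "'a idx \<Rightarrow> 'a idx \<Rightarrow> 'f" where h: "h \<in> T" "nw ws \<otimes> (nw (rev ws) \<otimes> h) = idm I" "(nw (rev ws) \<otimes> h) \<otimes> nw ws = idm I"
    using Cons by auto
  obtain k :: "'a idx \<Rightarrow> 'a idx \<Rightarrow> 'f" where k: "k \<in> T" "n a \<otimes> (k \<otimes> n a) = idm I" "(k \<otimes> n a) \<otimes> n a = idm I" using nr_inv[OF a(1)] by blast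
  have sr: "set (rev ws) \<subseteq> Bas" "set [a] \<subseteq> Bas" using a by auto
  obtain l where l: "l \<in> T" "(h \<otimes> k) \<otimes> n a = n a \<otimes> l" using nr_torus_commute[OF a(1) torus_mult[OF h(1) k(1)]] by blast
  have e: "nw (rev (a # ws)) \<otimes> l = (nw (rev ws) \<otimes> h) \<otimes> (k \<otimes> n a)"
  proof -
    have "nw (rev (a # ws)) \<otimes> l = nw (rev ws) \<otimes> (n a \<otimes> l)"
      by (simp add: nw_append[OF sr] nw_single a(1) mmul_assoc)
    then show ?thesis unfolding l(2)[symmetric] by (simp only: mmul_assoc)
  qed
  have s: "msupp I (n a)" "msupp I (k \<otimes> n a)" "msupp I (nw ws)" "msupp I (nw (rev ws) \<otimes> h)"
    by (intro msupp_mmul msupp_nr msupp_nw torus_msupp base_roots a h k sr)+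
  have "nw (a # ws) \<otimes> (nw (rev (a # ws)) \<otimes> l) = idm I \<and> (nw (rev (a # ws)) \<otimes> l) \<otimes> nw (a # ws) = idm I"
    unfolding e nw_Cons using inv_prod[OF s k(2,3) h(2,3)] by blast
  then show ?case using l(1) by blast
qed

section \<open>Words that act trivially on the roots\<close>

lemma root_split:
  assumes "\<beta> \<in> P" "\<beta> \<notin> Bas"
  shows "\<exists>\<gamma>\<in>Bas. \<beta> - \<gamma> \<in> P"
proof -
  have "\<exists>\<gamma>\<in>Bas. \<beta> \<bullet> \<gamma> > 0"
  proof (rule ccontr)
    assume "\<not> ?thesis"
    then have "\<beta> \<bullet> \<beta> \<le> 0" using assms(1)
      by (subst (2) expand[of \<beta>]) (auto simp: inner_sum_right pos_iff intro!: sum_nonpos mult_nonneg_nonpos)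
    then show False using root_inner_pos[OF pos_root[OF assms(1)]] by simp
  qed
  then obtain \<gamma> where g: "\<gamma> \<in> Bas" "\<beta> \<bullet> \<gamma> > 0" by blast
  have ne: "\<beta> \<noteq> \<gamma>" using g assms by blast
  have r: "\<beta> - \<gamma> \<in> \<Phi>" using root_add[OF pos_root[OF assms(1)] root_minus[OF base_roots[OF g(1)]]] g ne by simp
  obtain \<delta> where d: "\<delta> \<in> Bas" "\<delta> \<noteq> \<gamma>" "fw \<delta> \<bullet> \<beta> > 0" using pos_other_coord[OF assms(1) g(1) ne] by blast
  have "fw \<delta> \<bullet> (\<beta> - \<gamma>) > 0" using d fw_base[OF g(1), of \<delta>] by (simp add: inner_diff_right)
  then show ?thesis using pos_if_coord[OF r d(1)] g(1) by blast
qed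

text \<open>A product of the reflection representatives that acts trivially on the roots is diagonal with
  signs that are multiplicative on roots; it is therefore the torus element with these signs on the
  simple roots.\<close>

lemma zw_trivial_h:
  assumes ws: "set ws \<subseteq> Bas" "wword ws = id" and d: "\<delta> \<in> Bas"
  shows "zw ws t (Inr \<delta>) = (if t = Inr \<delta> then 1 else 0)"
proof -
  define m where "m \<epsilon> = zw ws (Inr \<epsilon>) (Inr \<delta>)" for \<epsilon>
  have i: "Inr \<delta> \<in> I" using d by (simp add: Inr_I)
  have z: "zw ws (Inl \<beta>) (Inr \<delta>) = 0" for \<beta>
  proof (rule ccontr)
    assume nz: "zw ws (Inl \<beta>) (Inr \<delta>) \<noteq> 0"
    then have "\<beta> = 0" using zw_supp[OF ws(1) nz] ws(2) by simp
    moreover have "\<beta> \<in> \<Phi>" using nz conjunct2[OF zw_aut[OF ws(1)]] unfolding msupp_def Inl_I[symmetric] by blast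
    ultimately show False using zero_not_root by simp
  qed
  \<comment> \<open>The automorphism property for \<open>[h_\<delta>, e_\<beta>]\<close>, with the
    sign of \<open>e_\<beta>\<close> cancelled. It says that the image of \<open>h_\<delta>\<close>
    pairs with all roots as \<open>h_\<delta>\<close> does.\<close>
  have c: "cartan \<beta> \<delta> = (\<Sum>\<epsilon>\<in>Bas. m \<epsilon> * cartan \<beta> \<epsilon>)" if b: "\<beta> \<in> \<Phi>" for \<beta>
  proof -
    obtain \<epsilon> :: int where e: "\<epsilon> = 1 \<or> \<epsilon> = -1" "\<And>t. zw ws t (Inl \<beta>) = (if t = Inl \<beta> then \<epsilon> else 0)"
      using zw_col[OF ws(1) b] ws(2) by auto
    have ib: "Inl \<beta> \<in> I" using b by (simp add: Inl_I)
    have "cartan \<beta> \<delta> * \<epsilon> = (\<Sum>k\<in>I. zw ws (Inl \<beta>) k * br (Inr \<delta>) (Inl \<beta>) k)"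
      using ib finite_I by (simp add: br_Inr e(2) if_distrib cong: if_cong)
    also have "\<dots> = bb (zw ws) (zw ws) (Inr \<delta>) (Inl \<beta>) (Inl \<beta>)"
      using zw_aut[OF ws(1)] i ib unfolding aut_def by blast
    also have "\<dots> = (\<Sum>p\<in>I. zw ws p (Inr \<delta>) * (\<Sum>q\<in>I. zw ws q (Inl \<beta>) * br p q (Inl \<beta>)))"
      by (simp add: bb_def sum_distrib_left mult.assoc)
    also have "\<dots> = (\<Sum>p\<in>I. zw ws p (Inr \<delta>) * (\<epsilon> * br p (Inl \<beta>) (Inl \<beta>)))"
      using ib finite_I by (simp add: e(2) if_distrib[of "\<lambda>x. x * _"] cong: if_cong)
    also have "\<dots> = (\<Sum>\<eta>\<in>Bas. m \<eta> * (\<epsilon> * cartan \<beta> \<eta>))" by (subst sum_I) (simp add: z m_def br_Inr)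
    also have "\<dots> = (\<Sum>\<eta>\<in>Bas. m \<eta> * cartan \<beta> \<eta>) * \<epsilon>" by (simp add: sum_distrib_left mult.left_commute mult.commute)
    finally show ?thesis using e(1) by auto
  qed
  have "(\<Sum>\<epsilon>\<in>Bas. of_int (m \<epsilon>) *\<^sub>R coroot \<epsilon>) \<bullet> \<beta> = coroot \<delta> \<bullet> \<beta>" if b: "\<beta> \<in> \<Phi>" for \<beta>
  proof -
    have "\<beta> \<bullet> (\<Sum>\<epsilon>\<in>Bas. of_int (m \<epsilon>) *\<^sub>R coroot \<epsilon>) = real_of_int (\<Sum>\<epsilon>\<in>Bas. m \<epsilon> * cartan \<beta> \<epsilon>)"
      by (simp add: inner_sum_right of_int_cartan_coroot b base_roots)
    also have "\<dots> = \<beta> \<bullet> coroot \<delta>" unfolding c[OF b, symmetric] by (simp add: of_int_cartan_coroot b base_roots d)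
    finally show ?thesis by (simp only: inner_commute)
  qed
  then have eq: "coroot \<delta> = (\<Sum>\<epsilon>\<in>Bas. of_int (m \<epsilon>) *\<^sub>R coroot \<epsilon>)" using base_roots by (intro eq_by_base) metis
  define m' where "m' \<epsilon> = (if \<epsilon> \<in> Bas then m \<epsilon> else 0)" for \<epsilon>
  have "hcoef Bas \<delta> = m'" by (rule hcoef_unique) (use eq in \<open>simp_all add: m'_def\<close>)
  then have mm: "\<epsilon> \<in> Bas \<Longrightarrow> m \<epsilon> = (if \<epsilon> = \<delta> then 1 else 0)" for \<epsilon>
    using hcoef_base[OF d] by (metis m'_def)
  show ?thesis
  proof (cases t)
    case (Inl \<beta>) then show ?thesis using z by simp
  next
    case (Inr \<epsilon>)
    show ?thesis
    proof (cases "\<epsilon> \<in> Bas")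
      case True then show ?thesis using mm Inr by (simp add: m_def)
    next
      case False
      then have "zw ws t (Inr \<delta>) = 0" using Inr conjunct2[OF zw_aut[OF ws(1)]] unfolding msupp_def Inr_I[symmetric] by blast
      then show ?thesis using Inr False d by auto
    qed
  qed
qed

lemma nw_trivial_torus:
  assumes ws: "set ws \<subseteq> Bas" "wword ws = id"
  shows "nw ws \<in> (T :: ('a idx \<Rightarrow> 'a idx \<Rightarrow> 'f::field) set)"
proof -
  define \<epsilon> where "\<epsilon> \<beta> = zw ws (Inl \<beta>) (Inl \<beta>)" for \<beta>
  have e: "\<epsilon> \<beta> = 1 \<or> \<epsilon> \<beta> = -1" "zw ws t (Inl \<beta>) = (if t = Inl \<beta> then \<epsilon> \<beta> else 0)" if "\<beta> \<in> \<Phi>" for \<beta> t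
    using zw_col[OF ws(1) that] ws(2) by (auto simp: \<epsilon>_def)
  have au: "(\<Sum>k\<in>I. zw ws t k * br (Inl \<beta>) (Inl \<gamma>) k) = \<epsilon> \<beta> * \<epsilon> \<gamma> * br (Inl \<beta>) (Inl \<gamma>) t"
    if "\<beta> \<in> \<Phi>" "\<gamma> \<in> \<Phi>" "t \<in> I" for \<beta> \<gamma> t
  proof -
    have i: "Inl \<beta> \<in> I" "Inl \<gamma> \<in> I" using that by (simp_all add: Inl_I)
    have "(\<Sum>k\<in>I. zw ws t k * br (Inl \<beta>) (Inl \<gamma>) k) = bb (zw ws) (zw ws) (Inl \<beta>) (Inl \<gamma>) t"
      using zw_aut[OF ws(1)] i that unfolding aut_def by blast
    also have "\<dots> = (\<Sum>p\<in>I. zw ws p (Inl \<beta>) * (\<Sum>q\<in>I. zw ws q (Inl \<gamma>) * br p q t))"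
      by (simp add: bb_def sum_distrib_left mult.assoc)
    also have "\<dots> = \<epsilon> \<beta> * (\<epsilon> \<gamma> * br (Inl \<beta>) (Inl \<gamma>) t)"
      using i finite_I by (simp add: e(2)[OF that(1)] e(2)[OF that(2)] if_distrib[of "\<lambda>x. x * _"] cong: if_cong)
    finally show ?thesis by simp
  qed
  \<comment> \<open>From the bracket of \<open>e_\<beta>\<close> and \<open>e_\<gamma>\<close> and
    its image. The structure constant is a nonzero integer, being \<plusminus>(p + 1) for the string
    length p, and cancels.\<close>
  have add: "\<epsilon> (\<beta> + \<gamma>) = \<epsilon> \<beta> * \<epsilon> \<gamma>" if r: "\<beta> \<in> \<Phi>" "\<gamma> \<in> \<Phi>" "\<beta> + \<gamma> \<in> \<Phi>" for \<beta> \<gamma>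
  proof -
    have ne: "\<gamma> \<noteq> - \<beta>" using r zero_not_root by auto
    have b: "br (Inl \<beta>) (Inl \<gamma>) k = (if k = Inl (\<beta> + \<gamma>) then N \<beta> \<gamma> else 0)" for k using r ne by (simp add: brk_def)
    have "\<epsilon> (\<beta> + \<gamma>) * N \<beta> \<gamma> = \<epsilon> \<beta> * \<epsilon> \<gamma> * N \<beta> \<gamma>"
      using au[OF r(1,2), of "Inl (\<beta> + \<gamma>)"] r(3) finite_I unfolding b
      by (simp add: Inl_I \<epsilon>_def if_distrib cong: if_cong)
    moreover have "N \<beta> \<gamma> \<noteq> 0" using N_cases[OF r] by linarith
    ultimately show ?thesis by simp
  qed
  \<comment> \<open>Here the bracket is \<open>h_\<beta>\<close>, which is fixed by
    \<open>zw_trivial_h\<close>; primitivity supplies a nonzero coefficient of it that can be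
    cancelled.\<close>
  have neg: "\<epsilon> \<beta> * \<epsilon> (- \<beta>) = 1" if r: "\<beta> \<in> \<Phi>" for \<beta>
  proof -
    obtain z :: "'a \<Rightarrow> int" where z: "(\<Sum>\<gamma>\<in>Bas. hcoef Bas \<beta> \<gamma> * z \<gamma>) = 1" using hcoef_primitive[OF r] by blast
    then obtain \<gamma> where g: "\<gamma> \<in> Bas" "hcoef Bas \<beta> \<gamma> \<noteq> 0" by (metis (no_types, lifting) mult_zero_left sum.neutral zero_neq_one)
    have b: "br (Inl \<beta>) (Inl (- \<beta>)) k = (case k of Inr \<gamma> \<Rightarrow> hcoef Bas \<beta> \<gamma> | Inl _ \<Rightarrow> 0)" for k by (simp add: brk_def)
    have "(\<Sum>k\<in>I. zw ws (Inr \<gamma>) k * br (Inl \<beta>) (Inl (- \<beta>)) k) = (\<Sum>\<delta>\<in>Bas. zw ws (Inr \<gamma>) (Inr \<delta>) * hcoef Bas \<beta> \<delta>)"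
      unfolding b by (subst sum_I) simp
    also have "\<dots> = hcoef Bas \<beta> \<gamma>" using g(1) finite_base by (simp add: zw_trivial_h[OF ws] if_distrib[of "\<lambda>x. x * _"] cong: if_cong)
    finally have "hcoef Bas \<beta> \<gamma> = \<epsilon> \<beta> * \<epsilon> (- \<beta>) * hcoef Bas \<beta> \<gamma>"
      using au[OF r root_minus[OF r], of "Inr \<gamma>"] g(1) by (simp add: b Inr_I)
    then show ?thesis using g(2) by simp
  qed
  define t :: "'a \<Rightarrow> 'f" where "t \<gamma> = of_int (\<epsilon> \<gamma>)" for \<gamma>
  have t: "nz t"
  proof
    fix \<gamma> assume "\<gamma> \<in> Bas"
    then have "\<epsilon> \<gamma> = 1 \<or> \<epsilon> \<gamma> = -1" using e(1) base_roots by blast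
    then show "t \<gamma> \<noteq> 0" by (elim disjE) (simp_all add: t_def)
  qed
  have cp: "chi t \<beta> = of_int (\<epsilon> \<beta>)" if "\<beta> \<in> P" for \<beta>
    using that
  proof (induction "nat \<lfloor>ht \<beta>\<rfloor>" arbitrary: \<beta> rule: less_induct)
    case less
    show ?case
    proof (cases "\<beta> \<in> Bas")
      case True
      have "chi t \<beta> = (\<Prod>\<gamma>\<in>Bas. if \<gamma> = \<beta> then t \<beta> else 1)"
        unfolding chi_def by (intro prod.cong) (auto simp: fw_base[OF True])
      then show ?thesis using True finite_base by (simp add: t_def)
    next
      case False
      obtain \<gamma> where g: "\<gamma> \<in> Bas" "\<beta> - \<gamma> \<in> P" using root_split[OF less.prems False] by blast
      have h: "ht (\<beta> - \<gamma>) = ht \<beta> - 1" using ht_base[OF g(1)] by (simp add: linear_diff[OF ht_linear])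
      have "nat \<lfloor>ht (\<beta> - \<gamma>)\<rfloor> < nat \<lfloor>ht \<beta>\<rfloor>" using ht_pos[OF g(2)] unfolding h by linarith
      from less.hyps[OF this g(2)] have 1: "chi t (\<beta> - \<gamma>) = of_int (\<epsilon> (\<beta> - \<gamma>))" .
      have "1 \<le> ht \<gamma>" "\<gamma> \<in> P" using ht_base[OF g(1)] base_pos[OF g(1)] by auto
      have "nat \<lfloor>ht \<gamma>\<rfloor> < nat \<lfloor>ht \<beta>\<rfloor>" using ht_pos[OF g(2)] ht_base[OF g(1)] unfolding h by linarith
      from less.hyps[OF this \<open>\<gamma> \<in> P\<close>] have 2: "chi t \<gamma> = of_int (\<epsilon> \<gamma>)" .
      have r: "\<beta> - \<gamma> \<in> \<Phi>" "\<gamma> \<in> \<Phi>" "\<beta> - \<gamma> + \<gamma> \<in> \<Phi>" using g base_roots pos_root less.prems by auto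
      have "chi t (\<beta> - \<gamma> + \<gamma>) = of_int (\<epsilon> (\<beta> - \<gamma>)) * of_int (\<epsilon> \<gamma>)"
        using chi_add[OF t, of "\<beta> - \<gamma>" \<gamma>] lattice_root r 1 2 by simp
      then show ?thesis using add[OF r] by simp
    qed
  qed
  have cr: "chi t \<beta> = of_int (\<epsilon> \<beta>)" if b: "\<beta> \<in> \<Phi>" for \<beta>
  proof (cases "\<beta> \<in> P")
    case True then show ?thesis by (rule cp)
  next
    case False
    then have m: "- \<beta> \<in> P" using pos_or_neg b by blast
    have "chi t (\<beta> + - \<beta>) = chi t \<beta> * chi t (- \<beta>)" using chi_add[OF t] lattice_root b root_minus by blast
    then have "chi t \<beta> * of_int (\<epsilon> (- \<beta>)) = 1" using cp[OF m] by (simp add: chi_0)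
    moreover have "of_int (\<epsilon> \<beta>) * (of_int (\<epsilon> (- \<beta>)) :: 'f) = 1" unfolding of_int_mult[symmetric] neg[OF b] by simp
    ultimately show ?thesis by (metis mult.commute mult.left_commute mult.right_neutral)
  qed
  have "nw ws i j = tor \<Phi> Bas t i j" for i j
  proof (cases "i \<in> I \<and> j \<in> I")
    case False
    then show ?thesis using msupp_nw[OF ws(1)] msupp_tor[of t] unfolding msupp_def by metis
  next
    case True
    then show ?thesis
      by (cases j) (auto simp: tor_eq nw_zmat zmat_def Inl_I Inr_I e(2) cr chi_0 zw_trivial_h[OF ws])
  qed
  then have "nw ws = tor \<Phi> Bas t" by (intro ext)
  then show ?thesis using torus_I[OF t] by simp
qed

text \<open>The reverse of one word followed by the other acts trivially, so its representative is a
  torus element, and the representative of the reverse is an inverse up to the torus.\<close>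

lemma nw_same_weyl:
  assumes "set us \<subseteq> Bas" "set vs \<subseteq> Bas" "wword us = wword vs"
  shows "\<exists>h\<in>(T :: ('a idx \<Rightarrow> 'a idx \<Rightarrow> 'f::field) set). nw us = nw vs \<otimes> h"
proof -
  obtain h :: "'a idx \<Rightarrow> 'a idx \<Rightarrow> 'f" where h: "h \<in> T" "nw vs \<otimes> (nw (rev vs) \<otimes> h) = idm I" using nw_inv[OF assms(2)] by blast
  obtain k where k: "k \<in> T" "h \<otimes> nw us = nw us \<otimes> k" using torus_nw[OF assms(1) h(1)] by blast
  have s: "set (rev vs) \<subseteq> Bas" using assms(2) by simp
  have "wword (rev vs @ us) = id" by (auto simp: wword_append assms(3) wword_rev)
  then have t: "nw (rev vs @ us) \<in> (T :: ('a idx \<Rightarrow> 'a idx \<Rightarrow> 'f) set)" using nw_trivial_torus[of "rev vs @ us"] assms by auto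
  have "nw us = (nw vs \<otimes> (nw (rev vs) \<otimes> h)) \<otimes> nw us" by (simp add: h(2) mmul_idm_left[OF finite_I msupp_nw[OF assms(1)]])
  also have "\<dots> = nw vs \<otimes> (nw (rev vs) \<otimes> (h \<otimes> nw us))" by (simp only: mmul_assoc)
  also have "\<dots> = nw vs \<otimes> (nw (rev vs @ us) \<otimes> k)" unfolding k(2) nw_append[OF s assms(1)] by (simp only: mmul_assoc)
  finally show ?thesis using torus_mult[OF t k(1)] by blast
qed

section \<open>Double cosets indexed by words\<close>

definition cell :: "'a list \<Rightarrow> ('a idx \<Rightarrow> 'a idx \<Rightarrow> 'f::field) set" where
  "cell ws = {b \<otimes> (nw ws \<otimes> c) | b c. b \<in> B \<and> c \<in> B}"

lemma cell_I: "b \<in> B \<Longrightarrow> c \<in> B \<Longrightarrow> b \<otimes> (nw ws \<otimes> c) \<in> cell ws"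
  by (auto simp: cell_def)

lemma cell_left: "b \<in> B \<Longrightarrow> g \<in> cell ws \<Longrightarrow> b \<otimes> g \<in> cell ws"
  unfolding cell_def
proof (elim CollectE exE conjE)
  fix b1 c assume "b \<in> B" "b1 \<in> B" "c \<in> B" "g = b1 \<otimes> (nw ws \<otimes> c)"
  then show "b \<otimes> g \<in> {b \<otimes> (nw ws \<otimes> c) | b c. b \<in> B \<and> c \<in> B}"
    using B_mult[of b b1] by (auto simp: mmul_assoc[symmetric])
qed

lemma cell_right: "b \<in> B \<Longrightarrow> g \<in> cell ws \<Longrightarrow> g \<otimes> b \<in> cell ws"
proof -
  assume b: "b \<in> B" and "g \<in> cell ws"
  then obtain b1 c where g: "b1 \<in> B" "c \<in> B" "g = b1 \<otimes> (nw ws \<otimes> c)" by (auto simp: cell_def)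
  have "g \<otimes> b = b1 \<otimes> (nw ws \<otimes> (c \<otimes> b))" unfolding g(3) by (simp only: mmul_assoc)
  then show ?thesis using cell_I[OF g(1) B_mult[OF g(2) b]] by simp
qed

lemma cell_Nil: "b \<in> B \<Longrightarrow> b \<in> cell []"
  using cell_I[OF _ B_one, of b "[]"] by (simp add: nw_Nil mmul_idm_left[OF finite_I msupp_idm] mmul_idm_right[OF finite_I B_msupp])

lemma cell_nw: "set ws \<subseteq> Bas \<Longrightarrow> nw ws \<in> cell ws"
  using cell_I[OF B_one B_one, of ws] by (simp add: mmul_idm_left[OF finite_I msupp_nw] mmul_idm_right[OF finite_I msupp_nw])

lemma nr_G: "\<gamma> \<in> Bas \<Longrightarrow> n \<gamma> \<in> G"
  unfolding nr_xz_eq using base_roots root_minus by (intro G_mult G_xz) blast+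

lemma nw_G: "set ws \<subseteq> Bas \<Longrightarrow> nw ws \<in> G"
  by (induction ws) (auto simp: nw_Nil nw_Cons G_one intro!: G_mult nr_G)

lemma cell_G: "set ws \<subseteq> Bas \<Longrightarrow> g \<in> cell ws \<Longrightarrow> g \<in> G"
  unfolding cell_def using G_mult B_sub_G nw_G by blast

text \<open>The BN-pair axiom that \<open>s B w\<close> lies in
  \<open>B s w B \<union> B w B\<close>. After \<open>nr_B\<close> a single root element for
  \<open>\<gamma>\<close> stands before \<open>nw ws\<close>, and it passes through into
  \<open>B\<close> on the right unless the inverse of \<open>wword ws\<close> makes
  \<open>\<gamma>\<close> negative.\<close>

lemma cell_step:
  fixes g :: "'a idx \<Rightarrow> 'a idx \<Rightarrow> 'f::field"
  assumes ws: "set ws \<subseteq> Bas" and g: "\<gamma> \<in> Bas" and x: "g \<in> cell ws"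
  shows "n \<gamma> \<otimes> g \<in> cell (\<gamma> # ws) \<union> cell ws"
proof -
  have gr: "\<gamma> \<in> \<Phi>" "- \<gamma> \<in> \<Phi>" using base_roots[OF g] root_minus by blast+
  obtain b c where bc: "b \<in> B" "c \<in> B" "g = b \<otimes> (nw ws \<otimes> c)" using x by (auto simp: cell_def)
  obtain b' a where b': "b' \<in> B" "n \<gamma> \<otimes> b = b' \<otimes> (n \<gamma> \<otimes> xz \<gamma> a)" using nr_B[OF g bc(1)] by blast
  have e: "n \<gamma> \<otimes> g = b' \<otimes> (n \<gamma> \<otimes> (xz \<gamma> a \<otimes> (nw ws \<otimes> c)))"
    unfolding bc(3) mmul_assoc[symmetric] b'(2) ..
  let ?h = "wword (rev ws) \<gamma>"
  have h: "?h \<in> \<Phi>" using wword_root[of "rev ws" \<gamma>] ws base_roots gr by auto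
  consider "?h \<in> P" | "a = 0" | "- ?h \<in> P" "a \<noteq> 0" using pos_or_neg[OF h] by blast
  then show ?thesis
  proof cases
    case 1
    obtain a' where "xz \<gamma> a \<otimes> nw ws = nw ws \<otimes> xz ?h a'" using xz_nw[OF ws gr(1)] by blast
    then have "n \<gamma> \<otimes> g = b' \<otimes> (nw (\<gamma> # ws) \<otimes> (xz ?h a' \<otimes> c))"
      unfolding e nw_Cons mmul_assoc by (metis mmul_assoc)
    then show ?thesis using cell_I[OF b'(1) B_mult[OF B_xz[OF 1] bc(2)]] by simp
  next
    case 2
    have "xz \<gamma> a \<otimes> (nw ws \<otimes> c) = nw ws \<otimes> c"
      unfolding 2 xz_0[OF gr(1)] by (rule mmul_idm_left[OF finite_I msupp_mmul[OF msupp_nw[OF ws] B_msupp[OF bc(2)]]])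
    then have "n \<gamma> \<otimes> g = b' \<otimes> (nw (\<gamma> # ws) \<otimes> c)" unfolding e nw_Cons mmul_assoc by simp
    then show ?thesis using cell_I[OF b'(1) bc(2)] by simp
  next
    \<comment> \<open>The rank one decomposition of \<open>xz (- \<gamma>) a1\<close> brings two
      copies of \<open>n \<gamma>\<close> together, and they combine to a torus element. What
      remains on the right is a root element for \<open>- \<gamma>\<close>, which does pass into
      \<open>B\<close>; so the letter \<open>\<gamma>\<close> disappears.\<close>
    case 3
    obtain a1 where a1: "a1 \<noteq> 0" "n \<gamma> \<otimes> xz \<gamma> a = xz (- \<gamma>) a1 \<otimes> n \<gamma>"
      using nw_xz[of "[\<gamma>]" \<gamma> a] g gr 3(2) by (auto simp: nw_single wword_Cons wword_Nil root_refl_self)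
    obtain h k where hk: "h \<in> T" "k \<in> T" "xz (- \<gamma>) a1 = xz \<gamma> (1 / a1) \<otimes> (h \<otimes> (n \<gamma> \<otimes> (k \<otimes> xz \<gamma> (1 / a1))))"
      using xz_neg_decomp[OF g a1(1)] by blast
    obtain a2 where a2: "xz \<gamma> (1 / a1) \<otimes> n \<gamma> = n \<gamma> \<otimes> xz (- \<gamma>) a2"
      using xz_nw[of "[\<gamma>]" \<gamma> "1 / a1"] g gr by (auto simp: nw_single wword_Cons wword_Nil root_refl_self)
    obtain l where l: "l \<in> T" "n \<gamma> \<otimes> k = l \<otimes> n \<gamma>" using nr_torus_commute[OF g hk(2)] by blast
    have mh: "wword (rev ws) (- \<gamma>) = - ?h" by (simp add: wword_minus)
    obtain a3 where a3: "xz (- \<gamma>) a2 \<otimes> nw ws = nw ws \<otimes> xz (- ?h) a3" using xz_nw[OF ws gr(2), of a2] unfolding mh by blast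
    have "n \<gamma> \<otimes> xz \<gamma> a = xz \<gamma> (1 / a1) \<otimes> (h \<otimes> ((n \<gamma> \<otimes> k) \<otimes> (xz \<gamma> (1 / a1) \<otimes> n \<gamma>)))"
      unfolding a1(2) hk(3) by (simp only: mmul_assoc)
    also have "\<dots> = xz \<gamma> (1 / a1) \<otimes> ((h \<otimes> l) \<otimes> ((n \<gamma> \<otimes> n \<gamma>) \<otimes> xz (- \<gamma>) a2))"
      unfolding l(2) a2 by (simp only: mmul_assoc)
    also have "\<dots> = (xz \<gamma> (1 / a1) \<otimes> ((h \<otimes> l) \<otimes> (n \<gamma> \<otimes> n \<gamma>))) \<otimes> xz (- \<gamma>) a2" by (simp only: mmul_assoc)
    finally have nx: "n \<gamma> \<otimes> xz \<gamma> a = (xz \<gamma> (1 / a1) \<otimes> ((h \<otimes> l) \<otimes> (n \<gamma> \<otimes> n \<gamma>))) \<otimes> xz (- \<gamma>) a2" .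
    let ?b = "xz \<gamma> (1 / a1) \<otimes> ((h \<otimes> l) \<otimes> (n \<gamma> \<otimes> n \<gamma>))"
    have bb: "?b \<in> B"
      by (intro B_mult B_xz base_pos g B_T hk l nr_sq)
    have "n \<gamma> \<otimes> g = b' \<otimes> ((n \<gamma> \<otimes> xz \<gamma> a) \<otimes> (nw ws \<otimes> c))" unfolding e by (simp only: mmul_assoc)
    also have "\<dots> = (b' \<otimes> ?b) \<otimes> ((xz (- \<gamma>) a2 \<otimes> nw ws) \<otimes> c)" unfolding nx by (simp only: mmul_assoc)
    also have "\<dots> = (b' \<otimes> ?b) \<otimes> (nw ws \<otimes> (xz (- ?h) a3 \<otimes> c))" unfolding a3 by (simp only: mmul_assoc)
    finally show ?thesis using cell_I[OF B_mult[OF b'(1) bb] B_mult[OF B_xz[OF 3(1)] bc(2)]] by simp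
  qed
qed

text \<open>The union of the cells is stable under left multiplication by \<open>B\<close> and,
  through \<open>cell_step\<close>, by representatives of words. An arbitrary root element is one
  for a simple root conjugated by such a representative.\<close>

lemma G_cells:
  fixes g :: "'a idx \<Rightarrow> 'a idx \<Rightarrow> 'f::field"
  assumes "g \<in> G" shows "\<exists>ws. set ws \<subseteq> Bas \<and> g \<in> cell ws"
proof -
  have nwc: "\<exists>vs. set vs \<subseteq> Bas \<and> nw us \<otimes> g \<in> cell vs" if "set us \<subseteq> Bas" "set ws \<subseteq> Bas" "g \<in> cell ws"
    for us ws and g :: "'a idx \<Rightarrow> 'a idx \<Rightarrow> 'f"
    using that
  proof (induction us)
    case Nil
    then have "msupp I g" using G_msupp[OF cell_G] by blast
    then show ?case using Nil by (auto simp: nw_Nil mmul_idm_left[OF finite_I])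
  next
    case (Cons a us)
    then obtain vs where vs: "set vs \<subseteq> Bas" "nw us \<otimes> g \<in> cell vs" by auto
    have "nw (a # us) \<otimes> g = n a \<otimes> (nw us \<otimes> g)" by (simp add: nw_Cons mmul_assoc)
    moreover have "n a \<otimes> (nw us \<otimes> g) \<in> cell (a # vs) \<union> cell vs"
      using cell_step[OF vs(1) _ vs(2)] Cons.prems by simp
    ultimately show ?case using vs(1) Cons.prems by (metis Un_iff insert_subset list.simps(15))
  qed
  show ?thesis
    using assms
  proof (induction rule: chev_group.induct)
    case cg_id
    then show ?case using cell_Nil[OF B_one] by (intro exI[of _ "[]"]) simp
  next
    case (cg_tor h g)
    then show ?case using cell_left[OF B_T] by blast
  next
    case (cg_root \<alpha> g a)
    then obtain ws where ws: "set ws \<subseteq> Bas" "g \<in> cell ws" by blast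
    obtain us \<gamma> where us: "set us \<subseteq> Bas" "\<gamma> \<in> Bas" "\<alpha> = wword us \<gamma>" using root_conj_base[OF cg_root(1)] by blast
    have wr: "wword (rev us) \<alpha> = \<gamma>" by (simp add: us(3) wword_rev)
    obtain a' where a': "xz \<alpha> a \<otimes> nw us = nw us \<otimes> xz \<gamma> a'" using xz_nw[OF us(1) cg_root(1)] unfolding wr by blast
    obtain h :: "'a idx \<Rightarrow> 'a idx \<Rightarrow> 'f" where h: "h \<in> T" "nw us \<otimes> (nw (rev us) \<otimes> h) = idm I" using nw_inv[OF us(1)] by blast
    have "h \<otimes> g \<in> cell ws" by (rule cell_left[OF B_T[OF h(1)] ws(2)])
    then obtain vs where vs: "set vs \<subseteq> Bas" "nw (rev us) \<otimes> (h \<otimes> g) \<in> cell vs"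
      using nwc[of "rev us" ws "h \<otimes> g"] us(1) ws(1) by auto
    have "xz \<gamma> a' \<otimes> (nw (rev us) \<otimes> (h \<otimes> g)) \<in> cell vs" by (rule cell_left[OF B_xz[OF base_pos[OF us(2)]] vs(2)])
    then obtain vs' where vs': "set vs' \<subseteq> Bas" "nw us \<otimes> (xz \<gamma> a' \<otimes> (nw (rev us) \<otimes> (h \<otimes> g))) \<in> cell vs'"
      using nwc[OF us(1) vs(1)] by blast
    have "nw us \<otimes> (xz \<gamma> a' \<otimes> (nw (rev us) \<otimes> (h \<otimes> g))) = (nw us \<otimes> xz \<gamma> a') \<otimes> (nw (rev us) \<otimes> (h \<otimes> g))" by (simp only: mmul_assoc)
    also have "\<dots> = xz \<alpha> a \<otimes> ((nw us \<otimes> (nw (rev us) \<otimes> h)) \<otimes> g)" unfolding a'[symmetric] by (simp only: mmul_assoc)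
    also have "\<dots> = xz \<alpha> a \<otimes> g" by (simp add: h(2) mmul_idm_left[OF finite_I G_msupp[OF cg_root(2)]])
    finally show ?case using vs' by (metis xr_eq_xz)
  qed
qed

section \<open>Inverses and products of cells\<close>

lemma inverse_unique:
  fixes g h k :: "'a idx \<Rightarrow> 'a idx \<Rightarrow> 'r::comm_semiring_1"
  assumes "msupp I h" "msupp I k" "h \<otimes> g = idm I" "g \<otimes> k = idm I"
  shows "h = k"
proof -
  have "h = h \<otimes> (g \<otimes> k)" unfolding assms(4) by (rule mmul_idm_right[OF finite_I assms(1), symmetric])
  also have "\<dots> = k" unfolding mmul_assoc[symmetric] assms(3) by (rule mmul_idm_left[OF finite_I assms(2)])
  finally show ?thesis .
qed

lemma cell_inverse:
  fixes g h :: "'a idx \<Rightarrow> 'a idx \<Rightarrow> 'f::field"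
  assumes ws: "set ws \<subseteq> Bas" and g: "g \<in> cell ws" and h: "msupp I h" "h \<otimes> g = idm I"
  shows "h \<in> cell (rev ws)"
proof -
  obtain b c where bc: "b \<in> B" "c \<in> B" "g = b \<otimes> (nw ws \<otimes> c)" using g by (auto simp: cell_def)
  obtain b' where b': "b' \<in> B" "b \<otimes> b' = idm I" "b' \<otimes> b = idm I" using B_inv[OF bc(1)] by blast
  obtain c' where c': "c' \<in> B" "c \<otimes> c' = idm I" "c' \<otimes> c = idm I" using B_inv[OF bc(2)] by blast
  obtain t :: "'a idx \<Rightarrow> 'a idx \<Rightarrow> 'f" where t: "t \<in> T" "nw ws \<otimes> (nw (rev ws) \<otimes> t) = idm I" "(nw (rev ws) \<otimes> t) \<otimes> nw ws = idm I"
    using nw_inv[OF ws] by blast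
  have sr: "set (rev ws) \<subseteq> Bas" using ws by simp
  have s: "msupp I (nw (rev ws) \<otimes> t)" by (intro msupp_mmul msupp_nw torus_msupp sr t)
  let ?k = "(c' \<otimes> (nw (rev ws) \<otimes> t)) \<otimes> b'"
  have "(nw ws \<otimes> c) \<otimes> (c' \<otimes> (nw (rev ws) \<otimes> t)) = idm I" "(c' \<otimes> (nw (rev ws) \<otimes> t)) \<otimes> (nw ws \<otimes> c) = idm I"
    using inv_prod[OF msupp_nw[OF ws] s B_msupp[OF bc(2)] B_msupp[OF c'(1)] t(2,3) c'(2,3)] by auto
  then have "g \<otimes> ?k = idm I" unfolding bc(3)
    using inv_prod(1)[OF B_msupp[OF bc(1)] B_msupp[OF b'(1)] msupp_mmul[OF msupp_nw[OF ws] B_msupp[OF bc(2)]]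
        msupp_mmul[OF B_msupp[OF c'(1)] s] b'(2,3)] by blast
  then have "h = ?k" using inverse_unique[OF h(1) _ h(2)] msupp_mmul[OF msupp_mmul[OF B_msupp[OF c'(1)] s] B_msupp[OF b'(1)]] by blast
  also have "\<dots> = c' \<otimes> (nw (rev ws) \<otimes> (t \<otimes> b'))" by (simp only: mmul_assoc)
  finally show ?thesis using cell_I[OF c'(1) B_mult[OF B_T[OF t(1)] b'(1)]] by simp
qed

text \<open>Inversion exchanges left and right, so this is \<open>cell_step\<close> for the inverse
  element and the reversed word.\<close>

lemma cell_step_right:
  fixes g :: "'a idx \<Rightarrow> 'a idx \<Rightarrow> 'f::field"
  assumes ws: "set ws \<subseteq> Bas" and g: "\<gamma> \<in> Bas" and x: "g \<in> cell ws"
  shows "g \<otimes> n \<gamma> \<in> cell (ws @ [\<gamma>]) \<union> cell ws"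
proof -
  obtain g' where g': "g' \<in> G" "g \<otimes> g' = idm I" "g' \<otimes> g = idm I" using G_inv[OF cell_G[OF ws x]] by blast
  obtain t :: "'a idx \<Rightarrow> 'a idx \<Rightarrow> 'f" where t: "t \<in> T" "n \<gamma> \<otimes> (t \<otimes> n \<gamma>) = idm I" "(t \<otimes> n \<gamma>) \<otimes> n \<gamma> = idm I" using nr_inv[OF g] by blast
  have sn: "msupp I (n \<gamma> :: 'a idx \<Rightarrow> 'a idx \<Rightarrow> 'f)" "msupp I (t \<otimes> n \<gamma>)" by (intro msupp_mmul torus_msupp msupp_nr base_roots g t)+
  have inv: "(g \<otimes> n \<gamma>) \<otimes> ((t \<otimes> n \<gamma>) \<otimes> g') = idm I"
    using inv_prod(1)[OF G_msupp[OF cell_G[OF ws x]] G_msupp[OF g'(1)] sn g'(2,3) t(2,3)] .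
  have s: "set (rev ws) \<subseteq> Bas" "set (\<gamma> # rev ws) \<subseteq> Bas" using ws g by auto
  have "g' \<in> cell (rev ws)" by (rule cell_inverse[OF ws x G_msupp[OF g'(1)] g'(3)])
  then have "n \<gamma> \<otimes> g' \<in> cell (\<gamma> # rev ws) \<union> cell (rev ws)" by (rule cell_step[OF s(1) g])
  then have "t \<otimes> (n \<gamma> \<otimes> g') \<in> cell (\<gamma> # rev ws) \<union> cell (rev ws)" using cell_left[OF B_T[OF t(1)]] by blast
  then have "(t \<otimes> n \<gamma>) \<otimes> g' \<in> cell (\<gamma> # rev ws) \<union> cell (rev ws)" by (simp only: mmul_assoc)
  moreover have sg: "msupp I (g \<otimes> n \<gamma>)" by (intro msupp_mmul sn G_msupp[OF cell_G[OF ws x]])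
  ultimately have "g \<otimes> n \<gamma> \<in> cell (rev (\<gamma> # rev ws)) \<union> cell (rev (rev ws))"
    using cell_inverse[OF s(2) _ sg inv] cell_inverse[OF s(1) _ sg inv] by blast
  then show ?thesis by simp
qed

text \<open>Each letter of the second word is either appended or dropped. Only the set of letters is
  tracked, which is the information that membership in a parabolic subgroup requires.\<close>

lemma cell_mult:
  fixes g h :: "'a idx \<Rightarrow> 'a idx \<Rightarrow> 'f::field"
  assumes "set ws \<subseteq> Bas" "set vs \<subseteq> Bas" "g \<in> cell ws" "h \<in> cell vs"
  shows "\<exists>us. set us \<subseteq> set vs \<and> g \<otimes> h \<in> cell (ws @ us)"
proof -
  have nwc: "\<exists>us. set us \<subseteq> set vs \<and> g \<otimes> nw vs \<in> cell (ws @ us)" if "set ws \<subseteq> Bas" "set vs \<subseteq> Bas" "g \<in> cell ws"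
    for ws vs and g :: "'a idx \<Rightarrow> 'a idx \<Rightarrow> 'f"
    using that
  proof (induction vs arbitrary: ws g)
    case Nil
    then have "msupp I g" using G_msupp[OF cell_G] by blast
    then show ?case using Nil by (auto simp: nw_Nil mmul_idm_right[OF finite_I])
  next
    case (Cons a vs)
    have a: "a \<in> Bas" "set vs \<subseteq> Bas" using Cons.prems by auto
    have e: "g \<otimes> nw (a # vs) = (g \<otimes> n a) \<otimes> nw vs" by (simp only: nw_Cons mmul_assoc)
    consider "g \<otimes> n a \<in> cell (ws @ [a])" | "g \<otimes> n a \<in> cell ws" using cell_step_right[OF Cons.prems(1) a(1) Cons.prems(3)] by blast
    then show ?case
    proof cases
      case 1
      then obtain us where "set us \<subseteq> set vs" "(g \<otimes> n a) \<otimes> nw vs \<in> cell ((ws @ [a]) @ us)"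
        using Cons.IH[OF _ a(2) 1] Cons.prems(1) a(1) by auto
      then show ?thesis unfolding e by (intro exI[of _ "a # us"]) auto
    next
      case 2
      then obtain us where "set us \<subseteq> set vs" "(g \<otimes> n a) \<otimes> nw vs \<in> cell (ws @ us)"
        using Cons.IH[OF Cons.prems(1) a(2) 2] by blast
      then show ?thesis unfolding e by (intro exI[of _ us]) auto
    qed
  qed
  obtain b c where bc: "b \<in> B" "c \<in> B" "h = b \<otimes> (nw vs \<otimes> c)" using assms(4) by (auto simp: cell_def)
  obtain us where us: "set us \<subseteq> set vs" "(g \<otimes> b) \<otimes> nw vs \<in> cell (ws @ us)"
    using nwc[OF assms(1,2) cell_right[OF bc(1) assms(3)]] by blast
  have "g \<otimes> h = ((g \<otimes> b) \<otimes> nw vs) \<otimes> c" unfolding bc(3) by (simp only: mmul_assoc)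
  then show ?thesis using cell_right[OF bc(2) us(2)] us(1) by metis
qed

text \<open>Triangularity for the dominance order of weights. Off-diagonal entries must change the
  weight, so the block of weight 0 is diagonal; this, with antisymmetry of the order, keeps the
  diagonal of a product nonzero.\<close>

definition tri :: "('a idx \<Rightarrow> 'a idx \<Rightarrow> 'f::field) \<Rightarrow> bool" where
  "tri A \<longleftrightarrow> msupp I A \<and> (\<forall>i j. A i j \<noteq> 0 \<longrightarrow> i = j \<or> wt i \<noteq> wt j \<and> (\<forall>\<gamma>\<in>Bas. fw \<gamma> \<bullet> (wt i - wt j) \<ge> 0)) \<and> (\<forall>i\<in>I. A i i \<noteq> 0)"

lemma tri_idm: "tri (idm I)"
  using msupp_idm[of I] by (auto simp: tri_def idm_def)

lemma tri_tor: "nz t \<Longrightarrow> tri (tor \<Phi> Bas t)"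
  using chi_nonzero msupp_tor[of t] by (auto simp: tri_def tor_eq)

lemma tri_xz: assumes "\<beta> \<in> P" shows "tri (xz \<beta> a)"
  unfolding tri_def
proof (intro conjI allI impI ballI)
  note b = pos_root[OF assms]
  show "msupp I (xz \<beta> a)" by (rule msupp_xz[OF b])
  show "xz \<beta> a i i \<noteq> 0" if "i \<in> I" for i using xz_diag[OF b, of i i a] that by (simp add: idm_def)
  fix i j assume nz: "xz \<beta> a i j \<noteq> 0"
  show "i = j \<or> wt i \<noteq> wt j \<and> (\<forall>\<gamma>\<in>Bas. fw \<gamma> \<bullet> (wt i - wt j) \<ge> 0)"
  proof (cases "wt i = wt j")
    case True
    then show ?thesis using xz_diag[OF b True, of a] nz by (auto simp: idm_def split: if_splits)
  next
    case False
    obtain k :: nat where "wt i = wt j + of_nat k *\<^sub>R \<beta>" using xz_supp[OF b nz] by blast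
    then show ?thesis using False assms by (auto simp: pos_iff)
  qed
qed

lemma tri_mmul: assumes "tri A" "tri C" shows "tri (A \<otimes> C)"
proof -
  have anti: "wt i = wt j" if "\<forall>\<gamma>\<in>Bas. fw \<gamma> \<bullet> (wt i - wt j) \<ge> 0" "\<forall>\<gamma>\<in>Bas. fw \<gamma> \<bullet> (wt j - wt i) \<ge> 0" for i j
  proof -
    have "fw \<gamma> \<bullet> (wt i - wt j) = 0" if "\<gamma> \<in> Bas" for \<gamma>
      using \<open>\<forall>\<gamma>\<in>Bas. fw \<gamma> \<bullet> (wt i - wt j) \<ge> 0\<close> \<open>\<forall>\<gamma>\<in>Bas. fw \<gamma> \<bullet> (wt j - wt i) \<ge> 0\<close> that
      by (force simp: inner_diff_right)
    then have "wt i - wt j = 0" by (subst expand) simp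
    then show ?thesis by simp
  qed
  show ?thesis unfolding tri_def
  proof (intro conjI allI impI ballI)
    show "msupp I (A \<otimes> C)" using assms by (intro msupp_mmul) (auto simp: tri_def)
    fix i j assume "(A \<otimes> C) i j \<noteq> 0"
    then obtain k where k: "A i k \<noteq> 0" "C k j \<noteq> 0" by (rule mmul_nonzeroE)
    show "i = j \<or> wt i \<noteq> wt j \<and> (\<forall>\<gamma>\<in>Bas. fw \<gamma> \<bullet> (wt i - wt j) \<ge> 0)"
    proof (cases "i = k \<or> k = j")
      case True
      then show ?thesis using k assms unfolding tri_def by blast
    next
      case False
      then have 1: "wt i \<noteq> wt k" "\<forall>\<gamma>\<in>Bas. fw \<gamma> \<bullet> (wt i - wt k) \<ge> 0"
        and 2: "\<forall>\<gamma>\<in>Bas. fw \<gamma> \<bullet> (wt k - wt j) \<ge> 0" using k assms unfolding tri_def by blast+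
      have "fw \<gamma> \<bullet> (wt i - wt j) = fw \<gamma> \<bullet> (wt i - wt k) + fw \<gamma> \<bullet> (wt k - wt j)" for \<gamma> by (simp add: inner_diff_right)
      moreover have "wt i \<noteq> wt j" using anti[of i k] 1 2 by metis
      ultimately show ?thesis using 1 2 by simp
    qed
  next
    fix i assume i: "i \<in> I"
    have "A i k * C k i = 0" if "k \<noteq> i" for k
    proof (rule ccontr)
      assume "A i k * C k i \<noteq> 0"
      then have "A i k \<noteq> 0" "C k i \<noteq> 0" by auto
      then have "wt i \<noteq> wt k" "\<forall>\<gamma>\<in>Bas. fw \<gamma> \<bullet> (wt i - wt k) \<ge> 0" "\<forall>\<gamma>\<in>Bas. fw \<gamma> \<bullet> (wt k - wt i) \<ge> 0"
        using assms that unfolding tri_def by blast+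
      then show False using anti by blast
    qed
    then have "(A \<otimes> C) i i = (\<Sum>k\<in>I. if k = i then A i i * C i i else 0)"
      unfolding mmul_def by (intro sum.cong) auto
    then show "(A \<otimes> C) i i \<noteq> 0" using i finite_I assms by (simp add: tri_def)
  qed
qed

lemma tri_B: "b \<in> B \<Longrightarrow> tri b"
proof (elim B_E)
  fix h u :: "'a idx \<Rightarrow> 'a idx \<Rightarrow> 'b" assume a: "h \<in> T" "u \<in> U" "b = h \<otimes> u"
  have "tri u" using a(2)
    by (induction rule: uplus.induct) (auto intro: tri_idm tri_mmul tri_xz simp: xr_eq_xz)
  moreover have "tri h" using a(1) by (auto elim: torus_E intro: tri_tor)
  ultimately show ?thesis using a(3) tri_mmul by blast
qed

text \<open>The entry of \<open>nw us \<otimes> b\<close> in the row of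
  \<open>wword us \<beta>\<close> and the column of \<open>\<beta>\<close> has a single nonzero
  summand, which involves a diagonal entry of \<open>b\<close>. It forces a nonzero entry of
  \<open>b'\<close> leading from weight \<open>wword vs \<beta>\<close> to
  \<open>wword us \<beta>\<close>.\<close>

lemma weyl_dominates:
  fixes b b' :: "'a idx \<Rightarrow> 'a idx \<Rightarrow> 'f::field"
  assumes "set us \<subseteq> Bas" "set vs \<subseteq> Bas" "b \<in> B" "b' \<in> B" and eq: "nw us \<otimes> b = b' \<otimes> nw vs"
    and r: "\<beta> \<in> \<Phi>" and g: "\<gamma> \<in> Bas"
  shows "fw \<gamma> \<bullet> wword us \<beta> \<ge> fw \<gamma> \<bullet> wword vs \<beta>"
proof -
  let ?i = "Inl (wword us \<beta>)" and ?j = "Inl \<beta>"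
  have ij: "?i \<in> I" "?j \<in> I" using r wword_root[of us \<beta>] assms(1) base_roots by (auto simp: Inl_I)
  have "nw us ?i k * b k ?j = 0" if "k \<in> I" "k \<noteq> ?j" for k
  proof (cases "nw us ?i k = (0::'f)")
    case False
    have "wword us \<beta> = wword us (wt k)" using nw_supp[OF assms(1) False] by simp
    then have "wt k = \<beta>" by (metis wword_rev)
    then show ?thesis using wt_eq_root[OF that(1) _ r] that(2) by blast
  qed simp
  then have "(nw us \<otimes> b) ?i ?j = (\<Sum>k\<in>I. if k = ?j then nw us ?i ?j * b ?j ?j else 0)"
    unfolding mmul_def by (intro sum.cong) auto
  then have "(nw us \<otimes> b) ?i ?j \<noteq> 0"
    using ij finite_I nw_root_entry[OF assms(1) r, where 'f='f] tri_B[OF assms(3)] by (simp add: tri_def)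
  then obtain k where k: "b' ?i k \<noteq> 0" "nw vs k ?j \<noteq> (0::'f)" unfolding eq by (rule mmul_nonzeroE)
  have "wt k = wword vs \<beta>" using nw_supp[OF assms(2) k(2)] by simp
  moreover have "fw \<gamma> \<bullet> (wt ?i - wt k) \<ge> 0" using tri_B[OF assms(4)] k(1) g unfolding tri_def by fastforce
  ultimately show ?thesis by (simp add: inner_diff_right)
qed

lemma cells_disjoint:
  fixes g :: "'a idx \<Rightarrow> 'a idx \<Rightarrow> 'f::field"
  assumes "set us \<subseteq> Bas" "set vs \<subseteq> Bas" "g \<in> cell us" "g \<in> cell vs"
  shows "wword us = wword vs"
proof -
  have half: "\<exists>b\<in>(B :: ('a idx \<Rightarrow> 'a idx \<Rightarrow> 'f) set). \<exists>b'\<in>B. nw us \<otimes> b = b' \<otimes> nw vs" if g: "g \<in> cell us" "g \<in> cell vs" and s: "set us \<subseteq> Bas" "set vs \<subseteq> Bas" for us vs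
  proof -
    obtain b c where 1: "b \<in> B" "c \<in> B" "g = b \<otimes> (nw us \<otimes> c)" using g(1) by (auto simp: cell_def)
    obtain b' c' where 2: "b' \<in> B" "c' \<in> B" "g = b' \<otimes> (nw vs \<otimes> c')" using g(2) by (auto simp: cell_def)
    obtain bi where bi: "bi \<in> B" "bi \<otimes> b = idm I" using B_inv[OF 1(1)] by blast
    obtain ci where ci: "ci \<in> B" "c' \<otimes> ci = idm I" using B_inv[OF 2(2)] by blast
    have "nw us \<otimes> (c \<otimes> ci) = (bi \<otimes> b) \<otimes> (nw us \<otimes> (c \<otimes> ci))"
      by (simp add: bi(2) mmul_idm_left[OF finite_I msupp_mmul[OF msupp_nw[OF s(1)] B_msupp[OF B_mult[OF 1(2) ci(1)]]]])
    also have "\<dots> = bi \<otimes> (g \<otimes> ci)" unfolding 1(3) by (simp only: mmul_assoc)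
    also have "\<dots> = (bi \<otimes> b') \<otimes> (nw vs \<otimes> (c' \<otimes> ci))" unfolding 2(3) by (simp only: mmul_assoc)
    also have "\<dots> = (bi \<otimes> b') \<otimes> nw vs" by (simp add: ci(2) mmul_idm_right[OF finite_I msupp_nw[OF s(2)]])
    finally show ?thesis using B_mult[OF 1(2) ci(1)] B_mult[OF bi(1) 2(1)] by blast
  qed
  have "fw \<gamma> \<bullet> wword us \<beta> = fw \<gamma> \<bullet> wword vs \<beta>" if "\<beta> \<in> \<Phi>" "\<gamma> \<in> Bas" for \<beta> \<gamma>
  proof (rule antisym)
    obtain b b' :: "'a idx \<Rightarrow> 'a idx \<Rightarrow> 'f" where "b \<in> B" "b' \<in> B" "nw us \<otimes> b = b' \<otimes> nw vs"
      using half[OF assms(3,4,1,2)] by blast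
    then show "fw \<gamma> \<bullet> wword vs \<beta> \<le> fw \<gamma> \<bullet> wword us \<beta>" by (rule weyl_dominates[OF assms(1,2) _ _ _ that])
    obtain b b' :: "'a idx \<Rightarrow> 'a idx \<Rightarrow> 'f" where "b \<in> B" "b' \<in> B" "nw vs \<otimes> b = b' \<otimes> nw us"
      using half[OF assms(4,3,2,1)] by blast
    then show "fw \<gamma> \<bullet> wword us \<beta> \<le> fw \<gamma> \<bullet> wword vs \<beta>" by (rule weyl_dominates[OF assms(2,1) _ _ _ that])
  qed
  then have "wword us \<beta> - wword vs \<beta> = 0" if "\<beta> \<in> \<Phi>" for \<beta>
    using that by (subst expand) (simp add: inner_diff_right)
  then show ?thesis using linear_eq_roots[OF wword_linear wword_linear] by auto
qed

lemma bruhat_iff: "g \<in> bruhat \<Phi> Bas N w \<longleftrightarrow> (\<exists>ws. set ws \<subseteq> Bas \<and> wword ws = w \<and> g \<in> cell ws)"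
  by (auto simp: bruhat_def wreps_def cell_def)

text \<open>The torus element by which two representatives differ is absorbed into the right factor
  from \<open>B\<close>; hence a cell depends only on the Weyl element of its word.\<close>

lemma cell_same_weyl:
  fixes g :: "'a idx \<Rightarrow> 'a idx \<Rightarrow> 'f::field"
  assumes "set us \<subseteq> Bas" "set vs \<subseteq> Bas" "wword us = wword vs" "g \<in> cell us"
  shows "g \<in> cell vs"
proof -
  obtain b c where 1: "b \<in> B" "c \<in> B" "g = b \<otimes> (nw us \<otimes> c)" using assms(4) by (auto simp: cell_def)
  obtain h :: "'a idx \<Rightarrow> 'a idx \<Rightarrow> 'f" where h: "h \<in> T" "nw us = nw vs \<otimes> h" using nw_same_weyl[OF assms(1-3)] by blast
  have "g = b \<otimes> (nw vs \<otimes> (h \<otimes> c))" unfolding 1(3) h(2) by (simp only: mmul_assoc)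
  then show ?thesis using cell_I[OF 1(1) B_mult[OF B_T[OF h(1)] 1(2)]] by simp
qed

text \<open>The rank one decomposition for a simple root \<open>\<gamma>\<close> is conjugated by a
  representative taking \<open>\<gamma>\<close> to \<open>\<beta>\<close>. The outer factors become
  root elements for the positive root \<open>\<beta>\<close> and lie in \<open>B\<close>, while the
  middle becomes a word for the reflection in \<open>\<beta>\<close>.\<close>

lemma xz_neg_cell:
  fixes c :: "'f::field"
  assumes b: "\<beta> \<in> P" and c: "c \<noteq> 0"
  shows "xz (- \<beta>) c \<in> bruhat \<Phi> Bas N (root_refl \<beta>)"
proof -
  have br: "\<beta> \<in> \<Phi>" "- \<beta> \<in> \<Phi>" using pos_root[OF b] root_minus by blast+
  obtain ws \<gamma> where ws: "set ws \<subseteq> Bas" "\<gamma> \<in> Bas" "\<beta> = wword ws \<gamma>" using root_conj_base[OF br(1)] by blast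
  have wr: "wword (rev ws) (- \<beta>) = - \<gamma>" "wword (rev ws) \<beta> = \<gamma>" by (simp_all add: ws(3) wword_minus wword_rev)
  have sr: "set (rev ws) \<subseteq> Bas" "set (\<gamma> # rev ws) \<subseteq> Bas" using ws by auto
  obtain c1 where c1: "c1 \<noteq> 0" "xz (- \<beta>) c \<otimes> nw ws = nw ws \<otimes> xz (- \<gamma>) c1"
    using xz_nw[OF ws(1) br(2), of c] c unfolding wr by blast
  obtain t :: "'a idx \<Rightarrow> 'a idx \<Rightarrow> 'f" where t: "t \<in> T" "nw ws \<otimes> (nw (rev ws) \<otimes> t) = idm I" using nw_inv[OF ws(1)] by blast
  obtain h k where hk: "h \<in> T" "k \<in> T" "xz (- \<gamma>) c1 = xz \<gamma> (1 / c1) \<otimes> (h \<otimes> (n \<gamma> \<otimes> (k \<otimes> xz \<gamma> (1 / c1))))"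
    using xz_neg_decomp[OF ws(2) c1(1)] by blast
  obtain c2 where c2: "nw ws \<otimes> xz \<gamma> (1 / c1) = xz \<beta> c2 \<otimes> nw ws" using nw_xz[OF ws(1) base_roots[OF ws(2)]] ws(3) by blast
  have swg: "wword (rev (rev ws)) \<gamma> = \<beta>" using ws(3) by simp
  obtain c3 where c3: "xz \<gamma> (1 / c1) \<otimes> nw (rev ws) = nw (rev ws) \<otimes> xz \<beta> c3"
    using xz_nw[OF sr(1) base_roots[OF ws(2)], of "1 / c1"] unfolding swg by blast
  obtain h' where h': "h' \<in> T" "nw ws \<otimes> h = h' \<otimes> nw ws" using nw_torus[OF ws(1) hk(1)] by blast
  obtain k' where k': "k' \<in> T" "k \<otimes> nw (rev ws) = nw (rev ws) \<otimes> k'" using torus_nw[OF sr(1) hk(2)] by blast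
  let ?R = "nw (rev ws)"
  have "xz (- \<beta>) c = xz (- \<beta>) c \<otimes> (nw ws \<otimes> (?R \<otimes> t))"
    unfolding t(2) by (rule mmul_idm_right[OF finite_I msupp_xz[OF br(2)], symmetric])
  also have "\<dots> = (xz (- \<beta>) c \<otimes> nw ws) \<otimes> (?R \<otimes> t)" by (simp only: mmul_assoc)
  also have "\<dots> = nw ws \<otimes> (xz (- \<gamma>) c1 \<otimes> (?R \<otimes> t))" unfolding c1(2) by (simp only: mmul_assoc)
  also have "\<dots> = (nw ws \<otimes> xz \<gamma> (1 / c1)) \<otimes> (h \<otimes> (n \<gamma> \<otimes> (k \<otimes> ((xz \<gamma> (1 / c1) \<otimes> ?R) \<otimes> t))))" unfolding hk(3) by (simp only: mmul_assoc)
  also have "\<dots> = xz \<beta> c2 \<otimes> ((nw ws \<otimes> h) \<otimes> (n \<gamma> \<otimes> ((k \<otimes> ?R) \<otimes> (xz \<beta> c3 \<otimes> t))))" unfolding c2 c3 by (simp only: mmul_assoc)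
  also have "\<dots> = (xz \<beta> c2 \<otimes> h') \<otimes> ((nw ws \<otimes> (n \<gamma> \<otimes> ?R)) \<otimes> (k' \<otimes> (xz \<beta> c3 \<otimes> t)))" unfolding h'(2) k'(2) by (simp only: mmul_assoc)
  also have "nw ws \<otimes> (n \<gamma> \<otimes> ?R) = nw (ws @ \<gamma> # rev ws)" unfolding nw_append[OF ws(1) sr(2)] nw_Cons ..
  finally have "xz (- \<beta>) c \<in> cell (ws @ \<gamma> # rev ws)"
    using cell_I[of "xz \<beta> c2 \<otimes> h'" "k' \<otimes> (xz \<beta> c3 \<otimes> t)"] B_mult B_xz[OF b] B_T h'(1) k'(1) t(1) by metis
  moreover have "wword (ws @ \<gamma> # rev ws) = root_refl \<beta>"
    unfolding ws(3) root_refl_conj by (simp add: wword_append wword_Cons o_assoc)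
  moreover have "set (ws @ \<gamma> # rev ws) \<subseteq> Bas" using ws by auto
  ultimately show ?thesis unfolding bruhat_iff by blast
qed

end

section \<open>Displacement and opposition of long root elements\<close>

locale long_root_elements = irred_root_base \<Phi> Bas + chevalley \<Phi> Bas N
  for \<Phi> Bas :: "'a::euclidean_space set" and N :: "'a \<Rightarrow> 'a \<Rightarrow> int"
begin

lemma coset_assoc: "coset I g (coset I h X) = coset I (g \<otimes> h) X"
  by (auto simp: coset_def image_image mmul_assoc)

lemma coset_eq_imp:
  assumes "coset I g B = coset I h B" "h \<in> G" shows "\<exists>b\<in>B. h = g \<otimes> b"
proof -
  have "h \<otimes> idm I \<in> coset I h B" using B_one by (auto simp: coset_def)
  then have "h \<in> coset I g B" using mmul_idm_right[OF finite_I G_msupp[OF assms(2)]] assms(1) by simp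
  then show ?thesis by (auto simp: coset_def)
qed

lemma bruhat_weyl: "g \<in> bruhat \<Phi> Bas N w \<Longrightarrow> w \<in> W"
  unfolding bruhat_iff using wword_in by blast

lemma bruhat_B: 
  assumes "g \<in> bruhat \<Phi> Bas N w" "b \<in> B" "c \<in> B" shows "b \<otimes> (g \<otimes> c) \<in> bruhat \<Phi> Bas N w"
  using assms cell_left cell_right unfolding bruhat_iff by blast

text \<open>\<open>wdist\<close> quantifies over representatives of the two chambers;
  \<open>bruhat\<close> is invariant under \<open>B\<close> on both sides, so any representatives
  may be tested.\<close>

lemma wdist_iff:
  fixes g h g' :: "'a idx \<Rightarrow> 'a idx \<Rightarrow> 'f::field"
  assumes g: "g \<in> G" "h \<in> G" "g' \<in> G" and inv: "g' \<otimes> g = idm I" "g \<otimes> g' = idm I"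
  shows "wdist \<Phi> Bas N (coset I g B) (coset I h B) w \<longleftrightarrow> g' \<otimes> h \<in> bruhat \<Phi> Bas N w"
proof
  assume "wdist \<Phi> Bas N (coset I g B) (coset I h B) w"
  then obtain g0 h0 where 0: "g0 \<in> G" "h0 \<in> G" "coset I g B = coset I g0 B" "coset I h B = coset I h0 B"
    "h0 \<in> coset I g0 (bruhat \<Phi> Bas N w)" unfolding wdist_def by blast
  obtain b where b: "b \<in> B" "g0 = g \<otimes> b" using coset_eq_imp[OF 0(3,1)] by blast
  obtain c where c: "c \<in> B" "h = h0 \<otimes> c" using coset_eq_imp[OF 0(4)[symmetric] g(2)] by blast
  obtain x where x: "x \<in> bruhat \<Phi> Bas N w" "h0 = g0 \<otimes> x" using 0(5) by (auto simp: coset_def)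
  have bx: "b \<otimes> (x \<otimes> c) \<in> bruhat \<Phi> Bas N w" by (rule bruhat_B[OF x(1) b(1) c(1)])
  then have sb: "msupp I (b \<otimes> (x \<otimes> c))" unfolding bruhat_iff using cell_G G_msupp by blast
  have "g' \<otimes> h = (g' \<otimes> g) \<otimes> (b \<otimes> (x \<otimes> c))" unfolding c(2) x(2) b(2) by (simp only: mmul_assoc)
  also have "\<dots> = b \<otimes> (x \<otimes> c)" unfolding inv(1) by (rule mmul_idm_left[OF finite_I sb])
  finally show "g' \<otimes> h \<in> bruhat \<Phi> Bas N w" using bx by simp
next
  assume a: "g' \<otimes> h \<in> bruhat \<Phi> Bas N w"
  have "h = g \<otimes> (g' \<otimes> h)" unfolding mmul_assoc[symmetric] inv(2) by (rule mmul_idm_left[OF finite_I G_msupp[OF g(2)], symmetric])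
  then have "h \<in> coset I g (bruhat \<Phi> Bas N w)" using a by (auto simp: coset_def)
  then show "wdist \<Phi> Bas N (coset I g B) (coset I h B) w"
    unfolding wdist_def using bruhat_weyl[OF a] g by blast
qed

lemma bruhat_unique:
  fixes g :: "'a idx \<Rightarrow> 'a idx \<Rightarrow> 'f::field"
  shows "g \<in> bruhat \<Phi> Bas N v \<Longrightarrow> g \<in> bruhat \<Phi> Bas N w \<Longrightarrow> v = w"
  unfolding bruhat_iff using cells_disjoint by blast

lemma B_bruhat_id: "b \<in> B \<Longrightarrow> b \<in> bruhat \<Phi> Bas N id"
  unfolding bruhat_iff using cell_Nil by (intro exI[of _ "[]"]) (simp add: wword_Nil)

lemma type_pres_aut_G:
  fixes \<theta> :: "'a idx \<Rightarrow> 'a idx \<Rightarrow> 'f::field"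
  assumes t: "\<theta> \<in> G" shows "type_pres_aut \<Phi> Bas N \<theta>"
proof -
  obtain \<theta>' where t': "\<theta>' \<in> G" "\<theta> \<otimes> \<theta>' = idm I" "\<theta>' \<otimes> \<theta> = idm I" using G_inv[OF t] by blast
  let ?C = "chambers \<Phi> Bas N :: ('a idx \<Rightarrow> 'a idx \<Rightarrow> 'f) set set"
  have into: "coset I k C \<in> ?C" if "k \<in> G" "C \<in> ?C" for k C
    using that G_mult by (fastforce simp: chambers_def coset_assoc)
  have cancel: "coset I k (coset I l C) = C" if kl: "k \<otimes> l = idm I" and C: "C \<in> ?C" for k l C
  proof -
    obtain g where g: "g \<in> G" "C = coset I g B" using C by (auto simp: chambers_def)
    show ?thesis unfolding coset_assoc g(2) mmul_assoc[symmetric] kl mmul_idm_left[OF finite_I G_msupp[OF g(1)]] ..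
  qed
  have "bij_betw (coset I \<theta>) ?C ?C"
    by (rule bij_betw_byWitness[of _ "coset I \<theta>'"]) (use into cancel t t' in blast)+
  moreover have "wdist \<Phi> Bas N C D w \<longleftrightarrow> wdist \<Phi> Bas N (coset I \<theta> C) (coset I \<theta> D) w" if C: "C \<in> ?C" and D: "D \<in> ?C" for C D w
  proof -
    obtain g where g: "g \<in> G" "C = coset I g B" using C by (auto simp: chambers_def)
    obtain h where h: "h \<in> G" "D = coset I h B" using D by (auto simp: chambers_def)
    obtain g' where g': "g' \<in> G" "g \<otimes> g' = idm I" "g' \<otimes> g = idm I" using G_inv[OF g(1)] by blast
    have i: "(\<theta> \<otimes> g) \<otimes> (g' \<otimes> \<theta>') = idm I" "(g' \<otimes> \<theta>') \<otimes> (\<theta> \<otimes> g) = idm I"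
      using inv_prod[OF G_msupp[OF t] G_msupp[OF t'(1)] G_msupp[OF g(1)] G_msupp[OF g'(1)] t'(2,3) g'(2,3)] by auto
    have "(g' \<otimes> \<theta>') \<otimes> (\<theta> \<otimes> h) = g' \<otimes> ((\<theta>' \<otimes> \<theta>) \<otimes> h)" by (simp only: mmul_assoc)
    also have "\<dots> = g' \<otimes> h" unfolding t'(3) mmul_idm_left[OF finite_I G_msupp[OF h(1)]] ..
    finally have "(g' \<otimes> \<theta>') \<otimes> (\<theta> \<otimes> h) = g' \<otimes> h" .
    then show ?thesis unfolding g(2) h(2) coset_assoc
      using wdist_iff[OF g(1) h(1) g'(1) g'(3,2), of w] wdist_iff[OF G_mult[OF t g(1)] G_mult[OF t h(1)] G_mult[OF g'(1) t'(1)] i(2,1), of w]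
      by simp
  qed
  ultimately show ?thesis unfolding type_pres_aut_def by blast
qed

text \<open>A root \<open>\<beta> + hr\<close> would lie above the highest root, so the sum is not a
  root and the two root elements commute.\<close>

lemma hr_xz_commute: "\<beta> \<in> P \<Longrightarrow> xz \<beta> a \<otimes> xz hr c = xz hr c \<otimes> xz \<beta> a"
proof (rule xz_commute)
  assume b: "\<beta> \<in> P"
  show "\<beta> \<in> \<Phi>" "hr \<in> \<Phi>" using b pos_root highest_root(1) by auto
  show "\<beta> + hr \<notin> \<Phi>"
  proof
    assume "\<beta> + hr \<in> \<Phi>"
    then have "nonneg_comb Bas (hr - (\<beta> + hr))" by (rule highest_root(2))
    moreover have "hr - (\<beta> + hr) = - \<beta>" by simp
    ultimately have "nonneg_comb Bas (- \<beta>)" by metis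
    then have "- \<beta> \<in> P" using root_minus[OF pos_root[OF b]] unfolding pos_roots_def by blast
    then show False using b not_pos_and_neg by blast
  qed
  show "hr \<noteq> - \<beta>" using b hr_pos not_pos_and_neg by metis
qed

text \<open>The unipotent part of \<open>b\<close> commutes with the root group of
  \<open>hr\<close>, and the torus part rescales its parameter.\<close>

lemma B_hr: "b \<in> B \<Longrightarrow> \<exists>a'. b \<otimes> xz hr a = xz hr a' \<otimes> b"
proof (elim B_E)
  fix h u assume a: "h \<in> T" "u \<in> U" "b = h \<otimes> u"
  have "u \<otimes> xz hr c = xz hr c \<otimes> u" for c
    using a(2)
  proof (induction rule: uplus.induct)
    case up_id
    then show ?case by (simp add: mmul_idm_left[OF finite_I msupp_xz] mmul_idm_right[OF finite_I msupp_xz] highest_root(1))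
  next
    case (up_root \<beta> u e)
    have "(xz \<beta> e \<otimes> u) \<otimes> xz hr c = (xz \<beta> e \<otimes> xz hr c) \<otimes> u" by (simp only: mmul_assoc up_root.IH)
    then show ?case unfolding xr_eq_xz hr_xz_commute[OF up_root(1)] by (simp only: mmul_assoc)
  qed
  moreover obtain c where "h \<otimes> xz hr a = xz hr (c * a) \<otimes> h" using torus_xz[OF a(1) highest_root(1)] by blast
  ultimately have "b \<otimes> xz hr a = xz hr (c * a) \<otimes> b" unfolding a(3) by (metis mmul_assoc)
  then show ?thesis by blast
qed

definition long_refl :: "('a \<Rightarrow> 'a) \<Rightarrow> bool" where
  "long_refl s \<longleftrightarrow> s = id \<or> (\<exists>w\<in>W. s = root_refl (w hr))"

text \<open>Both claims start from writing \<open>xz \<alpha> a\<close> as a conjugate of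
  \<open>xz hr a1\<close> by a representative of a Weyl element taking \<open>hr\<close> to
  \<open>\<alpha>\<close>. The nonvanishing of \<open>a1\<close> is recorded because a trivial root
  element would not leave \<open>B\<close>.\<close>

lemma conj_long_root_element:
  fixes a :: "'f::field"
  assumes lr: "long_root \<Phi> \<alpha>" and a: "a \<noteq> 0"
  shows "g \<in> G \<Longrightarrow> g' \<in> G \<Longrightarrow> g \<otimes> g' = idm I \<Longrightarrow> g' \<otimes> g = idm I \<Longrightarrow>
      \<exists>s. long_refl s \<and> g' \<otimes> (xz \<alpha> a \<otimes> g) \<in> bruhat \<Phi> Bas N s"
    and "long_refl s \<Longrightarrow> \<exists>g\<in>G. \<exists>g'\<in>G. g \<otimes> g' = idm I \<and> g' \<otimes> g = idm I \<and>
      g' \<otimes> (xz \<alpha> a \<otimes> g) \<in> bruhat \<Phi> Bas N s"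
proof -
  have ar: "\<alpha> \<in> \<Phi>" using lr by (simp add: long_root_def)
  obtain u where "u \<in> W" "\<alpha> = u hr" using long_root_conj[OF lr] by blast
  then obtain us where us: "set us \<subseteq> Bas" "\<alpha> = wword us hr" by (auto simp: weyl_gen_wword)
  have ru: "wword (rev us) \<alpha> = hr" by (simp add: us(2) wword_rev)
  obtain a1 where a1: "a1 \<noteq> 0" "xz \<alpha> a \<otimes> nw us = nw us \<otimes> xz hr a1"
    using xz_nw[OF us(1) ar, of a] a unfolding ru by blast
  obtain ti :: "'a idx \<Rightarrow> 'a idx \<Rightarrow> 'f" where ti: "ti \<in> T" "nw us \<otimes> (nw (rev us) \<otimes> ti) = idm I" "(nw (rev us) \<otimes> ti) \<otimes> nw us = idm I"
    using nw_inv[OF us(1)] by blast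
  define m where "m = (nw us :: 'a idx \<Rightarrow> 'a idx \<Rightarrow> 'f)"
  define mi where "mi = nw (rev us) \<otimes> ti"
  have m: "m \<in> G" "mi \<in> G" "m \<otimes> mi = idm I" "mi \<otimes> m = idm I"
    using ti us nw_G[OF us(1)] G_mult[OF nw_G[of "rev us"] G_torus[OF ti(1)]] by (simp_all add: m_def mi_def)
  have am: "xz \<alpha> a \<otimes> m = m \<otimes> xz hr a1" using a1 by (simp add: m_def)
  have hrr: "hr \<in> \<Phi>" by (rule highest_root(1))
  {
    assume g: "g \<in> G" "g' \<in> G" "g \<otimes> g' = idm I" "g' \<otimes> g = idm I"
    \<comment> \<open>The element becomes the conjugate of \<open>xz hr a1\<close> by
      \<open>k\<close>. In a decomposition \<open>k = b \<otimes> (nw ws \<otimes> c)\<close> the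
      factor \<open>c\<close> normalizes the root group of \<open>hr\<close> and
      \<open>nw ws\<close> moves it to another root group, so only \<open>b\<close> remains as
      conjugator.\<close>
    define k where "k = g' \<otimes> m"
    define ki where "ki = mi \<otimes> g"
    have k: "k \<in> G" "ki \<in> G" "k \<otimes> ki = idm I" "ki \<otimes> k = idm I"
      using inv_prod[OF G_msupp[OF g(2)] G_msupp[OF g(1)] G_msupp[OF m(1)] G_msupp[OF m(2)] g(4,3) m(3,4)]
      using g m by (auto simp: k_def ki_def intro: G_mult)
    have "g' \<otimes> (xz \<alpha> a \<otimes> g) = g' \<otimes> (xz \<alpha> a \<otimes> ((m \<otimes> mi) \<otimes> g))"
      unfolding m(3) mmul_idm_left[OF finite_I G_msupp[OF g(1)]] ..
    also have "\<dots> = g' \<otimes> ((xz \<alpha> a \<otimes> m) \<otimes> (mi \<otimes> g))" by (simp only: mmul_assoc)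
    also have "\<dots> = k \<otimes> (xz hr a1 \<otimes> ki)" unfolding am k_def ki_def by (simp only: mmul_assoc)
    finally have e1: "g' \<otimes> (xz \<alpha> a \<otimes> g) = k \<otimes> (xz hr a1 \<otimes> ki)" .
    obtain ws where ws: "set ws \<subseteq> Bas" "k \<in> cell ws" using G_cells[OF k(1)] by blast
    then obtain b c where bc: "b \<in> B" "c \<in> B" "k = b \<otimes> (nw ws \<otimes> c)" by (auto simp: cell_def)
    obtain a2 where a2: "c \<otimes> xz hr a1 = xz hr a2 \<otimes> c" using B_hr[OF bc(2)] by blast
    obtain a3 where a3: "nw ws \<otimes> xz hr a2 = xz (wword ws hr) a3 \<otimes> nw ws" using nw_xz[OF ws(1) hrr] by blast
    obtain bi where bi: "bi \<in> B" "b \<otimes> bi = idm I" "bi \<otimes> b = idm I" using B_inv[OF bc(1)] by blast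
    let ?x = "xz (wword ws hr) a3"
    have wr: "wword ws hr \<in> \<Phi>" using wword_root[of ws hr] ws(1) base_roots hrr by blast
    have "k \<otimes> xz hr a1 = b \<otimes> (nw ws \<otimes> (c \<otimes> xz hr a1))" unfolding bc(3) by (simp only: mmul_assoc)
    also have "\<dots> = b \<otimes> ((nw ws \<otimes> xz hr a2) \<otimes> c)" unfolding a2 by (simp only: mmul_assoc)
    also have "\<dots> = b \<otimes> (?x \<otimes> ((bi \<otimes> b) \<otimes> (nw ws \<otimes> c)))"
      unfolding a3 bi(3) mmul_idm_left[OF finite_I msupp_mmul[OF msupp_nw[OF ws(1)] B_msupp[OF bc(2)]]] by (simp only: mmul_assoc)
    also have "\<dots> = (b \<otimes> (?x \<otimes> bi)) \<otimes> k" unfolding bc(3) by (simp only: mmul_assoc)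
    finally have e2: "k \<otimes> xz hr a1 = (b \<otimes> (?x \<otimes> bi)) \<otimes> k" .
    have sx: "msupp I (b \<otimes> (?x \<otimes> bi))" by (intro msupp_mmul B_msupp bc bi msupp_xz wr)
    have "g' \<otimes> (xz \<alpha> a \<otimes> g) = (k \<otimes> xz hr a1) \<otimes> ki" unfolding e1 by (simp only: mmul_assoc)
    also have "\<dots> = (b \<otimes> (?x \<otimes> bi)) \<otimes> (k \<otimes> ki)" unfolding e2 by (simp only: mmul_assoc)
    also have "\<dots> = b \<otimes> (?x \<otimes> bi)" unfolding k(3) by (rule mmul_idm_right[OF finite_I sx])
    finally have e: "g' \<otimes> (xz \<alpha> a \<otimes> g) = b \<otimes> (?x \<otimes> bi)" .
    have "\<exists>s. long_refl s \<and> ?x \<in> bruhat \<Phi> Bas N s"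
    proof (cases "a3 = 0 \<or> wword ws hr \<in> P")
      case True
      then have "?x \<in> B" using B_xz B_one xz_0[OF wr] by metis
      then show ?thesis using B_bruhat_id by (auto simp: long_refl_def)
    next
      case False
      then have n: "- wword ws hr \<in> P" "a3 \<noteq> 0" using pos_or_neg[OF wr] by auto
      have "?x \<in> bruhat \<Phi> Bas N (root_refl (wword ws hr))"
        using xz_neg_cell[OF n] by (simp add: root_refl_minus)
      then show ?thesis using wword_in[OF ws(1)] unfolding long_refl_def by blast
    qed
    then show "\<exists>s. long_refl s \<and> g' \<otimes> (xz \<alpha> a \<otimes> g) \<in> bruhat \<Phi> Bas N s"
      unfolding e using bruhat_B[OF _ bc(1) bi(1)] by blast
  next
    assume s: "long_refl s"
    show "\<exists>g\<in>G. \<exists>g'\<in>G. g \<otimes> g' = idm I \<and> g' \<otimes> g = idm I \<and> g' \<otimes> (xz \<alpha> a \<otimes> g) \<in> bruhat \<Phi> Bas N s"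
    proof (cases "s = id")
      case True
      have "mi \<otimes> (xz \<alpha> a \<otimes> m) = (mi \<otimes> m) \<otimes> xz hr a1" unfolding am by (simp only: mmul_assoc)
      also have "\<dots> = xz hr a1" unfolding m(4) by (rule mmul_idm_left[OF finite_I msupp_xz[OF hrr]])
      finally have "mi \<otimes> (xz \<alpha> a \<otimes> m) \<in> bruhat \<Phi> Bas N s" unfolding True using B_bruhat_id[OF B_xz[OF hr_pos]] by simp
      then show ?thesis using m by blast
    next
      case False
      then obtain w where w: "w \<in> W" "s = root_refl (w hr)" using s by (auto simp: long_refl_def)
      \<comment> \<open>The reflection does not depend on the sign of its root, so \<open>w\<close>
        may be composed with the reflection in \<open>hr\<close> to make \<open>v hr\<close>
        negative; only then does the root element leave \<open>B\<close>.\<close>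
      obtain v where v: "v \<in> W" "s = root_refl (v hr)" "- v hr \<in> P"
      proof (cases "- w hr \<in> P")
        case True then show ?thesis using that w by blast
      next
        case F: False
        let ?v = "w \<circ> root_refl hr"
        have "w hr \<in> P" using F pos_or_neg weyl_root[OF w(1) hrr] by blast
        moreover have "?v hr = - w hr" by (simp add: root_refl_self weyl_minus[OF w(1)])
        moreover have "?v \<in> W" using weyl_gen_comp[OF w(1) root_refl_in_weyl[OF hrr]] .
        ultimately show ?thesis using that[of ?v] w(2) by (simp add: root_refl_minus)
      qed
      obtain ws where ws: "set ws \<subseteq> Bas" "v = wword ws" using v(1) by (auto simp: weyl_gen_wword)
      obtain t2 :: "'a idx \<Rightarrow> 'a idx \<Rightarrow> 'f" where t2: "t2 \<in> T" "nw ws \<otimes> (nw (rev ws) \<otimes> t2) = idm I" "(nw (rev ws) \<otimes> t2) \<otimes> nw ws = idm I"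
        using nw_inv[OF ws(1)] by blast
      define l where "l = (nw ws :: 'a idx \<Rightarrow> 'a idx \<Rightarrow> 'f)"
      define li where "li = nw (rev ws) \<otimes> t2"
      have l: "l \<in> G" "li \<in> G" "l \<otimes> li = idm I" "li \<otimes> l = idm I"
        using t2 ws nw_G[OF ws(1)] G_mult[OF nw_G[of "rev ws"] G_torus[OF t2(1)]] by (simp_all add: l_def li_def)
      obtain a2 where a2: "a2 \<noteq> 0" "l \<otimes> xz hr a1 = xz (v hr) a2 \<otimes> l" using nw_xz[OF ws(1) hrr, of a1] a1(1) unfolding l_def ws(2) by blast
      have vr: "v hr \<in> \<Phi>" by (rule weyl_root[OF v(1) hrr])
      have i: "(m \<otimes> li) \<otimes> (l \<otimes> mi) = idm I" "(l \<otimes> mi) \<otimes> (m \<otimes> li) = idm I"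
        using inv_prod[OF G_msupp[OF m(1)] G_msupp[OF m(2)] G_msupp[OF l(2)] G_msupp[OF l(1)] m(3,4) l(4,3)] by auto
      have "(l \<otimes> mi) \<otimes> (xz \<alpha> a \<otimes> (m \<otimes> li)) = l \<otimes> (mi \<otimes> ((xz \<alpha> a \<otimes> m) \<otimes> li))" by (simp only: mmul_assoc)
      also have "\<dots> = l \<otimes> ((mi \<otimes> m) \<otimes> (xz hr a1 \<otimes> li))" unfolding am by (simp only: mmul_assoc)
      also have "\<dots> = (l \<otimes> xz hr a1) \<otimes> li"
        unfolding m(4) mmul_idm_left[OF finite_I msupp_mmul[OF msupp_xz[OF hrr] G_msupp[OF l(2)]]] by (simp only: mmul_assoc)
      also have "\<dots> = xz (v hr) a2 \<otimes> (l \<otimes> li)" unfolding a2(2) by (simp only: mmul_assoc)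
      also have "\<dots> = xz (v hr) a2" unfolding l(3) by (rule mmul_idm_right[OF finite_I msupp_xz[OF vr]])
      finally have "(l \<otimes> mi) \<otimes> (xz \<alpha> a \<otimes> (m \<otimes> li)) = xz (v hr) a2" .
      moreover have "xz (v hr) a2 \<in> bruhat \<Phi> Bas N s"
        using xz_neg_cell[OF v(3) a2(1)] by (simp add: root_refl_minus v(2))
      ultimately have "(l \<otimes> mi) \<otimes> (xz \<alpha> a \<otimes> (m \<otimes> li)) \<in> bruhat \<Phi> Bas N s" by simp
      then show ?thesis using i G_mult[OF m(1) l(2)] G_mult[OF l(1) m(2)] by blast
    qed
  }
qed

lemma disp_long_root_element:
  fixes a :: "'f::field"
  assumes lr: "long_root \<Phi> \<alpha>" and a: "a \<noteq> 0"
  shows "disp \<Phi> Bas N (xz \<alpha> a) = {s. long_refl s}"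
proof (intro set_eqI iffI)
  have t: "xz \<alpha> a \<in> G" using lr by (intro G_xz) (simp add: long_root_def)
  fix s
  assume "s \<in> disp \<Phi> Bas N (xz \<alpha> a)"
  then obtain g where g: "g \<in> G" "wdist \<Phi> Bas N (coset I g B) (coset I (xz \<alpha> a \<otimes> g) B) s"
    unfolding disp_def chambers_def by (auto simp: coset_assoc)
  obtain g' where g': "g' \<in> G" "g \<otimes> g' = idm I" "g' \<otimes> g = idm I" using G_inv[OF g(1)] by blast
  have "g' \<otimes> (xz \<alpha> a \<otimes> g) \<in> bruhat \<Phi> Bas N s"
    using g(2) wdist_iff[OF g(1) G_mult[OF t g(1)] g'(1,3,2)] by simp
  then show "s \<in> {s. long_refl s}"
    using conj_long_root_element(1)[OF lr a g(1) g'] bruhat_unique by blast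
next
  have t: "xz \<alpha> a \<in> G" using lr by (intro G_xz) (simp add: long_root_def)
  fix s assume "s \<in> {s. long_refl s}"
  then obtain g g' where g: "g \<in> G" "g' \<in> G" "g \<otimes> g' = idm I" "g' \<otimes> g = idm I" "g' \<otimes> (xz \<alpha> a \<otimes> g) \<in> bruhat \<Phi> Bas N s"
    using conj_long_root_element(2)[OF lr a] by blast
  then have "wdist \<Phi> Bas N (coset I g B) (coset I (xz \<alpha> a \<otimes> g) B) s"
    using wdist_iff[OF g(1) G_mult[OF t g(1)] g(2,4,3)] by simp
  then show "s \<in> disp \<Phi> Bas N (xz \<alpha> a)"
    unfolding disp_def chambers_def coset_assoc[symmetric] using g(1) by blast
qed

section \<open>Simplices mapped to opposite simplices\<close>

lemma parabolic_iff:
  fixes p :: "'a idx \<Rightarrow> 'a idx \<Rightarrow> 'f::field"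
  assumes "K \<subseteq> Bas"
  shows "p \<in> parabolic \<Phi> Bas N K \<longleftrightarrow> (\<exists>ws. set ws \<subseteq> K \<and> p \<in> cell ws)"
proof
  assume "p \<in> parabolic \<Phi> Bas N K"
  then obtain vs where vs: "set vs \<subseteq> Bas" "wword vs \<in> weyl_gen K" "p \<in> cell vs"
    unfolding parabolic_def by (metis UN_E bruhat_iff)
  then obtain ws where ws: "set ws \<subseteq> K" "wword vs = wword ws" by (auto simp: weyl_gen_wword)
  then have "p \<in> cell ws" using cell_same_weyl[OF vs(1) _ ws(2) vs(3)] assms by blast
  then show "\<exists>ws. set ws \<subseteq> K \<and> p \<in> cell ws" using ws by blast
next
  assume "\<exists>ws. set ws \<subseteq> K \<and> p \<in> cell ws"
  then obtain ws where ws: "set ws \<subseteq> K" "p \<in> cell ws" by blast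
  then have "p \<in> bruhat \<Phi> Bas N (wword ws)" unfolding bruhat_iff using assms by blast
  then show "p \<in> parabolic \<Phi> Bas N K" unfolding parabolic_def using wword_in[OF ws(1)] by (rule UN_I[rotated])
qed

lemma opp_type_subset_polar:
  fixes a :: "'f::field"
  assumes lr: "long_root \<Phi> \<alpha>" and a: "a \<noteq> 0"
  shows "opp_type_of \<Phi> Bas N (xz \<alpha> a) \<subseteq> polar_type \<Phi> Bas"
proof
  let ?t = "xz \<alpha> a"
  have t: "?t \<in> G" using lr by (intro G_xz) (simp add: long_root_def)
  fix \<gamma> assume "\<gamma> \<in> opp_type_of \<Phi> Bas N ?t"
  then obtain J g where J: "J \<subseteq> Bas" "\<gamma> \<in> J" and g: "g \<in> G"
    and opp: "opposite_simplices \<Phi> Bas N J (coset I g (parabolic \<Phi> Bas N (Bas - J))) J (coset I (?t \<otimes> g) (parabolic \<Phi> Bas N (Bas - J)))"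
    unfolding opp_type_of_def by blast
  let ?Q = "parabolic \<Phi> Bas N (Bas - J) :: ('a idx \<Rightarrow> 'a idx \<Rightarrow> 'f) set"
  obtain c d where c: "c \<in> G" "coset I c B \<subseteq> coset I g ?Q" and d: "d \<in> G" "coset I d B \<subseteq> coset I (?t \<otimes> g) ?Q"
    and w: "wdist \<Phi> Bas N (coset I c B) (coset I d B) w0"
    using opp unfolding opposite_simplices_def chambers_def by blast
  have self: "h \<in> coset I h B" if "h \<in> G" for h
    using B_one mmul_idm_right[OF finite_I G_msupp[OF that]] unfolding coset_def by (metis imageI)
  obtain p where p: "p \<in> ?Q" "c = g \<otimes> p" using self[OF c(1)] c(2) by (auto simp: coset_def)
  obtain q where q: "q \<in> ?Q" "d = (?t \<otimes> g) \<otimes> q" using self[OF d(1)] d(2) by (auto simp: coset_def)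
  have K: "Bas - J \<subseteq> Bas" by blast
  obtain ps where ps: "set ps \<subseteq> Bas - J" "p \<in> cell ps" using p(1) unfolding parabolic_iff[OF K] by blast
  obtain qs where qs: "set qs \<subseteq> Bas - J" "q \<in> cell qs" using q(1) unfolding parabolic_iff[OF K] by blast
  have psB: "set ps \<subseteq> Bas" "set (rev ps) \<subseteq> Bas" "set qs \<subseteq> Bas" using ps qs by auto
  obtain p' where p': "p' \<in> G" "p \<otimes> p' = idm I" "p' \<otimes> p = idm I" using G_inv[OF cell_G[OF psB(1) ps(2)]] by blast
  have p'c: "p' \<in> cell (rev ps)" by (rule cell_inverse[OF psB(1) ps(2) G_msupp[OF p'(1)] p'(3)])
  obtain c' where c': "c' \<in> G" "c \<otimes> c' = idm I" "c' \<otimes> c = idm I" using G_inv[OF c(1)] by blast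
  obtain s where s: "long_refl s" "c' \<otimes> (?t \<otimes> c) \<in> bruhat \<Phi> Bas N s"
    using conj_long_root_element(1)[OF lr a c(1) c'] by blast
  then obtain ws where ws: "set ws \<subseteq> Bas" "wword ws = s" "c' \<otimes> (?t \<otimes> c) \<in> cell ws" unfolding bruhat_iff by blast
  obtain us where us: "set us \<subseteq> set (rev ps)" "(c' \<otimes> (?t \<otimes> c)) \<otimes> p' \<in> cell (ws @ us)" using cell_mult[OF ws(1) psB(2) ws(3) p'c] by blast
  have wu: "set (ws @ us) \<subseteq> Bas" using ws us psB by auto
  obtain vs where vs: "set vs \<subseteq> set qs" "((c' \<otimes> (?t \<otimes> c)) \<otimes> p') \<otimes> q \<in> cell ((ws @ us) @ vs)"
    using cell_mult[OF wu psB(3) us(2) qs(2)] by blast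
  have sq: "msupp I q" by (rule G_msupp[OF cell_G[OF psB(3) qs(2)]])
  have "((c' \<otimes> (?t \<otimes> c)) \<otimes> p') \<otimes> q = c' \<otimes> (?t \<otimes> (g \<otimes> ((p \<otimes> p') \<otimes> q)))" unfolding p(2) by (simp only: mmul_assoc)
  also have "\<dots> = c' \<otimes> d" unfolding p'(2) mmul_idm_left[OF finite_I sq] q(2) by (simp only: mmul_assoc)
  finally have e: "c' \<otimes> d \<in> cell (ws @ (us @ vs))" using vs(2) by simp
  have "c' \<otimes> d \<in> bruhat \<Phi> Bas N w0" using w wdist_iff[OF c(1) d(1) c'(1,3,2)] by simp
  moreover have "c' \<otimes> d \<in> bruhat \<Phi> Bas N (wword (ws @ (us @ vs)))"
    using e ws(1) us(1) vs(1) psB unfolding bruhat_iff by (intro exI[of _ "ws @ (us @ vs)"]) auto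
  ultimately have "w0 = s \<circ> wword (us @ vs)" using bruhat_unique ws(2) by (metis wword_append)
  moreover have "wword (us @ vs) \<in> weyl_gen (Bas - J)" using us(1) vs(1) ps(1) qs(1) by (intro wword_in) auto
  ultimately show "\<gamma> \<in> polar_type \<Phi> Bas" using type_subset_polar[of "wword (us @ vs)" J \<gamma> s] J s(1) by (simp add: long_refl_def)
qed

text \<open>\<open>opp_type_of\<close> is a union of types, so a single simplex of the full polar
  type that is mapped to an opposite one suffices.\<close>

lemma polar_subset_opp_type:
  fixes a :: "'f::field"
  assumes lr: "long_root \<Phi> \<alpha>" and a: "a \<noteq> 0"
  shows "polar_type \<Phi> Bas \<subseteq> opp_type_of \<Phi> Bas N (xz \<alpha> a)"
proof -
  let ?t = "xz \<alpha> a" and ?J = "polar_type \<Phi> Bas"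
  let ?K = "Bas - ?J"
  let ?Q = "parabolic \<Phi> Bas N ?K :: ('a idx \<Rightarrow> 'a idx \<Rightarrow> 'f) set"
  have t: "?t \<in> G" using lr by (intro G_xz) (simp add: long_root_def)
  have K: "?K \<subseteq> Bas" by blast
  obtain k where k: "k \<in> weyl_gen ?K" "root_refl hr \<circ> k = w0" using w0_factor by blast
  then obtain ks where ks: "set ks \<subseteq> ?K" "k = wword ks" by (auto simp: weyl_gen_wword)
  then have ksB: "set ks \<subseteq> Bas" by blast
  have "long_refl (root_refl hr)" unfolding long_refl_def using weyl_id by force
  then obtain g g' where g: "g \<in> G" "g' \<in> G" "g \<otimes> g' = idm I" "g' \<otimes> g = idm I"
    and x: "g' \<otimes> (?t \<otimes> g) \<in> bruhat \<Phi> Bas N (root_refl hr)"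
    using conj_long_root_element(2)[OF lr a] by blast
  obtain ws where ws: "set ws \<subseteq> Bas" "wword ws = root_refl hr" "g' \<otimes> (?t \<otimes> g) \<in> cell ws" using x unfolding bruhat_iff by blast
  then obtain b c where bc: "b \<in> B" "c \<in> B" "g' \<otimes> (?t \<otimes> g) = b \<otimes> (nw ws \<otimes> c)" by (auto simp: cell_def)
  obtain c' where c': "c' \<in> B" "c \<otimes> c' = idm I" using B_inv[OF bc(2)] by blast
  \<comment> \<open>The factor \<open>c'\<close> cancels the right Borel factor of
    \<open>g' \<otimes> (?t \<otimes> g)\<close>, so the product becomes exactly \<open>b\<close>
    times the representative of a word for \<open>w0\<close>, with no choice between cells. As
    \<open>p\<close> lies in the parabolic subgroup, the new chamber still belongs to the image
    simplex.\<close>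
  define p where "p = c' \<otimes> nw ks"
  have pc: "p \<in> cell ks" unfolding p_def by (rule cell_left[OF c'(1) cell_nw[OF ksB]])
  have pG: "p \<in> G" by (rule cell_G[OF ksB pc])
  have tg: "?t \<otimes> g \<in> G" "(?t \<otimes> g) \<otimes> p \<in> G" using G_mult t g pG by auto
  have "g' \<otimes> ((?t \<otimes> g) \<otimes> p) = (g' \<otimes> (?t \<otimes> g)) \<otimes> p" by (simp only: mmul_assoc)
  also have "\<dots> = b \<otimes> (nw ws \<otimes> ((c \<otimes> c') \<otimes> nw ks))" unfolding bc(3) p_def by (simp only: mmul_assoc)
  also have "\<dots> = b \<otimes> nw (ws @ ks)" unfolding c'(2) mmul_idm_left[OF finite_I msupp_nw[OF ksB]] nw_append[OF ws(1) ksB] ..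
  finally have "g' \<otimes> ((?t \<otimes> g) \<otimes> p) = b \<otimes> nw (ws @ ks)" .
  moreover have "b \<otimes> nw (ws @ ks) \<in> cell (ws @ ks)" using cell_left[OF bc(1) cell_nw[of "ws @ ks"]] ws(1) ksB by simp
  moreover have "wword (ws @ ks) = w0" using k(2) ks(2) ws(2) by (simp add: wword_append)
  ultimately have "g' \<otimes> ((?t \<otimes> g) \<otimes> p) \<in> bruhat \<Phi> Bas N w0"
    unfolding bruhat_iff using ws(1) ksB by (intro exI[of _ "ws @ ks"]) auto
  then have wd: "wdist \<Phi> Bas N (coset I g B) (coset I ((?t \<otimes> g) \<otimes> p) B) w0"
    using wdist_iff[OF g(1) tg(2) g(2,4,3)] by simp
  have BQ: "b \<in> ?Q" if "b \<in> B" for b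
    unfolding parabolic_iff[OF K] using cell_Nil[OF that] by (intro exI[of _ "[]"]) simp
  have pQ: "p \<otimes> b \<in> ?Q" if "b \<in> B" for b
    unfolding parabolic_iff[OF K] using cell_right[OF that pc] ks(1) by blast
  have sub1: "coset I g B \<subseteq> coset I g ?Q" using BQ by (auto simp: coset_def)
  have sub2: "coset I ((?t \<otimes> g) \<otimes> p) B \<subseteq> coset I (?t \<otimes> g) ?Q"
    unfolding coset_assoc[symmetric] using pQ by (auto simp: coset_def)
  have "opposite_simplices \<Phi> Bas N ?J (coset I g ?Q) ?J (coset I (?t \<otimes> g) ?Q)"
    unfolding opposite_simplices_def chambers_def
    using opp_type_polar wd sub1 sub2 g(1) tg(2) by blast
  moreover have "?J \<subseteq> Bas" by (auto simp: polar_type_def)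
  ultimately show ?thesis unfolding opp_type_of_def using g(1) by blast
qed

end

theorem theorem2p1:
  fixes \<Phi> Bas :: "'a::euclidean_space set" and N :: "'a \<Rightarrow> 'a \<Rightarrow> int"
    and \<alpha> :: 'a and a :: "'f::field"
  assumes "root_system \<Phi>" and "rs_reduced \<Phi>" and "rs_irreducible \<Phi>"
    and "is_base \<Phi> Bas" and "chevalley_basis \<Phi> Bas N"
    and "long_root \<Phi> \<alpha>" and "a \<noteq> 0"
  shows "type_pres_aut \<Phi> Bas N (xr \<Phi> Bas N \<alpha> a)
    \<and> opp_type_of \<Phi> Bas N (xr \<Phi> Bas N \<alpha> a) = polar_type \<Phi> Bas
    \<and> disp \<Phi> Bas N (xr \<Phi> Bas N \<alpha> a)
        = {id} \<union> {root_refl \<beta> | \<beta>. \<beta> \<in> (\<lambda>w. w (highest_root \<Phi> Bas)) ` weyl_gen Bas}"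
proof -
  interpret long_root_elements \<Phi> Bas N
    by unfold_locales (fact assms)+
  have "xz \<alpha> a \<in> G" using assms(6) by (intro G_xz) (simp add: long_root_def)
  then have "type_pres_aut \<Phi> Bas N (xz \<alpha> a)" by (rule type_pres_aut_G)
  moreover have "opp_type_of \<Phi> Bas N (xz \<alpha> a) = polar_type \<Phi> Bas"
    using opp_type_subset_polar[OF assms(6,7)] polar_subset_opp_type[OF assms(6,7)] by blast
  moreover have "disp \<Phi> Bas N (xz \<alpha> a) = {id} \<union> {root_refl \<beta> | \<beta>. \<beta> \<in> (\<lambda>w. w hr) ` W}"
    unfolding disp_long_root_element[OF assms(6,7)] long_refl_def by blast
  ultimately show ?thesis unfolding xr_eq_xz by blast
qed

end
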